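(* Let $1\leq l\leq r$, and suppose that $$\sigma\sqrt{n}\leq c_{0}\lambda_{\min}^{\star},\qquad r\leq c_{1}n/\log^{2}n\qquad\text{and}\qquad\Delta_{l}^{\star}>C_{0}\sigma\sqrt{r}\log n$$ for some sufficiently small (resp. large) constants $c_{0},c_{1}>0$ (resp. $C_{0}>0$). Let $\bm{a}\in\mathbb{R}^{n}$ be any fixed vector with $\|\bm{a}\|_{2}=1$. Then with probability at least $1-O(n^{-10})$, the plug-in estimator $u_{\bm{a}}^{\mathsf{plugin}}:=\bm{a}^{\top}\bm{u}_{l}$ and the de-biased estimator $$u_{\bm{a}}^{\mathsf{debiased}}:=\sqrt{1+b_{l}}\,\bm{a}^{\top}\bm{u}_{l},\qquad b_{l}:=\sum_{i:\,r<i\le n}\frac{\sigma^{2}}{(\lambda_{l}-\lambda_{i})^{2}},$$ satisfy $$\mathsf{dist}\big(u_{\bm{a}}^{\mathsf{plugin}},\bm{a}^{\top}\bm{u}_{l}^{\star}\big)\lesssim E_{\mathsf{md},l}+\frac{\sigma^{2}n}{\lambda_{l}^{\star2}}\big|\bm{a}^{\top}\bm{u}_{l}^{\star}\big|,\qquad \mathsf{dist}\big(u_{\bm{a}}^{\mathsf{debiased}},\bm{a}^{\top}\bm{u}_{l}^{\star}\big)\lesssim E_{\mathsf{md},l},$$ where $$E_{\mathsf{md},l}:=\frac{\sigma^{2}r\log n}{(\Delta_{l}^{\star})^{2}}\big|\bm{a}^{\top}\bm{u}_{l}^{\star}\big|+\sigma\sqrt{r\log\Big(\frac{n\kappa\lambda_{\max}^{\star}}{\Delta_{l}^{\star}}\Big)}\sum_{k:\,k\neq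 l,\,1\leq k\leq r}\frac{\big|\bm{a}^{\top}\bm{u}_{k}^{\star}\big|}{\big|\lambda_{l}^{\star}-\lambda_{k}^{\star}\big|}+\frac{\sigma\sqrt{\log\big(\frac{n\kappa\lambda_{\max}^{\star}}{\Delta_{l}^{\star}}\big)}}{|\lambda_{l}^{\star}|}.$$
   Context: Matrix denoising model. $\bm{M}^{\star}\in\mathbb{R}^{n\times n}$ is a deterministic symmetric rank-$r$ matrix with eigen-decomposition $\bm{M}^{\star}=\sum_{i=1}^{r}\lambda_{i}^{\star}\bm{u}_{i}^{\star}\bm{u}_{i}^{\star\top}$, where the $\bm{u}_{i}^{\star}$ are orthonormal, the $\lambda_i^\star$ are the nonzero eigenvalues, and $\lambda_{\min}^{\star}:=|\lambda_{r}^{\star}|\leq\cdots\leq|\lambda_{1}^{\star}|=:\lambda_{\max}^{\star}$; $\kappa:=\lambda_{\max}^{\star}/\lambda_{\min}^{\star}$. The eigen-gap is $\Delta_{l}^{\star}:=\min_{k\neq l,\,1\leq k\leq r}|\lambda_{l}^{\star}-\lambda_{k}^{\star}|$ if $r>1$ and $\Delta_{l}^{\star}:=\lambda_{\max}^{\star}$ if $r=1$. One observes $\bm{M}=\bm{M}^{\star}+\bm{H}$, where $\bm{H}=[H_{i,j}]$ is a symmetric random matrix whose entries on and below the diagonal are independent with $H_{i,i}\sim\mathcal{N}(0,2\sigma^{2})$ and $H_{i,j}\sim\mathcal{N}(0,\sigma^{2})$ for $i>j$. $\lambda_{l}$ denotes the $l$-th largest eigenvalue in magnitude of $\bm{M}$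 and $\bm{u}_{l}$ an associated unit eigenvector. $\mathsf{dist}(u,\bm{a}^{\top}\bm{u}_{l}^{\star}):=\min\{|u-\bm{a}^{\top}\bm{u}_{l}^{\star}|,\,|u+\bm{a}^{\top}\bm{u}_{l}^{\star}|\}$. Sums over $k\ne l$, $1\le k\le r$, are zero when $r=1$. $f(n)\lesssim g(n)$ (also $f=O(g)$) means $|f(n)|\leq Cg(n)$ for some universal constant $C>0$ when $n$ is sufficiently large.
   Formalization: If the nonzero eigenvalues of M* have both signs, λ_l is not the l-th largest eigenvalue of M in magnitude: among the r largest in magnitude, labels with positive λ* get the algebraically larger ones, by magnitude within each sign (the literal claim fails for λ* = (1,−1)). *)

theory Defs
  imports "HOL-Probability.Probability" "Jordan_Normal_Form.Char_Poly"
begin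

(* Vectors and matrices are those of Jordan_Normal_Form, since the dimension n is quantified
   inside the statement.  Coordinates run over 0..<n; eigenvalues and eigenvectors carry the
   labels 1..n. *)

no_notation Inner_Product.real_inner_class.inner (infix \<open>\<bullet>\<close> 70)
no_notation Finite_Cartesian_Product.vec_nth (infixl \<open>$\<close> 90)

definition norm2 :: "real vec \<Rightarrow> real" where
  "norm2 v = sqrt (v \<bullet> v)"

(* M = sum_{k=1..r} ls k * us k * (us k)^T with r nonzero eigenvalues, which makes M symmetric
   of rank r. *)
definition eigen_decomposition ::
  "nat \<Rightarrow> nat \<Rightarrow> real mat \<Rightarrow> (nat \<Rightarrow> real) \<Rightarrow> (nat \<Rightarrow> real vec) \<Rightarrow> bool" where
  "eigen_decomposition n r M ls us \<longleftrightarrow>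
     (\<forall>k\<in>{1..r}. us k \<in> carrier_vec n) \<and>
     (\<forall>j\<in>{1..r}. \<forall>k\<in>{1..r}. us j \<bullet> us k = (if j = k then 1 else 0)) \<and>
     (\<forall>k\<in>{1..r}. ls k \<noteq> 0) \<and>
     (\<forall>j\<in>{1..r}. \<forall>k\<in>{1..r}. j \<le> k \<longrightarrow> \<bar>ls k\<bar> \<le> \<bar>ls j\<bar>) \<and>
     M = mat n n (\<lambda>(i, j). \<Sum>k=1..r. ls k * us k $ i * us k $ j)"

definition lam_max :: "(nat \<Rightarrow> real) \<Rightarrow> real" where
  "lam_max ls = \<bar>ls 1\<bar>"

definition lam_min :: "nat \<Rightarrow> (nat \<Rightarrow> real) \<Rightarrow> real" where
  "lam_min r ls = \<bar>ls r\<bar>"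

definition cond_num :: "nat \<Rightarrow> (nat \<Rightarrow> real) \<Rightarrow> real" where
  "cond_num r ls = lam_max ls / lam_min r ls"

definition eigen_gap :: "nat \<Rightarrow> (nat \<Rightarrow> real) \<Rightarrow> nat \<Rightarrow> real" where
  "eigen_gap r ls l =
     (if r > 1 then Min ((\<lambda>k. \<bar>ls l - ls k\<bar>) ` ({1..r} - {l})) else lam_max ls)"

(* Joint law of the entries on and below the diagonal: independent, N(0, 2 sigma^2) on the
   diagonal and N(0, sigma^2) below it.  The second argument of normal_density is the standard
   deviation. *)
definition noise_law :: "nat \<Rightarrow> real \<Rightarrow> (nat \<times> nat \<Rightarrow> real) measure" where
  "noise_law n \<sigma> =
     PiM {(i, j). j \<le> i \<and> i < n}
       (\<lambda>(i, j). density lborel (normal_density 0 (if i = j then sqrt 2 * \<sigma> else \<sigma>)))"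

definition noise_mat :: "nat \<Rightarrow> (nat \<times> nat \<Rightarrow> real) \<Rightarrow> real mat" where
  "noise_mat n \<omega> = mat n n (\<lambda>(i, j). \<omega> (max i j, min i j))"

(* lam 1, ..., lam n are the eigenvalues of A, with multiplicity, in order of decreasing
   magnitude, labelled so that lam l is the counterpart of ls l.  If all of ls 1, ..., ls r have
   the same sign, this says exactly |lam 1| >= ... >= |lam n|.  If both signs occur, magnitude
   alone does not pair lam l with ls l: for spectrum {1, -1} the noise decides by a fair coin
   which of the two perturbed eigenvalues is larger in magnitude.  Therefore magnitudes are not
   compared across labels with ls of opposite sign; instead the labels with positive ls receive
   the algebraically larger ones among the r eigenvalues of largest magnitude. *)
definition eigenvalue_labelling ::
  "nat \<Rightarrow> nat \<Rightarrow> (nat \<Rightarrow> real) \<Rightarrow> real mat \<Rightarrow> (nat \<Rightarrow> real) \<Rightarrow> bool" where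
  "eigenvalue_labelling n r ls A lam \<longleftrightarrow>
     char_poly A = (\<Prod>i=1..n. [:- lam i, 1:]) \<and>
     (\<forall>i\<in>{1..n}. \<forall>j\<in>{1..n}. i \<le> j \<and> \<not> (j \<le> r \<and> ls i * ls j < 0) \<longrightarrow> \<bar>lam j\<bar> \<le> \<bar>lam i\<bar>) \<and>
     (\<forall>i\<in>{1..r}. \<forall>j\<in>{1..r}. ls i < 0 \<and> 0 < ls j \<longrightarrow> lam i \<le> lam j)"

definition sign_dist :: "real \<Rightarrow> real \<Rightarrow> real" where
  "sign_dist x t = min \<bar>x - t\<bar> \<bar>x + t\<bar>"

definition plugin_est :: "real vec \<Rightarrow> real vec \<Rightarrow> real" where
  "plugin_est a u = a \<bullet> u"

definition bias_corr :: "nat \<Rightarrow> nat \<Rightarrow> real \<Rightarrow> (nat \<Rightarrow> real) \<Rightarrow> nat \<Rightarrow> real" where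
  "bias_corr n r \<sigma> lam l = (\<Sum>i\<in>{r<..n}. \<sigma>\<^sup>2 / (lam l - lam i)\<^sup>2)"

definition debiased_est ::
  "nat \<Rightarrow> nat \<Rightarrow> real \<Rightarrow> (nat \<Rightarrow> real) \<Rightarrow> nat \<Rightarrow> real vec \<Rightarrow> real vec \<Rightarrow> real" where
  "debiased_est n r \<sigma> lam l a u = sqrt (1 + bias_corr n r \<sigma> lam l) * (a \<bullet> u)"

definition E_md ::
  "nat \<Rightarrow> nat \<Rightarrow> real \<Rightarrow> (nat \<Rightarrow> real) \<Rightarrow> (nat \<Rightarrow> real vec) \<Rightarrow> real vec \<Rightarrow> nat \<Rightarrow> real" where
  "E_md n r \<sigma> ls us a l =
     (let \<Delta> = eigen_gap r ls l;
          L = ln (real n * cond_num r ls * lam_max ls / \<Delta>)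
      in \<sigma>\<^sup>2 * real r * ln (real n) / \<Delta>\<^sup>2 * \<bar>a \<bullet> us l\<bar>
         + \<sigma> * sqrt (real r * L) * (\<Sum>k\<in>{1..r} - {l}. \<bar>a \<bullet> us k\<bar> / \<bar>ls l - ls k\<bar>)
         + \<sigma> * sqrt L / \<bar>ls l\<bar>)"

end

theory Submission
  imports Defs "HOL-Combinatorics.Permutations"
begin

text \<open>Rotate the coordinates so that the signal becomes \<open>diag (ls 0, ..., ls (r-1), 0, ..., 0)\<close>; the law of the
noise \<open>H\<close> is unchanged (\<open>rotw_preserves\<close>). Split the coordinates into \<open>T = {..<r}\<close> and \<open>B = {r..<n}\<close>. For \<open>\<bar>x\<bar>\<close> well
above the noise norm, eliminating \<open>B\<close> from \<open>(x - M) z = 0\<close> leaves the \<open>r\<close> equations \<open>(x - \<gamma> x - ls k) z k = (E x z) k\<close>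
on \<open>T\<close>, with \<open>\<gamma> x = \<sigma>\<^sup>2 tr ((x - H_BB)\<^sup>-\<^sup>1)\<close> the same shift for all \<open>k\<close>. The coupling \<open>H_TB\<close> is
independent of \<open>H_BB\<close>, so a Hanson-Wright bound and a net give \<open>\<parallel>E x\<parallel> \<lesssim> \<sigma> \<surd>(r log n)\<close> for all large \<open>x\<close> at once
(\<open>good_event\<close>, \<open>E_net\<close>), although \<open>\<gamma> x\<close> itself can be much larger than this. Counting eigenvalues by
quadratic forms on both sides of a level shows that \<open>lam l - \<gamma> (lam l)\<close> is within \<open>\<parallel>E\<parallel>\<close> of \<open>ls l\<close> and no other
eigenvalue is (\<open>loc_l\<close>, \<open>loc_other\<close>). As \<open>x - \<gamma> x\<close> is nearly an isometry, eigengaps survive, and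
\<open>\<bar>u k\<bar> \<lesssim> \<parallel>E\<parallel> / \<bar>ls l - ls k\<bar>\<close> for \<open>k \<noteq> l\<close> in \<open>T\<close> (\<open>u_coord\<close>).

The coordinate \<open>\<alpha> = u l\<close> and the part of \<open>u\<close> on \<open>B\<close> come from leaving out coordinate \<open>l\<close>. With \<open>h\<close> the \<open>l\<close>-th
column of \<open>H\<close> and \<open>N\<close> the matrix without row and column \<open>l\<close>, the eigenvector is \<open>\<alpha> (1, (lam l - N)\<^sup>-\<^sup>1 h)\<close>, hence
\<open>1/\<alpha>\<^sup>2 = 1 + \<parallel>(lam l - N)\<^sup>-\<^sup>1 h\<parallel>\<^sup>2\<close>. As \<open>h\<close> is independent of \<open>N\<close>, the squared norm concentrates around
\<open>\<sigma>\<^sup>2 tr ((lam l - N)\<^sup>-\<^sup>2)\<close>, and written in the eigenbasis of \<open>M\<close> this trace is, up to a rank-one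
correction, \<open>\<Sum>i\<noteq>l. (lam l - lam i)\<^sup>-\<^sup>2\<close>; its part over \<open>i \<ge> r\<close> is the bias correction (\<open>bias_close\<close>). So
\<open>sqrt (1 + b) \<bar>\<alpha>\<bar>\<close> is 1 up to the claimed error (\<open>debias_l\<close>), while \<open>\<bar>\<alpha>\<bar>\<close> alone misses 1 by up to order
\<open>\<sigma>\<^sup>2 n / ls l\<^sup>2\<close> (\<open>plugin_l\<close>). Likewise the part of \<open>a\<close> on \<open>B\<close> enters only through a linear form in \<open>h\<close>
(\<open>bot_part\<close>). Since \<open>lam l\<close> depends on \<open>h\<close>, these forms are controlled at all points of a fine grid around
\<open>ls l\<close>, and \<open>lam l\<close> is replaced by the nearest one.\<close>

section \<open>Vectors and orthonormal families on finite index sets\<close>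

text \<open>Vectors are functions, read only on a finite index set, because principal submatrices, blocks and
deleted coordinates of one matrix occur together.\<close>

definition dot :: "'i set => ('i => real) => ('i => real) => real" where
  "dot S u v = (\<Sum>i\<in>S. u i * v i)"

definition mv :: "'i set => ('k => 'i => real) => ('i => real) => 'k => real" where
  "mv S A v i = (\<Sum>j\<in>S. A i j * v j)"

definition orthon :: "'i set => 'k set => ('k => 'i => real) => bool" where
  "orthon S K V \<longleftrightarrow> (\<forall>j\<in>K. \<forall>k\<in>K. dot S (V j) (V k) = (if j = k then 1 else 0))"

definition sym_on :: "'i set => ('i => 'i => real) => bool" where
  "sym_on S A \<longleftrightarrow> (\<forall>i\<in>S. \<forall>j\<in>S. A i j = A j i)"

definition eigsys :: "'i set => ('i => 'i => real) => ('i => 'i => real) => ('i => real) => bool" where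
  "eigsys S A V \<nu> \<longleftrightarrow> orthon S S V \<and> (\<forall>k\<in>S. \<forall>i\<in>S. mv S A (V k) i = \<nu> k * V k i)"

lemma dot_cong: "(\<And>i. i \<in> S ==> u i = u' i) ==> (\<And>i. i \<in> S ==> v i = v' i) ==> dot S u v = dot S u' v'"
  by (auto simp: dot_def intro!: sum.cong)

lemma mv_cong: "(\<And>j. j \<in> S ==> A i j = A' i j) ==> (\<And>j. j \<in> S ==> v j = v' j) ==> mv S A v i = mv S A' v' i"
  by (auto simp: mv_def intro!: sum.cong)

lemma dot_commute: "dot S u v = dot S v u"
  by (simp add: dot_def mult.commute)

lemma dot_add_left: "dot S (\<lambda>i. u i + u' i) v = dot S u v + dot S u' v"
  and dot_add_right: "dot S v (\<lambda>i. u i + u' i) = dot S v u + dot S v u'"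
  and dot_diff_left: "dot S (\<lambda>i. u i - u' i) v = dot S u v - dot S u' v"
  and dot_diff_right: "dot S v (\<lambda>i. u i - u' i) = dot S v u - dot S v u'"
  and dot_scale_left: "dot S (\<lambda>i. c * u i) v = c * dot S u v"
  and dot_scale_right: "dot S v (\<lambda>i. c * u i) = c * dot S v u"
  by (simp_all add: dot_def algebra_simps sum.distrib sum_subtractf sum_distrib_left)

lemma dot_sum_left: "dot S (\<lambda>i. \<Sum>k\<in>K. f k i) v = (\<Sum>k\<in>K. dot S (f k) v)"
  unfolding dot_def sum_distrib_right by (rule sum.swap)

lemma dot_self_nonneg: "0 \<le> dot S v v"
  by (simp add: dot_def sum_nonneg)

lemma dot_self_eq_0: "finite S ==> dot S v v = 0 \<longleftrightarrow> (\<forall>i\<in>S. v i = 0)"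
  unfolding dot_def by (subst sum_nonneg_eq_0_iff) auto

lemma L2_set_sq: "(L2_set v S)\<^sup>2 = dot S v v"
  by (simp add: L2_set_def dot_def sum_nonneg power2_eq_square)

lemma L2_set_dot: "L2_set v S = sqrt (dot S v v)"
  by (simp add: L2_set_def dot_def power2_eq_square)

lemma dot_CS: "\<bar>dot S u v\<bar> \<le> L2_set u S * L2_set v S"
proof -
  have "\<bar>dot S u v\<bar> \<le> (\<Sum>i\<in>S. \<bar>u i\<bar> * \<bar>v i\<bar>)"
    unfolding dot_def by (rule order_trans[OF sum_abs]) (simp add: abs_mult)
  also have "... \<le> L2_set u S * L2_set v S" by (rule L2_set_mult_ineq)
  finally show ?thesis .
qed

lemma L2_set_scale: "L2_set (\<lambda>i. c * v i) S = \<bar>c\<bar> * L2_set v S"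
proof -
  have "dot S (\<lambda>i. c * v i) (\<lambda>i. c * v i) = c\<^sup>2 * dot S v v"
    by (simp add: dot_scale_left dot_scale_right power2_eq_square)
  then show ?thesis by (simp add: L2_set_dot real_sqrt_mult)
qed

lemma L2_set_subset: "finite S ==> T \<subseteq> S ==> L2_set v T \<le> L2_set v S"
  unfolding L2_set_def by (intro real_sqrt_le_mono sum_mono2) auto

lemma L2_set_diff: "L2_set (\<lambda>i. u i - v i) S \<le> L2_set u S + L2_set v S"
  using L2_set_triangle_ineq[of u "\<lambda>i. - v i" S] by (simp add: L2_set_def)

lemma mv_sym: "finite S ==> sym_on S A ==> dot S u (mv S A v) = dot S (mv S A u) v"
proof -
  assume A: "sym_on S A"
  have "dot S u (mv S A v) = (\<Sum>i\<in>S. \<Sum>j\<in>S. u i * (A i j * v j))"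
    by (simp add: dot_def mv_def sum_distrib_left)
  also have "... = (\<Sum>j\<in>S. \<Sum>i\<in>S. u i * (A i j * v j))" by (rule sum.swap)
  also have "... = dot S (mv S A u) v" using A
    by (auto simp: dot_def mv_def sum_distrib_right sym_on_def intro!: sum.cong)
  finally show ?thesis .
qed

lemma mv_add: "mv S A (\<lambda>i. u i + v i) i = mv S A u i + mv S A v i"
  and mv_diff: "mv S A (\<lambda>i. u i - v i) i = mv S A u i - mv S A v i"
  and mv_scale: "mv S A (\<lambda>i. c * v i) i = c * mv S A v i"
  by (simp_all add: mv_def algebra_simps sum.distrib sum_subtractf sum_distrib_left)

lemma mv_sum: "mv S A (\<lambda>i. \<Sum>k\<in>K. f k i) i = (\<Sum>k\<in>K. mv S A (f k) i)"
  unfolding mv_def sum_distrib_left by (rule sum.swap)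

text \<open>Gaussian elimination: solve one equation for one unknown and recurse on the others.\<close>

lemma underdetermined:
  fixes A :: "'k => 'i => real"
  assumes "finite K" "finite S" "card K < card S"
  shows "\<exists>c. (\<exists>j\<in>S. c j \<noteq> 0) \<and> (\<forall>k\<in>K. (\<Sum>j\<in>S. A k j * c j) = 0)"
  using assms
proof (induction K arbitrary: S A rule: finite_induct)
  case empty
  then have "S \<noteq> {}" by auto
  then show ?case by (intro exI[of _ "\<lambda>_. 1"]) auto
next
  case (insert k K)
  show ?case
  proof (cases "\<forall>j\<in>S. A k j = 0")
    case True
    have "card K < card S" using insert by simp
    from insert.IH[OF insert.prems(1) this, of A] True show ?thesis by (auto)
  next
    case False
    then obtain p where p: "p \<in> S" "A k p \<noteq> 0" by auto
    define A' where "A' k' j = A k' j - A k' p * A k j / A k p" for k' j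
    have "card K < card (S - {p})" using insert p by (simp add: card_Diff_singleton)
    from insert.IH[OF _ this, of A'] insert.prems obtain c where
      c: "\<exists>j\<in>S - {p}. c j \<noteq> 0" "\<forall>k'\<in>K. (\<Sum>j\<in>S - {p}. A' k' j * c j) = 0" by auto
    define c' where "c' = c(p := - (\<Sum>j\<in>S - {p}. A k j * c j) / A k p)"
    have sp: "(\<Sum>j\<in>S. A k' j * c' j) = A k' p * c' p + (\<Sum>j\<in>S - {p}. A k' j * c j)" for k'
      by (subst sum.remove[OF insert.prems(1) p(1)]) (auto simp: c'_def intro!: sum.cong)
    have "(\<Sum>j\<in>S. A k' j * c' j) = 0" if "k' \<in> insert k K" for k'
    proof (cases "k' = k")
      case True
      then show ?thesis unfolding sp using p by (simp add: c'_def)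
    next
      case False
      then have "(\<Sum>j\<in>S - {p}. A' k' j * c j) = 0" using c that by auto
      then have "(\<Sum>j\<in>S - {p}. A k' j * c j) = (\<Sum>j\<in>S - {p}. A k' p * (A k j * c j) / A k p)"
        by (simp add: A'_def algebra_simps sum_subtractf)
      also have "... = A k' p * (\<Sum>j\<in>S - {p}. A k j * c j) / A k p"
        by (simp add: sum_distrib_left sum_divide_distrib)
      finally show ?thesis unfolding sp by (simp add: c'_def)
    qed
    moreover have "\<exists>j\<in>S. c' j \<noteq> 0" using c(1) by (auto simp: c'_def)
    ultimately show ?thesis by blast
  qed
qed

lemma orthon_comb:
  assumes "finite K" "orthon S K V" "k \<in> K"
  shows "dot S (\<lambda>i. \<Sum>j\<in>K. c j * V j i) (V k) = c k"
proof -
  have "dot S (\<lambda>i. \<Sum>j\<in>K. c j * V j i) (V k) = (\<Sum>j\<in>K. c j * dot S (V j) (V k))"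
    by (simp add: dot_sum_left dot_scale_left)
  also have "... = (\<Sum>j\<in>K. if j = k then c j else 0)"
    by (rule sum.cong) (use assms in \<open>auto simp: orthon_def\<close>)
  finally show ?thesis using assms by simp
qed

text \<open>The residual \<open>w\<close> is orthogonal to every \<open>V k\<close>, and as there are as many vectors as dimensions this forces \<open>w = 0\<close>.\<close>

lemma orthon_expand:
  fixes V :: "'k => 'i => real"
  assumes fin: "finite S" "finite K" and V: "orthon S K V" and card: "card K = card S" and i: "i \<in> S"
  shows "v i = (\<Sum>k\<in>K. dot S v (V k) * V k i)"
proof -
  define w where "w i = v i - (\<Sum>k\<in>K. dot S v (V k) * V k i)" for i
  have w0: "dot S w (V k) = 0" if "k \<in> K" for k
    unfolding w_def using orthon_comb[OF fin(2) V that, of "\<lambda>k. dot S v (V k)"]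
    by (simp add: dot_diff_left)
  define U where "U x i = (case x of None => w i | Some k => V k i)" for x i
  let ?K = "insert None (Some ` K)"
  have "card ?K = Suc (card K)" using fin by (simp add: card_image)
  then obtain c where c: "\<exists>j\<in>?K. c j \<noteq> 0" "\<forall>i\<in>S. (\<Sum>x\<in>?K. U x i * c x) = 0"
    using underdetermined[of S ?K "\<lambda>i x. U x i"] fin card by auto
  have sum: "c None * w i + (\<Sum>k\<in>K. c (Some k) * V k i) = 0" if "i \<in> S" for i
  proof -
    have "(\<Sum>x\<in>?K. U x i * c x) = U None i * c None + (\<Sum>x\<in>Some ` K. U x i * c x)"
      using fin by (subst sum.insert) auto
    also have "(\<Sum>x\<in>Some ` K. U x i * c x) = (\<Sum>k\<in>K. c (Some k) * V k i)"
      by (subst sum.reindex) (auto simp: U_def mult.commute)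
    finally show ?thesis using c that by (simp add: U_def mult.commute)
  qed
  have z: "dot S (\<lambda>i. c None * w i + (\<Sum>k\<in>K. c (Some k) * V k i)) y = 0" for y
    unfolding dot_def by (rule sum.neutral) (use sum in auto)
  have ck: "c (Some k) = 0" if "k \<in> K" for k
    using z[of "V k"] orthon_comb[OF fin(2) V that, of "\<lambda>k. c (Some k)"] w0[OF that]
    by (simp add: dot_add_left dot_scale_left)
  with c have "c None \<noteq> 0" by auto
  then have "w i = 0" using sum[OF i] ck by simp
  then show ?thesis by (simp add: w_def)
qed

lemma parseval:
  assumes "finite S" "finite K" "orthon S K V" "card K = card S"
  shows "dot S u v = (\<Sum>k\<in>K. dot S u (V k) * dot S v (V k))"
proof -
  have "dot S u v = dot S (\<lambda>i. \<Sum>k\<in>K. dot S u (V k) * V k i) v"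
    by (rule dot_cong) (use orthon_expand[OF assms] in auto)
  also have "... = (\<Sum>k\<in>K. dot S u (V k) * dot S (V k) v)"
    by (simp add: dot_sum_left dot_scale_left)
  finally show ?thesis by (simp add: dot_commute)
qed

lemma orthon_rows:
  assumes "finite S" "finite K" "orthon S K V" "card K = card S" "i \<in> S" "j \<in> S"
  shows "(\<Sum>k\<in>K. V k i * V k j) = (if i = j then 1 else 0)"
proof -
  have e: "dot S (\<lambda>x. if x = j then 1 else 0) (V k) = V k j" for k
    using assms(1,6) by (simp add: dot_def if_distrib[of "\<lambda>x. x * _"] cong: if_cong)
  show ?thesis using orthon_expand[OF assms(1-5), of "\<lambda>x. if x = j then 1 else 0"]
    by (simp add: e mult.commute)
qed

lemma orthon_new:
  assumes fin: "finite S" "finite K" and lt: "card K < card S"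
  shows "\<exists>v. dot S v v = 1 \<and> (\<forall>k\<in>K. dot S v (V k) = 0) \<and> (\<forall>i. i \<notin> S --> v i = 0)"
proof -
  obtain c where c: "\<exists>j\<in>S. c j \<noteq> 0" "\<forall>k\<in>K. (\<Sum>j\<in>S. V k j * c j) = 0"
    using underdetermined[OF fin(2,1) lt] by blast
  define p where "p = dot S c c"
  have "p \<noteq> 0" unfolding p_def using c dot_self_eq_0[OF fin(1)] by auto
  then have p: "p > 0" using dot_self_nonneg[of S c] by (simp add: p_def)
  define v where "v i = (if i \<in> S then c i / sqrt p else 0)" for i
  have vy: "dot S v y = dot S c y / sqrt p" for y
    by (auto simp: dot_def v_def sum_divide_distrib intro!: sum.cong)
  have "dot S c v = p / sqrt p" using vy[of c] dot_commute[of S c v] by (simp add: p_def)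
  then have "dot S v v = 1" using vy[of v] p by simp
  moreover have "dot S c (V k) = 0" if "k \<in> K" for k
    using c(2) that by (simp add: dot_def mult.commute)
  then have "\<forall>k\<in>K. dot S v (V k) = 0" using vy by simp
  moreover have "\<forall>i. i \<notin> S --> v i = 0" by (simp add: v_def)
  ultimately show ?thesis by blast
qed

lemma orthon_insert:
  assumes "orthon S K V" "dot S v v = 1" "\<And>k. k \<in> K ==> dot S v (V k) = 0" "k0 \<notin> K"
  shows "orthon S (insert k0 K) (V(k0 := v))"
  using assms by (auto simp: orthon_def dot_commute)

lemma orthon_extend:
  assumes "finite S" "finite L" "K \<subseteq> L" "orthon S K V" "card L \<le> card S"
  shows "\<exists>V'. orthon S L V' \<and> (\<forall>k\<in>K. V' k = V k)"
  using assms(2-)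
proof (induction "card (L - K)" arbitrary: K V)
  case 0
  then have "K = L" by auto
  then show ?case using 0 by auto
next
  case (Suc m)
  then obtain k0 where k0: "k0 \<in> L" "k0 \<notin> K" by (metis Diff_iff card.empty ex_in_conv nat.distinct(1))
  have fK: "finite K" using Suc.prems finite_subset by blast
  have "card K < card L" using k0 Suc.prems by (intro psubset_card_mono) auto
  then obtain v where v: "dot S v v = 1" "\<forall>k\<in>K. dot S v (V k) = 0"
    using orthon_new[OF assms(1) fK, of V] Suc.prems by auto
  have "L - insert k0 K = (L - K) - {k0}" by auto
  then have m: "m = card (L - insert k0 K)" using Suc.hyps(2) k0 Suc.prems by simp
  obtain V' where "orthon S L V'" "\<forall>k\<in>insert k0 K. V' k = (V(k0 := v)) k"
    using Suc.hyps(1)[OF m Suc.prems(1) _ orthon_insert[OF Suc.prems(3) v(1)] Suc.prems(4)] v k0 Suc.prems by auto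
  then show ?case using k0 by (intro exI[of _ V']) auto
qed

section \<open>Spectral theorem\<close>

lemma compact_box:
  fixes X :: "'i => real set"
  assumes "\<And>i. compact (X i)"
  shows "compact {v. \<forall>i. v i \<in> X i}"
proof -
  have "compactin (product_topology (\<lambda>i. euclidean) UNIV) (PiE UNIV X)"
    using assms by (subst compactin_PiE) auto
  moreover have "PiE UNIV X = {v. \<forall>i. v i \<in> X i}" by (auto simp: PiE_def)
  ultimately show ?thesis by (metis compactin_euclidean_iff euclidean_product_topology)
qed

lemma continuous_on_dot: "continuous_on X f ==> continuous_on X g ==> continuous_on X (\<lambda>x. dot S (f x) (g x))"
proof -
  assume f: "continuous_on X f" and g: "continuous_on X g"
  have "continuous_on X (\<lambda>x. f x i)" "continuous_on X (\<lambda>x. g x i)" for i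
    using continuous_on_product_then_coordinatewise[OF f] continuous_on_product_then_coordinatewise[OF g] by auto
  then show ?thesis unfolding dot_def by (intro continuous_on_sum continuous_on_mult)
qed

lemma continuous_on_mv:
  fixes A :: "'k => 'i => real"
  shows "continuous_on X f ==> continuous_on X (\<lambda>x. mv S A (f x))"
proof (rule continuous_on_coordinatewise_then_product)
  fix i
  assume f: "continuous_on X f"
  have "continuous_on X (\<lambda>x. f x j)" for j
    using continuous_on_product_then_coordinatewise[OF f] by auto
  then show "continuous_on X (\<lambda>x. mv S A (f x) i)" unfolding mv_def
    by (intro continuous_on_sum continuous_on_mult continuous_on_const)
qed

text \<open>The feasible vectors form a compact subset of the product space once coordinates outside \<open>S\<close> are pinned to 0, and the form is continuous there.\<close>

lemma rayleigh_max:
  assumes fin: "finite S" "finite K" and lt: "card K < card S"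
  shows "\<exists>v. dot S v v = 1 \<and> (\<forall>k\<in>K. dot S v (V k) = 0) \<and>
     (\<forall>w. dot S w w = 1 --> (\<forall>k\<in>K. dot S w (V k) = 0) --> dot S w (mv S A w) \<le> dot S v (mv S A v))"
proof -
  define Bx :: "('a => real) set" where "Bx = {v. \<forall>i. v i \<in> (if i \<in> S then {-1..1} else {0})}"
  define C where "C = Bx \<inter> {v. dot S v v = 1} \<inter> (\<Inter>k\<in>K. {v. dot S v (V k) = 0})"
  have "compact Bx" unfolding Bx_def by (rule compact_box) auto
  moreover have "closed {v. dot S v v = 1}"
    by (intro closed_Collect_eq continuous_on_dot) (auto simp: continuous_on_id)
  moreover have "closed {v. dot S v (V k) = 0}" for k
    by (intro closed_Collect_eq continuous_on_dot) (auto simp: continuous_on_id)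
  ultimately have comp: "compact C" unfolding C_def by (intro compact_Int_closed closed_INT) auto
  have inC: "v \<in> C" if "dot S v v = 1" "\<forall>k\<in>K. dot S v (V k) = 0" "\<forall>i. i \<notin> S --> v i = 0" for v
  proof -
    have "v i \<in> {-1..1}" if i: "i \<in> S" for i
    proof -
      have "v i * v i \<le> dot S v v" unfolding dot_def by (rule member_le_sum[OF i]) (auto simp: fin)
      then have "(v i)\<^sup>2 \<le> 1" using \<open>dot S v v = 1\<close> by (simp add: power2_eq_square)
      then have "\<bar>v i\<bar> \<le> 1" by (simp only: abs_square_le_1)
      then show ?thesis by auto
    qed
    then show ?thesis using that by (auto simp: C_def Bx_def)
  qed
  have ne: "C \<noteq> {}" using orthon_new[OF fin lt, of V] inC by blast
  have "continuous_on C (\<lambda>v. dot S v (mv S A v))"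
    by (intro continuous_on_dot continuous_on_mv continuous_on_id)
  from continuous_attains_sup[OF comp ne this] obtain v where
    v: "v \<in> C" "\<forall>w\<in>C. dot S w (mv S A w) \<le> dot S v (mv S A v)" by blast
  show ?thesis
  proof (intro exI[of _ v] conjI allI impI)
    show "dot S v v = 1" "\<forall>k\<in>K. dot S v (V k) = 0" using v by (auto simp: C_def)
    fix w assume w: "dot S w w = 1" "\<forall>k\<in>K. dot S w (V k) = 0"
    define w' where "w' i = (if i \<in> S then w i else 0)" for i
    have e: "dot S w' y = dot S w y" "dot S y w' = dot S y w" "mv S A w' i = mv S A w i" for y i
      by (auto simp: dot_def mv_def w'_def intro!: sum.cong)
    have "mv S A w' = mv S A w" using e by auto
    then show "dot S w (mv S A w) \<le> dot S v (mv S A v)"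
      using v(2) inC[of w'] w e by (auto simp: w'_def)
  qed
qed

text \<open>First-order condition: a parabola through the origin that stays nonpositive has no slope there.\<close>

lemma linear_term_zero:
  fixes b c :: real
  assumes "\<And>t. t * b + t\<^sup>2 * c \<le> 0"
  shows "b = 0"
proof (rule ccontr)
  assume b: "b \<noteq> 0"
  define k where "k = \<bar>c\<bar> + 1"
  have k: "k > 0" "- k \<le> c" by (auto simp: k_def)
  \<comment> \<open>at this point the quadratic term is at most half of the linear one\<close>
  define t where "t = b / (2 * k)"
  have tk: "2 * (t * k) = b" using k by (simp add: t_def)
  have "t\<^sup>2 * (- k) \<le> t\<^sup>2 * c" by (rule mult_left_mono[OF k(2)]) simp
  moreover have "t\<^sup>2 * (- k) = - (t * (t * k))" by (simp add: power2_eq_square)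
  moreover have "t * b = 2 * (t * (t * k))" using tk by (metis mult.left_commute)
  ultimately have "t * (t * k) \<le> 0" using assms[of t] by linarith
  moreover have "t * (t * k) = t\<^sup>2 * k" by (simp add: power2_eq_square)
  moreover have "t\<^sup>2 * k > 0" using b k by (simp add: t_def)
  ultimately show False by linarith
qed

text \<open>A maximiser of the form on the orthogonal complement of earlier eigenvectors is stationary in every direction of that complement, hence an eigenvector.\<close>

lemma eigen_step:
  assumes fin: "finite S" "finite K" and lt: "card K < card S" and A: "sym_on S A"
    and K: "\<And>k i. k \<in> K ==> i \<in> S ==> mv S A (V k) i = \<nu> k * V k i"
  shows "\<exists>v m. dot S v v = 1 \<and> (\<forall>k\<in>K. dot S v (V k) = 0) \<and> (\<forall>i\<in>S. mv S A v i = m * v i)"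
proof -
  obtain v where v1: "dot S v v = 1" and vK: "\<forall>k\<in>K. dot S v (V k) = 0"
    and max: "\<And>w. dot S w w = 1 ==> \<forall>k\<in>K. dot S w (V k) = 0 ==> dot S w (mv S A w) \<le> dot S v (mv S A v)"
    using rayleigh_max[OF fin lt, of V A] by blast
  define m where "m = dot S v (mv S A v)"
  have max': "dot S w (mv S A w) \<le> m * dot S w w" if "\<forall>k\<in>K. dot S w (V k) = 0" for w
  proof (cases "dot S w w = 0")
    case True
    then have "\<forall>i\<in>S. w i = 0" using dot_self_eq_0[OF fin(1)] by auto
    then have "dot S w (mv S A w) = 0" by (simp add: dot_def)
    then show ?thesis using True by simp
  next
    case False
    then have p: "dot S w w > 0" using dot_self_nonneg[of S w] by linarith
    define c where "c = 1 / sqrt (dot S w w)"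
    have c2: "c * c * dot S w w = 1" using p by (simp add: c_def)
    have "dot S (\<lambda>i. c * w i) (mv S A (\<lambda>i. c * w i)) \<le> m"
      unfolding m_def using that c2 by (intro max) (auto simp: dot_scale_left dot_scale_right)
    then have "c * c * dot S w (mv S A w) \<le> m"
      unfolding mv_scale[abs_def] dot_scale_left dot_scale_right by (simp add: mult.assoc)
    then have "c * c * dot S w (mv S A w) * dot S w w \<le> m * dot S w w" using p by (simp add: mult_right_mono)
    moreover have "c * c * dot S w (mv S A w) * dot S w w = dot S w (mv S A w)" using c2
      by (simp add: mult.commute mult.left_commute)
    ultimately show ?thesis by simp
  qed
  define w where "w i = mv S A v i - m * v i" for i
  have Avk: "dot S (mv S A v) (V k) = 0" if "k \<in> K" for k
  proof -
    have "dot S (mv S A v) (V k) = dot S v (mv S A (V k))" using mv_sym[OF fin(1) A] by simp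
    also have "... = dot S v (\<lambda>i. \<nu> k * V k i)" by (rule dot_cong) (use K that in auto)
    finally show ?thesis using vK that by (simp add: dot_scale_right)
  qed
  have wK: "\<forall>k\<in>K. dot S w (V k) = 0" unfolding w_def using Avk vK by (auto simp: dot_diff_left dot_scale_left)
  have wv: "dot S w v = 0" unfolding w_def
    by (simp add: dot_diff_left dot_scale_left v1 m_def dot_commute)
  have "t * (2 * dot S w (mv S A v)) + t\<^sup>2 * (dot S w (mv S A w) - m * dot S w w) \<le> 0" for t
  proof -
    have e: "mv S A (\<lambda>i. v i + t * w i) = (\<lambda>i. mv S A v i + t * mv S A w i)"
    proof
      fix i
      show "mv S A (\<lambda>i. v i + t * w i) i = mv S A v i + t * mv S A w i"
        unfolding mv_add mv_scale ..
    qed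
    have "dot S (\<lambda>i. v i + t * w i) (mv S A (\<lambda>i. v i + t * w i)) \<le> m * dot S (\<lambda>i. v i + t * w i) (\<lambda>i. v i + t * w i)"
      by (rule max') (use vK wK in \<open>auto simp: dot_add_left dot_scale_left\<close>)
    moreover have "dot S v (mv S A w) = dot S w (mv S A v)"
      using mv_sym[OF fin(1) A, of v w] by (simp add: dot_commute)
    ultimately show ?thesis using wv v1 dot_commute[of S v w] unfolding e
      by (simp add: dot_add_left dot_add_right dot_scale_left dot_scale_right m_def[symmetric] algebra_simps power2_eq_square)
  qed
  from linear_term_zero[OF this] have z: "dot S w (mv S A v) = 0" by simp
  have "dot S w w = dot S w (\<lambda>i. mv S A v i - m * v i)"
    by (rule dot_cong) (auto simp: w_def)
  also have "... = dot S w (mv S A v) - m * dot S w v"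
    unfolding dot_diff_right dot_scale_right ..
  finally have "dot S w w = dot S w (mv S A v) - m * dot S w v" .
  then have "dot S w w = 0" using z wv by simp
  then have "\<forall>i\<in>S. w i = 0" using dot_self_eq_0[OF fin(1)] by auto
  then show ?thesis using v1 vK by (intro exI[of _ v] exI[of _ m]) (auto simp: w_def)
qed

theorem spectral_theorem:
  assumes fin: "finite S" and A: "sym_on S A"
  shows "\<exists>V \<nu>. eigsys S A V \<nu>"
proof -
  have "\<exists>V \<nu>. orthon S K V \<and> (\<forall>k\<in>K. \<forall>i\<in>S. mv S A (V k) i = \<nu> k * V k i)" if "K \<subseteq> S" for K
    using finite_subset[OF that fin] that
  proof (induction K rule: finite_induct)
    case empty
    show ?case by (simp add: orthon_def)
  next
    case (insert k0 K)
    then obtain V \<nu> where V: "orthon S K V" "\<forall>k\<in>K. \<forall>i\<in>S. mv S A (V k) i = \<nu> k * V k i" by auto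
    have "card K < card S" using insert fin by (intro psubset_card_mono) auto
    from eigen_step[OF fin insert(1) this A, of V \<nu>] V(2) obtain v m where
      v: "dot S v v = 1" "\<forall>k\<in>K. dot S v (V k) = 0" "\<forall>i\<in>S. mv S A v i = m * v i" by auto
    have "orthon S (insert k0 K) (V(k0 := v))" using V v insert by (intro orthon_insert) auto
    moreover have "\<forall>k\<in>insert k0 K. \<forall>i\<in>S. mv S A ((V(k0 := v)) k) i = (\<nu>(k0 := m)) k * (V(k0 := v)) k i"
      using V v insert by auto
    ultimately show ?case by blast
  qed
  from this[of S] show ?thesis by (auto simp: eigsys_def)
qed

section \<open>Operator norm and functions of a symmetric matrix\<close>

definition opb :: "'i set => ('i => 'i => real) => real => bool" where
  "opb S A c \<longleftrightarrow> (\<forall>v. L2_set (mv S A v) S \<le> c * L2_set v S)"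

lemma opbD: "opb S A c ==> L2_set (mv S A v) S \<le> c * L2_set v S"
  by (simp add: opb_def)

lemma eigsysD:
  "eigsys S A V \<nu> ==> orthon S S V"
  "eigsys S A V \<nu> ==> k \<in> S ==> i \<in> S ==> mv S A (V k) i = \<nu> k * V k i"
  by (auto simp: eigsys_def)

lemma orthon_self: "orthon S K V ==> k \<in> K ==> dot S (V k) (V k) = 1"
  by (simp add: orthon_def)

lemma eig_expand:
  assumes "finite S" "eigsys S A V \<nu>" "i \<in> S"
  shows "v i = (\<Sum>k\<in>S. dot S v (V k) * V k i)"
  by (rule orthon_expand[OF assms(1,1) eigsysD(1)[OF assms(2)] refl assms(3)])

lemma eig_parseval:
  assumes "finite S" "eigsys S A V \<nu>"
  shows "dot S u v = (\<Sum>k\<in>S. dot S u (V k) * dot S v (V k))"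
  by (rule parseval[OF assms(1,1) eigsysD(1)[OF assms(2)] refl])

lemma eig_rows:
  assumes "finite S" "eigsys S A V \<nu>" "i \<in> S" "j \<in> S"
  shows "(\<Sum>k\<in>S. V k i * V k j) = (if i = j then 1 else 0)"
  by (rule orthon_rows[OF assms(1,1) eigsysD(1)[OF assms(2)] refl assms(3,4)])

lemma eig_mv:
  assumes "finite S" "eigsys S A V \<nu>" "i \<in> S"
  shows "mv S A v i = (\<Sum>k\<in>S. \<nu> k * dot S v (V k) * V k i)"
proof -
  have "mv S A v i = mv S A (\<lambda>i. \<Sum>k\<in>S. dot S v (V k) * V k i) i"
    by (rule mv_cong) (use eig_expand[OF assms(1,2)] in auto)
  also have "... = (\<Sum>k\<in>S. dot S v (V k) * mv S A (V k) i)" by (simp add: mv_sum mv_scale)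
  also have "... = (\<Sum>k\<in>S. \<nu> k * dot S v (V k) * V k i)"
    by (rule sum.cong) (use eigsysD(2)[OF assms(2)] assms(3) in auto)
  finally show ?thesis .
qed

lemma eig_dot_mv:
  assumes "finite S" "eigsys S A V \<nu>" "k \<in> S"
  shows "dot S (mv S A v) (V k) = \<nu> k * dot S v (V k)"
proof -
  have "dot S (mv S A v) (V k) = dot S (\<lambda>i. \<Sum>j\<in>S. (\<nu> j * dot S v (V j)) * V j i) (V k)"
    by (rule dot_cong) (use eig_mv[OF assms(1,2)] in auto)
  also have "... = \<nu> k * dot S v (V k)"
    by (rule orthon_comb[OF assms(1) eigsysD(1)[OF assms(2)] assms(3)])
  finally show ?thesis .
qed

lemma eig_form:
  assumes "finite S" "eigsys S A V \<nu>"
  shows "dot S v (mv S A v) = (\<Sum>k\<in>S. \<nu> k * (dot S v (V k))\<^sup>2)"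
  unfolding eig_parseval[OF assms, of v "mv S A v"]
  by (rule sum.cong) (use eig_dot_mv[OF assms] in \<open>auto simp: power2_eq_square\<close>)

lemma eig_norm:
  assumes "finite S" "eigsys S A V \<nu>"
  shows "dot S (mv S A v) (mv S A v) = (\<Sum>k\<in>S. (\<nu> k)\<^sup>2 * (dot S v (V k))\<^sup>2)"
  unfolding eig_parseval[OF assms, of "mv S A v" "mv S A v"]
  by (rule sum.cong) (use eig_dot_mv[OF assms] in \<open>auto simp: power2_eq_square\<close>)

lemma eig_norm1:
  assumes "finite S" "eigsys S A V \<nu>"
  shows "dot S v v = (\<Sum>k\<in>S. (dot S v (V k))\<^sup>2)"
  unfolding eig_parseval[OF assms, of v v] by (simp add: power2_eq_square)

lemma opb_eig:
  assumes "finite S" "eigsys S A V \<nu>" "\<And>k. k \<in> S ==> \<bar>\<nu> k\<bar> \<le> c" "0 \<le> c"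
  shows "opb S A c"
  unfolding opb_def
proof
  fix v
  have "dot S (mv S A v) (mv S A v) \<le> (\<Sum>k\<in>S. c\<^sup>2 * (dot S v (V k))\<^sup>2)"
    unfolding eig_norm[OF assms(1,2)]
    by (intro sum_mono mult_right_mono) (use assms in \<open>auto simp: abs_le_square_iff[symmetric]\<close>)
  also have "... = c\<^sup>2 * dot S v v" by (simp add: eig_norm1[OF assms(1,2)] sum_distrib_left)
  finally have "sqrt (dot S (mv S A v) (mv S A v)) \<le> sqrt (c\<^sup>2 * dot S v v)" by simp
  then show "L2_set (mv S A v) S \<le> c * L2_set v S"
    using assms(4) by (simp add: L2_set_dot real_sqrt_mult)
qed

lemma eig_le_opb:
  assumes "finite S" "eigsys S A V \<nu>" "opb S A c" "k \<in> S"
  shows "\<bar>\<nu> k\<bar> \<le> c"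
proof -
  have 1: "dot S (V k) (V k) = 1" using orthon_self[OF eigsysD(1)[OF assms(2)] assms(4)] .
  have "L2_set (mv S A (V k)) S = L2_set (\<lambda>i. \<nu> k * V k i) S"
    unfolding L2_set_dot using dot_cong[of S "mv S A (V k)" "\<lambda>i. \<nu> k * V k i" "mv S A (V k)" "\<lambda>i. \<nu> k * V k i"]
      eigsysD(2)[OF assms(2,4)] by auto
  also have "... = \<bar>\<nu> k\<bar>" by (simp add: L2_set_scale L2_set_dot 1)
  finally show ?thesis using opbD[OF assms(3), of "V k"] by (simp add: L2_set_dot 1)
qed

lemma opb_of_form:
  assumes "finite S" "sym_on S A" "0 \<le> c" "\<And>v. dot S v v = 1 ==> \<bar>dot S v (mv S A v)\<bar> \<le> c"
  shows "opb S A c"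
proof -
  obtain V \<nu> where V: "eigsys S A V \<nu>" using spectral_theorem[OF assms(1,2)] by blast
  have "\<bar>\<nu> k\<bar> \<le> c" if k: "k \<in> S" for k
  proof -
    have 1: "dot S (V k) (V k) = 1" using orthon_self[OF eigsysD(1)[OF V] k] .
    have "dot S (V k) (mv S A (V k)) = \<nu> k"
      using eig_dot_mv[OF assms(1) V k, of "V k"] 1 by (simp add: dot_commute)
    then show ?thesis using assms(4)[OF 1] by simp
  qed
  then show ?thesis by (rule opb_eig[OF assms(1) V _ assms(3)])
qed

lemma opb_subset:
  assumes "finite S" "T \<subseteq> S" "opb S A c" "0 \<le> c"
  shows "opb T A c"
  unfolding opb_def
proof
  fix v :: "'a => real"
  define w where "w i = (if i \<in> T then v i else 0)" for i
  have e: "mv S A w i = mv T A v i" for i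
    unfolding mv_def w_def by (rule sum.mono_neutral_cong_right) (use assms in auto)
  have "L2_set w S = L2_set v T"
    unfolding L2_set_def w_def by (rule arg_cong[of _ _ sqrt], rule sum.mono_neutral_cong_right) (use assms in auto)
  moreover have "L2_set (mv T A v) T \<le> L2_set (mv T A v) S" by (rule L2_set_subset[OF assms(1,2)])
  moreover have "L2_set (mv S A w) S = L2_set (mv T A v) S" by (simp add: e[abs_def])
  ultimately show "L2_set (mv T A v) T \<le> c * L2_set v T" using opbD[OF assms(3), of w] by simp
qed

lemma opb_block:
  fixes v :: "'i => real"
  assumes "finite S" "T \<subseteq> S" "B \<subseteq> S" "opb S A c"
  shows "L2_set (mv T A v) B \<le> c * L2_set v T"
proof -
  define w where "w i = (if i \<in> T then v i else 0)" for i
  have e: "mv S A w i = mv T A v i" for i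
    unfolding mv_def w_def by (rule sum.mono_neutral_cong_right) (use assms in auto)
  have "L2_set w S = L2_set v T"
    unfolding L2_set_def w_def by (rule arg_cong[of _ _ sqrt], rule sum.mono_neutral_cong_right) (use assms in auto)
  moreover have "L2_set (mv T A v) B \<le> L2_set (mv T A v) S" by (rule L2_set_subset[OF assms(1,3)])
  moreover have "L2_set (mv S A w) S = L2_set (mv T A v) S" by (simp add: e[abs_def])
  ultimately show ?thesis using opbD[OF assms(4), of w] by simp
qed

lemma eig_entry:
  assumes "finite S" "eigsys S A V \<nu>" "i \<in> S" "j \<in> S"
  shows "A i j = (\<Sum>k\<in>S. \<nu> k * V k i * V k j)"
proof -
  have e: "dot S (\<lambda>x. if x = j then 1 else 0) (V k) = V k j" for k
    using assms(1,4) by (simp add: dot_def if_distrib[of "\<lambda>x. x * _"] cong: if_cong)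
  have "A i j = mv S A (\<lambda>x. if x = j then 1 else 0) i"
    using assms(1,4) by (simp add: mv_def if_distrib[of "\<lambda>x. _ * x"] cong: if_cong)
  then show ?thesis unfolding eig_mv[OF assms(1-3)] e by (simp add: mult_ac)
qed

lemma eig_trace:
  assumes "finite S" "eigsys S A V \<nu>"
  shows "(\<Sum>i\<in>S. A i i) = (\<Sum>k\<in>S. \<nu> k)"
proof -
  have "(\<Sum>i\<in>S. A i i) = (\<Sum>i\<in>S. \<Sum>k\<in>S. \<nu> k * (V k i * V k i))"
    by (rule sum.cong) (use eig_entry[OF assms] in \<open>auto simp: mult.assoc\<close>)
  also have "... = (\<Sum>k\<in>S. \<nu> k * dot S (V k) (V k))"
    by (subst sum.swap) (simp add: dot_def sum_distrib_left)
  also have "... = (\<Sum>k\<in>S. \<nu> k)" using orthon_self[OF eigsysD(1)[OF assms(2)]] by simp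
  finally show ?thesis .
qed

lemma eig_frob:
  assumes "finite S" "eigsys S A V \<nu>"
  shows "(\<Sum>i\<in>S. \<Sum>j\<in>S. (A i j)\<^sup>2) = (\<Sum>k\<in>S. (\<nu> k)\<^sup>2)"
proof -
  have "(\<Sum>j\<in>S. (A i j)\<^sup>2) = (\<Sum>k\<in>S. (\<nu> k)\<^sup>2 * (V k i * V k i))" if i: "i \<in> S" for i
  proof -
    have "(\<Sum>j\<in>S. (A i j)\<^sup>2) = dot S (A i) (A i)" by (simp add: dot_def power2_eq_square)
    also have "... = (\<Sum>k\<in>S. (dot S (A i) (V k))\<^sup>2)" by (rule eig_norm1[OF assms])
    also have "... = (\<Sum>k\<in>S. (\<nu> k)\<^sup>2 * (V k i * V k i))"
    proof (rule sum.cong)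
      fix k assume k: "k \<in> S"
      have "dot S (A i) (V k) = mv S A (V k) i" by (simp add: dot_def mv_def)
      then show "(dot S (A i) (V k))\<^sup>2 = (\<nu> k)\<^sup>2 * (V k i * V k i)"
        using eigsysD(2)[OF assms(2) k i] by (simp add: power2_eq_square)
    qed simp
    finally show ?thesis .
  qed
  then have "(\<Sum>i\<in>S. \<Sum>j\<in>S. (A i j)\<^sup>2) = (\<Sum>i\<in>S. \<Sum>k\<in>S. (\<nu> k)\<^sup>2 * (V k i * V k i))" by simp
  also have "... = (\<Sum>k\<in>S. (\<nu> k)\<^sup>2 * dot S (V k) (V k))"
    by (subst sum.swap) (simp add: dot_def sum_distrib_left)
  also have "... = (\<Sum>k\<in>S. (\<nu> k)\<^sup>2)" using orthon_self[OF eigsysD(1)[OF assms(2)]] by simp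
  finally show ?thesis .
qed

text \<open>Needed for the eigenbasis of the full matrix, which does not diagonalise the block whose norm is taken.\<close>

lemma frob_basis:
  assumes "finite S" "orthon S S V"
  shows "(\<Sum>i\<in>S. \<Sum>j\<in>S. (A i j)\<^sup>2) = (\<Sum>k\<in>S. dot S (mv S A (V k)) (mv S A (V k)))"
proof -
  have "(\<Sum>j\<in>S. (A i j)\<^sup>2) = (\<Sum>k\<in>S. (mv S A (V k) i)\<^sup>2)" for i
  proof -
    have "(\<Sum>j\<in>S. (A i j)\<^sup>2) = dot S (A i) (A i)" by (simp add: dot_def power2_eq_square)
    also have "... = (\<Sum>k\<in>S. dot S (A i) (V k) * dot S (A i) (V k))"
      by (rule parseval[OF assms(1,1,2) refl])
    finally show ?thesis by (simp add: dot_def mv_def power2_eq_square)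
  qed
  then have "(\<Sum>i\<in>S. \<Sum>j\<in>S. (A i j)\<^sup>2) = (\<Sum>i\<in>S. \<Sum>k\<in>S. (mv S A (V k) i)\<^sup>2)" by simp
  also have "... = (\<Sum>k\<in>S. \<Sum>i\<in>S. (mv S A (V k) i)\<^sup>2)" by (rule sum.swap)
  finally show ?thesis by (simp add: dot_def power2_eq_square)
qed

text \<open>Functional calculus in entries; shifts, pseudo-inverses and products of resolvents are all obtained from it.\<close>

lemma eigsys_fn:
  assumes "finite S" "eigsys S A V \<nu>" "\<And>i j. i \<in> S ==> j \<in> S ==> F i j = (\<Sum>k\<in>S. f k * V k i * V k j)"
  shows "eigsys S F V f"
  unfolding eigsys_def
proof (intro conjI ballI)
  show "orthon S S V" by (rule eigsysD(1)[OF assms(2)])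
  fix k i assume k: "k \<in> S" and i: "i \<in> S"
  have "mv S F (V k) i = (\<Sum>j\<in>S. \<Sum>q\<in>S. f q * V q i * (V q j * V k j))"
    unfolding mv_def by (rule sum.cong) (use assms(3) i in \<open>auto simp: sum_distrib_right mult.assoc\<close>)
  also have "... = (\<Sum>q\<in>S. f q * V q i * dot S (V q) (V k))"
    by (subst sum.swap) (simp add: dot_def sum_distrib_left)
  also have "... = (\<Sum>q\<in>S. if q = k then f q * V q i else 0)"
    by (rule sum.cong) (use eigsysD(1)[OF assms(2)] k in \<open>auto simp: orthon_def\<close>)
  finally show "mv S F (V k) i = f k * V k i" using k assms(1) by simp
qed

lemma eigsys_shift:
  assumes "finite S" "eigsys S A V \<mu>"
  shows "eigsys S (\<lambda>i j. (if i = j then x else 0) - A i j) V (\<lambda>k. x - \<mu> k)"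
proof (rule eigsys_fn[OF assms])
  fix i j assume ij: "i \<in> S" "j \<in> S"
  have "(\<Sum>k\<in>S. (x - \<mu> k) * V k i * V k j) = x * (\<Sum>k\<in>S. V k i * V k j) - (\<Sum>k\<in>S. \<mu> k * V k i * V k j)"
    by (simp add: sum_distrib_left left_diff_distrib sum_subtractf mult.assoc)
  then show "(if i = j then x else 0) - A i j = (\<Sum>k\<in>S. (x - \<mu> k) * V k i * V k j)"
    using eig_rows[OF assms ij] eig_entry[OF assms ij] by simp
qed

text \<open>Half of Courant-Fischer: if fewer than \<open>card J\<close> eigenvalues had property \<open>P\<close>, some nontrivial combination of the \<open>W j\<close> would be orthogonal to all their eigenvectors.\<close>

lemma eig_count:
  assumes "finite S" "finite J"
    "\<And>c. \<exists>j\<in>J. c j \<noteq> 0 ==> \<exists>k\<in>S. P k \<and> dot S (\<lambda>i. \<Sum>j\<in>J. c j * W j i) (V k) \<noteq> 0"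
  shows "card J \<le> card {k\<in>S. P k}"
proof (rule ccontr)
  assume "\<not> card J \<le> card {k\<in>S. P k}"
  then obtain c where c: "\<exists>j\<in>J. c j \<noteq> 0" "\<forall>k\<in>{k\<in>S. P k}. (\<Sum>j\<in>J. dot S (W j) (V k) * c j) = 0"
    using underdetermined[of "{k\<in>S. P k}" J "\<lambda>k j. dot S (W j) (V k)"] assms by auto
  have "dot S (\<lambda>i. \<Sum>j\<in>J. c j * W j i) (V k) = (\<Sum>j\<in>J. dot S (W j) (V k) * c j)" for k
    by (simp add: dot_sum_left dot_scale_left mult.commute)
  with assms(3)[OF c(1)] c(2) show False by auto
qed

section \<open>A net of the unit ball and the operator norm\<close>

text \<open>With \<open>d = card T\<close>, the points \<open>netp T z\<close> are those of the grid of spacing \<open>1 / (4 \<surd>d)\<close> in the ball of radius \<open>5/4\<close>; rounding a unit vector moves it by at most \<open>1/4\<close>.\<close>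

definition netZ :: "'i set => ('i => int) set" where
  "netZ T = {z \<in> PiE T (\<lambda>_. UNIV). (\<Sum>i\<in>T. (z i)\<^sup>2) \<le> 25 * int (card T)}"

definition netp :: "'i set => ('i => int) => 'i => real" where
  "netp T z i = real_of_int (z i) / (4 * sqrt (real (card T)))"

lemma geom_int: "(\<Sum>z\<in>{- int m..int m}. (1/2::real) ^ nat \<bar>z\<bar>) = 3 - 2 * (1/2) ^ m"
proof (induction m)
  case (Suc m)
  have "{- int (Suc m)..int (Suc m)} = insert (- int (Suc m)) (insert (int (Suc m)) {- int m..int m})" by auto
  then have "(\<Sum>z\<in>{- int (Suc m)..int (Suc m)}. (1/2::real) ^ nat \<bar>z\<bar>) =
     (1/2) ^ Suc m + ((1/2) ^ Suc m + (\<Sum>z\<in>{- int m..int m}. (1/2::real) ^ nat \<bar>z\<bar>))"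
    by (simp add: nat_add_distrib abs_if)
  then show ?case using Suc by simp
qed simp

lemma abs_le_sq_int: "\<bar>x\<bar> \<le> x\<^sup>2" for x :: int
proof (cases "x = 0")
  case False
  then have "\<bar>x\<bar> ^ 1 \<le> \<bar>x\<bar> ^ 2" by (intro power_increasing) auto
  then show ?thesis by simp
qed simp

lemma netZ_sub:
  assumes "finite T" shows "netZ T \<subseteq> PiE T (\<lambda>_. {- int (25 * card T)..int (25 * card T)})"
proof
  fix z assume z: "z \<in> netZ T"
  have "z i \<in> {- int (25 * card T)..int (25 * card T)}" if i: "i \<in> T" for i
  proof -
    have "\<bar>z i\<bar> \<le> (z i)\<^sup>2" by (rule abs_le_sq_int)
    also have "(z i)\<^sup>2 \<le> (\<Sum>i\<in>T. (z i)\<^sup>2)" by (rule member_le_sum[OF i]) (auto simp: assms)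
    finally show ?thesis using z by (auto simp: netZ_def)
  qed
  then show "z \<in> PiE T (\<lambda>_. {- int (25 * card T)..int (25 * card T)})" using z by (auto simp: netZ_def PiE_iff)
qed

lemma finite_netZ: "finite T ==> finite (netZ T)"
  by (rule finite_subset[OF netZ_sub]) (auto intro: finite_PiE)

text \<open>Exponential counting: \<open>\<bar>z\<bar> \<le> z\<^sup>2\<close> makes \<open>2 ^ (25 d) * (\<Prod>i. 2 ^ - \<bar>z i\<bar>)\<close> at least 1 on the net, and the sum of the product over all \<open>z\<close> factorises.\<close>

lemma card_netZ:
  assumes "finite T" shows "real (card (netZ T)) \<le> exp (27 * real (card T))"
proof -
  define d where "d = card T"
  define f where "f z = (\<Prod>i\<in>T. (1/2::real) ^ nat \<bar>z i\<bar>)" for z :: "'a => int"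
  have 1: "1 \<le> 2 ^ (25 * d) * f z" if z: "z \<in> netZ T" for z
  proof -
    have "int (\<Sum>i\<in>T. nat \<bar>z i\<bar>) = (\<Sum>i\<in>T. \<bar>z i\<bar>)" by simp
    also have "(\<Sum>i\<in>T. \<bar>z i\<bar>) \<le> (\<Sum>i\<in>T. (z i)\<^sup>2)" by (rule sum_mono) (rule abs_le_sq_int)
    also have "... \<le> int (25 * d)" using z by (simp add: netZ_def d_def)
    finally have "(\<Sum>i\<in>T. nat \<bar>z i\<bar>) \<le> 25 * d" by linarith
    then have "(1/2::real) ^ (25 * d) \<le> (1/2) ^ (\<Sum>i\<in>T. nat \<bar>z i\<bar>)" by (intro power_decreasing) auto
    also have "... = f z" by (simp add: f_def power_sum)
    finally have "2 ^ (25 * d) * (1/2::real) ^ (25 * d) \<le> 2 ^ (25 * d) * f z" by (intro mult_left_mono) auto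
    moreover have "2 ^ (25 * d) * (1/2::real) ^ (25 * d) = 1" by (simp add: power_mult_distrib[symmetric])
    ultimately show ?thesis by simp
  qed
  have "real (card (netZ T)) = (\<Sum>z\<in>netZ T. 1)" by simp
  also have "... \<le> (\<Sum>z\<in>netZ T. 2 ^ (25 * d) * f z)" by (rule sum_mono) (rule 1)
  also have "... \<le> (\<Sum>z\<in>PiE T (\<lambda>_. {- int (25 * d)..int (25 * d)}). 2 ^ (25 * d) * f z)"
  proof (rule sum_mono2)
    show "finite (PiE T (\<lambda>_. {- int (25 * d)..int (25 * d)}))" by (rule finite_PiE[OF assms]) auto
    show "netZ T \<subseteq> PiE T (\<lambda>_. {- int (25 * d)..int (25 * d)})" using netZ_sub[OF assms] by (simp add: d_def)
  qed (simp add: f_def prod_nonneg)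
  also have "... = 2 ^ (25 * d) * (\<Sum>z\<in>PiE T (\<lambda>_. {- int (25 * d)..int (25 * d)}). f z)" by (simp add: sum_distrib_left)
  also have "(\<Sum>z\<in>PiE T (\<lambda>_. {- int (25 * d)..int (25 * d)}). f z) = (\<Prod>i\<in>T. \<Sum>z\<in>{- int (25 * d)..int (25 * d)}. (1/2) ^ nat \<bar>z\<bar>)"
    unfolding f_def by (rule prod_sum_PiE[symmetric]) (auto simp: assms)
  also have "... = (3 - 2 * (1/2) ^ (25 * d)) ^ d" unfolding geom_int by (simp add: d_def)
  also have "... \<le> 3 ^ d"
  proof (rule power_mono)
    have "(1/2::real) ^ (25 * d) \<le> 1" by (rule power_le_one) auto
    then show "0 \<le> 3 - 2 * (1/2::real) ^ (25 * d)" by linarith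
  qed simp
  finally have "real (card (netZ T)) \<le> 2 ^ (25 * d) * 3 ^ d" by simp
  also have "2 ^ (25 * d) * (3::real) ^ d \<le> 2 ^ (25 * d) * 4 ^ d" by (intro mult_left_mono power_mono) auto
  also have "... = 2 ^ (27 * d)"
  proof -
    have "(4::real) ^ d = 2 ^ (2 * d)" by (simp add: power_mult)
    then show ?thesis by (simp flip: power_add)
  qed
  also have "... \<le> (exp 1) ^ (27 * d)" using exp_ge_add_one_self[of 1] by (intro power_mono) auto
  also have "... = exp (27 * real d)" by (simp flip: exp_of_nat_mult)
  finally show ?thesis by (simp add: d_def)
qed

lemma netp_norm:
  assumes "finite T" "z \<in> netZ T"
  shows "dot T (netp T z) (netp T z) \<le> 25 / 16"
proof (cases "T = {}")
  case False
  define d where "d = real (card T)"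
  have d: "d > 0" using False assms by (simp add: d_def card_gt_0_iff)
  have e: "dot T (netp T z) (netp T z) = (\<Sum>i\<in>T. (real_of_int (z i))\<^sup>2) / (16 * d)"
    using d by (simp add: dot_def netp_def d_def[symmetric] sum_divide_distrib power2_eq_square)
  have "real_of_int (\<Sum>i\<in>T. (z i)\<^sup>2) \<le> real_of_int (25 * int (card T))"
    unfolding of_int_le_iff using assms(2) by (simp add: netZ_def)
  then have "(\<Sum>i\<in>T. (real_of_int (z i))\<^sup>2) \<le> 25 * d" by (simp add: d_def)
  then have "(\<Sum>i\<in>T. (real_of_int (z i))\<^sup>2) / (16 * d) \<le> 25 * d / (16 * d)"
    using d by (intro divide_right_mono) auto
  then show ?thesis unfolding e using d by simp
qed (simp add: dot_def)

lemma net_cover: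
  assumes "finite T" "T \<noteq> {}" "dot T v v = 1"
  shows "\<exists>z\<in>netZ T. L2_set (\<lambda>i. v i - netp T z i) T \<le> 1/4"
proof -
  define d where "d = real (card T)"
  have d: "d > 0" using assms by (simp add: d_def card_gt_0_iff)
  define q where "q = 4 * sqrt d"
  have q: "q > 0" "q\<^sup>2 = 16 * d" using d by (simp_all add: q_def power_mult_distrib)
  define z where "z = restrict (\<lambda>i. \<lfloor>q * v i\<rfloor>) T"
  have close: "(v i - netp T z i)\<^sup>2 \<le> 1 / (16 * d)" if i: "i \<in> T" for i
  proof -
    have "v i - netp T z i = (q * v i - \<lfloor>q * v i\<rfloor>) / q"
      using i q by (simp add: netp_def z_def q_def d_def[symmetric] diff_divide_distrib)
    then have "(v i - netp T z i)\<^sup>2 = (q * v i - \<lfloor>q * v i\<rfloor>)\<^sup>2 / (16 * d)" by (simp add: power_divide q)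
    also have "(q * v i - \<lfloor>q * v i\<rfloor>)\<^sup>2 \<le> 1" by (rule power_le_one) linarith+
    finally show ?thesis using d by (simp add: divide_right_mono)
  qed
  have "(\<Sum>i\<in>T. (v i - netp T z i)\<^sup>2) \<le> (\<Sum>i\<in>T. 1 / (16 * d))" by (rule sum_mono) (rule close)
  also have "... = (1/4)\<^sup>2" using d by (simp add: d_def power2_eq_square)
  finally have L: "L2_set (\<lambda>i. v i - netp T z i) T \<le> 1/4"
    unfolding L2_set_def by (intro real_le_lsqrt) (auto simp: sum_nonneg)
  have "L2_set (netp T z) T \<le> L2_set (\<lambda>i. v i - netp T z i) T + L2_set v T"
    using L2_set_diff[of v "\<lambda>i. v i - netp T z i" T] by (simp add: algebra_simps)
  then have "L2_set (netp T z) T \<le> 5/4" using L assms(3) by (simp add: L2_set_dot)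
  then have "(L2_set (netp T z) T)\<^sup>2 \<le> (5/4)\<^sup>2" by (intro power_mono) auto
  then have n: "dot T (netp T z) (netp T z) \<le> 25/16" unfolding L2_set_sq by (simp add: power2_eq_square)
  have "dot T (netp T z) (netp T z) = (\<Sum>i\<in>T. (real_of_int (z i))\<^sup>2) / (16 * d)"
    using d by (simp add: dot_def netp_def d_def[symmetric] sum_divide_distrib power2_eq_square)
  then have "(\<Sum>i\<in>T. (real_of_int (z i))\<^sup>2) = dot T (netp T z) (netp T z) * (16 * d)" using d by simp
  also have "... \<le> 25/16 * (16 * d)" using n d by (intro mult_right_mono) auto
  finally have "(\<Sum>i\<in>T. (real_of_int (z i))\<^sup>2) \<le> 25 * d" by simp
  then have "real_of_int (\<Sum>i\<in>T. (z i)\<^sup>2) \<le> real_of_int (25 * int (card T))" by (simp add: d_def)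
  then have "z \<in> netZ T" unfolding netZ_def of_int_le_iff by (simp add: z_def)
  then show ?thesis using L by blast
qed

text \<open>At a top eigenvector \<open>v\<close> replace \<open>v\<close> by a net point in both arguments; this loses at most \<open>5/16 + 1/4 = 9/16\<close> of the norm.\<close>

lemma net_opnorm:
  assumes fin: "finite T" and Q: "sym_on T Q" and \<tau>0: "0 \<le> \<tau>"
    and \<tau>: "\<And>z. z \<in> netZ T ==> \<bar>dot T (netp T z) (mv T Q (netp T z))\<bar> \<le> \<tau>"
  shows "opb T Q (16/7 * \<tau>)"
proof (cases "T = {}")
  case True
  then show ?thesis by (simp add: opb_def L2_set_def)
next
  case ne: False
  obtain V \<nu> where V: "eigsys T Q V \<nu>" using spectral_theorem[OF fin Q] by blast
  define s where "s = Max ((\<lambda>k. \<bar>\<nu> k\<bar>) ` T)"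
  have "s \<in> (\<lambda>k. \<bar>\<nu> k\<bar>) ` T" unfolding s_def by (rule Max_in) (use fin ne in auto)
  then obtain k where k: "k \<in> T" "s = \<bar>\<nu> k\<bar>" by auto
  have s0: "0 \<le> s" using k by simp
  have le: "\<bar>\<nu> j\<bar> \<le> s" if "j \<in> T" for j unfolding s_def by (rule Max_ge) (use fin that in auto)
  have op: "opb T Q s" by (rule opb_eig[OF fin V le s0])
  define v where "v = V k"
  have v1: "dot T v v = 1" unfolding v_def using orthon_self[OF eigsysD(1)[OF V] k(1)] .
  then have Lv: "L2_set v T = 1" by (simp add: L2_set_dot)
  obtain z where z: "z \<in> netZ T" "L2_set (\<lambda>i. v i - netp T z i) T \<le> 1/4"
    using net_cover[OF fin ne v1] by blast
  define \<zeta> where "\<zeta> = netp T z"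
  have z2: "L2_set (\<lambda>i. v i - \<zeta> i) T \<le> 1/4" using z by (simp add: \<zeta>_def)
  have Lz: "L2_set \<zeta> T \<le> 5/4"
    using L2_set_diff[of v "\<lambda>i. v i - \<zeta> i" T] z2 Lv by (simp add: algebra_simps)
  have "dot T v (mv T Q v) = dot T (\<lambda>i. v i - \<zeta> i) (mv T Q \<zeta>) + dot T v (mv T Q (\<lambda>i. v i - \<zeta> i)) + dot T \<zeta> (mv T Q \<zeta>)"
    by (simp add: mv_diff[abs_def] dot_diff_left dot_diff_right)
  moreover have "\<bar>dot T (\<lambda>i. v i - \<zeta> i) (mv T Q \<zeta>)\<bar> \<le> 1/4 * (s * (5/4))"
    by (rule order_trans[OF dot_CS]) (intro mult_mono z2 order_trans[OF opbD[OF op]] mult_left_mono Lz s0, auto)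
  moreover have "\<bar>dot T v (mv T Q (\<lambda>i. v i - \<zeta> i))\<bar> \<le> 1 * (s * (1/4))"
    by (rule order_trans[OF dot_CS]) (intro mult_mono order_trans[OF opbD[OF op]] mult_left_mono z2 s0, auto simp: Lv)
  moreover have "\<bar>dot T \<zeta> (mv T Q \<zeta>)\<bar> \<le> \<tau>" unfolding \<zeta>_def by (rule \<tau>[OF z(1)])
  moreover have "dot T v (mv T Q v) = \<nu> k"
    using eig_dot_mv[OF fin V k(1), of v] v1 by (simp add: v_def dot_commute)
  ultimately have "s \<le> 1/4 * (s * (5/4)) + 1 * (s * (1/4)) + \<tau>" using k(2) by linarith
  then have "s \<le> 16/7 * \<tau>" by simp
  then have "s * L2_set v T \<le> 16/7 * \<tau> * L2_set v T" for v by (rule mult_right_mono) simp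
  then show ?thesis using op unfolding opb_def by (blast intro: order_trans)
qed

section \<open>A measurable pseudo-inverse\<close>

text \<open>Landweber iteration for \<open>A X = I\<close> multiplies the error at an eigenvalue \<open>\<nu>\<close> by \<open>1 - lwc * \<nu>\<^sup>2\<close>, which this step size keeps in \<open>[0, 1]\<close>. Its iterates are polynomials in the entries, so the limit is measurable in the matrix.\<close>

definition lwc :: "'i set => ('i => 'i => real) => real" where
  "lwc S A = 1 / (1 + (\<Sum>i\<in>S. \<Sum>j\<in>S. (A i j)\<^sup>2))"

primrec lw :: "'i set => ('i => 'i => real) => nat => 'i => 'i => real" where
  "lw S A 0 = (\<lambda>i j. 0)"
| "lw S A (Suc m) = (\<lambda>i j. lw S A m i j +
     lwc S A * (\<Sum>k\<in>S. A i k * ((if k = j then 1 else 0) - (\<Sum>p\<in>S. A k p * lw S A m p j))))"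

text \<open>The limit inverts nonzero eigenvalues and keeps zero ones, so it exists for every symmetric matrix and is the inverse of an invertible one.\<close>

definition pinv :: "'i set => ('i => 'i => real) => 'i => 'i => real" where
  "pinv S A i j = lim (\<lambda>m. lw S A m i j)"

lemma lwc_cong: "(\<And>i j. i \<in> S ==> j \<in> S ==> A i j = A' i j) ==> lwc S A = lwc S A'"
  by (simp add: lwc_def)

lemma lw_cong:
  assumes "\<And>i j. i \<in> S ==> j \<in> S ==> A i j = A' i j" "i \<in> S" "j \<in> S"
  shows "lw S A m i j = lw S A' m i j"
  using assms(2,3)
proof (induction m arbitrary: i j)
  case (Suc m)
  have "(\<Sum>p\<in>S. A k p * lw S A m p j) = (\<Sum>p\<in>S. A' k p * lw S A' m p j)" if "k \<in> S" for k
    by (rule sum.cong) (use Suc assms(1) that in auto)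
  then have "(\<Sum>k\<in>S. A i k * ((if k = j then 1 else 0) - (\<Sum>p\<in>S. A k p * lw S A m p j))) =
    (\<Sum>k\<in>S. A' i k * ((if k = j then 1 else 0) - (\<Sum>p\<in>S. A' k p * lw S A' m p j)))"
    by (intro sum.cong) (use Suc assms(1) in auto)
  moreover have "lwc S A = lwc S A'" by (rule lwc_cong) (rule assms(1))
  ultimately show ?case using Suc by simp
qed simp

lemma pinv_cong:
  assumes "\<And>i j. i \<in> S ==> j \<in> S ==> A i j = A' i j" "i \<in> S" "j \<in> S"
  shows "pinv S A i j = pinv S A' i j"
  unfolding pinv_def using lw_cong[OF assms] by simp

lemma lw_eig:
  assumes "finite S" "eigsys S A V \<nu>" "i \<in> S" "j \<in> S"
  shows "lw S A m i j = (\<Sum>k\<in>S. (inverse (\<nu> k) * (1 - (1 - lwc S A * (\<nu> k)\<^sup>2) ^ m)) * V k i * V k j)"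
  using assms(3,4)
proof (induction m arbitrary: i j)
  case 0
  then show ?case by simp
next
  case (Suc m)
  define x where "x m k = inverse (\<nu> k) * (1 - (1 - lwc S A * (\<nu> k)\<^sup>2) ^ m)" for m k
  have xs: "x (Suc m) k = x m k + lwc S A * (\<nu> k * (1 - \<nu> k * x m k))" for k
  proof (cases "\<nu> k = 0")
    case False
    define p where "p = (1 - lwc S A * (\<nu> k)\<^sup>2) ^ m"
    have "\<nu> k * x m k = 1 - p" using False by (simp add: x_def p_def)
    moreover have "x (Suc m) k = inverse (\<nu> k) * (1 - (1 - lwc S A * (\<nu> k)\<^sup>2) * p)" by (simp add: x_def p_def)
    moreover have "x m k = inverse (\<nu> k) * (1 - p)" by (simp add: x_def p_def)
    moreover have "inverse (\<nu> k) * (\<nu> k)\<^sup>2 = \<nu> k" using False by (simp add: power2_eq_square)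
    moreover have "inverse (\<nu> k) * (1 - (1 - lwc S A * (\<nu> k)\<^sup>2) * p) =
       inverse (\<nu> k) * (1 - p) + lwc S A * (inverse (\<nu> k) * (\<nu> k)\<^sup>2 * p)" by (simp add: algebra_simps)
    ultimately have "x (Suc m) k = inverse (\<nu> k) * (1 - p) + lwc S A * (\<nu> k * p)"
      and xm: "x m k = inverse (\<nu> k) * (1 - p)" by simp_all
    moreover have "1 - \<nu> k * x m k = p" using \<open>\<nu> k * x m k = 1 - p\<close> by simp
    ultimately show ?thesis by (simp only: )
  qed (simp add: x_def)
  have 1: "(\<Sum>p\<in>S. A k p * lw S A m p j) = (\<Sum>q\<in>S. \<nu> q * x m q * V q k * V q j)" if k: "k \<in> S" for k
  proof -
    have "(\<Sum>p\<in>S. A k p * lw S A m p j) = (\<Sum>p\<in>S. \<Sum>q\<in>S. (x m q * V q j) * (A k p * V q p))"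
      by (rule sum.cong) (use Suc in \<open>auto simp: x_def sum_distrib_left mult_ac\<close>)
    also have "... = (\<Sum>q\<in>S. (x m q * V q j) * mv S A (V q) k)"
      by (subst sum.swap) (simp add: mv_def sum_distrib_left)
    also have "... = (\<Sum>q\<in>S. \<nu> q * x m q * V q k * V q j)"
      by (rule sum.cong) (use eigsysD(2)[OF assms(2)] k in auto)
    finally show ?thesis .
  qed
  have 2: "(if k = j then 1 else 0) - (\<Sum>p\<in>S. A k p * lw S A m p j) = (\<Sum>q\<in>S. (1 - \<nu> q * x m q) * V q k * V q j)"
    if k: "k \<in> S" for k
    using eig_rows[OF assms(1,2) k Suc.prems(2)] unfolding 1[OF k]
    by (simp add: left_diff_distrib sum_subtractf)
  have 3: "(\<Sum>k\<in>S. A i k * ((if k = j then 1 else 0) - (\<Sum>p\<in>S. A k p * lw S A m p j))) =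
      (\<Sum>q\<in>S. \<nu> q * (1 - \<nu> q * x m q) * V q i * V q j)"
  proof -
    have "(\<Sum>k\<in>S. A i k * ((if k = j then 1 else 0) - (\<Sum>p\<in>S. A k p * lw S A m p j))) =
       (\<Sum>k\<in>S. \<Sum>q\<in>S. ((1 - \<nu> q * x m q) * V q j) * (A i k * V q k))"
    proof (rule sum.cong)
      fix k assume k: "k \<in> S"
      show "A i k * ((if k = j then 1 else 0) - (\<Sum>p\<in>S. A k p * lw S A m p j)) =
         (\<Sum>q\<in>S. ((1 - \<nu> q * x m q) * V q j) * (A i k * V q k))"
        unfolding 2[OF k] sum_distrib_left by (rule sum.cong) (simp_all add: mult_ac)
    qed simp
    also have "... = (\<Sum>q\<in>S. ((1 - \<nu> q * x m q) * V q j) * mv S A (V q) i)"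
      by (subst sum.swap) (simp add: mv_def sum_distrib_left)
    also have "... = (\<Sum>q\<in>S. \<nu> q * (1 - \<nu> q * x m q) * V q i * V q j)"
      by (rule sum.cong) (use eigsysD(2)[OF assms(2)] Suc.prems in auto)
    finally show ?thesis .
  qed
  have "lw S A (Suc m) i j = (\<Sum>q\<in>S. x m q * V q i * V q j) + lwc S A * (\<Sum>q\<in>S. \<nu> q * (1 - \<nu> q * x m q) * V q i * V q j)"
    using Suc 3 by (simp add: x_def)
  also have "... = (\<Sum>q\<in>S. x (Suc m) q * V q i * V q j)"
    unfolding xs sum_distrib_left sum.distrib[symmetric]
    by (rule sum.cong) (auto simp: algebra_simps)
  finally show ?case by (simp add: x_def)
qed

lemma pinv_entry:
  assumes "finite S" "eigsys S A V \<nu>" "i \<in> S" "j \<in> S"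
  shows "pinv S A i j = (\<Sum>k\<in>S. inverse (\<nu> k) * V k i * V k j)"
proof -
  have "(\<lambda>m. inverse (\<nu> k) * (1 - (1 - lwc S A * (\<nu> k)\<^sup>2) ^ m)) \<longlonglongrightarrow> inverse (\<nu> k)" if k: "k \<in> S" for k
  proof (cases "\<nu> k = 0")
    case False
    have "(\<nu> k)\<^sup>2 \<le> (\<Sum>k\<in>S. (\<nu> k)\<^sup>2)" by (rule member_le_sum[OF k]) (auto simp: assms(1))
    then have c: "(\<nu> k)\<^sup>2 < 1 + (\<Sum>i\<in>S. \<Sum>j\<in>S. (A i j)\<^sup>2)" unfolding eig_frob[OF assms(1,2)] by simp
    moreover have "(\<nu> k)\<^sup>2 > 0" using False by simp
    moreover have "0 < 1 + (\<Sum>i\<in>S. \<Sum>j\<in>S. (A i j)\<^sup>2)"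
      using sum_nonneg[of S "\<lambda>i. \<Sum>j\<in>S. (A i j)\<^sup>2"] by (simp add: sum_nonneg add_pos_nonneg)
    ultimately have "lwc S A * (\<nu> k)\<^sup>2 > 0" "lwc S A * (\<nu> k)\<^sup>2 < 1" by (auto simp: lwc_def divide_simps)
    then have "norm (1 - lwc S A * (\<nu> k)\<^sup>2) < 1" by (simp add: abs_if)
    then have "(\<lambda>m. (1 - lwc S A * (\<nu> k)\<^sup>2) ^ m) \<longlonglongrightarrow> 0" by (rule LIMSEQ_power_zero)
    then have "(\<lambda>m. inverse (\<nu> k) * (1 - (1 - lwc S A * (\<nu> k)\<^sup>2) ^ m)) \<longlonglongrightarrow> inverse (\<nu> k) * (1 - 0)"
      by (intro tendsto_mult[OF tendsto_const] tendsto_diff[OF tendsto_const])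
    then show ?thesis by simp
  qed simp
  then have "(\<lambda>m. lw S A m i j) \<longlonglongrightarrow> (\<Sum>k\<in>S. inverse (\<nu> k) * V k i * V k j)"
    unfolding lw_eig[OF assms] by (intro tendsto_sum tendsto_mult tendsto_const)
  then show ?thesis unfolding pinv_def by (rule limI)
qed

lemma eigsys_pinv:
  assumes "finite S" "eigsys S A V \<nu>"
  shows "eigsys S (pinv S A) V (\<lambda>k. inverse (\<nu> k))"
  by (rule eigsys_fn[OF assms]) (rule pinv_entry[OF assms])

lemma eigsys_sym: "finite S ==> eigsys S A V \<nu> ==> sym_on S A"
proof -
  assume f: "finite S" and V: "eigsys S A V \<nu>"
  show ?thesis unfolding sym_on_def
  proof (intro ballI)
    fix i j assume ij: "i \<in> S" "j \<in> S"
    show "A i j = A j i"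
      unfolding eig_entry[OF f V ij] eig_entry[OF f V ij(2,1)] by (rule sum.cong) (auto simp: mult_ac)
  qed
qed

lemma pinv_sym: "finite S ==> sym_on S A ==> sym_on S (pinv S A)"
proof -
  assume f: "finite S" and A: "sym_on S A"
  obtain V \<nu> where "eigsys S A V \<nu>" using spectral_theorem[OF f A] by blast
  from eigsys_sym[OF f eigsys_pinv[OF f this]] show ?thesis .
qed

lemma pinv_solve:
  assumes "finite S" "eigsys S A V \<nu>" "\<And>k. k \<in> S ==> \<nu> k \<noteq> 0" "i \<in> S"
  shows "mv S A (mv S (pinv S A) y) i = y i"
proof -
  have "mv S A (mv S (pinv S A) y) i = (\<Sum>k\<in>S. \<nu> k * (inverse (\<nu> k) * dot S y (V k)) * V k i)"
    unfolding eig_mv[OF assms(1,2,4)]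
    by (rule sum.cong) (auto simp: eig_dot_mv[OF assms(1) eigsys_pinv[OF assms(1,2)]])
  also have "... = (\<Sum>k\<in>S. dot S y (V k) * V k i)" by (rule sum.cong) (use assms(3) in auto)
  finally show ?thesis using eig_expand[OF assms(1,2,4)] by simp
qed

lemma pinv_unique:
  assumes "finite S" "eigsys S A V \<nu>" "\<And>k. k \<in> S ==> \<nu> k \<noteq> 0" "\<And>i. i \<in> S ==> mv S A z i = y i" "i \<in> S"
  shows "z i = mv S (pinv S A) y i"
proof -
  have "inverse (\<nu> k) * dot S y (V k) = dot S z (V k)" if k: "k \<in> S" for k
  proof -
    have "dot S y (V k) = dot S (mv S A z) (V k)" by (rule dot_cong) (use assms(4) in auto)
    then show ?thesis using eig_dot_mv[OF assms(1,2) k] assms(3)[OF k] by simp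
  qed
  then have "mv S (pinv S A) y i = (\<Sum>k\<in>S. dot S z (V k) * V k i)"
    unfolding eig_mv[OF assms(1) eigsys_pinv[OF assms(1,2)] assms(5)] by (intro sum.cong) auto
  then show ?thesis using eig_expand[OF assms(1,2,5)] by simp
qed

lemmas poly_measurable = borel_measurable_sum borel_measurable_times borel_measurable_const

lemma lw_measurable:
  assumes A: "\<And>i j. i \<in> S ==> j \<in> S ==> (\<lambda>\<omega>. A \<omega> i j) \<in> borel_measurable M" and "i \<in> S" "j \<in> S"
  shows "(\<lambda>\<omega>. lw S (A \<omega>) m i j) \<in> borel_measurable M"
  using assms(2,3)
proof (induction m arbitrary: i j)
  case (Suc m)
  have c: "(\<lambda>\<omega>. lwc S (A \<omega>)) \<in> borel_measurable M"
    unfolding lwc_def by (intro borel_measurable_divide borel_measurable_add borel_measurable_sum borel_measurable_power borel_measurable_const A)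
  show ?case unfolding lw.simps
    by (intro borel_measurable_add borel_measurable_times borel_measurable_sum borel_measurable_diff c borel_measurable_const A Suc)
qed simp

lemma pinv_measurable:
  assumes "\<And>i j. i \<in> S ==> j \<in> S ==> (\<lambda>\<omega>. A \<omega> i j) \<in> borel_measurable M" "i \<in> S" "j \<in> S"
  shows "(\<lambda>\<omega>. pinv S (A \<omega>) i j) \<in> borel_measurable M"
  unfolding pinv_def by (intro borel_measurable_lim_metric lw_measurable[OF assms])

section \<open>Rotation invariance of Gaussian vectors\<close>

definition nd :: "real => real measure" where
  "nd s = density lborel (normal_density 0 s)"

lemma sets_nd[measurable_cong, simp]: "sets (nd s) = sets borel" and space_nd[simp]: "space (nd s) = UNIV"
  by (simp_all add: nd_def)

lemma prob_nd: "s > 0 ==> prob_space (nd s)"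
  unfolding nd_def by (rule prob_space_normal_density)

lemma nn_integral_nd:
  assumes [measurable]: "f \<in> borel_measurable borel"
  shows "(\<integral>\<^sup>+x. f x \<partial>nd s) = (\<integral>\<^sup>+x. ennreal (normal_density 0 s x) * f x \<partial>lborel)"
  unfolding nd_def by (subst nn_integral_density) auto

lemma psf_nd: "(\<And>i. s i > 0) ==> product_sigma_finite (\<lambda>i. nd (s i))"
  unfolding product_sigma_finite_def using prob_nd prob_space_imp_sigma_finite by blast

lemma prob_PiM_nd: "(\<And>i. s i > 0) ==> prob_space (PiM I (\<lambda>i. nd (s i)))"
  by (intro prob_space_PiM prob_nd)

text \<open>For \<open>c \<noteq> 0\<close> substitute in one variable and then in the other; the factors \<open>\<bar>c\<bar>\<close> and \<open>1 / \<bar>c\<bar>\<close> cancel.\<close>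

lemma rotate_lborel:
  fixes G :: "real => real => ennreal"
  assumes G[measurable]: "case_prod G \<in> borel_measurable (borel \<Otimes>\<^sub>M borel)" and cs: "c\<^sup>2 + s\<^sup>2 = 1"
  shows "(\<integral>\<^sup>+x. \<integral>\<^sup>+y. G (c * x - s * y) (s * x + c * y) \<partial>lborel \<partial>lborel) = (\<integral>\<^sup>+x. \<integral>\<^sup>+y. G x y \<partial>lborel \<partial>lborel)"
proof -
  have swap: "(\<integral>\<^sup>+x. \<integral>\<^sup>+y. H x y \<partial>lborel \<partial>lborel) = (\<integral>\<^sup>+y. \<integral>\<^sup>+x. H x y \<partial>lborel \<partial>lborel)"
    if [measurable]: "case_prod H \<in> borel_measurable (borel \<Otimes>\<^sub>M borel)" for H :: "real => real => ennreal"
    by (rule lborel_pair.Fubini'[symmetric]) measurable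
  show ?thesis
  proof (cases "c = 0")
    case True
    then have s: "s = 1 \<or> s = -1" using cs by (simp add: power2_eq_1_iff)
    then have s0: "s \<noteq> 0" "\<bar>s\<bar> = 1" by auto
    have "(\<integral>\<^sup>+x. \<integral>\<^sup>+y. G (c * x - s * y) (s * x + c * y) \<partial>lborel \<partial>lborel) = (\<integral>\<^sup>+x. \<integral>\<^sup>+y. G (0 + (-s) * y) (s * x) \<partial>lborel \<partial>lborel)"
      using True by simp
    also have "... = (\<integral>\<^sup>+x. \<integral>\<^sup>+u. G u (s * x) \<partial>lborel \<partial>lborel)"
    proof (rule nn_integral_cong)
      fix x
      show "(\<integral>\<^sup>+y. G (0 + (-s) * y) (s * x) \<partial>lborel) = (\<integral>\<^sup>+u. G u (s * x) \<partial>lborel)"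
        using nn_integral_real_affine[of "\<lambda>u. G u (s * x)" "-s" 0] s0 by simp
    qed
    also have "... = (\<integral>\<^sup>+u. \<integral>\<^sup>+x. G u (s * x) \<partial>lborel \<partial>lborel)" by (rule swap) measurable
    also have "... = (\<integral>\<^sup>+u. \<integral>\<^sup>+v. G u v \<partial>lborel \<partial>lborel)"
    proof (rule nn_integral_cong)
      fix u
      show "(\<integral>\<^sup>+x. G u (s * x) \<partial>lborel) = (\<integral>\<^sup>+v. G u v \<partial>lborel)"
        using nn_integral_real_affine[of "\<lambda>v. G u v" s 0] s0 by simp
    qed
    finally show ?thesis .
  next
    case c0: False
    define I where "I = (\<integral>\<^sup>+x. \<integral>\<^sup>+y. G (c * x - s * y) (s * x + c * y) \<partial>lborel \<partial>lborel)"
    have "I = (\<integral>\<^sup>+y. \<integral>\<^sup>+x. G (c * x - s * y) (s * x + c * y) \<partial>lborel \<partial>lborel)"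
      unfolding I_def by (rule swap) measurable
    then have "ennreal \<bar>c\<bar> * I = (\<integral>\<^sup>+y. ennreal \<bar>c\<bar> * (\<integral>\<^sup>+x. G (c * x - s * y) (s * x + c * y) \<partial>lborel) \<partial>lborel)"
      by (simp add: nn_integral_cmult)
    also have "... = (\<integral>\<^sup>+y. \<integral>\<^sup>+u. G u (s * u / c + 1 / c * y) \<partial>lborel \<partial>lborel)"
    proof (rule nn_integral_cong)
      fix y
      have e: "s * (- (s * y) + c * x) / c + 1 / c * y = s * x + c * y" for x
      proof -
        have "s * (- (s * y) + c * x) / c + 1 / c * y = ((1 - s\<^sup>2) * y + c * (s * x)) / c"
          using c0 by (simp add: field_simps power2_eq_square)
        also have "1 - s\<^sup>2 = c\<^sup>2" using cs by simp
        also have "(c\<^sup>2 * y + c * (s * x)) / c = s * x + c * y" using c0 by (simp add: field_simps power2_eq_square)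
        finally show ?thesis .
      qed
      have "(\<integral>\<^sup>+u. G u (s * u / c + 1 / c * y) \<partial>lborel) = ennreal \<bar>c\<bar> * (\<integral>\<^sup>+x. G (- (s * y) + c * x) (s * (- (s * y) + c * x) / c + 1 / c * y) \<partial>lborel)"
        by (rule nn_integral_real_affine[of "\<lambda>u. G u (s * u / c + 1 / c * y)" c "- (s * y)"]) (use c0 in measurable)
      then show "ennreal \<bar>c\<bar> * (\<integral>\<^sup>+x. G (c * x - s * y) (s * x + c * y) \<partial>lborel) = (\<integral>\<^sup>+u. G u (s * u / c + 1 / c * y) \<partial>lborel)"
        unfolding e by simp
    qed
    also have "... = (\<integral>\<^sup>+u. \<integral>\<^sup>+y. G u (s * u / c + 1 / c * y) \<partial>lborel \<partial>lborel)" by (rule swap) measurable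
    finally have 1: "ennreal \<bar>c\<bar> * I = (\<integral>\<^sup>+u. \<integral>\<^sup>+y. G u (s * u / c + 1 / c * y) \<partial>lborel \<partial>lborel)" .
    have "(\<integral>\<^sup>+u. \<integral>\<^sup>+v. G u v \<partial>lborel \<partial>lborel) = (\<integral>\<^sup>+u. ennreal \<bar>1/c\<bar> * (\<integral>\<^sup>+y. G u (s * u / c + 1 / c * y) \<partial>lborel) \<partial>lborel)"
    proof (rule nn_integral_cong)
      fix u
      show "(\<integral>\<^sup>+v. G u v \<partial>lborel) = ennreal \<bar>1/c\<bar> * (\<integral>\<^sup>+y. G u (s * u / c + 1 / c * y) \<partial>lborel)"
        by (rule nn_integral_real_affine[of "\<lambda>v. G u v" "1/c" "s * u / c"]) (use c0 in auto)
    qed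
    also have "... = ennreal \<bar>1/c\<bar> * (ennreal \<bar>c\<bar> * I)" unfolding 1 by (rule nn_integral_cmult) measurable
    also have "... = I" using c0 by (simp add: mult.assoc[symmetric] flip: ennreal_mult)
    finally show ?thesis unfolding I_def by simp
  qed
qed

lemma rotate_nd:
  fixes F :: "real => real => ennreal"
  assumes F[measurable]: "case_prod F \<in> borel_measurable (borel \<Otimes>\<^sub>M borel)" and cs: "c\<^sup>2 + s\<^sup>2 = 1"
  shows "(\<integral>\<^sup>+x. \<integral>\<^sup>+y. F (c * x - s * y) (s * x + c * y) \<partial>nd 1 \<partial>nd 1) = (\<integral>\<^sup>+x. \<integral>\<^sup>+y. F x y \<partial>nd 1 \<partial>nd 1)"
proof -
  define \<phi> where "\<phi> x y = ennreal (normal_density 0 1 x * normal_density 0 1 y)" for x y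
  have \<phi>m[measurable]: "case_prod \<phi> \<in> borel_measurable (borel \<Otimes>\<^sub>M borel)" unfolding \<phi>_def by measurable
  have \<phi>r: "\<phi> (c * x - s * y) (s * x + c * y) = \<phi> x y" for x y
  proof -
    have "(c * x - s * y)\<^sup>2 + (s * x + c * y)\<^sup>2 = (c\<^sup>2 + s\<^sup>2) * x\<^sup>2 + (c\<^sup>2 + s\<^sup>2) * y\<^sup>2"
      by (simp add: power2_eq_square algebra_simps)
    then have "- (c * x - s * y)\<^sup>2 / 2 + - (s * x + c * y)\<^sup>2 / 2 = - x\<^sup>2 / 2 + - y\<^sup>2 / 2" using cs by simp
    then show ?thesis unfolding \<phi>_def std_normal_density_def
      by (simp add: mult_ac flip: exp_add)
  qed
  have two: "(\<integral>\<^sup>+x. \<integral>\<^sup>+y. H x y \<partial>nd 1 \<partial>nd 1) = (\<integral>\<^sup>+x. \<integral>\<^sup>+y. \<phi> x y * H x y \<partial>lborel \<partial>lborel)"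
    if [measurable]: "case_prod H \<in> borel_measurable (borel \<Otimes>\<^sub>M borel)" for H :: "real => real => ennreal"
  proof -
    have "(\<integral>\<^sup>+x. \<integral>\<^sup>+y. H x y \<partial>nd 1 \<partial>nd 1) = (\<integral>\<^sup>+x. \<integral>\<^sup>+y. ennreal (normal_density 0 1 y) * H x y \<partial>lborel \<partial>nd 1)"
      by (intro nn_integral_cong nn_integral_nd) measurable
    also have "... = (\<integral>\<^sup>+x. ennreal (normal_density 0 1 x) * (\<integral>\<^sup>+y. ennreal (normal_density 0 1 y) * H x y \<partial>lborel) \<partial>lborel)"
      by (rule nn_integral_nd) measurable
    also have "... = (\<integral>\<^sup>+x. \<integral>\<^sup>+y. \<phi> x y * H x y \<partial>lborel \<partial>lborel)"
      unfolding \<phi>_def by (intro nn_integral_cong) (simp add: ennreal_mult mult.assoc nn_integral_cmult)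
    finally show ?thesis .
  qed
  have "(\<integral>\<^sup>+x. \<integral>\<^sup>+y. F (c * x - s * y) (s * x + c * y) \<partial>nd 1 \<partial>nd 1) =
    (\<integral>\<^sup>+x. \<integral>\<^sup>+y. \<phi> (c * x - s * y) (s * x + c * y) * F (c * x - s * y) (s * x + c * y) \<partial>lborel \<partial>lborel)"
    unfolding \<phi>r by (rule two) measurable
  also have "... = (\<integral>\<^sup>+x. \<integral>\<^sup>+y. \<phi> x y * F x y \<partial>lborel \<partial>lborel)"
    by (rule rotate_lborel[OF _ cs, of "\<lambda>x y. \<phi> x y * F x y"]) measurable
  also have "... = (\<integral>\<^sup>+x. \<integral>\<^sup>+y. F x y \<partial>nd 1 \<partial>nd 1)" by (rule two[symmetric]) measurable
  finally show ?thesis .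
qed

abbreviation gau :: "'i set => ('i => real) measure" where
  "gau I \<equiv> PiM I (\<lambda>_. nd 1)"

abbreviation iid :: "'i set => real => ('i => real) measure" where
  "iid I \<sigma> \<equiv> PiM I (\<lambda>_. nd \<sigma>)"

definition pairrot :: "'i => 'i => real => real => ('i => real) => 'i => real" where
  "pairrot a b c s x = (x(a := c * x a - s * x b))(b := s * x a + c * x b)"

lemma pairrot_measurable:
  assumes "a \<in> I" "b \<in> I"
  shows "pairrot a b c s \<in> measurable (gau I) (gau I)"
  unfolding pairrot_def
proof (rule measurable_fun_upd[of I I b], use assms in blast)
  have [measurable]: "(\<lambda>\<omega>. \<omega> a) \<in> borel_measurable (gau I)" "(\<lambda>\<omega>. \<omega> b) \<in> borel_measurable (gau I)"
    using measurable_component_singleton[OF assms(1), of "\<lambda>_. nd 1"] measurable_component_singleton[OF assms(2), of "\<lambda>_. nd 1"]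
    by (simp_all add: measurable_cong_sets[OF refl sets_nd])
  show "(\<lambda>x. x(a := c * x a - s * x b)) \<in> measurable (gau I) (gau I)"
    by (rule measurable_fun_upd[of I I a]) (use assms in \<open>auto simp: measurable_cong_sets[OF refl sets_nd]\<close>)
  show "(\<lambda>\<omega>. s * \<omega> a + c * \<omega> b) \<in> measurable (gau I) (nd 1)"
    by (simp add: measurable_cong_sets[OF refl sets_nd])
qed

lemma pairrot_invariant:
  assumes fin: "finite I" and ab: "a \<in> I" "b \<in> I" "a \<noteq> b" and cs: "c\<^sup>2 + s\<^sup>2 = 1"
    and f: "f \<in> borel_measurable (gau I)"
  shows "(\<integral>\<^sup>+\<omega>. f (pairrot a b c s \<omega>) \<partial>gau I) = (\<integral>\<^sup>+\<omega>. f \<omega> \<partial>gau I)"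
proof -
  interpret product_sigma_finite "\<lambda>_::'a. nd 1" by (rule psf_nd) simp
  define J where "J = I - {a, b}"
  have I: "I = insert a (insert b J)" "a \<notin> insert b J" "b \<notin> J" "finite J" "finite (insert b J)"
    using ab fin by (auto simp: J_def)
  have two: "(\<integral>\<^sup>+\<omega>. g \<omega> \<partial>gau I) = (\<integral>\<^sup>+w. \<integral>\<^sup>+z. \<integral>\<^sup>+y. g ((w(b := z))(a := y)) \<partial>nd 1 \<partial>nd 1 \<partial>gau J)"
    if g[measurable]: "g \<in> borel_measurable (gau I)" for g :: "('a => real) => ennreal"
  proof -
    have g': "g \<in> borel_measurable (gau (insert a (insert b J)))" using g I(1) by simp
    have "(\<lambda>(x, y). g (x(a := y))) \<in> borel_measurable (gau (insert b J) \<Otimes>\<^sub>M nd 1)"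
      using measurable_comp[OF measurable_add_dim[of a "insert b J" "\<lambda>_. nd 1"] g'] by (simp add: comp_def split_def)
    then have m: "(\<lambda>x. \<integral>\<^sup>+y. g (x(a := y)) \<partial>nd 1) \<in> borel_measurable (gau (insert b J))"
      using sigma_finite_measure.borel_measurable_nn_integral[OF sigma_finite_measures, of "\<lambda>x y. g (x(a := y))"] by simp
    show ?thesis unfolding I(1) product_nn_integral_insert[OF I(5,2) g'] product_nn_integral_insert[OF I(4,3) m] ..
  qed
  have fr: "(\<lambda>\<omega>. f (pairrot a b c s \<omega>)) \<in> borel_measurable (gau I)"
    using measurable_comp[OF pairrot_measurable[OF ab(1,2)] f] by (simp add: comp_def)
  show ?thesis unfolding two[OF f] two[OF fr]
  proof (rule nn_integral_cong)
    fix w assume w: "w \<in> space (gau J)"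
    define F where "F z y = f ((w(b := z))(a := y))" for z y
    have "(\<lambda>p. (w(b := fst p))(a := snd p)) \<in> measurable (borel \<Otimes>\<^sub>M borel) (gau I)"
      unfolding I(1)
      by (rule measurable_fun_upd[of _ "insert b J"], simp, rule measurable_fun_upd[of _ J])
         (use w in \<open>auto simp: measurable_cong_sets[OF refl sets_nd]\<close>)
    from measurable_comp[OF this f] have F: "case_prod F \<in> borel_measurable (borel \<Otimes>\<^sub>M borel)"
      by (simp add: F_def comp_def split_def)
    have "f (pairrot a b c s ((w(b := z))(a := y))) = F (c * z - (-s) * y) ((-s) * z + c * y)" for z y
      unfolding F_def pairrot_def by (rule arg_cong[of _ _ f]) (use ab in \<open>auto simp: algebra_simps\<close>)
    then show "(\<integral>\<^sup>+z. \<integral>\<^sup>+y. f (pairrot a b c s ((w(b := z))(a := y))) \<partial>nd 1 \<partial>nd 1) = (\<integral>\<^sup>+z. \<integral>\<^sup>+y. f ((w(b := z))(a := y)) \<partial>nd 1 \<partial>nd 1)"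
      using rotate_nd[OF F, of c "-s"] cs by (simp add: F_def)
  qed
qed

definition lin :: "'i set => ('i => 'i => real) => ('i => real) => 'i => real" where
  "lin I V \<omega> = (\<lambda>i\<in>I. \<Sum>j\<in>I. V i j * \<omega> j)"

text \<open>Orthogonality of the matrix, in the form \<open>transpose V * V = 1\<close>.\<close>

definition colorth :: "'i set => ('i => 'i => real) => bool" where
  "colorth I V \<longleftrightarrow> (\<forall>j\<in>I. \<forall>k\<in>I. (\<Sum>i\<in>I. V i j * V i k) = (if j = k then 1 else 0))"

definition pres :: "'i set => ('i => 'i => real) => bool" where
  "pres I V \<longleftrightarrow> (\<forall>f\<in>borel_measurable (gau I). (\<integral>\<^sup>+\<omega>. f (lin I V \<omega>) \<partial>gau I) = (\<integral>\<^sup>+\<omega>. f \<omega> \<partial>gau I))"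

lemma component_measurable: "i \<in> I ==> (\<lambda>\<omega>. \<omega> i) \<in> borel_measurable (PiM I (\<lambda>i. nd (s i)))"
  using measurable_component_singleton[of i I "\<lambda>i. nd (s i)"] by (simp add: measurable_cong_sets[OF refl sets_nd])

lemma lin_measurable: "lin I V \<in> measurable (gau I) (gau I)"
  unfolding lin_def
  by (rule measurable_restrict)
     (auto simp: measurable_cong_sets[OF refl sets_nd] intro!: borel_measurable_sum borel_measurable_times component_measurable)

lemma space_PiM_nd: "space (PiM I (\<lambda>i. nd (s i))) = extensional I"
  by (auto simp: space_PiM PiE_def)

text \<open>Each Givens rotation of the coordinates \<open>a, b\<close> clears the entry \<open>V' b a\<close>; rotations preserve the Gaussian law, so it suffices to treat a matrix whose column \<open>a\<close> vanishes off the diagonal.\<close>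

lemma givens_elim:
  assumes fin: "finite I" and a: "a \<in> I" and V: "colorth I V" and F: "finite F" "F \<subseteq> I - {a}"
  shows "\<exists>V'. colorth I V' \<and> (\<forall>j\<in>F. V' j a = 0) \<and> (pres I V' --> pres I V)"
  using F
proof (induction F rule: finite_induct)
  case empty
  then show ?case using V by auto
next
  case (insert b F)
  then obtain V' where V': "colorth I V'" "\<forall>j\<in>F. V' j a = 0" "pres I V' --> pres I V" by auto
  have b: "b \<in> I" "a \<noteq> b" using insert by auto
  define p where "p = V' a a"
  define q where "q = V' b a"
  show ?case
  proof (cases "q = 0")
    case True
    then show ?thesis using V' by (auto simp: q_def)
  next
    case False
    define \<rho> where "\<rho> = sqrt (p\<^sup>2 + q\<^sup>2)"
    have \<rho>: "\<rho> > 0" "\<rho>\<^sup>2 = p\<^sup>2 + q\<^sup>2" using False by (auto simp: \<rho>_def sum_power2_gt_zero_iff)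
    define c where "c = p / \<rho>"
    define s where "s = q / \<rho>"
    have "c\<^sup>2 + s\<^sup>2 = (p\<^sup>2 + q\<^sup>2) / \<rho>\<^sup>2" by (simp add: c_def s_def power_divide add_divide_distrib)
    then have cs: "c\<^sup>2 + s\<^sup>2 = 1" unfolding \<rho>(2)[symmetric] using \<rho>(1) by simp
    define W where "W i k = (if i = a then c * V' a k + s * V' b k else if i = b then - s * V' a k + c * V' b k else V' i k)" for i k
    have I: "I = insert a (insert b (I - {a, b}))" using a b by auto
    have colW: "colorth I W"
      unfolding colorth_def
    proof (intro ballI)
      fix j k assume jk: "j \<in> I" "k \<in> I"
      have split: "(\<Sum>i\<in>I. U i j * U i k) = U a j * U a k + U b j * U b k + (\<Sum>i\<in>I - {a, b}. U i j * U i k)" for U :: "'a => 'a => real"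
        by (subst I) (use b fin in simp)
      have "W a j * W a k + W b j * W b k = (c\<^sup>2 + s\<^sup>2) * (V' a j * V' a k + V' b j * V' b k)"
        using b by (simp add: W_def power2_eq_square algebra_simps)
      moreover have "(\<Sum>i\<in>I - {a, b}. W i j * W i k) = (\<Sum>i\<in>I - {a, b}. V' i j * V' i k)"
        by (rule sum.cong) (auto simp: W_def)
      ultimately have "(\<Sum>i\<in>I. W i j * W i k) = (\<Sum>i\<in>I. V' i j * V' i k)" unfolding split cs by simp
      then show "(\<Sum>i\<in>I. W i j * W i k) = (if j = k then 1 else 0)" using V'(1) jk by (simp add: colorth_def)
    qed
    have "s * p = c * q" by (simp add: c_def s_def)
    then have "W b a = 0" using b by (simp add: W_def p_def[symmetric] q_def[symmetric])
    moreover have "W j a = 0" if "j \<in> F" for j using that insert V'(2) by (auto simp: W_def)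
    moreover have "pres I V'" if W: "pres I W"
      unfolding pres_def
    proof
      fix f :: "('a => real) => ennreal" assume f: "f \<in> borel_measurable (gau I)"
      have fr: "(\<lambda>\<omega>. f (pairrot a b c s \<omega>)) \<in> borel_measurable (gau I)"
        using measurable_comp[OF pairrot_measurable[OF a b(1)] f] by (simp add: comp_def)
      have e: "pairrot a b c s (lin I W \<omega>) = lin I V' \<omega>" for \<omega>
      proof
        fix i
        have Wa: "(\<Sum>j\<in>I. W a j * \<omega> j) = c * (\<Sum>j\<in>I. V' a j * \<omega> j) + s * (\<Sum>j\<in>I. V' b j * \<omega> j)"
          by (simp add: W_def sum_distrib_left algebra_simps sum.distrib)
        have Wb: "(\<Sum>j\<in>I. W b j * \<omega> j) = c * (\<Sum>j\<in>I. V' b j * \<omega> j) - s * (\<Sum>j\<in>I. V' a j * \<omega> j)"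
          using b by (simp add: W_def sum_distrib_left algebra_simps sum.distrib sum_subtractf)
        have 1: "c * (c * x + s * y) - s * (c * y - s * x) = x" for x y
        proof -
          have "c * (c * x + s * y) - s * (c * y - s * x) = (c\<^sup>2 + s\<^sup>2) * x" by (simp add: power2_eq_square algebra_simps)
          then show ?thesis using cs by simp
        qed
        have 2: "s * (c * x + s * y) + c * (c * y - s * x) = y" for x y
        proof -
          have "s * (c * x + s * y) + c * (c * y - s * x) = (c\<^sup>2 + s\<^sup>2) * y" by (simp add: power2_eq_square algebra_simps)
          then show ?thesis using cs by simp
        qed
        show "pairrot a b c s (lin I W \<omega>) i = lin I V' \<omega> i"
        proof -
          consider "i = b" | "i = a" | "i \<noteq> a" "i \<noteq> b" by blast
          then show ?thesis
          proof cases
            case 1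
            then show ?thesis using a b 2 by (simp add: pairrot_def lin_def Wa Wb)
          next
            case 2
            then show ?thesis using a b 1 by (simp add: pairrot_def lin_def Wa Wb)
          next
            case 3
            then show ?thesis by (simp add: pairrot_def lin_def W_def)
          qed
        qed
      qed
      have "(\<integral>\<^sup>+\<omega>. f (lin I V' \<omega>) \<partial>gau I) = (\<integral>\<^sup>+\<omega>. f (pairrot a b c s (lin I W \<omega>)) \<partial>gau I)" by (simp add: e)
      also have "... = (\<integral>\<^sup>+\<omega>. f (pairrot a b c s \<omega>) \<partial>gau I)" by (rule bspec[OF W[unfolded pres_def] fr])
      also have "... = (\<integral>\<^sup>+\<omega>. f \<omega> \<partial>gau I)" by (rule pairrot_invariant[OF fin a b cs f])
      finally show "(\<integral>\<^sup>+\<omega>. f (lin I V' \<omega>) \<partial>gau I) = (\<integral>\<^sup>+\<omega>. f \<omega> \<partial>gau I)" .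
    qed
    ultimately show ?thesis using colW V'(3) by blast
  qed
qed

lemma nd_flip:
  assumes [measurable]: "g \<in> borel_measurable borel" and e: "e = 1 \<or> e = -1"
  shows "(\<integral>\<^sup>+y. g (e * y) \<partial>nd 1) = (\<integral>\<^sup>+y. g y \<partial>nd 1)"
proof -
  have e': "e \<noteq> 0" "\<bar>e\<bar> = 1" "(e * y)\<^sup>2 = y\<^sup>2" for y using e by auto
  have nde: "normal_density 0 1 (e * y) = normal_density 0 1 y" for y unfolding std_normal_density_def e' ..
  have "(\<integral>\<^sup>+y. g (e * y) \<partial>nd 1) = (\<integral>\<^sup>+y. ennreal (normal_density 0 1 (e * y)) * g (e * y) \<partial>lborel)"
    unfolding nde by (rule nn_integral_nd) measurable
  also have "... = (\<integral>\<^sup>+y. ennreal (normal_density 0 1 y) * g y \<partial>lborel)"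
    using nn_integral_real_affine[of "\<lambda>y. ennreal (normal_density 0 1 y) * g y" e 0] e' by simp
  finally show ?thesis by (simp add: nn_integral_nd)
qed

text \<open>After \<open>givens_elim\<close> column \<open>a\<close> is \<open>\<plusminus>\<close> a unit vector, and by orthogonality so is row \<open>a\<close>: the matrix is a sign times an orthogonal matrix in fewer dimensions.\<close>

theorem gauss_orthogonal_invariant:
  assumes "finite I" "colorth I V" shows "pres I V"
  using assms
proof (induction I arbitrary: V rule: finite_induct)
  case empty
  have "lin {} V \<omega> = \<omega>" if "\<omega> \<in> space (gau {})" for \<omega>
    using that by (auto simp: lin_def space_PiM)
  then show ?case unfolding pres_def by (auto intro!: nn_integral_cong)
next
  case (insert a I)
  let ?I = "insert a I"
  have finI: "finite ?I" using insert by simp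
  obtain V' where V': "colorth ?I V'" "\<forall>j\<in>I. V' j a = 0" "pres ?I V' --> pres ?I V"
    using givens_elim[OF finI _ insert.prems, of a I] insert by auto
  define e where "e = V' a a"
  have split: "(\<Sum>i\<in>?I. g i) = g a + (\<Sum>i\<in>I. g i)" for g :: "'a => real" using insert by simp
  have "(\<Sum>i\<in>?I. V' i a * V' i a) = 1" using V'(1) by (simp add: colorth_def)
  then have "e * e = 1" unfolding split using V'(2) by (simp add: e_def)
  then have e: "e = 1 \<or> e = -1" by (simp add: square_eq_1_iff)
  have row: "V' a k = 0" if k: "k \<in> I" for k
  proof -
    have "(\<Sum>i\<in>?I. V' i k * V' i a) = 0" using V'(1) k insert by (auto simp: colorth_def)
    then have "V' a k * e = 0" unfolding split using V'(2) by (simp add: e_def)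
    then show ?thesis using e by auto
  qed
  have "colorth I V'" unfolding colorth_def
  proof (intro ballI)
    fix j k assume jk: "j \<in> I" "k \<in> I"
    have "(\<Sum>i\<in>?I. V' i j * V' i k) = (if j = k then 1 else 0)" using V'(1) jk by (simp add: colorth_def)
    then show "(\<Sum>i\<in>I. V' i j * V' i k) = (if j = k then 1 else 0)" unfolding split using row jk by simp
  qed
  then have IH: "pres I V'" by (rule insert.IH)
  interpret product_sigma_finite "\<lambda>_::'a. nd 1" by (rule psf_nd) simp
  have linV: "lin ?I V' (x(a := y)) = (lin I V' x)(a := e * y)" for x y
  proof
    fix i
    have s: "(\<Sum>j\<in>?I. V' i j * (x(a := y)) j) = V' i a * y + (\<Sum>j\<in>I. V' i j * x j)"
      unfolding split using insert by (auto intro!: sum.cong)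
    show "lin ?I V' (x(a := y)) i = ((lin I V' x)(a := e * y)) i"
      unfolding lin_def using s V'(2) row insert by (auto simp: e_def)
  qed
  have "pres ?I V'" unfolding pres_def
  proof
    fix f :: "('a => real) => ennreal" assume f: "f \<in> borel_measurable (gau ?I)"
    have fl: "(\<lambda>\<omega>. f (lin ?I V' \<omega>)) \<in> borel_measurable (gau ?I)"
      using measurable_comp[OF lin_measurable f] by (simp add: comp_def)
    define g where "g x = (\<integral>\<^sup>+y. f (x(a := y)) \<partial>nd 1)" for x
    have fm: "(\<lambda>(x, y). f (x(a := y))) \<in> borel_measurable (gau I \<Otimes>\<^sub>M nd 1)"
      using measurable_comp[OF measurable_add_dim[of a I "\<lambda>_. nd 1"] f] by (simp add: comp_def split_def)
    have g: "g \<in> borel_measurable (gau I)" unfolding g_def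
      using sigma_finite_measure.borel_measurable_nn_integral[OF sigma_finite_measures fm] .
    have "(\<integral>\<^sup>+\<omega>. f (lin ?I V' \<omega>) \<partial>gau ?I) = (\<integral>\<^sup>+x. \<integral>\<^sup>+y. f (lin ?I V' (x(a := y))) \<partial>nd 1 \<partial>gau I)"
      by (rule product_nn_integral_insert[OF insert(1,2) fl])
    also have "... = (\<integral>\<^sup>+x. g (lin I V' x) \<partial>gau I)"
    proof (rule nn_integral_cong)
      fix x assume x: "x \<in> space (gau I)"
      have "lin I V' x \<in> space (gau I)" using measurable_space[OF lin_measurable x] .
      from measurable_component_update[OF this insert(2)]
      have "(\<lambda>y. (lin I V' x)(a := y)) \<in> measurable (nd 1) (gau ?I)" .
      from measurable_compose[OF this f] have m: "(\<lambda>y. f ((lin I V' x)(a := y))) \<in> borel_measurable borel"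
        by (simp only: measurable_cong_sets[OF sets_nd refl])
      show "(\<integral>\<^sup>+y. f (lin ?I V' (x(a := y))) \<partial>nd 1) = g (lin I V' x)"
        unfolding linV g_def by (rule nd_flip[OF m e])
    qed
    also have "... = (\<integral>\<^sup>+x. g x \<partial>gau I)" by (rule bspec[OF IH[unfolded pres_def] g])
    also have "... = (\<integral>\<^sup>+\<omega>. f \<omega> \<partial>gau ?I)" unfolding g_def by (rule product_nn_integral_insert[OF insert(1,2) f, symmetric])
    finally show "(\<integral>\<^sup>+\<omega>. f (lin ?I V' \<omega>) \<partial>gau ?I) = (\<integral>\<^sup>+\<omega>. f \<omega> \<partial>gau ?I)" .
  qed
  then show ?case using V'(3) by simp
qed

section \<open>Gaussian tail bounds\<close>

lemma chernoff:
  fixes Z :: "'m => real"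
  assumes Z[measurable]: "Z \<in> borel_measurable M" and B: "(\<integral>\<^sup>+\<omega>. ennreal (exp (\<theta> * Z \<omega>)) \<partial>M) \<le> ennreal B"
    and \<theta>: "0 \<le> \<theta>" and B0: "0 \<le> B"
  shows "emeasure M {\<omega>\<in>space M. t \<le> Z \<omega>} \<le> ennreal (B * exp (- (\<theta> * t)))"
proof -
  have "emeasure M {\<omega>\<in>space M. t \<le> Z \<omega>} \<le> emeasure M ({\<omega>\<in>space M. 1 \<le> ennreal (exp (- (\<theta> * t))) * ennreal (exp (\<theta> * Z \<omega>))})"
  proof (rule emeasure_mono)
    show "{\<omega>\<in>space M. t \<le> Z \<omega>} \<subseteq> {\<omega>\<in>space M. 1 \<le> ennreal (exp (- (\<theta> * t))) * ennreal (exp (\<theta> * Z \<omega>))}"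
    proof clarsimp
      fix \<omega> assume "t \<le> Z \<omega>"
      then have "0 \<le> - (\<theta> * t) + \<theta> * Z \<omega>" using \<theta> by (simp add: mult_left_mono)
      then have "1 \<le> exp (- (\<theta> * t)) * exp (\<theta> * Z \<omega>)" by (simp flip: exp_add)
      then show "1 \<le> ennreal (exp (- (\<theta> * t))) * ennreal (exp (\<theta> * Z \<omega>))"
        by (simp flip: ennreal_mult)
    qed
  qed simp
  also have "... \<le> ennreal (exp (- (\<theta> * t))) * (\<integral>\<^sup>+\<omega>. ennreal (exp (\<theta> * Z \<omega>)) * indicator (space M) \<omega> \<partial>M)"
    by (rule nn_integral_Markov_inequality) auto
  also have "(\<integral>\<^sup>+\<omega>. ennreal (exp (\<theta> * Z \<omega>)) * indicator (space M) \<omega> \<partial>M) = (\<integral>\<^sup>+\<omega>. ennreal (exp (\<theta> * Z \<omega>)) \<partial>M)"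
    by (rule nn_integral_cong) simp
  also have "ennreal (exp (- (\<theta> * t))) * ... \<le> ennreal (exp (- (\<theta> * t))) * ennreal B" by (intro mult_left_mono B) simp
  also have "... = ennreal (B * exp (- (\<theta> * t)))" using B0 by (simp add: mult.commute flip: ennreal_mult)
  finally show ?thesis .
qed

lemma two_sided:
  fixes Z :: "'m => real"
  assumes Z[measurable]: "Z \<in> borel_measurable M"
    and "emeasure M {\<omega>\<in>space M. t \<le> Z \<omega>} \<le> ennreal p" "emeasure M {\<omega>\<in>space M. t \<le> - Z \<omega>} \<le> ennreal p" "0 \<le> p"
  shows "emeasure M {\<omega>\<in>space M. t < \<bar>Z \<omega>\<bar>} \<le> ennreal (2 * p)"
proof -
  have "emeasure M {\<omega>\<in>space M. t < \<bar>Z \<omega>\<bar>} \<le> emeasure M ({\<omega>\<in>space M. t \<le> Z \<omega>} \<union> {\<omega>\<in>space M. t \<le> - Z \<omega>})"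
  proof (rule emeasure_mono)
    show "{\<omega>\<in>space M. t < \<bar>Z \<omega>\<bar>} \<subseteq> {\<omega>\<in>space M. t \<le> Z \<omega>} \<union> {\<omega>\<in>space M. t \<le> - Z \<omega>}"
      by (auto simp: abs_if split: if_splits)
    show "{\<omega>\<in>space M. t \<le> Z \<omega>} \<union> {\<omega>\<in>space M. t \<le> - Z \<omega>} \<in> sets M" by (intro sets.Un) measurable
  qed
  also have "... \<le> emeasure M {\<omega>\<in>space M. t \<le> Z \<omega>} + emeasure M {\<omega>\<in>space M. t \<le> - Z \<omega>}"
    by (rule emeasure_subadditive) measurable
  also have "... \<le> ennreal p + ennreal p" by (rule add_mono) (rule assms)+
  also have "... = ennreal (2 * p)" using assms(4) by (simp flip: ennreal_plus)
  finally show ?thesis .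
qed

lemma nn_integral_normal_density: "s > 0 ==> (\<integral>\<^sup>+x. ennreal (normal_density m s x) \<partial>lborel) = 1"
  by (subst nn_integral_eq_integral) auto

lemma mgf_nd:
  assumes s: "s > 0"
  shows "(\<integral>\<^sup>+x. ennreal (exp (\<theta> * x)) \<partial>nd s) = ennreal (exp (\<theta>\<^sup>2 * s\<^sup>2 / 2))"
proof -
  have e: "normal_density 0 s x * exp (\<theta> * x) = exp (\<theta>\<^sup>2 * s\<^sup>2 / 2) * normal_density (\<theta> * s\<^sup>2) s x" for x
  proof -
    have "- x\<^sup>2 / (2 * s\<^sup>2) + \<theta> * x = \<theta>\<^sup>2 * s\<^sup>2 / 2 + - (x - \<theta> * s\<^sup>2)\<^sup>2 / (2 * s\<^sup>2)"
      using s by (simp add: field_simps power2_eq_square)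
    then have "exp (- x\<^sup>2 / (2 * s\<^sup>2)) * exp (\<theta> * x) = exp (\<theta>\<^sup>2 * s\<^sup>2 / 2) * exp (- (x - \<theta> * s\<^sup>2)\<^sup>2 / (2 * s\<^sup>2))"
      by (simp only: exp_add[symmetric])
    then show ?thesis by (simp add: normal_density_def mult_ac)
  qed
  have "(\<integral>\<^sup>+x. ennreal (exp (\<theta> * x)) \<partial>nd s) = (\<integral>\<^sup>+x. ennreal (normal_density 0 s x) * ennreal (exp (\<theta> * x)) \<partial>lborel)"
    by (rule nn_integral_nd) measurable
  also have "... = (\<integral>\<^sup>+x. ennreal (exp (\<theta>\<^sup>2 * s\<^sup>2 / 2)) * ennreal (normal_density (\<theta> * s\<^sup>2) s x) \<partial>lborel)"
    by (rule nn_integral_cong) (simp add: e flip: ennreal_mult)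
  also have "... = ennreal (exp (\<theta>\<^sup>2 * s\<^sup>2 / 2)) * 1"
    by (subst nn_integral_cmult) (auto simp: nn_integral_normal_density s)
  finally show ?thesis by simp
qed

lemma lin_tail1:
  fixes c :: "'i => real"
  assumes fin: "finite I" and s: "\<And>i. s i > 0" and w: "(\<Sum>i\<in>I. (s i)\<^sup>2 * (c i)\<^sup>2) \<le> w\<^sup>2" "0 < w" and L: "0 \<le> L"
  shows "emeasure (PiM I (\<lambda>i. nd (s i))) {\<omega>\<in>space (PiM I (\<lambda>i. nd (s i))). sqrt (2 * L) * w \<le> (\<Sum>i\<in>I. c i * \<omega> i)} \<le> ennreal (exp (- L))"
proof -
  let ?M = "PiM I (\<lambda>i. nd (s i))"
  interpret product_sigma_finite "\<lambda>i. nd (s i)" by (rule psf_nd) (rule s)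
  define \<theta> where "\<theta> = sqrt (2 * L) / w"
  have \<theta>: "0 \<le> \<theta>" using w L by (simp add: \<theta>_def)
  have m: "(\<lambda>\<omega>. \<Sum>i\<in>I. c i * \<omega> i) \<in> borel_measurable ?M"
    by (intro poly_measurable component_measurable)
  have \<theta>w: "\<theta>\<^sup>2 * w\<^sup>2 = 2 * L" "\<theta> * (sqrt (2 * L) * w) = 2 * L"
    using w L by (simp_all add: \<theta>_def power_divide)
  have "(\<integral>\<^sup>+\<omega>. ennreal (exp (\<theta> * (\<Sum>i\<in>I. c i * \<omega> i))) \<partial>?M) = (\<integral>\<^sup>+\<omega>. (\<Prod>i\<in>I. ennreal (exp (\<theta> * c i * \<omega> i))) \<partial>?M)"
    by (intro nn_integral_cong) (simp add: sum_distrib_left exp_sum fin prod_ennreal mult.assoc)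
  also have "... = (\<Prod>i\<in>I. \<integral>\<^sup>+x. ennreal (exp (\<theta> * c i * x)) \<partial>nd (s i))"
    by (rule product_nn_integral_prod[OF fin]) (simp add: measurable_cong_sets[OF sets_nd refl])
  also have "... = (\<Prod>i\<in>I. ennreal (exp ((\<theta> * c i)\<^sup>2 * (s i)\<^sup>2 / 2)))" by (simp add: mgf_nd s)
  also have "... = ennreal (exp (\<theta>\<^sup>2 * (\<Sum>i\<in>I. (s i)\<^sup>2 * (c i)\<^sup>2) / 2))"
    by (simp add: prod_ennreal exp_sum[symmetric] fin sum_distrib_left sum_divide_distrib power_mult_distrib mult_ac)
  also have "... \<le> ennreal (exp L)"
  proof (rule ennreal_leI)
    have "\<theta>\<^sup>2 * (\<Sum>i\<in>I. (s i)\<^sup>2 * (c i)\<^sup>2) \<le> \<theta>\<^sup>2 * w\<^sup>2" by (intro mult_left_mono w) simp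
    then show "exp (\<theta>\<^sup>2 * (\<Sum>i\<in>I. (s i)\<^sup>2 * (c i)\<^sup>2) / 2) \<le> exp L" using \<theta>w by simp
  qed
  finally have "(\<integral>\<^sup>+\<omega>. ennreal (exp (\<theta> * (\<Sum>i\<in>I. c i * \<omega> i))) \<partial>?M) \<le> ennreal (exp L)" .
  from chernoff[OF m this \<theta>, of "sqrt (2 * L) * w"] show ?thesis
    unfolding \<theta>w by (simp flip: exp_add)
qed

text \<open>Chernoff bound with the moment generating function of the normal law. The case \<open>w = 0\<close> is kept, since the coefficients may vanish.\<close>

theorem lin_tail:
  fixes c :: "'i => real"
  assumes fin: "finite I" and s: "\<And>i. s i > 0" and w: "(\<Sum>i\<in>I. (s i)\<^sup>2 * (c i)\<^sup>2) \<le> w\<^sup>2" "0 \<le> w" and L: "0 \<le> L"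
  shows "emeasure (PiM I (\<lambda>i. nd (s i))) {\<omega>\<in>space (PiM I (\<lambda>i. nd (s i))). sqrt (2 * L) * w < \<bar>\<Sum>i\<in>I. c i * \<omega> i\<bar>} \<le> ennreal (2 * exp (- L))"
proof (cases "w = 0")
  case True
  then have "(\<Sum>i\<in>I. (s i)\<^sup>2 * (c i)\<^sup>2) = 0" using w(1) by (simp add: sum_nonneg antisym)
  then have "\<forall>i\<in>I. (s i)\<^sup>2 * (c i)\<^sup>2 = 0" by (subst (asm) sum_nonneg_eq_0_iff[OF fin]) auto
  then have "\<forall>i\<in>I. c i = 0" using s by (metis less_irrefl mult_eq_0_iff power2_less_0 zero_eq_power2)
  then show ?thesis using True by simp
next
  case False
  then have w0: "0 < w" using w by simp
  let ?M = "PiM I (\<lambda>i. nd (s i))"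
  have m: "(\<lambda>\<omega>. \<Sum>i\<in>I. c i * \<omega> i) \<in> borel_measurable ?M"
    by (intro poly_measurable component_measurable)
  have "(\<Sum>i\<in>I. (s i)\<^sup>2 * (- c i)\<^sup>2) \<le> w\<^sup>2" using w(1) by simp
  from lin_tail1[OF fin s this w0 L] have "emeasure ?M {\<omega>\<in>space ?M. sqrt (2 * L) * w \<le> - (\<Sum>i\<in>I. c i * \<omega> i)} \<le> ennreal (exp (- L))"
    by (simp add: sum_negf)
  from two_sided[OF m lin_tail1[OF fin s w(1) w0 L] this] show ?thesis by simp
qed

lemma prod_mono_ennreal:
  fixes f g :: "'i => ennreal"
  assumes "finite I" "\<And>i. i \<in> I ==> f i \<le> g i"
  shows "prod f I \<le> prod g I"
  using assms by (induction I rule: finite_induct) (auto intro!: mult_mono)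

text \<open>The exact value is \<open>(1 - 2 a) powr (-1/2)\<close>; the bound expands its logarithm to second order.\<close>

lemma exp_quad_nd:
  assumes a: "\<bar>a\<bar> \<le> 1/4"
  shows "(\<integral>\<^sup>+x. ennreal (exp (a * x\<^sup>2)) \<partial>nd 1) \<le> ennreal (exp (a + 4 * a\<^sup>2))"
proof -
  define q where "q = 1 - 2 * a"
  have q: "q > 0" using a by (simp add: q_def)
  define \<tau> where "\<tau> = 1 / sqrt q"
  have \<tau>: "\<tau> > 0" "\<tau>\<^sup>2 = 1 / q" using q by (simp_all add: \<tau>_def power_divide)
  have e: "normal_density 0 1 x * exp (a * x\<^sup>2) = \<tau> * normal_density 0 \<tau> x" for x
  proof -
    have "- x\<^sup>2 / 2 + a * x\<^sup>2 = - x\<^sup>2 / (2 * \<tau>\<^sup>2)" using q by (simp add: \<tau> q_def field_simps)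
    then have "exp (- x\<^sup>2 / 2) * exp (a * x\<^sup>2) = exp (- x\<^sup>2 / (2 * \<tau>\<^sup>2))" by (simp flip: exp_add)
    moreover have "\<tau> / sqrt (2 * pi * \<tau>\<^sup>2) = 1 / sqrt (2 * pi)" using \<tau>(1) by (simp add: real_sqrt_mult)
    moreover have "normal_density 0 1 x * exp (a * x\<^sup>2) = 1 / sqrt (2 * pi) * (exp (- x\<^sup>2 / 2) * exp (a * x\<^sup>2))"
      by (simp add: normal_density_def)
    moreover have "\<tau> * normal_density 0 \<tau> x = \<tau> / sqrt (2 * pi * \<tau>\<^sup>2) * exp (- x\<^sup>2 / (2 * \<tau>\<^sup>2))"
      by (simp add: normal_density_def)
    ultimately show ?thesis by simp
  qed
  have "(\<integral>\<^sup>+x. ennreal (exp (a * x\<^sup>2)) \<partial>nd 1) = (\<integral>\<^sup>+x. ennreal (normal_density 0 1 x) * ennreal (exp (a * x\<^sup>2)) \<partial>lborel)"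
    by (rule nn_integral_nd) measurable
  also have "... = (\<integral>\<^sup>+x. ennreal \<tau> * ennreal (normal_density 0 \<tau> x) \<partial>lborel)"
    using \<tau>(1) by (intro nn_integral_cong) (simp add: e flip: ennreal_mult)
  also have "... = ennreal \<tau>"
    by (subst nn_integral_cmult) (auto simp: nn_integral_normal_density \<tau>)
  also have "... \<le> ennreal (exp (a + 4 * a\<^sup>2))"
  proof (rule ennreal_leI)
    have "- 2 * a - 8 * a\<^sup>2 \<le> ln q"
    proof (cases "0 \<le> a")
      case True
      have "- (2 * a) - 2 * (2 * a)\<^sup>2 \<le> ln (1 - 2 * a)"
        by (rule ln_one_minus_pos_lower_bound) (use True a in auto)
      then show ?thesis by (simp add: q_def power_mult_distrib)
    next
      case False
      have "- (2 * a) - (- (2 * a))\<^sup>2 \<le> ln (1 + - (2 * a))"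
        by (rule ln_one_plus_pos_lower_bound) (use False a in auto)
      then have "- (2 * a) - 4 * a\<^sup>2 \<le> ln q" by (simp add: q_def power_mult_distrib)
      moreover have "0 \<le> a\<^sup>2" by simp
      ultimately show ?thesis by linarith
    qed
    then have "- (ln q / 2) \<le> a + 4 * a\<^sup>2" by simp
    then have "exp (- (ln q / 2)) \<le> exp (a + 4 * a\<^sup>2)" by simp
    moreover have "exp (- (ln q / 2)) = \<tau>"
      using q by (simp add: \<tau>_def exp_minus ln_sqrt[symmetric] field_simps)
    ultimately show "\<tau> \<le> exp (a + 4 * a\<^sup>2)" by simp
  qed
  finally show ?thesis .
qed

text \<open>Hanson-Wright for a Gaussian vector: rotating to the eigenbasis of \<open>A\<close> turns the form into \<open>\<Sum>k. \<nu> k * \<omega> k ^ 2\<close>, whose exponential moments factorise.\<close>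

lemma quad_tail1:
  fixes A :: "'i => 'i => real"
  assumes fin: "finite I" and V: "eigsys I A V \<nu>" and D: "\<And>k. k \<in> I ==> \<bar>\<nu> k\<bar> \<le> D" "0 < D"
    and F: "(\<Sum>k\<in>I. (\<nu> k)\<^sup>2) \<le> F\<^sup>2" "0 \<le> F" and L: "0 < L"
  shows "emeasure (gau I) {\<omega>\<in>space (gau I). 4 * (F * sqrt L + D * L) \<le> dot I \<omega> (mv I A \<omega>) - (\<Sum>i\<in>I. A i i)} \<le> ennreal (exp (- L))"
proof -
  interpret product_sigma_finite "\<lambda>_::'i. nd 1" by (rule psf_nd) simp
  define Z where "Z \<omega> = dot I \<omega> (mv I A \<omega>) - (\<Sum>i\<in>I. A i i)" for \<omega>
  \<comment> \<open>\<open>1/q\<close> is the exponent: the first term makes \<open>exp_quad_nd\<close> applicable, the second balances \<open>\<theta>\<^sup>2 F\<^sup>2\<close> against \<open>L\<close>\<close>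
  define q where "q = 4 * D + 2 * F / sqrt L"
  have q: "q > 0" "4 * D \<le> q" "2 * F / sqrt L \<le> q" using D F L by (auto simp: q_def add_pos_nonneg)
  define \<theta> where "\<theta> = 1 / q"
  have \<theta>: "0 \<le> \<theta>" using q by (simp add: \<theta>_def)
  have small: "\<bar>\<theta> * \<nu> k\<bar> \<le> 1/4" if "k \<in> I" for k
  proof -
    have "4 * \<bar>\<nu> k\<bar> \<le> q" using D(1)[OF that] q(2) by linarith
    then show ?thesis using q(1) by (simp add: \<theta>_def abs_mult field_simps)
  qed
  have m: "Z \<in> borel_measurable (gau I)" unfolding Z_def dot_def mv_def
    by (intro borel_measurable_sum borel_measurable_times borel_measurable_diff borel_measurable_const component_measurable)
  define G where "G \<omega> = (\<Prod>k\<in>I. ennreal (exp (\<theta> * \<nu> k * (\<omega> k)\<^sup>2)))" for \<omega> :: "'i => real"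
  have G: "G \<in> borel_measurable (gau I)" unfolding G_def
  proof (rule borel_measurable_prod_ennreal)
    fix k assume "k \<in> I"
    from component_measurable[OF this, of "\<lambda>_. 1"] have [measurable]: "(\<lambda>\<omega>. \<omega> k) \<in> borel_measurable (gau I)" .
    show "(\<lambda>\<omega>. ennreal (exp (\<theta> * \<nu> k * (\<omega> k)\<^sup>2))) \<in> borel_measurable (gau I)" by measurable
  qed
  have co: "colorth I V" unfolding colorth_def
    using eig_rows[OF fin V] by simp
  have eG: "ennreal (exp (\<theta> * Z \<omega>)) = ennreal (exp (- (\<theta> * (\<Sum>k\<in>I. \<nu> k)))) * G (lin I V \<omega>)" for \<omega>
  proof -
    have "dot I \<omega> (V k) = lin I V \<omega> k" if "k \<in> I" for k using that by (simp add: dot_def lin_def mult.commute)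
    then have "dot I \<omega> (mv I A \<omega>) = (\<Sum>k\<in>I. \<nu> k * (lin I V \<omega> k)\<^sup>2)" unfolding eig_form[OF fin V] by simp
    then have "\<theta> * Z \<omega> = - (\<theta> * (\<Sum>k\<in>I. \<nu> k)) + (\<Sum>k\<in>I. \<theta> * \<nu> k * (lin I V \<omega> k)\<^sup>2)"
      unfolding Z_def eig_trace[OF fin V] by (simp add: algebra_simps sum_distrib_left)
    then have "exp (\<theta> * Z \<omega>) = exp (- (\<theta> * (\<Sum>k\<in>I. \<nu> k))) * (\<Prod>k\<in>I. exp (\<theta> * \<nu> k * (lin I V \<omega> k)\<^sup>2))"
      by (simp only: exp_add exp_sum[OF fin])
    then show ?thesis by (simp add: G_def prod_ennreal ennreal_mult prod_nonneg)
  qed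
  have GL: "(\<lambda>\<omega>. G (lin I V \<omega>)) \<in> borel_measurable (gau I)"
    using measurable_comp[OF lin_measurable G] by (simp add: comp_def)
  have "(\<integral>\<^sup>+\<omega>. ennreal (exp (\<theta> * Z \<omega>)) \<partial>gau I) = ennreal (exp (- (\<theta> * (\<Sum>k\<in>I. \<nu> k)))) * (\<integral>\<^sup>+\<omega>. G (lin I V \<omega>) \<partial>gau I)"
    unfolding eG by (rule nn_integral_cmult[OF GL])
  also have "(\<integral>\<^sup>+\<omega>. G (lin I V \<omega>) \<partial>gau I) = (\<integral>\<^sup>+\<omega>. G \<omega> \<partial>gau I)"
    by (rule bspec[OF gauss_orthogonal_invariant[OF fin co, unfolded pres_def] G])
  also have "... = (\<Prod>k\<in>I. \<integral>\<^sup>+x. ennreal (exp (\<theta> * \<nu> k * x\<^sup>2)) \<partial>nd 1)" unfolding G_def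
    by (rule product_nn_integral_prod[OF fin]) (simp add: measurable_cong_sets[OF sets_nd refl])
  also have "... \<le> (\<Prod>k\<in>I. ennreal (exp (\<theta> * \<nu> k + 4 * (\<theta> * \<nu> k)\<^sup>2)))"
    by (rule prod_mono_ennreal[OF fin]) (use exp_quad_nd small in auto)
  also have "... = ennreal (exp (\<Sum>k\<in>I. \<theta> * \<nu> k + 4 * (\<theta> * \<nu> k)\<^sup>2))" by (simp add: prod_ennreal exp_sum fin)
  also have "ennreal (exp (- (\<theta> * (\<Sum>k\<in>I. \<nu> k)))) * ... = ennreal (exp (4 * \<theta>\<^sup>2 * (\<Sum>k\<in>I. (\<nu> k)\<^sup>2)))"
    by (simp add: ennreal_mult[symmetric] exp_add[symmetric] sum.distrib sum_distrib_left power_mult_distrib mult_ac)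
  also have "... \<le> ennreal (exp (4 * \<theta>\<^sup>2 * F\<^sup>2))" using F by (intro ennreal_leI) (simp add: mult_left_mono)
  finally have "(\<integral>\<^sup>+\<omega>. ennreal (exp (\<theta> * Z \<omega>)) \<partial>gau I) \<le> ennreal (exp (4 * \<theta>\<^sup>2 * F\<^sup>2))"
    by (simp add: mult_left_mono)
  from chernoff[OF m this \<theta>, of "4 * (F * sqrt L + D * L)"]
  have 1: "emeasure (gau I) {\<omega>\<in>space (gau I). 4 * (F * sqrt L + D * L) \<le> Z \<omega>} \<le>
     ennreal (exp (4 * \<theta>\<^sup>2 * F\<^sup>2 - \<theta> * (4 * (F * sqrt L + D * L))))" by (simp add: exp_add[symmetric])
  have sL: "sqrt L > 0" "sqrt L * sqrt L = L" using L by auto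
  have "\<theta> * F \<le> sqrt L / 2"
  proof -
    have "2 * F \<le> q * sqrt L" using q(3) sL by (simp add: field_simps)
    then show ?thesis using q(1) by (simp add: \<theta>_def field_simps)
  qed
  then have "4 * \<theta>\<^sup>2 * F\<^sup>2 \<le> 4 * (\<theta> * F) * (sqrt L / 2)"
    using mult_left_mono[of "\<theta> * F" "sqrt L / 2" "4 * (\<theta> * F)"] \<theta> F by (simp add: power2_eq_square mult_ac)
  then have "4 * \<theta>\<^sup>2 * F\<^sup>2 - \<theta> * (4 * (F * sqrt L + D * L)) \<le> - (\<theta> * (4 * D * L + 2 * F * sqrt L))"
    by (simp add: algebra_simps)
  also have "4 * D * L + 2 * F * sqrt L = L * q"
  proof -
    have "L * q = 4 * D * L + 2 * F * (L / sqrt L)" by (simp add: q_def algebra_simps)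
    also have "L / sqrt L = sqrt L" using sL by (simp add: field_simps)
    finally show ?thesis by simp
  qed
  also have "- (\<theta> * (L * q)) = - L" using q(1) by (simp add: \<theta>_def)
  finally have "exp (4 * \<theta>\<^sup>2 * F\<^sup>2 - \<theta> * (4 * (F * sqrt L + D * L))) \<le> exp (- L)" by simp
  then have "ennreal (exp (4 * \<theta>\<^sup>2 * F\<^sup>2 - \<theta> * (4 * (F * sqrt L + D * L)))) \<le> ennreal (exp (- L))" by (rule ennreal_leI)
  with 1 show ?thesis unfolding Z_def by (rule order_trans)
qed

lemma quad_tail2:
  fixes A :: "'i => 'i => real"
  assumes fin: "finite I" and V: "eigsys I A V \<nu>" and D: "\<And>k. k \<in> I ==> \<bar>\<nu> k\<bar> \<le> D" "0 \<le> D"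
    and F: "(\<Sum>k\<in>I. (\<nu> k)\<^sup>2) \<le> F\<^sup>2" "0 \<le> F" and L: "0 < L"
  shows "emeasure (gau I) {\<omega>\<in>space (gau I). 4 * (F * sqrt L + D * L) < \<bar>dot I \<omega> (mv I A \<omega>) - (\<Sum>i\<in>I. A i i)\<bar>} \<le> ennreal (2 * exp (- L))"
proof (cases "D = 0")
  case True
  then have "\<forall>k\<in>I. \<nu> k = 0" using D by auto
  then have "A i j = 0" if "i \<in> I" "j \<in> I" for i j using eig_entry[OF fin V that] by simp
  then have "dot I \<omega> (mv I A \<omega>) = 0" "(\<Sum>i\<in>I. A i i) = 0" for \<omega> by (simp_all add: dot_def mv_def)
  moreover have "0 \<le> F * sqrt L" using F L by simp
  ultimately have e: "{\<omega>\<in>space (gau I). 4 * (F * sqrt L + D * L) < \<bar>dot I \<omega> (mv I A \<omega>) - (\<Sum>i\<in>I. A i i)\<bar>} = {}"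
    using True by (simp add: not_less)
  show ?thesis unfolding e by simp
next
  case False
  then have D0: "0 < D" using D by simp
  define Z where "Z \<omega> = dot I \<omega> (mv I A \<omega>) - (\<Sum>i\<in>I. A i i)" for \<omega>
  have m: "Z \<in> borel_measurable (gau I)" unfolding Z_def dot_def mv_def
    by (intro borel_measurable_sum borel_measurable_times borel_measurable_diff borel_measurable_const component_measurable)
  have V': "eigsys I (\<lambda>i j. - A i j) V (\<lambda>k. - \<nu> k)"
    by (rule eigsys_fn[OF fin V]) (simp add: eig_entry[OF fin V] sum_negf)
  have e: "dot I \<omega> (mv I (\<lambda>i j. - A i j) \<omega>) - (\<Sum>i\<in>I. - A i i) = - Z \<omega>" for \<omega>
    by (simp add: Z_def dot_def mv_def sum_negf)
  have "emeasure (gau I) {\<omega>\<in>space (gau I). 4 * (F * sqrt L + D * L) \<le> - Z \<omega>} \<le> ennreal (exp (- L))"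
    using quad_tail1[OF fin V' _ D0 _ F(2) L] D F unfolding e by simp
  moreover have "emeasure (gau I) {\<omega>\<in>space (gau I). 4 * (F * sqrt L + D * L) \<le> Z \<omega>} \<le> ennreal (exp (- L))"
    using quad_tail1[OF fin V D(1) D0 F L] unfolding Z_def .
  ultimately show ?thesis using two_sided[OF m] unfolding Z_def by simp
qed

section \<open>General variances\<close>

lemma nd_scale:
  assumes s: "s > 0"
  shows "distr (nd 1) borel (\<lambda>x. s * x) = nd s"
proof -
  interpret prob_space "nd 1" by (rule prob_nd) simp
  have "distributed (nd 1) lborel (\<lambda>x. x) (normal_density 0 1)"
    by (auto simp: distributed_def nd_def distr_id2)
  from normal_density_affine[OF this, of s 0] s have "distributed (nd 1) lborel (\<lambda>x. s * x) (normal_density 0 s)" by simp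
  then have "distr (nd 1) lborel (\<lambda>x. s * x) = nd s" by (simp add: distributed_def nd_def)
  moreover have "distr (nd 1) lborel (\<lambda>x. s * x) = distr (nd 1) borel (\<lambda>x. s * x)"
    by (rule distr_cong) auto
  ultimately show ?thesis by simp
qed

definition scl :: "'i set => ('i => real) => ('i => real) => 'i => real" where
  "scl I s \<omega> = (\<lambda>i\<in>I. s i * \<omega> i)"

lemma scl_measurable: "scl I s \<in> measurable (PiM I (\<lambda>i. nd (t i))) (PiM I (\<lambda>i. nd (t' i)))"
  unfolding scl_def
  by (rule measurable_restrict)
     (auto simp: measurable_cong_sets[OF refl sets_nd] intro!: borel_measurable_times component_measurable)

lemma PiM_scale:
  assumes fin: "finite I" and s: "\<And>i. s i > 0"
  shows "distr (gau I) (PiM I (\<lambda>i. nd (s i))) (scl I s) = PiM I (\<lambda>i. nd (s i))"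
proof -
  interpret S: product_sigma_finite "\<lambda>i. nd (s i)" by (rule psf_nd) (rule s)
  interpret P: product_sigma_finite "\<lambda>_::'a. nd 1" by (rule psf_nd) simp
  show ?thesis
  proof (rule S.PiM_eqI[OF fin])
    fix A assume A: "\<And>i. i \<in> I ==> A i \<in> sets (nd (s i))"
    have A': "PiE I A \<in> sets (PiM I (\<lambda>i. nd (s i)))" by (rule sets_PiM_I_finite[OF fin A])
    have pre: "scl I s -` PiE I A \<inter> space (gau I) = PiE I (\<lambda>i. (\<lambda>x. s i * x) -` A i)"
      by (auto simp: scl_def space_PiM PiE_iff)
    have "emeasure (distr (gau I) (PiM I (\<lambda>i. nd (s i))) (scl I s)) (PiE I A) = emeasure (gau I) (PiE I (\<lambda>i. (\<lambda>x. s i * x) -` A i))"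
      by (simp add: emeasure_distr[OF scl_measurable A'] pre)
    also have "... = (\<Prod>i\<in>I. emeasure (nd 1) ((\<lambda>x. s i * x) -` A i))"
    proof (rule P.emeasure_PiM[OF fin])
      fix i assume "i \<in> I"
      then have "A i \<in> sets borel" using A by simp
      then have "(\<lambda>x. s i * x) -` A i \<inter> space borel \<in> sets borel" by (intro measurable_sets[of _ borel borel]) auto
      then show "(\<lambda>x. s i * x) -` A i \<in> sets (nd 1)" by simp
    qed
    also have "... = (\<Prod>i\<in>I. emeasure (nd (s i)) (A i))"
    proof (rule prod.cong)
      fix i assume "i \<in> I"
      then have Ai: "A i \<in> sets borel" using A by simp
      show "emeasure (nd 1) ((\<lambda>x. s i * x) -` A i) = emeasure (nd (s i)) (A i)"
        unfolding nd_scale[OF s, of i, symmetric] by (subst emeasure_distr) (auto simp: Ai measurable_cong_sets[OF sets_nd refl])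
    qed simp
    finally show "emeasure (distr (gau I) (PiM I (\<lambda>i. nd (s i))) (scl I s)) (PiE I A) = (\<Prod>i\<in>I. emeasure (nd (s i)) (A i))" .
  qed simp
qed

text \<open>\<open>F\<close> and \<open>D\<close> bound the Frobenius and the operator norm of \<open>A\<close>.\<close>

theorem quad_tail:
  fixes A :: "'i => 'i => real"
  assumes fin: "finite I" and V: "eigsys I A V \<nu>" and D: "\<And>k. k \<in> I ==> \<bar>\<nu> k\<bar> \<le> D" "0 \<le> D"
    and F: "(\<Sum>k\<in>I. (\<nu> k)\<^sup>2) \<le> F\<^sup>2" "0 \<le> F" and L: "0 < L" and \<sigma>: "\<sigma> > 0"
  shows "emeasure (iid I \<sigma>) {\<omega>\<in>space (iid I \<sigma>).
     \<sigma>\<^sup>2 * (4 * (F * sqrt L + D * L)) < \<bar>dot I \<omega> (mv I A \<omega>) - \<sigma>\<^sup>2 * (\<Sum>i\<in>I. A i i)\<bar>} \<le> ennreal (2 * exp (- L))"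
proof -
  let ?M = "PiM I (\<lambda>_. nd \<sigma>)"
  let ?E = "{\<omega>\<in>space ?M. \<sigma>\<^sup>2 * (4 * (F * sqrt L + D * L)) < \<bar>dot I \<omega> (mv I A \<omega>) - \<sigma>\<^sup>2 * (\<Sum>i\<in>I. A i i)\<bar>}"
  have [measurable]: "(\<lambda>\<omega>. dot I \<omega> (mv I A \<omega>)) \<in> borel_measurable ?M" unfolding dot_def mv_def
    by (intro poly_measurable component_measurable)
  have E: "?E \<in> sets ?M" by measurable
  have "emeasure ?M ?E = emeasure (distr (gau I) ?M (scl I (\<lambda>_. \<sigma>))) ?E" using PiM_scale[OF fin, of "\<lambda>_. \<sigma>"] \<sigma> by simp
  also have "... = emeasure (gau I) (scl I (\<lambda>_. \<sigma>) -` ?E \<inter> space (gau I))" by (rule emeasure_distr[OF scl_measurable E])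
  also have "scl I (\<lambda>_. \<sigma>) -` ?E \<inter> space (gau I) = {\<omega>\<in>space (gau I). 4 * (F * sqrt L + D * L) < \<bar>dot I \<omega> (mv I A \<omega>) - (\<Sum>i\<in>I. A i i)\<bar>}"
  proof -
    have "dot I (scl I (\<lambda>_. \<sigma>) \<omega>) (mv I A (scl I (\<lambda>_. \<sigma>) \<omega>)) = \<sigma>\<^sup>2 * dot I \<omega> (mv I A \<omega>)" for \<omega>
      unfolding dot_def mv_def scl_def by (simp add: sum_distrib_left power2_eq_square mult_ac)
    then have "\<bar>dot I (scl I (\<lambda>_. \<sigma>) \<omega>) (mv I A (scl I (\<lambda>_. \<sigma>) \<omega>)) - \<sigma>\<^sup>2 * (\<Sum>i\<in>I. A i i)\<bar> = \<sigma>\<^sup>2 * \<bar>dot I \<omega> (mv I A \<omega>) - (\<Sum>i\<in>I. A i i)\<bar>" for \<omega>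
      by (simp add: abs_mult flip: right_diff_distrib)
    then show ?thesis using \<sigma> by (auto simp: scl_def space_PiM_nd)
  qed
  also have "emeasure (gau I) ... \<le> ennreal (2 * exp (- L))" by (rule quad_tail2[OF fin V D F L])
  finally show ?thesis .
qed

section \<open>Integrating out a block of coordinates\<close>

text \<open>A probability bound that holds for every value \<open>y\<close> of the coordinates in \<open>I\<close> holds for the joint law; this is how independence of blocks is used.\<close>

lemma section_bound:
  fixes s :: "'i => real"
  assumes fin: "finite I" "finite J" "I \<inter> J = {}" and s: "\<And>i. s i > 0"
    and P: "P \<in> sets (PiM (I \<union> J) (\<lambda>i. nd (s i)))"
    and bd: "\<And>y. y \<in> space (PiM I (\<lambda>i. nd (s i))) ==>
       emeasure (PiM J (\<lambda>i. nd (s i))) {z \<in> space (PiM J (\<lambda>i. nd (s i))). merge I J (y, z) \<in> P} \<le> \<delta>"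
  shows "emeasure (PiM (I \<union> J) (\<lambda>i. nd (s i))) P \<le> \<delta>"
proof -
  interpret product_sigma_finite "\<lambda>i. nd (s i)" by (rule psf_nd) (rule s)
  interpret prob_space "PiM I (\<lambda>i. nd (s i))" by (rule prob_PiM_nd) (rule s)
  have "emeasure (PiM (I \<union> J) (\<lambda>i. nd (s i))) P = (\<integral>\<^sup>+\<omega>. indicator P \<omega> \<partial>PiM (I \<union> J) (\<lambda>i. nd (s i)))"
    using P by simp
  also have "... = (\<integral>\<^sup>+y. \<integral>\<^sup>+z. indicator P (merge I J (y, z)) \<partial>PiM J (\<lambda>i. nd (s i)) \<partial>PiM I (\<lambda>i. nd (s i)))"
    by (rule product_nn_integral_fold[OF fin(3,1,2)]) (use P in simp)
  also have "... \<le> (\<integral>\<^sup>+y. \<delta> \<partial>PiM I (\<lambda>i. nd (s i)))"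
  proof (rule nn_integral_mono)
    fix y assume y: "y \<in> space (PiM I (\<lambda>i. nd (s i)))"
    have "(\<lambda>z. merge I J (y, z)) \<in> measurable (PiM J (\<lambda>i. nd (s i))) (PiM (I \<union> J) (\<lambda>i. nd (s i)))"
      using measurable_comp[OF measurable_Pair1'[OF y] measurable_merge] by (simp add: comp_def)
    then have m: "{z \<in> space (PiM J (\<lambda>i. nd (s i))). merge I J (y, z) \<in> P} \<in> sets (PiM J (\<lambda>i. nd (s i)))"
      using measurable_sets[OF \<open>(\<lambda>z. merge I J (y, z)) \<in> _\<close> P] by (simp add: vimage_def Int_def conj_commute)
    have "(\<integral>\<^sup>+z. indicator P (merge I J (y, z)) \<partial>PiM J (\<lambda>i. nd (s i))) =
       (\<integral>\<^sup>+z. indicator {z \<in> space (PiM J (\<lambda>i. nd (s i))). merge I J (y, z) \<in> P} z \<partial>PiM J (\<lambda>i. nd (s i)))"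
      by (rule nn_integral_cong) (simp split: split_indicator)
    also have "... \<le> \<delta>" using m bd[OF y] by simp
    finally show "(\<integral>\<^sup>+z. indicator P (merge I J (y, z)) \<partial>PiM J (\<lambda>i. nd (s i))) \<le> \<delta>" .
  qed
  also have "... = \<delta>" by (simp add: emeasure_space_1)
  finally show ?thesis .
qed

section \<open>The Schur complement of a spiked matrix\<close>

definition spk :: "nat => (nat => real) => (nat => nat => real) => nat => nat => real" where
  "spk r ls H i j = (if i = j \<and> i < r then ls i else 0) + H i j"

definition shiftm :: "real => (nat => nat => real) => nat => nat => real" where
  "shiftm x H i j = (if i = j then x else 0) - H i j"

definition res :: "nat => nat => (nat => nat => real) => real => nat => nat => real" where
  "res n r H x = pinv {r..<n} (shiftm x H)"

text \<open>The common shift of the \<open>r\<close> large eigenvalues: the conditional mean of \<open>Gmat\<close> given the block \<open>B\<close> is \<open>gam\<close> times the identity.\<close>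

definition gam :: "nat => nat => (nat => nat => real) => real => real => real" where
  "gam n r H \<sigma> x = \<sigma>\<^sup>2 * (\<Sum>i\<in>{r..<n}. res n r H x i i)"

definition Gmat :: "nat => nat => (nat => nat => real) => real => nat => nat => real" where
  "Gmat n r H x k k' = (\<Sum>i\<in>{r..<n}. \<Sum>j\<in>{r..<n}. H k i * res n r H x i j * H j k')"

definition Emat :: "nat => nat => (nat => nat => real) => real => real => nat => nat => real" where
  "Emat n r H \<sigma> x k k' = H k k' + (Gmat n r H x k k' - (if k = k' then gam n r H \<sigma> x else 0))"

lemma mv_shiftm: "finite S ==> i \<in> S ==> mv S (shiftm x H) v i = x * v i - mv S H v i"
  by (simp add: mv_def shiftm_def left_diff_distrib sum_subtractf if_distrib[of "\<lambda>y. y * _"] cong: if_cong)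

lemma mv_un: "finite A ==> finite B ==> A \<inter> B = {} ==> mv (A \<union> B) M z i = mv A M z i + mv B M z i"
  by (simp add: mv_def sum.union_disjoint)

lemma dot_un: "finite A ==> finite B ==> A \<inter> B = {} ==> dot (A \<union> B) u v = dot A u v + dot B u v"
  by (simp add: dot_def sum.union_disjoint)

lemma sym_on_subset: "sym_on S A ==> T \<subseteq> S ==> sym_on T A"
  by (auto simp: sym_on_def)

lemma abs_le_L2: "finite S ==> i \<in> S ==> \<bar>v i\<bar> \<le> L2_set v S"
proof -
  assume S: "finite S" "i \<in> S"
  have "\<bar>v i\<bar> = L2_set v {i}" by (simp add: L2_set_def)
  also have "... \<le> L2_set v S" using S by (intro L2_set_subset) auto
  finally show ?thesis .
qed

lemma form_le_opb: "opb S A c ==> \<bar>dot S v (mv S A v)\<bar> \<le> c * dot S v v"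
proof -
  assume A: "opb S A c"
  have "\<bar>dot S v (mv S A v)\<bar> \<le> L2_set v S * L2_set (mv S A v) S" by (rule dot_CS)
  also have "... \<le> L2_set v S * (c * L2_set v S)" by (intro mult_left_mono opbD[OF A]) simp
  also have "... = c * dot S v v" by (simp add: L2_set_sq[symmetric] power2_eq_square)
  finally show ?thesis .
qed

lemma inverse_le:
  fixes a d :: real
  assumes a: "0 < a" "a / 2 \<le> \<bar>d\<bar>"
  shows "\<bar>inverse d\<bar> \<le> 2 / a"
proof -
  have "0 < a / 2" using a(1) by simp
  from le_imp_inverse_le[OF a(2) this] have "inverse \<bar>d\<bar> \<le> inverse (a / 2)" .
  then show ?thesis by (simp only: abs_inverse inverse_divide)
qed

text \<open>The deterministic setting: \<open>\<rho>\<close> bounds the noise, \<open>\<epsilon>\<close> bounds the reduced noise \<open>E x\<close> for every \<open>x\<close> at the scale of the signal, and the signal (at least \<open>lm\<close>) dominates both.\<close>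

locale spiked =
  fixes n r :: nat and ls :: "nat => real" and H :: "nat => nat => real" and \<sigma> \<rho> \<epsilon> lm :: real
  assumes rn: "r \<le> n" and n0: "0 < n"
    and H_sym: "sym_on {..<n} H" and H_op: "opb {..<n} H \<rho>"
    and \<sigma>0: "0 < \<sigma>" and \<sigma>\<rho>: "\<sigma> * sqrt (real n) \<le> \<rho>" and \<rho>lm: "100 * \<rho> \<le> lm"
    and lsm: "\<And>k. k < r ==> lm \<le> \<bar>ls k\<bar>"
    and \<epsilon>0: "0 \<le> \<epsilon>" and \<epsilon>\<rho>: "\<epsilon> \<le> \<rho>"
    and E_op: "\<And>x. lm / 2 \<le> \<bar>x\<bar> ==> opb {..<r} (Emat n r H \<sigma> x) \<epsilon>"
begin

abbreviation "S \<equiv> {..<n}"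
abbreviation "T \<equiv> {..<r}"
abbreviation "B \<equiv> {r..<n}"
abbreviation "M \<equiv> spk r ls H"
abbreviation "R \<equiv> res n r H"
abbreviation "\<gamma> \<equiv> gam n r H \<sigma>"
abbreviation "E \<equiv> Emat n r H \<sigma>"

lemma STB: "S = T \<union> B" "T \<inter> B = {}" using rn by auto

lemma \<rho>0: "0 < \<rho>"
proof -
  have "0 < \<sigma> * sqrt (real n)" using \<sigma>0 n0 by simp
  then show ?thesis using \<sigma>\<rho> by linarith
qed

lemma lm0: "0 < lm" using \<rho>0 \<rho>lm by linarith

lemma \<epsilon>lm: "100 * \<epsilon> \<le> lm" using \<epsilon>\<rho> \<rho>lm by linarith

lemma \<sigma>2n: "\<sigma>\<^sup>2 * real n \<le> \<rho>\<^sup>2"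
proof -
  have "(\<sigma> * sqrt (real n))\<^sup>2 \<le> \<rho>\<^sup>2" using \<sigma>\<rho> \<sigma>0 by (intro power_mono) auto
  then show ?thesis by (simp add: power_mult_distrib)
qed

lemma H_op': "S' \<subseteq> S ==> opb S' H \<rho>"
  using opb_subset[OF _ _ H_op] \<rho>0 by auto

lemma H_block: "A \<subseteq> S ==> C \<subseteq> S ==> L2_set (mv A H v) C \<le> \<rho> * L2_set v A"
  by (rule opb_block[OF _ _ _ H_op]) auto

lemma H_symD: "i < n ==> j < n ==> H i j = H j i"
  using H_sym by (auto simp: sym_on_def)

lemma B_eig: "\<exists>V \<mu>. eigsys B H V \<mu> \<and> (\<forall>k\<in>B. \<bar>\<mu> k\<bar> \<le> \<rho>)"
proof -
  have "sym_on B H" by (rule sym_on_subset[OF H_sym]) auto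
  then obtain V \<mu> where V: "eigsys B H V \<mu>" using spectral_theorem[of B H] by auto
  have "opb B H \<rho>" by (rule H_op') auto
  then show ?thesis using eig_le_opb[OF _ V] V by blast
qed

lemma res_eig:
  assumes x: "lm / 2 \<le> \<bar>x\<bar>" and V: "eigsys B H V \<mu>" and \<mu>: "\<forall>k\<in>B. \<bar>\<mu> k\<bar> \<le> \<rho>"
  shows "eigsys B (shiftm x H) V (\<lambda>k. x - \<mu> k)" "eigsys B (R x) V (\<lambda>k. inverse (x - \<mu> k))"
    "\<And>k. k \<in> B ==> \<bar>x\<bar> / 2 \<le> \<bar>x - \<mu> k\<bar>"
proof -
  show 1: "eigsys B (shiftm x H) V (\<lambda>k. x - \<mu> k)"
    unfolding shiftm_def[abs_def] by (rule eigsys_shift[OF _ V]) simp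
  show "eigsys B (R x) V (\<lambda>k. inverse (x - \<mu> k))" unfolding res_def by (rule eigsys_pinv[OF _ 1]) simp
  show "\<bar>x\<bar> / 2 \<le> \<bar>x - \<mu> k\<bar>" if "k \<in> B" for k
    using bspec[OF \<mu> that] x \<rho>lm \<rho>0 by linarith
qed

lemma res_nonzero: "lm / 2 \<le> \<bar>x\<bar> ==> 0 < \<bar>x\<bar>" using lm0 by linarith

lemma res_solve:
  assumes x: "lm / 2 \<le> \<bar>x\<bar>" and i: "i \<in> B"
  shows "x * mv B (R x) y i - mv B H (mv B (R x) y) i = y i"
proof -
  obtain V \<mu> where V: "eigsys B H V \<mu>" and \<mu>B: "\<forall>k\<in>B. \<bar>\<mu> k\<bar> \<le> \<rho>" using B_eig by blast
  note e = res_eig[OF x V \<mu>B]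
  have nz: "x - \<mu> k \<noteq> 0" if "k \<in> B" for k using e(3)[OF that] res_nonzero[OF x] by auto
  have "mv B (shiftm x H) (mv B (R x) y) i = y i" unfolding res_def
    by (rule pinv_solve[OF _ e(1) nz i]) auto
  then show ?thesis using i by (simp add: mv_shiftm)
qed

lemma res_unique:
  assumes x: "lm / 2 \<le> \<bar>x\<bar>" and eq: "\<And>i. i \<in> B ==> x * z i - mv B H z i = y i" and i: "i \<in> B"
  shows "z i = mv B (R x) y i"
proof -
  obtain V \<mu> where V: "eigsys B H V \<mu>" and \<mu>B: "\<forall>k\<in>B. \<bar>\<mu> k\<bar> \<le> \<rho>" using B_eig by blast
  note e = res_eig[OF x V \<mu>B]
  have nz: "x - \<mu> k \<noteq> 0" if "k \<in> B" for k using e(3)[OF that] res_nonzero[OF x] by auto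
  show ?thesis unfolding res_def
    by (rule pinv_unique[OF _ e(1) nz _ i]) (use eq in \<open>auto simp: mv_shiftm\<close>)
qed

lemma res_op: assumes x: "lm / 2 \<le> \<bar>x\<bar>" shows "opb B (R x) (2 / \<bar>x\<bar>)"
proof -
  obtain V \<mu> where V: "eigsys B H V \<mu>" and \<mu>B: "\<forall>k\<in>B. \<bar>\<mu> k\<bar> \<le> \<rho>" using B_eig by blast
  note e = res_eig[OF x V \<mu>B]
  show ?thesis
  proof (rule opb_eig[OF _ e(2)])
    show "\<bar>inverse (x - \<mu> k)\<bar> \<le> 2 / \<bar>x\<bar>" if "k \<in> B" for k
      by (rule inverse_le[OF res_nonzero[OF x] e(3)[OF that]])
  qed auto
qed

lemma gam_eig:
  assumes x: "lm / 2 \<le> \<bar>x\<bar>" and V: "eigsys B H V \<mu>" and \<mu>: "\<forall>k\<in>B. \<bar>\<mu> k\<bar> \<le> \<rho>"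
  shows "\<gamma> x = \<sigma>\<^sup>2 * (\<Sum>k\<in>B. inverse (x - \<mu> k))"
proof -
  have "(\<Sum>i\<in>B. R x i i) = (\<Sum>k\<in>B. inverse (x - \<mu> k))"
    by (rule eig_trace[OF _ res_eig(2)[OF x V \<mu>]]) auto
  then show ?thesis unfolding gam_def by simp
qed

lemma gam_bound: assumes x: "lm / 2 \<le> \<bar>x\<bar>" shows "\<bar>\<gamma> x\<bar> \<le> \<rho> / 25"
proof -
  obtain V \<mu> where V: "eigsys B H V \<mu>" and \<mu>B: "\<forall>k\<in>B. \<bar>\<mu> k\<bar> \<le> \<rho>" using B_eig by blast
  have "\<bar>\<Sum>k\<in>B. inverse (x - \<mu> k)\<bar> \<le> (\<Sum>k\<in>B. 2 / \<bar>x\<bar>)"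
  proof (rule order_trans[OF sum_abs], rule sum_mono)
    show "\<bar>inverse (x - \<mu> k)\<bar> \<le> 2 / \<bar>x\<bar>" if "k \<in> B" for k
      by (rule inverse_le[OF res_nonzero[OF x] res_eig(3)[OF x V \<mu>B that]])
  qed
  also have "... = real (n - r) * (2 / \<bar>x\<bar>)" by simp
  also have "... \<le> real n * (2 / \<bar>x\<bar>)" by (rule mult_right_mono) auto
  finally have sb: "\<bar>\<Sum>k\<in>B. inverse (x - \<mu> k)\<bar> \<le> real n * (2 / \<bar>x\<bar>)" .
  have ge: "\<gamma> x = \<sigma>\<^sup>2 * (\<Sum>k\<in>B. inverse (x - \<mu> k))" by (rule gam_eig[OF x V \<mu>B])
  have "\<bar>\<gamma> x\<bar> \<le> \<sigma>\<^sup>2 * (real n * (2 / \<bar>x\<bar>))"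
    unfolding ge abs_mult abs_power2 by (rule mult_left_mono[OF sb]) simp
  also have "... = (\<sigma>\<^sup>2 * real n) * (2 / \<bar>x\<bar>)" by simp
  also have "... \<le> \<rho>\<^sup>2 * (2 / (50 * \<rho>))"
  proof (rule mult_mono[OF \<sigma>2n])
    have "50 * \<rho> \<le> \<bar>x\<bar>" using x \<rho>lm by linarith
    then show "2 / \<bar>x\<bar> \<le> 2 / (50 * \<rho>)" using \<rho>0 by (intro frac_le) auto
  qed (use \<rho>0 in auto)
  also have "... = \<rho> / 25" using \<rho>0 by (simp add: power2_eq_square)
  finally show ?thesis .
qed

text \<open>\<open>\<gamma>\<close> has derivative of order \<open>\<sigma>\<^sup>2 n / x\<^sup>2\<close>, which the signal-to-noise ratio makes small; hence \<open>x - \<gamma> x\<close> is close to an isometry.\<close>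

lemma gam_lipschitz:
  assumes x: "lm / 2 \<le> \<bar>x\<bar>" and y: "lm / 2 \<le> \<bar>y\<bar>" shows "\<bar>\<gamma> x - \<gamma> y\<bar> \<le> \<bar>x - y\<bar> / 100"
proof -
  obtain V \<mu> where V: "eigsys B H V \<mu>" and \<mu>B: "\<forall>k\<in>B. \<bar>\<mu> k\<bar> \<le> \<rho>" using B_eig by blast
  have ex: "25 * \<rho> \<le> \<bar>x - \<mu> k\<bar>" and ey: "25 * \<rho> \<le> \<bar>y - \<mu> k\<bar>" if "k \<in> B" for k
  proof -
    have "\<bar>x\<bar> / 2 \<le> \<bar>x - \<mu> k\<bar>" by (rule res_eig(3)[OF x V \<mu>B that])
    then show "25 * \<rho> \<le> \<bar>x - \<mu> k\<bar>" using x \<rho>lm by linarith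
    have "\<bar>y\<bar> / 2 \<le> \<bar>y - \<mu> k\<bar>" by (rule res_eig(3)[OF y V \<mu>B that])
    then show "25 * \<rho> \<le> \<bar>y - \<mu> k\<bar>" using y \<rho>lm by linarith
  qed
  have tm: "\<bar>inverse (x - \<mu> k) - inverse (y - \<mu> k)\<bar> \<le> \<bar>x - y\<bar> / (625 * \<rho>\<^sup>2)" if k: "k \<in> B" for k
  proof -
    have nz: "x - \<mu> k \<noteq> 0" "y - \<mu> k \<noteq> 0" using ex[OF k] ey[OF k] \<rho>0 by auto
    have "inverse (x - \<mu> k) - inverse (y - \<mu> k) = (y - x) / ((x - \<mu> k) * (y - \<mu> k))"
      using nz by (simp add: divide_simps)
    then have "\<bar>inverse (x - \<mu> k) - inverse (y - \<mu> k)\<bar> = \<bar>x - y\<bar> / (\<bar>x - \<mu> k\<bar> * \<bar>y - \<mu> k\<bar>)"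
      by (simp add: abs_mult abs_minus_commute)
    also have "... \<le> \<bar>x - y\<bar> / ((25 * \<rho>) * (25 * \<rho>))"
    proof (rule frac_le)
      show "25 * \<rho> * (25 * \<rho>) \<le> \<bar>x - \<mu> k\<bar> * \<bar>y - \<mu> k\<bar>"
        using ex[OF k] ey[OF k] \<rho>0 by (intro mult_mono) auto
    qed (use \<rho>0 in auto)
    finally show ?thesis by (simp add: power2_eq_square)
  qed
  have "\<gamma> x - \<gamma> y = \<sigma>\<^sup>2 * (\<Sum>k\<in>B. inverse (x - \<mu> k) - inverse (y - \<mu> k))"
    unfolding gam_eig[OF x V \<mu>B] gam_eig[OF y V \<mu>B] by (simp add: sum_subtractf right_diff_distrib)
  moreover have "\<bar>\<Sum>k\<in>B. inverse (x - \<mu> k) - inverse (y - \<mu> k)\<bar> \<le> (\<Sum>k\<in>B. \<bar>x - y\<bar> / (625 * \<rho>\<^sup>2))"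
    by (rule order_trans[OF sum_abs]) (intro sum_mono tm)
  ultimately have "\<bar>\<gamma> x - \<gamma> y\<bar> \<le> \<sigma>\<^sup>2 * (\<Sum>k\<in>B. \<bar>x - y\<bar> / (625 * \<rho>\<^sup>2))"
    by (simp only: abs_mult abs_power2) (erule mult_left_mono, simp)
  also have "... \<le> \<sigma>\<^sup>2 * (real n * (\<bar>x - y\<bar> / (625 * \<rho>\<^sup>2)))"
  proof (rule mult_left_mono)
    have "(\<Sum>k\<in>B. \<bar>x - y\<bar> / (625 * \<rho>\<^sup>2)) = real (n - r) * (\<bar>x - y\<bar> / (625 * \<rho>\<^sup>2))" by simp
    also have "... \<le> real n * (\<bar>x - y\<bar> / (625 * \<rho>\<^sup>2))" by (rule mult_right_mono) auto
    finally show "(\<Sum>k\<in>B. \<bar>x - y\<bar> / (625 * \<rho>\<^sup>2)) \<le> real n * (\<bar>x - y\<bar> / (625 * \<rho>\<^sup>2))" .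
  qed simp
  also have "... = (\<sigma>\<^sup>2 * real n) * (\<bar>x - y\<bar> / (625 * \<rho>\<^sup>2))" by simp
  also have "... \<le> \<rho>\<^sup>2 * (\<bar>x - y\<bar> / (625 * \<rho>\<^sup>2))" by (intro mult_right_mono \<sigma>2n) auto
  also have "... = \<bar>x - y\<bar> / 625" using \<rho>0 by (simp add: power2_eq_square)
  also have "... \<le> \<bar>x - y\<bar> / 100" by simp
  finally show ?thesis .
qed

lemma mv_E:
  assumes "T' \<subseteq> T" "k \<in> T'"
  shows "mv T' (E x) z k = mv T' H z k + mv B H (mv B (R x) (mv T' H z)) k - \<gamma> x * z k"
proof -
  have fT: "finite T'" using assms finite_subset by auto
  have "mv B H (mv B (R x) (mv T' H z)) k = (\<Sum>i\<in>B. \<Sum>j\<in>B. \<Sum>k'\<in>T'. H k i * R x i j * H j k' * z k')"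
    by (simp add: mv_def sum_distrib_left mult.assoc)
  also have "... = (\<Sum>i\<in>B. \<Sum>k'\<in>T'. \<Sum>j\<in>B. H k i * R x i j * H j k' * z k')"
    by (rule sum.cong[OF refl]) (rule sum.swap)
  also have "... = (\<Sum>k'\<in>T'. \<Sum>i\<in>B. \<Sum>j\<in>B. H k i * R x i j * H j k' * z k')" by (rule sum.swap)
  also have "... = (\<Sum>k'\<in>T'. Gmat n r H x k k' * z k')" by (simp add: Gmat_def sum_distrib_right)
  finally show ?thesis using assms fT
    by (simp add: mv_def Emat_def algebra_simps sum.distrib sum_subtractf if_distrib[of "\<lambda>y. y * _"] if_distrib[of "\<lambda>y. _ * y"] cong: if_cong)
qed

text \<open>Block elimination of \<open>B\<close>. The subset \<open>T'\<close> allows the same identity for the matrix with coordinate \<open>l\<close> removed.\<close>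

lemma schur:
  assumes T': "T' \<subseteq> T" and x: "lm / 2 \<le> \<bar>x\<bar>"
    and eq: "\<And>i. i \<in> T' \<union> B ==> x * z i - mv (T' \<union> B) M z i = y i"
  shows "\<And>i. i \<in> B ==> z i = mv B (R x) (\<lambda>j. y j + mv T' H z j) i"
    and "\<And>k. k \<in> T' ==> (x - \<gamma> x - ls k) * z k - mv T' (E x) z k = y k + mv B H (mv B (R x) y) k"
proof -
  have fT: "finite T'" "T' \<inter> B = {}" using T' finite_subset by auto
  have MB: "mv (T' \<union> B) M z i = mv T' H z i + mv B H z i" if "i \<in> B" for i
  proof -
    have "mv (T' \<union> B) M z i = mv (T' \<union> B) H z i" by (rule mv_cong) (use that in \<open>auto simp: spk_def\<close>)
    then show ?thesis using mv_un[OF fT(1) _ fT(2)] by simp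
  qed
  have MT: "mv (T' \<union> B) M z k = ls k * z k + mv T' H z k + mv B H z k" if k: "k \<in> T'" for k
  proof -
    have "mv (T' \<union> B) M z k = (\<Sum>j\<in>T' \<union> B. (if k = j then ls k * z k else 0) + H k j * z j)"
      unfolding mv_def by (rule sum.cong) (use k T' in \<open>auto simp: spk_def algebra_simps\<close>)
    also have "... = ls k * z k + mv (T' \<union> B) H z k" using k fT by (simp add: sum.distrib mv_def)
    finally show ?thesis using mv_un[OF fT(1) _ fT(2)] by simp
  qed
  show zB: "z i = mv B (R x) (\<lambda>j. y j + mv T' H z j) i" if "i \<in> B" for i
  proof (rule res_unique[OF x _ that])
    fix i assume "i \<in> B"
    then show "x * z i - mv B H z i = y i + mv T' H z i" using eq[of i] MB by simp
  qed
  fix k assume k: "k \<in> T'"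
  have "mv B H z k = mv B H (mv B (R x) (\<lambda>j. y j + mv T' H z j)) k" by (rule mv_cong) (use zB in auto)
  also have "... = mv B H (\<lambda>i. mv B (R x) y i + mv B (R x) (mv T' H z) i) k" by (rule mv_cong) (auto simp: mv_add)
  also have "... = mv B H (mv B (R x) y) k + mv B H (mv B (R x) (mv T' H z)) k" by (rule mv_add)
  finally show "(x - \<gamma> x - ls k) * z k - mv T' (E x) z k = y k + mv B H (mv B (R x) y) k"
    using eq[of k] MT[OF k] mv_E[OF T' k, of x z] k by (simp add: algebra_simps)
qed

lemma E_op': "T' \<subseteq> T ==> lm / 2 \<le> \<bar>x\<bar> ==> opb T' (E x) \<epsilon>"
  using opb_subset[OF _ _ E_op \<epsilon>0] by auto

lemma eig_coord:
  assumes T': "T' \<subseteq> T" and x: "lm / 2 \<le> \<bar>x\<bar>"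
    and eq: "\<And>i. i \<in> T' \<union> B ==> mv (T' \<union> B) M z i = x * z i"
  shows "\<And>i. i \<in> B ==> z i = mv B (R x) (mv T' H z) i"
    and "\<And>k. k \<in> T' ==> (x - \<gamma> x - ls k) * z k = mv T' (E x) z k"
proof -
  have e0: "x * z i - mv (T' \<union> B) M z i = 0" if "i \<in> T' \<union> B" for i using eq[OF that] by simp
  have 0: "mv A C (\<lambda>_. 0) i = 0" for A :: "nat set" and C :: "nat => nat => real" and i by (simp add: mv_def)
  then have 00: "mv B (R x) (\<lambda>_. 0) = (\<lambda>_. 0)" by auto
  show "z i = mv B (R x) (mv T' H z) i" if "i \<in> B" for i
    using schur(1)[OF T' x e0 that] by simp
  show "(x - \<gamma> x - ls k) * z k = mv T' (E x) z k" if "k \<in> T'" for k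
    using schur(2)[OF T' x e0 that] unfolding 00 0 by simp
qed

text \<open>If every \<open>x - \<gamma> x - ls k\<close> exceeded \<open>\<epsilon>\<close>, the reduced equation would force the coordinates of the eigenvector on \<open>T\<close>, and then those on \<open>B\<close>, to vanish.\<close>

lemma eig_loc:
  assumes T': "T' \<subseteq> T" and x: "lm / 2 \<le> \<bar>x\<bar>"
    and eq: "\<And>i. i \<in> T' \<union> B ==> mv (T' \<union> B) M z i = x * z i" and nz: "i0 \<in> T' \<union> B" "z i0 \<noteq> 0"
  shows "\<exists>k\<in>T'. \<bar>x - \<gamma> x - ls k\<bar> \<le> \<epsilon>"
proof (rule ccontr)
  assume "\<not> ?thesis"
  then have far: "\<epsilon> < \<bar>x - \<gamma> x - ls k\<bar>" if "k \<in> T'" for k using that by force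
  have fT: "finite T'" using T' finite_subset by auto
  have "\<exists>k\<in>T'. z k \<noteq> 0"
  proof (rule ccontr)
    assume z0: "\<not> (\<exists>k\<in>T'. z k \<noteq> 0)"
    then have "mv T' H z = (\<lambda>_. 0)" by (auto simp: mv_def)
    then have "z i = 0" if "i \<in> B" for i using eig_coord(1)[OF T' x eq that] by (simp add: mv_def)
    then show False using nz z0 by auto
  qed
  then obtain k0 where k0: "k0 \<in> T'" "z k0 \<noteq> 0" by auto
  have "(\<Sum>k\<in>T'. \<epsilon>\<^sup>2 * (z k)\<^sup>2) < (\<Sum>k\<in>T'. (mv T' (E x) z k)\<^sup>2)"
  proof (rule sum_strict_mono_ex1[OF fT])
    have e: "(mv T' (E x) z k)\<^sup>2 = (x - \<gamma> x - ls k)\<^sup>2 * (z k)\<^sup>2" if "k \<in> T'" for k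
      using eig_coord(2)[OF T' x eq that] by (simp flip: power_mult_distrib)
    have lt: "\<epsilon>\<^sup>2 < (x - \<gamma> x - ls k)\<^sup>2" if "k \<in> T'" for k
      using power_strict_mono[OF far[OF that] \<epsilon>0, of 2] by simp
    show "\<forall>k\<in>T'. \<epsilon>\<^sup>2 * (z k)\<^sup>2 \<le> (mv T' (E x) z k)\<^sup>2"
    proof
      fix k assume k: "k \<in> T'"
      show "\<epsilon>\<^sup>2 * (z k)\<^sup>2 \<le> (mv T' (E x) z k)\<^sup>2"
        unfolding e[OF k] by (rule mult_right_mono[OF less_imp_le[OF lt[OF k]]]) simp
    qed
    show "\<exists>k\<in>T'. \<epsilon>\<^sup>2 * (z k)\<^sup>2 < (mv T' (E x) z k)\<^sup>2" using e lt k0 by (intro bexI[of _ k0]) auto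
  qed
  then have "\<epsilon>\<^sup>2 * dot T' z z < (L2_set (mv T' (E x) z) T')\<^sup>2"
    unfolding L2_set_sq by (simp add: dot_def power2_eq_square sum_distrib_left mult_ac)
  also have "... \<le> (\<epsilon> * L2_set z T')\<^sup>2" by (intro power_mono opbD[OF E_op'[OF T' x]]) simp
  also have "... = \<epsilon>\<^sup>2 * dot T' z z" by (simp add: power_mult_distrib L2_set_sq)
  finally show False by simp
qed

text \<open>Vectors supported on \<open>B\<close> see only the noise, so their image has at most \<open>\<rho>\<close> times their norm.\<close>

lemma small_count:
  assumes T': "T' \<subseteq> T" and W: "eigsys (T' \<union> B) M W \<nu>"
  shows "card B \<le> card {k \<in> T' \<union> B. \<bar>\<nu> k\<bar> \<le> \<rho>}"
proof (rule eig_count[where W = "\<lambda>j i. if i = j then 1 else 0" and V = W])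
  let ?S = "T' \<union> B"
  show fS: "finite ?S" "finite B" using T' finite_subset by auto
  fix c :: "nat => real" assume c: "\<exists>j\<in>B. c j \<noteq> 0"
  define z where "z i = (\<Sum>j\<in>B. c j * (if i = j then 1 else 0))" for i
  have z: "z i = (if i \<in> B then c i else 0)" for i
    by (simp add: z_def if_distrib[of "\<lambda>y. _ * y"] cong: if_cong)
  show "\<exists>k\<in>?S. \<bar>\<nu> k\<bar> \<le> \<rho> \<and> dot ?S (\<lambda>i. \<Sum>j\<in>B. c j * (if i = j then 1 else 0)) (W k) \<noteq> 0"
  proof (rule ccontr)
    assume "\<not> ?thesis"
    then have far: "\<rho> < \<bar>\<nu> k\<bar> \<or> dot ?S z (W k) = 0" if "k \<in> ?S" for k using that unfolding z_def by force
    have Mz: "mv ?S M z i = mv ?S H z i" if "i \<in> ?S" for i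
      unfolding mv_def by (rule sum.cong) (auto simp: z spk_def)
    have "dot ?S z z \<noteq> 0" using c z dot_self_eq_0[OF fS(1), of z] by auto
    then have "\<exists>k\<in>?S. dot ?S z (W k) \<noteq> 0" unfolding eig_norm1[OF fS(1) W] by (metis (no_types, lifting) power_zero_numeral sum.neutral)
    then obtain k0 where k0: "k0 \<in> ?S" "dot ?S z (W k0) \<noteq> 0" by blast
    have lt: "\<rho>\<^sup>2 < (\<nu> k)\<^sup>2" if "\<rho> < \<bar>\<nu> k\<bar>" for k
      using power_strict_mono[OF that _, of 2] \<rho>0 by simp
    have "\<rho>\<^sup>2 * dot ?S z z = (\<Sum>k\<in>?S. \<rho>\<^sup>2 * (dot ?S z (W k))\<^sup>2)" unfolding eig_norm1[OF fS(1) W] by (simp add: sum_distrib_left)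
    also have "... < (\<Sum>k\<in>?S. (\<nu> k)\<^sup>2 * (dot ?S z (W k))\<^sup>2)"
    proof (rule sum_strict_mono_ex1[OF fS(1)])
      show "\<forall>k\<in>?S. \<rho>\<^sup>2 * (dot ?S z (W k))\<^sup>2 \<le> (\<nu> k)\<^sup>2 * (dot ?S z (W k))\<^sup>2"
      proof
        fix k assume "k \<in> ?S"
        from far[OF this] show "\<rho>\<^sup>2 * (dot ?S z (W k))\<^sup>2 \<le> (\<nu> k)\<^sup>2 * (dot ?S z (W k))\<^sup>2"
        proof
          assume "\<rho> < \<bar>\<nu> k\<bar>"
          then show ?thesis by (intro mult_right_mono[OF less_imp_le[OF lt]]) auto
        qed simp
      qed
      show "\<exists>k\<in>?S. \<rho>\<^sup>2 * (dot ?S z (W k))\<^sup>2 < (\<nu> k)\<^sup>2 * (dot ?S z (W k))\<^sup>2"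
        using far[OF k0(1)] k0 lt[of k0] by (intro bexI[of _ k0] mult_strict_right_mono) auto
    qed
    also have "... = (L2_set (mv ?S M z) ?S)\<^sup>2" unfolding L2_set_sq eig_norm[OF fS(1) W] ..
    also have "L2_set (mv ?S M z) ?S = L2_set (mv ?S H z) ?S" by (rule L2_set_cong[OF refl Mz])
    also have "(L2_set (mv ?S H z) ?S)\<^sup>2 \<le> (\<rho> * L2_set z ?S)\<^sup>2"
      by (intro power_mono opbD[OF H_op']) (use T' rn in auto)
    also have "... = \<rho>\<^sup>2 * dot ?S z z" by (simp add: power_mult_distrib L2_set_sq)
    finally show False by simp
  qed
qed

lemma large_count:
  assumes T': "T' \<subseteq> T" and W: "eigsys (T' \<union> B) M W \<nu>"
  shows "card {k \<in> T' \<union> B. \<rho> < \<bar>\<nu> k\<bar>} \<le> card T'"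
proof -
  let ?S = "T' \<union> B"
  have fS: "finite T'" "finite ?S" "T' \<inter> B = {}" using T' finite_subset by auto
  have "card ?S = card {k \<in> ?S. \<rho> < \<bar>\<nu> k\<bar>} + card {k \<in> ?S. \<bar>\<nu> k\<bar> \<le> \<rho>}"
    by (subst card_Un_disjoint[symmetric]) (use fS in \<open>auto intro!: arg_cong[of _ _ card]\<close>)
  moreover have "card ?S = card T' + card B" using fS by (simp add: card_Un_disjoint)
  ultimately show ?thesis using small_count[OF assms] by linarith
qed

section \<open>Counting eigenvalues\<close>

text \<open>The congruence that block-diagonalises \<open>M - x\<close>: for \<open>j \<in> T\<close> the vector is \<open>e j\<close> completed on \<open>B\<close> by the resolvent, for \<open>j \<in> B\<close> it is \<open>e j\<close>.\<close>

definition Wv :: "real => nat => nat => real" where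
  "Wv x j i = (if j < r then (if i < r then (if i = j then 1 else 0) else mv B (R x) (\<lambda>i. H i j) i)
     else (if i = j then 1 else 0))"

lemma M_sym: "sym_on S M"
  using H_sym by (auto simp: sym_on_def spk_def)

text \<open>Congruence preserves inertia: the form of \<open>M - x\<close> splits into a part on \<open>T\<close> governed by \<open>ls k - x + \<gamma> x\<close> up to \<open>E x\<close> and a part on \<open>B\<close> with the sign of \<open>-x\<close>.\<close>

lemma quad_form:
  assumes x: "lm / 2 \<le> \<bar>x\<bar>"
  defines "z \<equiv> \<lambda>c i. \<Sum>j\<in>S. c j * Wv x j i"
  shows "dot S (z c) (mv S M (z c)) - x * dot S (z c) (z c) =
    (\<Sum>k\<in>T. (ls k - x + \<gamma> x) * (c k)\<^sup>2) + dot T c (mv T (E x) c) - dot B c (\<lambda>i. x * c i - mv B H c i)"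
proof -
  define z1 where "z1 i = (if i < r then c i else mv B (R x) (mv T H c) i)" for i
  define e where "e i = (if i < r then 0 else c i)" for i
  have zi: "z c i = z1 i + e i" if "i \<in> S" for i
  proof -
    have "z c i = (\<Sum>j\<in>T. c j * Wv x j i) + (\<Sum>j\<in>B. c j * Wv x j i)"
      unfolding z_def STB(1) using STB(2) by (simp add: sum.union_disjoint)
    moreover have "(\<Sum>j\<in>T. c j * Wv x j i) = z1 i"
    proof (cases "i < r")
      case True
      then show ?thesis by (simp add: Wv_def z1_def if_distrib[of "\<lambda>y. _ * y"] cong: if_cong)
    next
      case False
      have "(\<Sum>j\<in>T. c j * Wv x j i) = (\<Sum>j\<in>T. \<Sum>p\<in>B. c j * (R x i p * H p j))"
        using False by (simp add: Wv_def mv_def sum_distrib_left)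
      also have "... = (\<Sum>p\<in>B. \<Sum>j\<in>T. c j * (R x i p * H p j))" by (rule sum.swap)
      finally show ?thesis using False by (simp add: z1_def mv_def sum_distrib_left mult_ac)
    qed
    moreover have "(\<Sum>j\<in>B. c j * Wv x j i) = e i"
    proof -
      have "(\<Sum>j\<in>B. c j * Wv x j i) = (\<Sum>j\<in>B. if i = j then c j else 0)"
        by (rule sum.cong) (auto simp: Wv_def)
      then show ?thesis using that by (auto simp: e_def)
    qed
    ultimately show ?thesis by simp
  qed
  define Q where "Q u v = dot S u (\<lambda>i. mv S M v i - x * v i)" for u v
  have Qadd: "Q (\<lambda>i. u i + u' i) v = Q u v + Q u' v" "Q u (\<lambda>i. v i + v' i) = Q u v + Q u v'" for u u' v v'
    by (simp_all add: Q_def dot_def mv_add algebra_simps sum.distrib sum_subtractf)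
  have Qsym: "Q u v = Q v u" for u v
    using mv_sym[OF _ M_sym, of u v] by (simp add: Q_def dot_diff_right dot_scale_right dot_commute)
  have "dot S (z c) (mv S M (z c)) - x * dot S (z c) (z c) = Q (z c) (z c)"
    by (simp add: Q_def dot_diff_right dot_scale_right)
  also have "... = Q (\<lambda>i. z1 i + e i) (\<lambda>i. z1 i + e i)"
  proof -
    have "mv S M (z c) i = mv S M (\<lambda>i. z1 i + e i) i" for i by (rule mv_cong) (use zi in auto)
    then show ?thesis unfolding Q_def by (intro dot_cong) (use zi in auto)
  qed
  also have "... = Q z1 z1 + 2 * Q e z1 + Q e e" unfolding Qadd using Qsym[of z1 e] by simp
  finally have Qsum: "dot S (z c) (mv S M (z c)) - x * dot S (z c) (z c) = Q z1 z1 + 2 * Q e z1 + Q e e" .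
  have Qz: "Q e z1 = 0 \<and> Q z1 z1 = (\<Sum>k\<in>T. (ls k - x + \<gamma> x) * (c k)\<^sup>2) + dot T c (mv T (E x) c)"
  proof -
    define y where "y i = x * z1 i - mv (T \<union> B) M z1 i" for i
    have yeq: "x * z1 i - mv (T \<union> B) M z1 i = y i" if "i \<in> T \<union> B" for i by (simp add: y_def)
    have TBe: "mv T H z1 i = mv T H c i" for i by (rule mv_cong) (auto simp: z1_def)
    have y0: "y i = 0" if i: "i \<in> B" for i
    proof -
      have z1i: "z1 i = mv B (R x) (mv T H c) i" using i by (simp add: z1_def)
      have "mv (T \<union> B) M z1 i = mv (T \<union> B) H z1 i" by (rule mv_cong) (use i in \<open>auto simp: spk_def\<close>)
      also have "... = mv T H z1 i + mv B H z1 i" by (rule mv_un) auto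
      also have "mv B H z1 i = mv B H (mv B (R x) (mv T H c)) i" by (rule mv_cong) (auto simp: z1_def)
      finally have "y i = x * mv B (R x) (mv T H c) i - mv B H (mv B (R x) (mv T H c)) i - mv T H c i"
        using i by (simp add: y_def TBe z1i)
      then show ?thesis using res_solve[OF x i] by simp
    qed
    have Ry: "mv B (R x) y = (\<lambda>_. 0)" using y0 by (auto simp: mv_def)
    have yT: "y k = (x - \<gamma> x - ls k) * c k - mv T (E x) c k" if k: "k \<in> T" for k
    proof -
      have "(x - \<gamma> x - ls k) * z1 k - mv T (E x) z1 k = y k + mv B H (mv B (R x) y) k"
        by (rule schur(2)[OF _ x yeq]) (use k in auto)
      moreover have "mv T (E x) z1 k = mv T (E x) c k" by (rule mv_cong) (auto simp: z1_def)
      ultimately show ?thesis unfolding Ry using k by (simp add: z1_def mv_def)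
    qed
    have Qy: "Q u z1 = - dot S u y" for u
      unfolding Q_def y_def STB(1) by (simp add: dot_def sum_negf[symmetric] algebra_simps)
    have sp: "dot S u y = dot T u y" for u
    proof -
      have "dot S u y = dot T u y + dot B u y" unfolding STB(1) by (rule dot_un) auto
      also have "dot B u y = 0" unfolding dot_def using y0 by (intro sum.neutral) auto
      finally show ?thesis by simp
    qed
    have "dot T e y = 0" by (auto simp: dot_def e_def)
    moreover have "dot T z1 y = dot T c (\<lambda>k. (x - \<gamma> x - ls k) * c k - mv T (E x) c k)"
      by (rule dot_cong) (use yT in \<open>auto simp: z1_def\<close>)
    moreover have "dot T c (\<lambda>k. (x - \<gamma> x - ls k) * c k - mv T (E x) c k) =
       - (\<Sum>k\<in>T. (ls k - x + \<gamma> x) * (c k)\<^sup>2) - dot T c (mv T (E x) c)"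
      unfolding dot_diff_right by (simp add: dot_def sum_negf[symmetric] power2_eq_square algebra_simps)
    ultimately show ?thesis unfolding Qy sp by simp
  qed
  have Qe: "Q e e = - dot B c (\<lambda>i. x * c i - mv B H c i)"
  proof -
    have me: "mv S M e i = mv B H c i" if "i \<in> B" for i
    proof -
      have "mv S M e i = mv T M e i + mv B M e i" unfolding STB(1) by (rule mv_un) auto
      also have "mv T M e i = 0" by (auto simp: mv_def e_def)
      also have "mv B M e i = mv B H c i" by (rule mv_cong) (auto simp: e_def spk_def)
      finally show ?thesis by simp
    qed
    have "Q e e = dot T e (\<lambda>i. mv S M e i - x * e i) + dot B e (\<lambda>i. mv S M e i - x * e i)"
      unfolding Q_def STB(1) by (rule dot_un) auto
    also have "dot T e (\<lambda>i. mv S M e i - x * e i) = 0" by (auto simp: dot_def e_def)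
    also have "dot B e (\<lambda>i. mv S M e i - x * e i) = dot B c (\<lambda>i. mv B H c i - x * c i)"
      by (rule dot_cong) (use me in \<open>auto simp: e_def\<close>)
    also have "... = - dot B c (\<lambda>i. x * c i - mv B H c i)" by (simp add: dot_diff_right)
    finally show ?thesis by simp
  qed
  show ?thesis unfolding Qsum Qe using Qz by simp
qed

lemma eig_shift_form:
  assumes V: "eigsys S M V lam"
  shows "dot S z (mv S M z) - x * dot S z z = (\<Sum>k\<in>S. (lam k - x) * (dot S z (V k))\<^sup>2)"
  unfolding eig_form[OF finite_lessThan V] eig_norm1[OF finite_lessThan V, of z]
  by (simp add: sum_distrib_left sum_subtractf left_diff_distrib)

text \<open>On the span of the \<open>Wv x k\<close> with \<open>ls k\<close> beyond the level, the form of \<open>M - x\<close> is definite. The sign \<open>s\<close> treats both ends of the spectrum together.\<close>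

lemma cnt_up:
  assumes V: "eigsys S M V lam" and s: "s = 1 \<or> s = -1" and x: "lm / 2 \<le> s * x"
  shows "card {k \<in> T. s * (x - \<gamma> x) + \<epsilon> < s * ls k} \<le> card {i \<in> S. s * x < s * lam i}"
proof (rule eig_count[where W = "Wv x" and V = V])
  let ?K = "{k \<in> T. s * (x - \<gamma> x) + \<epsilon> < s * ls k}"
  have x': "lm / 2 \<le> \<bar>x\<bar>" using s x by auto
  show "finite S" "finite ?K" by auto
  fix c :: "nat => real" assume c: "\<exists>j\<in>?K. c j \<noteq> 0"
  then obtain k0 where k0: "k0 \<in> ?K" "c k0 \<noteq> 0" by auto
  define d where "d j = (if j \<in> ?K then c j else 0)" for j
  define z where "z i = (\<Sum>j\<in>S. d j * Wv x j i)" for i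
  have z: "z i = (\<Sum>j\<in>?K. c j * Wv x j i)" for i
    unfolding z_def by (rule sum.mono_neutral_cong_right) (use rn in \<open>auto simp: d_def\<close>)
  show "\<exists>k\<in>S. s * x < s * lam k \<and> dot S (\<lambda>i. \<Sum>j\<in>?K. c j * Wv x j i) (V k) \<noteq> 0"
  proof (rule ccontr)
    assume neg: "\<not> ?thesis"
    have "s * (\<Sum>k\<in>S. (lam k - x) * (dot S z (V k))\<^sup>2) = (\<Sum>k\<in>S. (s * lam k - s * x) * (dot S z (V k))\<^sup>2)"
      by (simp add: sum_distrib_left algebra_simps)
    also have "... \<le> 0"
    proof (rule sum_nonpos)
      fix k assume "k \<in> S"
      then have "s * lam k \<le> s * x \<or> dot S z (V k) = 0" using neg unfolding z[abs_def] by force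
      then show "(s * lam k - s * x) * (dot S z (V k))\<^sup>2 \<le> 0" by (auto intro: mult_nonpos_nonneg)
    qed
    finally have le: "s * (\<Sum>k\<in>S. (lam k - x) * (dot S z (V k))\<^sup>2) \<le> 0" .
    have "(\<Sum>k\<in>S. (lam k - x) * (dot S z (V k))\<^sup>2) = (\<Sum>k\<in>T. (ls k - x + \<gamma> x) * (d k)\<^sup>2) + dot T d (mv T (E x) d)
       - dot B d (\<lambda>i. x * d i - mv B H d i)"
      using quad_form[OF x', of d] unfolding eig_shift_form[OF V, symmetric] z_def by simp
    also have "dot B d (\<lambda>i. x * d i - mv B H d i) = 0" by (auto simp: dot_def d_def)
    finally have q: "(\<Sum>k\<in>S. (lam k - x) * (dot S z (V k))\<^sup>2) = (\<Sum>k\<in>T. (ls k - x + \<gamma> x) * (d k)\<^sup>2) + dot T d (mv T (E x) d)" by simp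
    have "\<bar>s * dot T d (mv T (E x) d)\<bar> \<le> \<epsilon> * dot T d d" using form_le_opb[OF E_op[OF x'], of d] s by (auto simp: abs_mult)
    moreover have "\<epsilon> * dot T d d < (\<Sum>k\<in>T. (s * ls k - s * (x - \<gamma> x)) * (d k)\<^sup>2)"
      unfolding dot_def sum_distrib_left
    proof (rule sum_strict_mono_ex1)
      show "\<forall>k\<in>T. \<epsilon> * (d k * d k) \<le> (s * ls k - s * (x - \<gamma> x)) * (d k)\<^sup>2"
        by (auto simp: d_def power2_eq_square intro!: mult_right_mono)
      show "\<exists>k\<in>T. \<epsilon> * (d k * d k) < (s * ls k - s * (x - \<gamma> x)) * (d k)\<^sup>2"
      proof (rule bexI[of _ k0])
        have "0 < d k0 * d k0" using k0 by (simp add: d_def) (metis not_real_square_gt_zero)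
        then show "\<epsilon> * (d k0 * d k0) < (s * ls k0 - s * (x - \<gamma> x)) * (d k0)\<^sup>2"
          unfolding power2_eq_square using k0 by (intro mult_strict_right_mono) auto
      qed (use k0 in auto)
    qed simp
    moreover have "(\<Sum>k\<in>T. (s * ls k - s * (x - \<gamma> x)) * (d k)\<^sup>2) = s * (\<Sum>k\<in>T. (ls k - x + \<gamma> x) * (d k)\<^sup>2)"
      by (simp add: sum_distrib_left algebra_simps)
    ultimately have "0 < s * (\<Sum>k\<in>S. (lam k - x) * (dot S z (V k))\<^sup>2)" unfolding q by (simp add: distrib_left)
    then show False using le by linarith
  qed
qed

text \<open>The complementary count; here all of \<open>B\<close> contributes, because there the form has the sign of \<open>-x\<close>.\<close>

lemma cnt_dn:
  assumes V: "eigsys S M V lam" and s: "s = 1 \<or> s = -1" and x: "lm / 2 \<le> s * x"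
  shows "(n - r) + card {k \<in> T. s * ls k < s * (x - \<gamma> x) - \<epsilon>} \<le> card {i \<in> S. s * lam i < s * x}"
proof -
  let ?K' = "{k \<in> T. s * ls k < s * (x - \<gamma> x) - \<epsilon>}"
  let ?K = "?K' \<union> B"
  have "card ?K \<le> card {i \<in> S. s * lam i < s * x}"
  proof (rule eig_count[where W = "Wv x" and V = V])
    have x': "lm / 2 \<le> \<bar>x\<bar>" using s x by auto
    show "finite S" "finite ?K" by auto
    fix c :: "nat => real" assume c: "\<exists>j\<in>?K. c j \<noteq> 0"
    then obtain k0 where k0: "k0 \<in> ?K" "c k0 \<noteq> 0" by blast
    define d where "d j = (if j \<in> ?K then c j else 0)" for j
    define z where "z i = (\<Sum>j\<in>S. d j * Wv x j i)" for i
    have z: "z i = (\<Sum>j\<in>?K. c j * Wv x j i)" for i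
      unfolding z_def by (rule sum.mono_neutral_cong_right) (use rn in \<open>auto simp: d_def\<close>)
    show "\<exists>k\<in>S. s * lam k < s * x \<and> dot S (\<lambda>i. \<Sum>j\<in>?K. c j * Wv x j i) (V k) \<noteq> 0"
    proof (rule ccontr)
      assume neg: "\<not> ?thesis"
      have "0 \<le> (\<Sum>k\<in>S. (s * lam k - s * x) * (dot S z (V k))\<^sup>2)"
      proof (rule sum_nonneg)
        fix k assume "k \<in> S"
        then have "s * x \<le> s * lam k \<or> dot S z (V k) = 0" using neg unfolding z[abs_def] by force
        then show "0 \<le> (s * lam k - s * x) * (dot S z (V k))\<^sup>2" by auto
      qed
      also have "... = s * (\<Sum>k\<in>S. (lam k - x) * (dot S z (V k))\<^sup>2)"
        by (simp add: sum_distrib_left algebra_simps)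
      finally have le: "0 \<le> s * (\<Sum>k\<in>S. (lam k - x) * (dot S z (V k))\<^sup>2)" .
      have q: "(\<Sum>k\<in>S. (lam k - x) * (dot S z (V k))\<^sup>2) = (\<Sum>k\<in>T. (ls k - x + \<gamma> x) * (d k)\<^sup>2) + dot T d (mv T (E x) d)
         - dot B d (\<lambda>i. x * d i - mv B H d i)"
        using quad_form[OF x', of d] unfolding eig_shift_form[OF V, symmetric] z_def by simp
      have 1: "\<bar>s * dot T d (mv T (E x) d)\<bar> \<le> \<epsilon> * dot T d d" using form_le_opb[OF E_op[OF x'], of d] s by (auto simp: abs_mult)
      have tm: "(s * ls k - s * (x - \<gamma> x)) * (d k)\<^sup>2 \<le> - \<epsilon> * (d k * d k)"
        "d k \<noteq> 0 ==> (s * ls k - s * (x - \<gamma> x)) * (d k)\<^sup>2 < - \<epsilon> * (d k * d k)" if "k \<in> T" for k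
      proof -
        have p: "d k \<noteq> 0 ==> 0 < d k * d k" by (metis not_real_square_gt_zero)
        show 2: "d k \<noteq> 0 ==> (s * ls k - s * (x - \<gamma> x)) * (d k)\<^sup>2 < - \<epsilon> * (d k * d k)"
          unfolding power2_eq_square using p that by (intro mult_strict_right_mono) (auto simp: d_def split: if_splits)
        show "(s * ls k - s * (x - \<gamma> x)) * (d k)\<^sup>2 \<le> - \<epsilon> * (d k * d k)" using 2 by (cases "d k = 0") auto
      qed
      have s1: "(\<Sum>k\<in>T. (s * ls k - s * (x - \<gamma> x)) * (d k)\<^sup>2) \<le> - \<epsilon> * dot T d d"
        unfolding dot_def sum_distrib_left by (rule sum_mono) (use tm in auto)
      have s2: "(\<Sum>k\<in>T. (s * ls k - s * (x - \<gamma> x)) * (d k)\<^sup>2) < - \<epsilon> * dot T d d" if "k0 \<in> T"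
        unfolding dot_def sum_distrib_left
      proof (rule sum_strict_mono_ex1)
        have "d k0 \<noteq> 0" using k0 by (simp add: d_def)
        then show "\<exists>k\<in>T. (s * ls k - s * (x - \<gamma> x)) * (d k)\<^sup>2 < - \<epsilon> * (d k * d k)" using tm(2) that by blast
      qed (use tm in auto)
      have e: "(\<Sum>k\<in>T. (s * ls k - s * (x - \<gamma> x)) * (d k)\<^sup>2) = s * (\<Sum>k\<in>T. (ls k - x + \<gamma> x) * (d k)\<^sup>2)"
        by (simp add: sum_distrib_left algebra_simps)
      have b: "s * dot B d (\<lambda>i. x * d i - mv B H d i) = (s * x) * dot B d d - s * dot B d (mv B H d)"
        by (simp add: dot_diff_right dot_scale_right right_diff_distrib)
      have BS: "B \<subseteq> S" by auto
      have "\<bar>s * dot B d (mv B H d)\<bar> \<le> \<rho> * dot B d d" using form_le_opb[OF H_op'[OF BS], of d] s by (auto simp: abs_mult)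
      then have b1: "(s * x - \<rho>) * dot B d d \<le> s * dot B d (\<lambda>i. x * d i - mv B H d i)" unfolding b by (simp add: left_diff_distrib)
      have pos: "0 < s * x - \<rho>" using x \<rho>lm \<rho>0 by linarith
      have b0: "0 \<le> (s * x - \<rho>) * dot B d d" using pos dot_self_nonneg[of B d] by simp
      have "s * (\<Sum>k\<in>S. (lam k - x) * (dot S z (V k))\<^sup>2) < 0"
      proof (cases "k0 \<in> T")
        case True
        then show ?thesis unfolding q using s2 1 b0 b1 e by (simp add: algebra_simps)
      next
        case False
        then have "k0 \<in> B" "d k0 \<noteq> 0" using k0 by (auto simp: d_def)
        then have "dot B d d \<noteq> 0" using dot_self_eq_0[of B d] by auto
        then have "0 < dot B d d" using dot_self_nonneg[of B d] by linarith
        then have "0 < (s * x - \<rho>) * dot B d d" using pos by simp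
        then show ?thesis unfolding q using s1 1 b1 e by (simp add: algebra_simps)
      qed
      then show False using le by linarith
    qed
  qed
  moreover have "card ?K = card ?K' + (n - r)" by (subst card_Un_disjoint) auto
  ultimately show ?thesis by simp
qed

end

section \<open>Location of the labelled eigenvalues\<close>

definition labelling :: "nat => nat => (nat => real) => (nat => real) => bool" where
  "labelling n r ls lam \<longleftrightarrow>
     (\<forall>i<n. \<forall>j<n. i \<le> j \<and> \<not> (j < r \<and> ls i * ls j < 0) --> \<bar>lam j\<bar> \<le> \<bar>lam i\<bar>) \<and>
     (\<forall>i<r. \<forall>j<r. ls i < 0 \<and> 0 < ls j --> lam i \<le> lam j)"

locale labelled = spiked +
  fixes l :: nat and \<Delta> :: real and V :: "nat => nat => real" and lam :: "nat => real"
  assumes l: "l < r"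
    and lsdec: "\<And>j k. j \<le> k ==> k < r ==> \<bar>ls k\<bar> \<le> \<bar>ls j\<bar>"
    and \<Delta>0: "0 < \<Delta>" and gap: "\<And>k. k < r ==> k \<noteq> l ==> \<Delta> \<le> \<bar>ls l - ls k\<bar>"
    and \<epsilon>\<Delta>: "100 * \<epsilon> \<le> \<Delta>" and eig: "eigsys S M V lam" and lab: "labelling n r ls lam"
begin

definition g :: "real => real" where "g x = x - \<gamma> x"

lemma g_lip:
  assumes "lm / 2 \<le> \<bar>x\<bar>" "lm / 2 \<le> \<bar>y\<bar>"
  shows "\<bar>g x - g y\<bar> \<le> 101/100 * \<bar>x - y\<bar>"
proof -
  have "\<bar>g x - g y\<bar> = \<bar>(x - y) - (\<gamma> x - \<gamma> y)\<bar>" unfolding g_def by (simp add: algebra_simps)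
  also have "... \<le> \<bar>x - y\<bar> + \<bar>\<gamma> x - \<gamma> y\<bar>" by (rule abs_triangle_ineq4)
  finally show ?thesis using gam_lipschitz[OF assms] by simp
qed

lemma g_close:
  assumes "lm / 2 \<le> \<bar>x\<bar>"
  shows "\<bar>g x - x\<bar> \<le> \<rho> / 25"
  using gam_bound[OF assms] unfolding g_def by simp

abbreviation "Lg s \<equiv> {i \<in> S. lm / 2 < s * lam i}"
abbreviation "Sm \<equiv> {i \<in> S. \<bar>lam i\<bar> \<le> \<rho>}"
abbreviation "Pos s \<equiv> {k \<in> T. 0 < s * ls k}"

lemma ls_nz: "k < r ==> ls k \<noteq> 0" using lsm[of k] lm0 by auto

lemma card_Lg: assumes s: "s = 1 \<or> s = -1" shows "card (Pos s) \<le> card (Lg s)"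
proof -
  define x where "x = s * (lm / 2)"
  have sx: "s * x = lm / 2" "\<bar>x\<bar> = lm / 2" using s lm0 by (auto simp: x_def)
  have "Pos s \<subseteq> {k \<in> T. s * (x - \<gamma> x) + \<epsilon> < s * ls k}"
  proof
    fix k assume k: "k \<in> Pos s"
    then have "s * ls k = \<bar>ls k\<bar>" using s by auto
    then have "lm \<le> s * ls k" using lsm[of k] k by simp
    moreover have "\<bar>s * \<gamma> x\<bar> \<le> \<rho> / 25" using gam_bound[of x] sx s by (auto simp: abs_mult)
    moreover have "s * (x - \<gamma> x) = lm / 2 - s * \<gamma> x" using sx by (simp add: right_diff_distrib)
    ultimately have "s * (x - \<gamma> x) + \<epsilon> < s * ls k" using \<rho>lm \<rho>0 \<epsilon>lm by linarith
    then show "k \<in> {k \<in> T. s * (x - \<gamma> x) + \<epsilon> < s * ls k}" using k by simp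
  qed
  then have "card (Pos s) \<le> card {k \<in> T. s * (x - \<gamma> x) + \<epsilon> < s * ls k}" by (intro card_mono) auto
  also have "... \<le> card {i \<in> S. s * x < s * lam i}" by (rule cnt_up[OF eig s]) (simp add: sx)
  finally show ?thesis by (simp add: sx)
qed

lemma eigM: "eigsys (T \<union> B) M V lam" using eig STB(1) by simp

text \<open>The lower bounds for the two large groups and for the small one add up to \<open>n\<close>, so all three are equalities.\<close>

lemma cards: "card (Lg 1) = card (Pos 1)" "card (Lg (-1)) = card (Pos (-1))" "card Sm = n - r"
  "Lg 1 \<union> Lg (-1) \<union> Sm = S"
proof -
  have TP: "Pos 1 \<union> Pos (-1) = T" using ls_nz by (auto simp: neq_iff)
  have "card T = card (Pos 1) + card (Pos (-1))"
    by (subst TP[symmetric], rule card_Un_disjoint) auto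
  then have r: "card (Pos 1) + card (Pos (-1)) = r" by simp
  have sm: "n - r \<le> card Sm" using small_count[OF order_refl eigM] STB(1) by simp
  have d1: "Lg 1 \<inter> Lg (-1) = {}" using lm0 by auto
  have d2: "(Lg 1 \<union> Lg (-1)) \<inter> Sm = {}" using \<rho>lm \<rho>0 lm0 by auto
  have c: "card (Lg 1 \<union> Lg (-1) \<union> Sm) = card (Lg 1) + card (Lg (-1)) + card Sm"
    by (subst card_Un_disjoint, simp, simp, rule d2, subst card_Un_disjoint, simp, simp, rule d1) simp
  have sub: "Lg 1 \<union> Lg (-1) \<union> Sm \<subseteq> S" by auto
  then have le: "card (Lg 1 \<union> Lg (-1) \<union> Sm) \<le> n" using card_mono[OF finite_lessThan sub] by simp
  note u = card_Lg[of 1] card_Lg[of "-1"]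
  show "card (Lg 1) = card (Pos 1)" "card (Lg (-1)) = card (Pos (-1))" "card Sm = n - r"
    using c le u r sm rn by (simp_all)
  then have "card (Lg 1 \<union> Lg (-1) \<union> Sm) = card S" using c r rn by simp
  then show "Lg 1 \<union> Lg (-1) \<union> Sm = S" by (intro card_subset_eq[OF finite_lessThan sub])
qed

lemma lab1: "i < n ==> j < n ==> i \<le> j ==> \<not> (j < r \<and> ls i * ls j < 0) ==> \<bar>lam j\<bar> \<le> \<bar>lam i\<bar>"
  using lab unfolding labelling_def by blast

lemma lab2: "i < r ==> j < r ==> ls i < 0 ==> 0 < ls j ==> lam i \<le> lam j"
  using lab unfolding labelling_def by blast

text \<open>Otherwise \<open>i\<close> and all of \<open>B\<close> would be small, one more than there are small eigenvalues.\<close>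

lemma top_not_small: assumes i: "i < r" shows "i \<notin> Sm"
proof
  assume iS: "i \<in> Sm"
  have "insert i B \<subseteq> Sm"
  proof
    fix j assume "j \<in> insert i B"
    then show "j \<in> Sm" using iS lab1[of i j] i rn by auto
  qed
  then have "card (insert i B) \<le> card Sm" by (intro card_mono) auto
  moreover have "card (insert i B) = Suc (n - r)" using i by (subst card_insert_disjoint) auto
  ultimately show False using cards(3) by simp
qed

lemma top_split: "i < r ==> i \<in> Lg 1 \<or> i \<in> Lg (-1)"
proof -
  assume i: "i < r"
  then have "i \<in> Lg 1 \<union> Lg (-1) \<union> Sm" using cards(4) rn by auto
  then show ?thesis using top_not_small[OF i] by blast
qed

lemma top_big: "i < r ==> lm / 2 \<le> \<bar>lam i\<bar>"
  using top_split[of i] by auto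

lemma bot_small: assumes i: "r \<le> i" "i < n" shows "\<bar>lam i\<bar> \<le> \<rho>"
proof -
  have "Sm \<subseteq> B"
  proof
    fix j assume j: "j \<in> Sm"
    then have "\<not> j < r" using top_not_small by blast
    then show "j \<in> B" using j by simp
  qed
  then have "Sm = B" using cards(3) by (intro card_subset_eq) auto
  then have "i \<in> Sm" using i by simp
  then show ?thesis by simp
qed

text \<open>The algebraic ordering across opposite signs is used here: a label with \<open>s * ls k > 0\<close> in the wrong group would, with all labels of sign \<open>-s\<close>, make that group too large.\<close>

lemma top_sign: assumes s: "s = 1 \<or> s = -1" and k: "k < r" "0 < s * ls k" shows "lm / 2 < s * lam k"
proof (rule ccontr)
  assume n: "\<not> ?thesis"
  then have kn: "k \<in> Lg (- s)" using top_split[OF k(1)] s by auto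
  have "insert k (Pos (- s)) \<subseteq> Lg (- s)"
  proof
    fix j assume "j \<in> insert k (Pos (- s))"
    then show "j \<in> Lg (- s)"
    proof
      assume j: "j \<in> Pos (- s)"
      have "s * lam j \<le> s * lam k" using s lab2[of j k] lab2[of k j] j k by auto
      then show ?thesis using kn j rn by auto
    qed (use kn in auto)
  qed
  then have "card (insert k (Pos (- s))) \<le> card (Lg (- s))" by (intro card_mono) auto
  moreover have "k \<notin> Pos (- s)" using k by auto
  then have "card (insert k (Pos (- s))) = Suc (card (Pos (- s)))" by simp
  ultimately show False using cards(1,2) s by auto
qed

lemma Vk_nonzero: "i < n ==> \<exists>j\<in>T \<union> B. V i j \<noteq> 0"
proof (rule ccontr)
  assume i: "i < n" and "\<not> (\<exists>j\<in>T \<union> B. V i j \<noteq> 0)"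
  then have "dot S (V i) (V i) = 0" unfolding STB(1) by (simp add: dot_def)
  moreover have "dot S (V i) (V i) = 1" using orthon_self[OF eigsysD(1)[OF eig]] i by auto
  ultimately show False by simp
qed

lemma loc_some: assumes i: "i < n" and big: "lm / 2 \<le> \<bar>lam i\<bar>" shows "\<exists>k<r. \<bar>g (lam i) - ls k\<bar> \<le> \<epsilon>"
proof -
  obtain j where j: "j \<in> T \<union> B" "V i j \<noteq> 0" using Vk_nonzero[OF i] by blast
  have "i \<in> T \<union> B" using i by auto
  from eig_loc[OF order_refl big eigsysD(2)[OF eigM this] j] show ?thesis by (auto simp: g_def)
qed

text \<open>All comparisons are made after multiplying by the sign of \<open>ls l\<close>, so that eigenvalue \<open>l\<close> counts from the top.\<close>

definition sg :: real where "sg = sgn (ls l)"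

lemma sg: "sg = 1 \<or> sg = -1" "0 < sg * ls l" "sg * ls l = \<bar>ls l\<bar>"
  using ls_nz[OF l] by (auto simp: sg_def sgn_if)

abbreviation "Up \<equiv> {k \<in> T. sg * ls l \<le> sg * ls k}"

lemma sg_diff: "\<bar>sg * a - sg * b\<bar> = \<bar>a - b\<bar>" using sg(1) by auto

lemma gap': "k < r ==> k \<noteq> l ==> sg * ls l + \<Delta> \<le> sg * ls k \<or> sg * ls k \<le> sg * ls l - \<Delta>"
  using gap[of k] sg_diff[of "ls l" "ls k"] \<Delta>0 by linarith

lemma l_sign: "lm / 2 < sg * lam l" by (rule top_sign[OF sg(1) l sg(2)])

text \<open>A larger \<open>sg * ls k\<close> means a larger magnitude and hence a smaller label, which orders the \<open>lam\<close> the same way.\<close>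

lemma Up_ge: assumes k: "k \<in> Up" shows "sg * lam l \<le> sg * lam k"
proof (cases "k = l")
  case False
  have kr: "k < r" and pos: "0 < sg * ls k" using k sg(2) by auto
  have "\<bar>ls k\<bar> = sg * ls k" using pos sg(1) by auto
  moreover have "sg * ls l + \<Delta> \<le> sg * ls k" using gap'[OF kr False] k \<Delta>0 by auto
  ultimately have "\<bar>ls l\<bar> < \<bar>ls k\<bar>" using sg(3) \<Delta>0 by linarith
  then have "k \<le> l" using lsdec[of l k] kr by linarith
  moreover have "\<not> ls k * ls l < 0" using pos sg(1,2) by (auto simp: mult_less_0_iff)
  ultimately have "\<bar>lam l\<bar> \<le> \<bar>lam k\<bar>" using lab1[of k l] kr l rn by simp
  moreover have "lm / 2 < sg * lam k" by (rule top_sign[OF sg(1) kr pos])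
  ultimately show ?thesis using l_sign lm0 sg(1) by auto
qed simp

lemma above_l: assumes i: "i < n" "sg * lam l < sg * lam i" shows "i \<in> Up - {l}"
proof -
  have il: "i \<noteq> l" using i by auto
  have abs: "\<bar>lam l\<bar> < \<bar>lam i\<bar>" using i l_sign lm0 sg(1) by auto
  have ir: "i < r"
  proof (rule ccontr)
    assume "\<not> i < r"
    then have "\<bar>lam i\<bar> \<le> \<bar>lam l\<bar>" using lab1[of l i] i l by auto
    then show False using abs by simp
  qed
  have pos: "0 < sg * ls i"
  proof (rule ccontr)
    assume "\<not> ?thesis"
    then have "0 < (- sg) * ls i" using ls_nz[OF ir] sg(1) by auto
    from top_sign[OF _ ir this] have "lm / 2 < - sg * lam i" using sg(1) by auto
    then show False using i l_sign lm0 by auto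
  qed
  have same: "\<not> ls l * ls i < 0" using pos sg(1,2) by (auto simp: mult_less_0_iff)
  have "i < l"
  proof (rule ccontr)
    assume "\<not> i < l"
    then have "\<bar>lam i\<bar> \<le> \<bar>lam l\<bar>" using lab1[of l i] same i l rn by auto
    then show False using abs by simp
  qed
  then have "\<bar>ls l\<bar> \<le> \<bar>ls i\<bar>" using lsdec[of i l] l by simp
  moreover have "\<bar>ls i\<bar> = sg * ls i" using pos sg(1) by auto
  ultimately have "sg * ls l \<le> sg * ls i" using sg(3) by linarith
  then show ?thesis using ir il by simp
qed

lemma card_not_Up: "card {k \<in> T. \<not> sg * ls l \<le> sg * ls k} + card Up = r"
proof -
  have "{k \<in> T. \<not> sg * ls l \<le> sg * ls k} \<union> Up = T" by auto
  moreover have "card ({k \<in> T. \<not> sg * ls l \<le> sg * ls k} \<union> Up) = card {k \<in> T. \<not> sg * ls l \<le> sg * ls k} + card Up"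
    by (rule card_Un_disjoint) auto
  ultimately show ?thesis by simp
qed

lemma l_Up: "l \<in> Up" using l by simp

text \<open>No label in \<open>Up\<close> lies below \<open>lam l\<close>, and only labels in \<open>Up - {l}\<close> lie above it. If \<open>lam l\<close> sat near another \<open>ls k\<close>, \<open>cnt_dn\<close> or \<open>cnt_up\<close> at the level \<open>lam l\<close> would contradict this.\<close>

theorem loc_l: "\<bar>g (lam l) - ls l\<bar> \<le> \<epsilon>"
proof -
  have ln: "l < n" using l rn by simp
  obtain k where k: "k < r" "\<bar>g (lam l) - ls k\<bar> \<le> \<epsilon>" using loc_some[OF ln top_big[OF l]] by blast
  have kd: "\<bar>sg * g (lam l) - sg * ls k\<bar> \<le> \<epsilon>" using k(2) sg_diff by simp
  have xl: "lm / 2 \<le> sg * lam l" using l_sign by simp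
  show ?thesis
  proof (cases "k = l")
    case False
    from gap'[OF k(1) False] show ?thesis
    proof
      assume up: "sg * ls l + \<Delta> \<le> sg * ls k"
      let ?K = "{k \<in> T. sg * ls k < sg * (lam l - \<gamma> (lam l)) - \<epsilon>}"
      have "insert l {k \<in> T. \<not> sg * ls l \<le> sg * ls k} \<subseteq> ?K"
        using l kd up \<epsilon>\<Delta> \<Delta>0 \<epsilon>0 unfolding g_def by auto
      then have "card (insert l {k \<in> T. \<not> sg * ls l \<le> sg * ls k}) \<le> card ?K" by (intro card_mono) auto
      then have c1: "Suc (card {k \<in> T. \<not> sg * ls l \<le> sg * ls k}) \<le> card ?K" by simp
      have c2: "(n - r) + card ?K \<le> card {i \<in> S. sg * lam i < sg * lam l}" by (rule cnt_dn[OF eig sg(1) xl])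
      have "{i \<in> S. sg * lam i < sg * lam l} \<inter> Up = {}" using Up_ge by force
      then have "card {i \<in> S. sg * lam i < sg * lam l} + card Up = card ({i \<in> S. sg * lam i < sg * lam l} \<union> Up)"
        by (subst card_Un_disjoint) auto
      also have "... \<le> card S" by (rule card_mono) (use rn in auto)
      finally show ?thesis using c1 c2 card_not_Up rn by simp
    next
      assume dn: "sg * ls k \<le> sg * ls l - \<Delta>"
      let ?K = "{k \<in> T. sg * (lam l - \<gamma> (lam l)) + \<epsilon> < sg * ls k}"
      have "Up \<subseteq> ?K" using kd dn \<epsilon>\<Delta> \<Delta>0 unfolding g_def by auto
      then have "card Up \<le> card ?K" by (intro card_mono) auto
      also have "... \<le> card {i \<in> S. sg * lam l < sg * lam i}" by (rule cnt_up[OF eig sg(1) xl])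
      also have "... \<le> card (Up - {l})" using above_l by (intro card_mono) auto
      also have "... < card Up" by (rule card_Diff1_less) (use l_Up in auto)
      finally show ?thesis by simp
    qed
  qed (use k in simp)
qed

text \<open>Were there two eigenvalues near \<open>ls l\<close>, \<open>cnt_up\<close> and \<open>cnt_dn\<close> would produce \<open>n - 1\<close> further ones.\<close>

theorem loc_other:
  assumes i: "i < n" "i \<noteq> l" "lm / 2 \<le> \<bar>lam i\<bar>"
  shows "\<exists>k<r. k \<noteq> l \<and> \<bar>g (lam i) - ls k\<bar> \<le> \<epsilon>"
proof -
  obtain k where k: "k < r" "\<bar>g (lam i) - ls k\<bar> \<le> \<epsilon>" using loc_some[OF i(1,3)] by blast
  show ?thesis
  proof (cases "k = l")
    case True
    have si: "\<bar>sg * g (lam i) - sg * ls l\<bar> \<le> \<epsilon>" and sl: "\<bar>sg * g (lam l) - sg * ls l\<bar> \<le> \<epsilon>"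
      using k(2) True loc_l sg_diff by auto
    have "\<bar>sg * g (lam i) - sg * lam i\<bar> \<le> \<rho> / 25" using g_close[OF i(3)] sg_diff by simp
    moreover have "lm \<le> sg * ls l" using lsm[OF l] sg(3) by simp
    ultimately have "0 < sg * lam i" using si \<epsilon>lm \<rho>lm \<rho>0 by linarith
    then have xi: "lm / 2 \<le> sg * lam i" using i(3) sg(1) by auto
    have xl: "lm / 2 \<le> sg * lam l" using l_sign by simp
    obtain a b where ab: "{a, b} = {i, l}" "sg * lam a \<le> sg * lam b" "lm / 2 \<le> sg * lam a" "lm / 2 \<le> sg * lam b"
      "\<bar>sg * g (lam a) - sg * ls l\<bar> \<le> \<epsilon>" "\<bar>sg * g (lam b) - sg * ls l\<bar> \<le> \<epsilon>"
    proof (cases "sg * lam i \<le> sg * lam l")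
      case True
      then show ?thesis using that[of i l] xi xl si sl by auto
    next
      case False
      then show ?thesis using that[of l i] xi xl si sl by auto
    qed
    let ?Ka = "{k \<in> T. sg * ls k < sg * (lam a - \<gamma> (lam a)) - \<epsilon>}"
    let ?Kb = "{k \<in> T. sg * (lam b - \<gamma> (lam b)) + \<epsilon> < sg * ls k}"
    let ?A = "{j \<in> S. sg * lam j < sg * lam a}"
    let ?B = "{j \<in> S. sg * lam b < sg * lam j}"
    have "{k \<in> T. \<not> sg * ls l \<le> sg * ls k} \<subseteq> ?Ka"
    proof clarsimp
      fix k assume k: "k < r" "\<not> sg * ls l \<le> sg * ls k"
      then have "k \<noteq> l" by auto
      then have "sg * ls k \<le> sg * ls l - \<Delta>" using gap'[OF k(1)] k(2) \<Delta>0 by auto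
      then show "sg * ls k < sg * (lam a - \<gamma> (lam a)) - \<epsilon>" using ab(5) \<epsilon>\<Delta> \<Delta>0 unfolding g_def by linarith
    qed
    then have "card {k \<in> T. \<not> sg * ls l \<le> sg * ls k} \<le> card ?Ka" by (intro card_mono) auto
    moreover have "(n - r) + card ?Ka \<le> card ?A" by (rule cnt_dn[OF eig sg(1) ab(3)])
    moreover have "Up - {l} \<subseteq> ?Kb"
    proof
      fix k assume k: "k \<in> Up - {l}"
      then have "sg * ls l + \<Delta> \<le> sg * ls k" using gap'[of k] \<Delta>0 by auto
      then show "k \<in> ?Kb" using ab(6) \<epsilon>\<Delta> \<Delta>0 k unfolding g_def by auto
    qed
    then have "card (Up - {l}) \<le> card ?Kb" by (intro card_mono) auto
    moreover have "card ?Kb \<le> card ?B" by (rule cnt_up[OF eig sg(1) ab(4)])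
    moreover have "card (Up - {l}) = card Up - 1" using l_Up by (subst card_Diff_singleton) auto
    moreover have "0 < card Up" using l_Up by (auto simp: card_gt_0_iff)
    moreover have "card ?A + card ?B + 2 \<le> n"
    proof -
      have d: "?A \<inter> ?B = {}" using ab(2) by auto
      have nab: "{a, b} \<inter> (?A \<union> ?B) = {}" using ab(2) by auto
      have "card {a, b} = 2" unfolding ab(1) using i(2) by simp
      then have "card ?A + card ?B + 2 = card ({a, b} \<union> (?A \<union> ?B))"
        using card_Un_disjoint[OF _ _ d] card_Un_disjoint[OF _ _ nab] by simp
      also have "... \<le> card S" unfolding ab(1) by (rule card_mono) (use i l rn in auto)
      finally show ?thesis by simp
    qed
    ultimately show ?thesis using card_not_Up rn by linarith
  qed (use k in blast)
qed

lemma g_far: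
  assumes x: "lm / 2 \<le> \<bar>x\<bar>" and k: "k < r" "k \<noteq> l" "\<bar>g x - ls k\<bar> \<le> \<epsilon>"
  shows "9/10 * \<Delta> \<le> \<bar>lam l - x\<bar>"
proof -
  have "\<Delta> - 2 * \<epsilon> \<le> \<bar>g (lam l) - g x\<bar>" using gap[OF k(1,2)] k(3) loc_l by linarith
  also have "... \<le> 101/100 * \<bar>lam l - x\<bar>" by (rule g_lip[OF top_big[OF l] x])
  finally have d: "\<Delta> - 2 * \<epsilon> \<le> 101/100 * \<bar>lam l - x\<bar>" .
  have "98 * \<Delta> \<le> 101 * \<bar>lam l - x\<bar>" using d \<epsilon>\<Delta> by (simp add: field_simps)
  then show ?thesis using \<Delta>0 by (simp add: field_simps)
qed

lemma lam_sep: "i < r ==> i \<noteq> l ==> 9/10 * \<Delta> \<le> \<bar>lam l - lam i\<bar>"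
  using loc_other[of i] top_big[of i] g_far[of "lam i"] rn by auto

lemma lam_l: "9/10 * \<bar>ls l\<bar> \<le> \<bar>lam l\<bar>" "\<bar>lam l\<bar> \<le> 11/10 * \<bar>ls l\<bar>" "\<bar>lam l - ls l\<bar> \<le> 2 * \<rho>"
proof -
  have "\<bar>lam l - ls l\<bar> \<le> \<epsilon> + \<rho> / 25" using loc_l g_close[OF top_big[OF l]] by linarith
  then show 1: "\<bar>lam l - ls l\<bar> \<le> 2 * \<rho>" using \<epsilon>\<rho> \<rho>0 by linarith
  show "9/10 * \<bar>ls l\<bar> \<le> \<bar>lam l\<bar>" "\<bar>lam l\<bar> \<le> 11/10 * \<bar>ls l\<bar>" using 1 lsm[OF l] \<rho>lm by linarith+
qed

lemma lam_bot: "r \<le> i ==> i < n ==> 4/5 * \<bar>ls l\<bar> \<le> \<bar>lam l - lam i\<bar>"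
  using bot_small[of i] lam_l(1) lsm[OF l] \<rho>lm by linarith

lemma lam_simple: "i < n ==> i \<noteq> l ==> lam i \<noteq> lam l"
  using lam_sep[of i] lam_bot[of i] \<Delta>0 ls_nz[OF l] by (cases "i < r") auto

text \<open>\<open>lam l\<close> is a simple eigenvalue, so any unit eigenvector is \<open>\<plusminus> V l\<close>.\<close>

lemma eigvec_unique:
  assumes u: "\<And>i. i \<in> S ==> mv S M u i = lam l * u i" and i: "i \<in> S"
  shows "u i = dot S u (V l) * V l i"
proof -
  have z: "dot S u (V k) = 0" if k: "k \<in> S" "k \<noteq> l" for k
  proof -
    have "lam k * dot S u (V k) = dot S (mv S M u) (V k)" by (rule eig_dot_mv[OF _ eig k(1), symmetric]) simp
    also have "... = dot S (\<lambda>i. lam l * u i) (V k)" by (rule dot_cong) (use u in auto)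
    also have "... = lam l * dot S u (V k)" by (simp add: dot_scale_left)
    finally show ?thesis using lam_simple[of k] k by auto
  qed
  have lS: "l \<in> S" using l rn by auto
  have "u i = (\<Sum>k\<in>S. dot S u (V k) * V k i)" by (rule eig_expand[OF _ eig i]) simp
  also have "... = dot S u (V l) * V l i + (\<Sum>k\<in>S - {l}. dot S u (V k) * V k i)"
    by (rule sum.remove[OF _ lS]) simp
  also have "(\<Sum>k\<in>S - {l}. dot S u (V k) * V k i) = 0" by (rule sum.neutral) (use z in auto)
  finally show ?thesis by simp
qed

end

section \<open>Leaving out one coordinate\<close>

definition mprod :: "'i set => ('i => 'i => real) => ('i => 'i => real) => 'i => 'i => real" where
  "mprod S A B i j = (\<Sum>k\<in>S. A i k * B k j)"

definition frob2 :: "'i set => ('i => 'i => real) => real" where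
  "frob2 S A = (\<Sum>i\<in>S. \<Sum>j\<in>S. (A i j)\<^sup>2)"

definition tr :: "'i set => ('i => 'i => real) => real" where
  "tr S A = (\<Sum>i\<in>S. A i i)"

lemma eigsys_mprod:
  assumes "finite S" "eigsys S A V \<nu>" "eigsys S B V \<mu>"
  shows "eigsys S (mprod S A B) V (\<lambda>k. \<nu> k * \<mu> k)"
  unfolding eigsys_def
proof (intro conjI ballI)
  show "orthon S S V" by (rule eigsysD(1)[OF assms(2)])
  fix k i assume k: "k \<in> S" and i: "i \<in> S"
  have "mv S (mprod S A B) (V k) i = (\<Sum>j\<in>S. \<Sum>p\<in>S. A i p * (B p j * V k j))"
    by (simp add: mv_def mprod_def sum_distrib_right mult.assoc)
  also have "... = (\<Sum>p\<in>S. A i p * mv S B (V k) p)"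
    by (subst sum.swap) (simp add: mv_def sum_distrib_left)
  also have "... = (\<Sum>p\<in>S. A i p * (\<mu> k * V k p))"
    by (rule sum.cong) (use eigsysD(2)[OF assms(3) k] in auto)
  also have "... = \<mu> k * mv S A (V k) i" by (simp add: mv_def sum_distrib_left mult_ac)
  finally show "mv S (mprod S A B) (V k) i = \<nu> k * \<mu> k * V k i"
    using eigsysD(2)[OF assms(2) k i] by simp
qed

lemma inv_sq_diff:
  fixes p q m d :: real
  assumes m: "0 < m" "m \<le> \<bar>p\<bar>" "m \<le> \<bar>q\<bar>" and d: "\<bar>p - q\<bar> \<le> d"
  shows "\<bar>(inverse p)\<^sup>2 - (inverse q)\<^sup>2\<bar> \<le> 2 * d * (1 / m ^ 3)"
proof -
  have nz: "p \<noteq> 0" "q \<noteq> 0" using m by auto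
  have im: "\<bar>inverse p\<bar> \<le> 1 / m" "\<bar>inverse q\<bar> \<le> 1 / m"
    using m by (simp_all add: divide_inverse le_imp_inverse_le)
  have "inverse p - inverse q = (q - p) * (inverse p * inverse q)" using nz by (simp add: field_simps)
  then have "\<bar>inverse p - inverse q\<bar> = \<bar>p - q\<bar> * (\<bar>inverse p\<bar> * \<bar>inverse q\<bar>)"
    by (simp only: abs_mult abs_minus_commute)
  also have "... \<le> d * (1 / m * (1 / m))" by (intro mult_mono im d) (use m d in auto)
  finally have 1: "\<bar>inverse p - inverse q\<bar> \<le> d * (1 / m * (1 / m))" .
  have 2: "\<bar>inverse p + inverse q\<bar> \<le> 2 * (1 / m)" using im by (rule_tac order_trans[OF abs_triangle_ineq]) linarith
  have "(inverse p)\<^sup>2 - (inverse q)\<^sup>2 = (inverse p - inverse q) * (inverse p + inverse q)"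
    by (simp add: power2_eq_square algebra_simps)
  then have "\<bar>(inverse p)\<^sup>2 - (inverse q)\<^sup>2\<bar> = \<bar>inverse p - inverse q\<bar> * \<bar>inverse p + inverse q\<bar>" by (simp only: abs_mult)
  also have "... \<le> (d * (1 / m * (1 / m))) * (2 * (1 / m))"
    by (intro mult_mono 1 2) (use m d in auto)
  also have "... = 2 * d * (1 / m ^ 3)" using m by (simp add: field_simps power3_eq_cube)
  finally show ?thesis .
qed

definition off :: "nat => nat => nat set" where "off n l = {..<n} - {l}"

text \<open>The resolvent of the matrix without row and column \<open>l\<close>. It is independent of column \<open>l\<close> of the noise.\<close>

definition Tx :: "nat => nat => (nat => real) => (nat => nat => real) => nat => real => nat => nat => real" where
  "Tx n r ls H l x = pinv (off n l) (shiftm x (spk r ls H))"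

definition botp :: "nat => (nat => real) => nat => real" where
  "botp r a i = (if i < r then 0 else a i)"

text \<open>\<open>rows_ok\<close>, \<open>quad_ok\<close> and \<open>lin_ok\<close> hold with high probability for a fixed \<open>x\<close>, as they bound forms in noise entries that are independent of the coefficients. In \<open>quad_ok\<close> the operator norm of \<open>A\<close> enters through \<open>(tr A\<^sup>4) powr (1/4)\<close>, an explicit upper bound for it.\<close>

definition rows_ok :: "nat => nat => (nat => nat => real) => real => real => (nat => real) => real => bool" where
  "rows_ok n r H \<sigma> lg a x \<longleftrightarrow> (\<forall>k<r. \<bar>\<Sum>i\<in>{r..<n}. mv {r..<n} (res n r H x) a i * H i k\<bar>
     \<le> 6 * \<sigma> * sqrt lg * L2_set (mv {r..<n} (res n r H x) a) {r..<n})"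

definition quad_ok :: "nat => nat => (nat => real) => (nat => nat => real) => real => real => nat => real => bool" where
  "quad_ok n r ls H \<sigma> lg l x \<longleftrightarrow> (let Sl = off n l; t = Tx n r ls H l x; A = mprod Sl t t; h = (\<lambda>i. H i l) in
     \<bar>dot Sl h (mv Sl A h) - \<sigma>\<^sup>2 * tr Sl A\<bar> \<le>
       \<sigma>\<^sup>2 * (4 * (sqrt (frob2 Sl A) * sqrt (16 * lg) + sqrt (sqrt (frob2 Sl (mprod Sl A A))) * (16 * lg))))"

definition lin_ok :: "nat => nat => (nat => real) => (nat => nat => real) => real => real => nat => (nat => real) => real => bool" where
  "lin_ok n r ls H \<sigma> lg l a x \<longleftrightarrow> (let Sl = off n l; w = mv Sl (Tx n r ls H l x) (botp r a) in
     \<bar>dot Sl w (\<lambda>i. H i l)\<bar> \<le> 6 * \<sigma> * sqrt lg * L2_set w Sl)"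

text \<open>The point \<open>x\<close> stands in for \<open>lam l\<close>: unlike \<open>lam l\<close> it may be treated as fixed when the three events are estimated.\<close>

locale debias = labelled +
  fixes lg x :: real and a :: "nat => real"
  assumes lg1: "1 \<le> lg" and lgn: "lg\<^sup>2 \<le> real n"
    and \<sigma>\<epsilon>: "\<sigma> \<le> \<epsilon>" and \<epsilon>up: "\<epsilon> \<le> 80 * (\<sigma> * sqrt (real r * lg))" and \<rho>up: "\<rho> \<le> 51 * (\<sigma> * sqrt (real n))"
    and \<Delta>low: "\<sigma> * sqrt (real r * lg) \<le> \<Delta>"
    and xl: "\<bar>x - lam l\<bar> \<le> \<sigma> / real n" and a1: "dot S a a = 1"
    and e4: "rows_ok n r H \<sigma> lg a x" and e5: "quad_ok n r ls H \<sigma> lg l x" and e6: "lin_ok n r ls H \<sigma> lg l a x"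

text \<open>\<open>W\<close> and \<open>\<nu>\<close> diagonalise the matrix without coordinate \<open>l\<close>.\<close>

locale loo = debias +
  fixes W :: "nat => nat => real" and \<nu> :: "nat => real"
  assumes Neig: "eigsys (off n l) M W \<nu>"
begin

abbreviation "Sl \<equiv> off n l"
abbreviation "T' \<equiv> {..<r} - {l}"
abbreviation "\<Lambda> \<equiv> \<bar>ls l\<bar>"
abbreviation "\<mu>l \<equiv> lam l"
abbreviation "TX \<equiv> Tx n r ls H l"
abbreviation "h \<equiv> (\<lambda>i. H i l)"
abbreviation "u \<equiv> V l"
abbreviation "\<alpha> \<equiv> V l l"
abbreviation "aB \<equiv> botp r a"

lemma fSl: "finite Sl" by (simp add: off_def)

lemma Sl_eq: "Sl = T' \<union> B" using l rn by (auto simp: off_def)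

lemma S_eq: "S = insert l Sl" "l \<notin> Sl" using l rn by (auto simp: off_def)

lemma ln: "l < n" using l rn by simp

lemma T'T: "T' \<subseteq> T" by auto

lemma \<Lambda>: "lm \<le> \<Lambda>" "0 < \<Lambda>" using lsm[OF l] lm0 by linarith+

lemma \<sigma>small: "\<sigma> \<le> \<Delta> / 100" "\<sigma> \<le> \<Lambda> / 100" "\<sigma> / real n \<le> \<sigma>" "0 \<le> \<sigma> / real n"
proof -
  show "\<sigma> \<le> \<Delta> / 100" using \<sigma>\<epsilon> \<epsilon>\<Delta> by linarith
  show "\<sigma> \<le> \<Lambda> / 100" using \<sigma>\<epsilon> \<epsilon>\<rho> \<rho>lm \<Lambda>(1) by linarith
  show "\<sigma> / real n \<le> \<sigma>" using \<sigma>0 n0 by (simp add: divide_le_eq)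
  show "0 \<le> \<sigma> / real n" using \<sigma>0 by simp
qed

text \<open>A lower bound for the distance of \<open>lam l\<close> and of \<open>x\<close> to \<open>\<nu> j\<close>: at most \<open>r\<close> of the \<open>\<nu> j\<close> are large, and those are separated by the eigengap.\<close>

definition mj :: "nat => real" where "mj j = (if lm / 2 \<le> \<bar>\<nu> j\<bar> then 4/5 * \<Delta> else \<Lambda> / 5)"

lemma mj0: "0 < mj j" using \<Delta>0 \<Lambda>(2) by (simp add: mj_def)

lemma Neig': "eigsys (T' \<union> B) M W \<nu>" using Neig Sl_eq by simp

text \<open>A large \<open>\<nu> j\<close> satisfies the reduced equation without label \<open>l\<close>, so it lies near some \<open>ls k\<close> with \<open>k \<noteq> l\<close>, and the gap applies.\<close>

lemma sep_l: assumes j: "j \<in> Sl"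
  shows "mj j \<le> \<bar>\<mu>l - \<nu> j\<bar>" "mj j \<le> \<bar>x - \<nu> j\<bar>"
proof -
  have dx: "\<bar>x - \<mu>l\<bar> \<le> \<Delta> / 100" "\<bar>x - \<mu>l\<bar> \<le> \<Lambda> / 100" using xl \<sigma>small by linarith+
  have "mj j \<le> \<bar>\<mu>l - \<nu> j\<bar> \<and> mj j \<le> \<bar>x - \<nu> j\<bar>"
  proof (cases "lm / 2 \<le> \<bar>\<nu> j\<bar>")
    case True
    have "dot Sl (W j) (W j) = 1" by (rule orthon_self[OF eigsysD(1)[OF Neig] j])
    then have "\<not> (\<forall>i\<in>Sl. W j i = 0)" using dot_self_eq_0[OF fSl, of "W j"] by auto
    then obtain i0 where i0: "i0 \<in> Sl" "W j i0 \<noteq> 0" by blast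
    have j': "j \<in> T' \<union> B" "i0 \<in> T' \<union> B" using j i0 Sl_eq by simp_all
    obtain k where k: "k \<in> T'" "\<bar>\<nu> j - \<gamma> (\<nu> j) - ls k\<bar> \<le> \<epsilon>"
      using eig_loc[OF T'T True eigsysD(2)[OF Neig' j'(1)] j'(2) i0(2)] by blast
    have "9/10 * \<Delta> \<le> \<bar>\<mu>l - \<nu> j\<bar>" by (rule g_far[OF True]) (use k in \<open>auto simp: g_def\<close>)
    then show ?thesis using True dx(1) \<Delta>0 unfolding mj_def by (simp add: abs_if split: if_splits)
  next
    case False
    have "9/10 * \<Lambda> - lm / 2 \<le> \<bar>\<mu>l - \<nu> j\<bar>" using lam_l(1) False by linarith
    then have "2/5 * \<Lambda> \<le> \<bar>\<mu>l - \<nu> j\<bar>" using \<Lambda>(1) by simp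
    then show ?thesis using False dx(2) \<Lambda>(2) unfolding mj_def by (simp add: abs_if split: if_splits)
  qed
  then show "mj j \<le> \<bar>\<mu>l - \<nu> j\<bar>" "mj j \<le> \<bar>x - \<nu> j\<bar>" by auto
qed

lemma big_card: "card {j \<in> Sl. lm / 2 \<le> \<bar>\<nu> j\<bar>} \<le> r"
proof -
  have "card {j \<in> Sl. lm / 2 \<le> \<bar>\<nu> j\<bar>} \<le> card {k \<in> T' \<union> B. \<rho> < \<bar>\<nu> k\<bar>}"
    by (rule card_mono) (use \<rho>lm \<rho>0 lm0 Sl_eq in auto)
  also have "... \<le> card T'" by (rule large_count[OF T'T Neig'])
  also have "... \<le> card T" by (rule card_mono) auto
  finally show ?thesis by simp
qed

lemma sum_mj: "(\<Sum>j\<in>Sl. 1 / mj j ^ p) \<le> real r * (1 / (4/5 * \<Delta>) ^ p) + real n * (1 / (\<Lambda> / 5) ^ p)"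
proof -
  let ?Bg = "{j \<in> Sl. lm / 2 \<le> \<bar>\<nu> j\<bar>}"
  have "(\<Sum>j\<in>Sl. 1 / mj j ^ p) = (\<Sum>j\<in>?Bg. 1 / mj j ^ p) + (\<Sum>j\<in>Sl - ?Bg. 1 / mj j ^ p)"
    using fSl by (subst sum.subset_diff[of ?Bg]) auto
  also have "(\<Sum>j\<in>?Bg. 1 / mj j ^ p) = real (card ?Bg) * (1 / (4/5 * \<Delta>) ^ p)"
    by (simp add: mj_def)
  also have "... \<le> real r * (1 / (4/5 * \<Delta>) ^ p)" using big_card \<Delta>0 by (intro mult_right_mono) auto
  also have "(\<Sum>j\<in>Sl - ?Bg. 1 / mj j ^ p) = (\<Sum>j\<in>Sl - ?Bg. 1 / (\<Lambda> / 5) ^ p)"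
    by (rule sum.cong) (auto simp: mj_def)
  also have "... \<le> (\<Sum>j\<in>S. 1 / (\<Lambda> / 5) ^ p)" by (rule sum_mono2) (use \<Lambda>(2) in \<open>auto simp: off_def\<close>)
  also have "... = real n * (1 / (\<Lambda> / 5) ^ p)" by simp
  finally show ?thesis by simp
qed

lemma one_mj: "1 / mj j ^ p \<le> 1 / (4/5 * \<Delta>) ^ p + 1 / (\<Lambda> / 5) ^ p"
  using \<Delta>0 \<Lambda>(2) by (simp add: mj_def)

lemma inv_le: "j \<in> Sl ==> \<bar>inverse (\<mu>l - \<nu> j)\<bar> \<le> 1 / mj j" "j \<in> Sl ==> \<bar>inverse (x - \<nu> j)\<bar> \<le> 1 / mj j"
proof -
  show "j \<in> Sl ==> \<bar>inverse (\<mu>l - \<nu> j)\<bar> \<le> 1 / mj j"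
    using le_imp_inverse_le[OF sep_l(1) mj0] by (simp add: divide_inverse)
  show "j \<in> Sl ==> \<bar>inverse (x - \<nu> j)\<bar> \<le> 1 / mj j"
    using le_imp_inverse_le[OF sep_l(2) mj0] by (simp add: divide_inverse)
qed

lemma nz: "j \<in> Sl ==> \<mu>l - \<nu> j \<noteq> 0" "j \<in> Sl ==> x - \<nu> j \<noteq> 0"
  using sep_l[of j] mj0[of j] by auto

lemma shift_eig: "eigsys Sl (shiftm y M) W (\<lambda>j. y - \<nu> j)"
  unfolding shiftm_def[abs_def] by (rule eigsys_shift[OF fSl Neig])

lemma TX_eig: "eigsys Sl (TX y) W (\<lambda>j. inverse (y - \<nu> j))"
  unfolding Tx_def by (rule eigsys_pinv[OF fSl shift_eig])

lemma u1: "dot S u u = 1" using orthon_self[OF eigsysD(1)[OF eig]] ln by auto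

lemma Mu: "i \<in> S ==> mv S M u i = \<mu>l * u i"
  using eigsysD(2)[OF eig, of l i] ln by auto

lemma mvS: "mv S A v i = A i l * v l + mv Sl A v i"
  unfolding mv_def S_eq(1) using fSl S_eq(2) by simp

lemma dotS: "dot S v w = v l * w l + dot Sl v w"
  unfolding dot_def S_eq(1) using fSl S_eq(2) by simp

lemma M_off: "i \<in> Sl ==> M i l = H i l" by (auto simp: spk_def off_def)

lemma u_eq: assumes i: "i \<in> Sl" shows "y * u i - mv Sl M u i = \<alpha> * h i + (y - \<mu>l) * u i"
  using Mu[of i] i mvS[of M u i] M_off[OF i] by (simp add: off_def algebra_simps)

text \<open>Rows other than \<open>l\<close> of the eigenvector equation, solved for the other coordinates.\<close>

lemma u_loo: assumes i: "i \<in> Sl" shows "u i = \<alpha> * mv Sl (TX \<mu>l) h i"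
proof -
  have "u i = mv Sl (TX \<mu>l) (\<lambda>i. \<alpha> * h i) i" unfolding Tx_def
    by (rule pinv_unique[OF fSl shift_eig nz(1) _ i]) (use u_eq[of _ \<mu>l] in \<open>simp_all add: mv_shiftm[OF fSl]\<close>)
  then show ?thesis by (simp add: mv_scale)
qed

lemma u_loo_x: assumes i: "i \<in> Sl" shows "u i = \<alpha> * mv Sl (TX x) h i + (x - \<mu>l) * mv Sl (TX x) u i"
proof -
  have "u i = mv Sl (TX x) (\<lambda>i. \<alpha> * h i + (x - \<mu>l) * u i) i" unfolding Tx_def
    by (rule pinv_unique[OF fSl shift_eig nz(2) _ i]) (use u_eq[of _ x] in \<open>simp_all add: mv_shiftm[OF fSl]\<close>)
  then show ?thesis by (simp add: mv_add mv_scale)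
qed

text \<open>\<open>1 + \<tau> = 1 / \<alpha>\<^sup>2\<close> by normalisation; estimating \<open>\<tau>\<close> by \<open>bl\<close> is the purpose of the rest of this part.\<close>

definition \<tau> where "\<tau> = dot Sl (mv Sl (TX \<mu>l) h) (mv Sl (TX \<mu>l) h)"

lemma \<alpha>\<tau>: "\<alpha>\<^sup>2 * (1 + \<tau>) = 1"
proof -
  have "dot Sl u u = dot Sl (\<lambda>i. \<alpha> * mv Sl (TX \<mu>l) h i) (\<lambda>i. \<alpha> * mv Sl (TX \<mu>l) h i)"
    by (rule dot_cong) (use u_loo in auto)
  then have "dot Sl u u = \<alpha>\<^sup>2 * \<tau>" by (simp add: dot_scale_left dot_scale_right \<tau>_def power2_eq_square)
  then show ?thesis using u1 dotS[of u u] by (simp add: power2_eq_square algebra_simps)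
qed

lemma \<tau>0: "0 \<le> \<tau>" by (simp add: \<tau>_def dot_self_nonneg)

lemma \<alpha>0: "\<alpha> \<noteq> 0" using \<alpha>\<tau> by auto

lemma \<alpha>1: "\<bar>\<alpha>\<bar> \<le> 1"
proof -
  have "\<alpha>\<^sup>2 \<le> \<alpha>\<^sup>2 * (1 + \<tau>)" using \<tau>0 by (simp add: mult_le_cancel_left1)
  then have "\<alpha>\<^sup>2 \<le> 1" using \<alpha>\<tau> by simp
  then show ?thesis by (simp only: abs_square_le_1)
qed

definition hj where "hj j = (dot Sl h (W j))\<^sup>2"

lemma \<tau>_eig: "\<tau> = (\<Sum>j\<in>Sl. (inverse (\<mu>l - \<nu> j))\<^sup>2 * hj j)"
  unfolding \<tau>_def hj_def by (rule eig_norm[OF fSl TX_eig])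

lemma h_norm: "dot Sl h h \<le> \<rho>\<^sup>2"
proof -
  have "mv {l} H (\<lambda>_. 1) = h" by (auto simp: mv_def)
  moreover have "L2_set (mv {l} H (\<lambda>_. 1)) Sl \<le> \<rho> * L2_set (\<lambda>_. 1) {l}" by (rule H_block) (use ln in \<open>auto simp: off_def\<close>)
  ultimately have "L2_set h Sl \<le> \<rho>" by (simp add: L2_set_def)
  then have "(L2_set h Sl)\<^sup>2 \<le> \<rho>\<^sup>2" by (intro power_mono) auto
  then show ?thesis by (simp add: L2_set_sq)
qed

lemma hj_sum: "(\<Sum>j\<in>Sl. hj j) \<le> \<rho>\<^sup>2"
  unfolding hj_def eig_norm1[OF fSl Neig, symmetric] by (rule h_norm)

text \<open>\<open>t1 * \<bar>a l\<bar>\<close> and \<open>t3\<close> are the first and the last term of the error bound.\<close>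

definition t1 where "t1 = \<sigma>\<^sup>2 * real r * lg / \<Delta>\<^sup>2"
definition t3 where "t3 = \<sigma> * sqrt lg / \<Lambda>"

lemma r1: "1 \<le> real r" using l by simp

lemma t1_ge: "\<sigma>\<^sup>2 / \<Delta>\<^sup>2 \<le> t1"
proof -
  have "1 \<le> real r * lg" using mult_mono[of 1 "real r" 1 lg] r1 lg1 by simp
  then have "\<sigma>\<^sup>2 * 1 \<le> \<sigma>\<^sup>2 * (real r * lg)" by (intro mult_left_mono) auto
  then show ?thesis unfolding t1_def by (intro divide_right_mono) (auto simp: mult.assoc)
qed

lemma t1_r: "\<sigma>\<^sup>2 * real r / \<Delta>\<^sup>2 \<le> t1"
proof -
  have "\<sigma>\<^sup>2 * real r * 1 \<le> \<sigma>\<^sup>2 * real r * lg" by (intro mult_left_mono lg1) auto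
  then show ?thesis unfolding t1_def by (intro divide_right_mono) auto
qed

lemma t3_ge: "\<sigma> / \<Lambda> \<le> t3"
proof -
  have "\<sigma> * 1 \<le> \<sigma> * sqrt lg" using lg1 \<sigma>0 by (intro mult_left_mono) auto
  then show ?thesis unfolding t3_def using \<Lambda>(2) by (intro divide_right_mono) auto
qed

lemma t0: "0 \<le> t1" "0 \<le> t3" using \<sigma>0 lg1 by (auto simp: t1_def t3_def)

lemma \<sigma>\<Lambda>1: "\<sigma> / \<Lambda> \<le> 1/100" "\<sigma> / \<Delta> \<le> 1/100" "0 \<le> \<sigma> / \<Lambda>" "0 \<le> \<sigma> / \<Delta>"
  using \<sigma>small \<Lambda>(2) \<Delta>0 \<sigma>0 by (simp_all add: divide_le_eq)

definition cub where "cub = 1 / (4/5 * \<Delta>) ^ 3 + 1 / (\<Lambda> / 5) ^ 3"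

lemma cub0: "0 \<le> cub" using \<Delta>0 \<Lambda>(2) by (simp add: cub_def)

lemma cub_bound: "\<sigma> ^ 3 * cub \<le> t1 / 50 + t3 / 80"
proof -
  have e: "\<sigma> ^ 3 * cub = 125 / 64 * (\<sigma> / \<Delta> * (\<sigma>\<^sup>2 / \<Delta>\<^sup>2)) + 125 * ((\<sigma> / \<Lambda>) * ((\<sigma> / \<Lambda>) * (\<sigma> / \<Lambda>)))"
    using \<Delta>0 \<Lambda>(2) by (simp add: cub_def field_simps power3_eq_cube power2_eq_square)
  have 1: "\<sigma> / \<Delta> * (\<sigma>\<^sup>2 / \<Delta>\<^sup>2) \<le> 1/100 * t1" by (intro mult_mono \<sigma>\<Lambda>1 t1_ge t0) auto
  have "(\<sigma> / \<Lambda>) * (\<sigma> / \<Lambda>) \<le> 1/100 * (1/100)" by (intro mult_mono \<sigma>\<Lambda>1) (auto simp: \<sigma>\<Lambda>1)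
  then have 2: "(\<sigma> / \<Lambda>) * ((\<sigma> / \<Lambda>) * (\<sigma> / \<Lambda>)) \<le> t3 * (1/100 * (1/100))"
    by (intro mult_mono t3_ge t0) (use \<sigma>\<Lambda>1 in auto)
  show ?thesis unfolding e using 1 2 t0 by linarith
qed

lemma inv_diff: "j \<in> Sl ==> \<bar>(inverse (\<mu>l - \<nu> j))\<^sup>2 - (inverse (x - \<nu> j))\<^sup>2\<bar> \<le> 2 * (\<sigma> / real n) * cub"
proof -
  assume j: "j \<in> Sl"
  have "\<bar>(inverse (\<mu>l - \<nu> j))\<^sup>2 - (inverse (x - \<nu> j))\<^sup>2\<bar> \<le> 2 * (\<sigma> / real n) * (1 / mj j ^ 3)"
    by (rule inv_sq_diff[OF mj0 sep_l[OF j]]) (use xl in \<open>simp add: abs_minus_commute\<close>)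
  also have "... \<le> 2 * (\<sigma> / real n) * cub" unfolding cub_def using \<sigma>small by (intro mult_left_mono one_mj) auto
  finally show ?thesis .
qed

text \<open>\<open>\<tau>\<close> and the trace of the squared resolvent, at \<open>x\<close> and at \<open>lam l\<close>, in the eigenbasis without coordinate \<open>l\<close>.\<close>

definition \<tau>x where "\<tau>x = (\<Sum>j\<in>Sl. (inverse (x - \<nu> j))\<^sup>2 * hj j)"
definition trx where "trx = (\<Sum>j\<in>Sl. (inverse (x - \<nu> j))\<^sup>2)"
definition trl where "trl = (\<Sum>j\<in>Sl. (inverse (\<mu>l - \<nu> j))\<^sup>2)"

lemma \<tau>_at_x: "\<bar>\<tau> - \<tau>x\<bar> \<le> 5202 * (t1 / 50 + t3 / 80)"
proof -
  have "\<tau> - \<tau>x = (\<Sum>j\<in>Sl. ((inverse (\<mu>l - \<nu> j))\<^sup>2 - (inverse (x - \<nu> j))\<^sup>2) * hj j)"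
    by (simp add: \<tau>_eig \<tau>x_def left_diff_distrib sum_subtractf)
  then have "\<bar>\<tau> - \<tau>x\<bar> \<le> (\<Sum>j\<in>Sl. \<bar>(inverse (\<mu>l - \<nu> j))\<^sup>2 - (inverse (x - \<nu> j))\<^sup>2\<bar> * hj j)"
    by (simp only:) (rule order_trans[OF sum_abs], simp add: abs_mult hj_def)
  also have "... \<le> (\<Sum>j\<in>Sl. (2 * (\<sigma> / real n) * cub) * hj j)"
    by (intro sum_mono mult_right_mono inv_diff) (auto simp: hj_def)
  also have "... = (2 * (\<sigma> / real n) * cub) * (\<Sum>j\<in>Sl. hj j)" by (simp add: sum_distrib_left)
  also have "... \<le> (2 * (\<sigma> / real n) * cub) * \<rho>\<^sup>2" using cub0 \<sigma>small by (intro mult_left_mono hj_sum) auto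
  also have "... \<le> (2 * (\<sigma> / real n) * cub) * (2601 * (\<sigma>\<^sup>2 * real n))"
  proof (rule mult_left_mono)
    have "\<rho>\<^sup>2 \<le> (51 * (\<sigma> * sqrt (real n)))\<^sup>2" using \<rho>up \<rho>0 by (intro power_mono) auto
    then show "\<rho>\<^sup>2 \<le> 2601 * (\<sigma>\<^sup>2 * real n)" by (simp add: power_mult_distrib)
  qed (use cub0 \<sigma>small in auto)
  also have "... = 5202 * (\<sigma> ^ 3 * cub)" using n0 by (simp add: field_simps power3_eq_cube power2_eq_square)
  also have "... \<le> 5202 * (t1 / 50 + t3 / 80)" using cub_bound by simp
  finally show ?thesis .
qed

lemma card_Sl: "real (card Sl) \<le> real n" using card_mono[of S Sl] by (simp add: off_def)

lemma trace_at_x: "\<bar>\<sigma>\<^sup>2 * trl - \<sigma>\<^sup>2 * trx\<bar> \<le> 2 * (t1 / 50 + t3 / 80)"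
proof -
  have "\<bar>trl - trx\<bar> \<le> (\<Sum>j\<in>Sl. \<bar>(inverse (\<mu>l - \<nu> j))\<^sup>2 - (inverse (x - \<nu> j))\<^sup>2\<bar>)"
    unfolding trl_def trx_def sum_subtractf[symmetric] by (rule sum_abs)
  also have "... \<le> (\<Sum>j\<in>Sl. 2 * (\<sigma> / real n) * cub)" by (rule sum_mono) (rule inv_diff)
  also have "... = real (card Sl) * (2 * (\<sigma> / real n) * cub)" by simp
  also have "... \<le> real n * (2 * (\<sigma> / real n) * cub)"
    using card_Sl cub0 \<sigma>small by (intro mult_right_mono) auto
  also have "... = 2 * \<sigma> * cub" using n0 by simp
  finally have d: "\<bar>trl - trx\<bar> \<le> 2 * \<sigma> * cub" .
  have "\<bar>\<sigma>\<^sup>2 * trl - \<sigma>\<^sup>2 * trx\<bar> = \<sigma>\<^sup>2 * \<bar>trl - trx\<bar>" by (simp add: abs_mult flip: right_diff_distrib)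
  also have "... \<le> \<sigma>\<^sup>2 * (2 * \<sigma> * cub)" by (intro mult_left_mono d) simp
  also have "... = 2 * (\<sigma> ^ 3 * cub)" by (simp add: power3_eq_cube power2_eq_square)
  also have "... \<le> 2 * (t1 / 50 + t3 / 80)" using cub_bound by simp
  finally show ?thesis .
qed

end

context loo
begin

section \<open>The de-biasing factor\<close>

text \<open>Squared resolvent bounds at the scale of the gap and at the scale of \<open>ls l\<close>.\<close>

definition PP where "PP = 25/16 / \<Delta>\<^sup>2"
definition QQ where "QQ = 25 / \<Lambda>\<^sup>2"

lemma PQ0: "0 \<le> PP" "0 \<le> QQ" by (simp_all add: PP_def QQ_def)

lemma PQ_pow: "1 / (4/5 * \<Delta>) ^ 2 = PP" "1 / (\<Lambda> / 5) ^ 2 = QQ" "1 / (4/5 * \<Delta>) ^ 4 = PP\<^sup>2" "1 / (\<Lambda> / 5) ^ 4 = QQ\<^sup>2"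
  "1 / (4/5 * \<Delta>) ^ 8 = (PP\<^sup>2)\<^sup>2" "1 / (\<Lambda> / 5) ^ 8 = (QQ\<^sup>2)\<^sup>2"
  by (simp_all add: PP_def QQ_def power_mult_distrib power_divide flip: power_mult)

lemma \<sigma>P: "\<sigma>\<^sup>2 * PP \<le> 25/16 * t1"
  using t1_ge by (simp add: PP_def)

lemma \<sigma>Q: "\<sigma>\<^sup>2 * QQ \<le> t3 / 4"
proof -
  have "\<sigma>\<^sup>2 * QQ = 25 * ((\<sigma> / \<Lambda>) * (\<sigma> / \<Lambda>))" by (simp add: QQ_def power2_eq_square)
  also have "(\<sigma> / \<Lambda>) * (\<sigma> / \<Lambda>) \<le> 1/100 * t3" by (intro mult_mono \<sigma>\<Lambda>1 t3_ge) auto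
  finally show ?thesis by simp
qed

text \<open>The fluctuation is \<open>\<sigma>\<^sup>2 (\<parallel>A\<parallel>_F \<surd>lg + (tr A\<^sup>4) powr (1/4) * lg)\<close> with \<open>A\<close> the squared resolvent. At most \<open>r\<close> directions are at distance \<open>\<Delta>\<close> and up to \<open>n\<close> at distance \<open>ls l\<close>, which gives \<open>t1\<close> and \<open>t3\<close>; \<open>lg\<^sup>2 \<le> n\<close> absorbs the logarithm in the second part.\<close>

lemma \<tau>x_concentrates: "\<bar>\<tau>x - \<sigma>\<^sup>2 * trx\<bar> \<le> 125 * t1 + 20 * t3"
proof -
  define A where "A = mprod Sl (TX x) (TX x)"
  define iv where "iv j = inverse (x - \<nu> j)" for j
  have eA: "eigsys Sl A W (\<lambda>j. iv j * iv j)" unfolding A_def iv_def by (rule eigsys_mprod[OF fSl TX_eig TX_eig])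
  have eAA: "eigsys Sl (mprod Sl A A) W (\<lambda>j. (iv j * iv j) * (iv j * iv j))" by (rule eigsys_mprod[OF fSl eA eA])
  have 1: "dot Sl h (mv Sl A h) = \<tau>x" unfolding eig_form[OF fSl eA] \<tau>x_def hj_def iv_def
    by (simp add: power2_eq_square)
  have 2: "tr Sl A = trx" unfolding tr_def eig_trace[OF fSl eA] trx_def iv_def by (simp add: power2_eq_square)
  have ivle: "\<bar>iv j\<bar> \<le> 1 / mj j" if "j \<in> Sl" for j unfolding iv_def by (rule inv_le(2)[OF that])
  have ivp: "\<bar>iv j\<bar> ^ p \<le> 1 / mj j ^ p" if "j \<in> Sl" for j p
    using power_mono[OF ivle[OF that], of p] by (simp add: power_divide)
  have "frob2 Sl A = (\<Sum>j\<in>Sl. \<bar>iv j\<bar> ^ 4)" unfolding frob2_def eig_frob[OF fSl eA]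
    by (simp add: power_mult_distrib power_numeral_even mult_ac)
  also have "... \<le> (\<Sum>j\<in>Sl. 1 / mj j ^ 4)" by (rule sum_mono) (rule ivp)
  also have "... \<le> real r * PP\<^sup>2 + real n * QQ\<^sup>2" using sum_mj[of 4] unfolding PQ_pow .
  finally have "sqrt (frob2 Sl A) \<le> sqrt (real r * PP\<^sup>2 + real n * QQ\<^sup>2)" by simp
  also have "... \<le> sqrt (real r * PP\<^sup>2) + sqrt (real n * QQ\<^sup>2)" by (rule sqrt_add_le_add_sqrt) auto
  finally have F: "sqrt (frob2 Sl A) \<le> sqrt r * PP + sqrt n * QQ" using PQ0 by (simp add: real_sqrt_mult)
  have "frob2 Sl (mprod Sl A A) = (\<Sum>j\<in>Sl. \<bar>iv j\<bar> ^ 8)" unfolding frob2_def eig_frob[OF fSl eAA]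
    by (simp add: power_mult_distrib power_numeral_even mult_ac)
  also have "... \<le> (\<Sum>j\<in>Sl. 1 / mj j ^ 8)" by (rule sum_mono) (rule ivp)
  also have "... \<le> real r * (PP\<^sup>2)\<^sup>2 + real n * (QQ\<^sup>2)\<^sup>2" using sum_mj[of 8] unfolding PQ_pow .
  finally have "sqrt (frob2 Sl (mprod Sl A A)) \<le> sqrt (real r * (PP\<^sup>2)\<^sup>2 + real n * (QQ\<^sup>2)\<^sup>2)" by simp
  also have "... \<le> sqrt (real r * (PP\<^sup>2)\<^sup>2) + sqrt (real n * (QQ\<^sup>2)\<^sup>2)" by (rule sqrt_add_le_add_sqrt) auto
  finally have "sqrt (frob2 Sl (mprod Sl A A)) \<le> sqrt r * PP\<^sup>2 + sqrt n * QQ\<^sup>2"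
    by (simp only: real_sqrt_mult real_sqrt_abs abs_power2)
  then have "sqrt (sqrt (frob2 Sl (mprod Sl A A))) \<le> sqrt (sqrt r * PP\<^sup>2 + sqrt n * QQ\<^sup>2)" by simp
  also have "... \<le> sqrt (sqrt r * PP\<^sup>2) + sqrt (sqrt n * QQ\<^sup>2)" by (rule sqrt_add_le_add_sqrt) auto
  finally have D: "sqrt (sqrt (frob2 Sl (mprod Sl A A))) \<le> sqrt (sqrt r) * PP + sqrt (sqrt n) * QQ"
    using PQ0 by (simp add: real_sqrt_mult)
  have lg0: "0 \<le> lg" using lg1 by simp
  have sq16: "sqrt (16 * lg) = 4 * sqrt lg" by (simp add: real_sqrt_mult)
  have rl: "1 \<le> real r * lg" using mult_mono[of 1 "real r" 1 lg] r1 lg1 by simp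
  have a1: "sqrt r * sqrt lg \<le> real r * lg"
  proof -
    have "sqrt (real r * lg) \<le> sqrt ((real r * lg)\<^sup>2)" using rl by (intro real_sqrt_le_mono self_le_power) auto
    then show ?thesis using rl by (simp add: real_sqrt_mult)
  qed
  have a2: "sqrt (sqrt r) * lg \<le> real r * lg"
  proof (rule mult_right_mono)
    have "sqrt r \<le> r" using r1 by (intro real_le_lsqrt) (auto simp: self_le_power)
    moreover have "sqrt (sqrt r) \<le> sqrt r" using r1 by (intro real_sqrt_le_mono real_le_lsqrt) (auto simp: self_le_power)
    ultimately show "sqrt (sqrt r) \<le> r" by linarith
  qed (rule lg0)
  have a3: "sqrt (sqrt n) * lg \<le> sqrt n * sqrt lg"
  proof -
    have "lg \<le> sqrt n" using lgn by (intro real_le_rsqrt)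
    then have "sqrt lg \<le> sqrt (sqrt n)" by simp
    then have "sqrt (sqrt n) * (sqrt lg * sqrt lg) \<le> sqrt (sqrt n) * (sqrt (sqrt n) * sqrt lg)"
      using lg0 by (intro mult_left_mono mult_right_mono) auto
    then show ?thesis using lg0 by (simp flip: mult.assoc)
  qed
  have "\<bar>\<tau>x - \<sigma>\<^sup>2 * trx\<bar> \<le> \<sigma>\<^sup>2 * (4 * (sqrt (frob2 Sl A) * sqrt (16 * lg) + sqrt (sqrt (frob2 Sl (mprod Sl A A))) * (16 * lg)))"
    using e5 unfolding quad_ok_def Let_def A_def[symmetric] 1 2 .
  also have "... \<le> \<sigma>\<^sup>2 * (4 * ((sqrt r * PP + sqrt n * QQ) * (4 * sqrt lg) + (sqrt (sqrt r) * PP + sqrt (sqrt n) * QQ) * (16 * lg)))"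
    unfolding sq16 using lg0 by (intro mult_left_mono add_mono mult_right_mono F D) auto
  also have "... = \<sigma>\<^sup>2 * (16 * (PP * (sqrt r * sqrt lg)) + 64 * (PP * (sqrt (sqrt r) * lg)) + 16 * (QQ * (sqrt n * sqrt lg)) + 64 * (QQ * (sqrt (sqrt n) * lg)))"
    by (simp add: algebra_simps)
  also have "... \<le> \<sigma>\<^sup>2 * (16 * (PP * (real r * lg)) + 64 * (PP * (real r * lg)) + 16 * (QQ * (sqrt n * sqrt lg)) + 64 * (QQ * (sqrt n * sqrt lg)))"
    by (intro mult_left_mono add_mono a1 a2 a3 PQ0) auto
  also have "... = 80 * (\<sigma>\<^sup>2 * (PP * (real r * lg))) + 80 * (\<sigma>\<^sup>2 * (QQ * (sqrt n * sqrt lg)))" by (simp add: algebra_simps)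
  also have "\<sigma>\<^sup>2 * (PP * (real r * lg)) = 25/16 * t1" by (simp add: PP_def t1_def)
  also have "\<sigma>\<^sup>2 * (QQ * (sqrt n * sqrt lg)) = 25 * ((\<sigma> * sqrt n / \<Lambda>) * t3)" by (simp add: QQ_def t3_def power2_eq_square)
  also have "80 * (25/16 * t1) + 80 * (25 * ((\<sigma> * sqrt n / \<Lambda>) * t3)) \<le> 125 * t1 + 20 * t3"
  proof -
    have "\<sigma> * sqrt n \<le> \<Lambda> / 100" using \<sigma>\<rho> \<rho>lm \<Lambda>(1) by linarith
    then have "\<sigma> * sqrt n / \<Lambda> \<le> 1/100" using \<Lambda>(2) by (simp add: divide_le_eq)
    then have "(\<sigma> * sqrt n / \<Lambda>) * t3 \<le> 1/100 * t3" by (intro mult_right_mono t0)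
    then show ?thesis by simp
  qed
  finally show ?thesis .
qed

definition trG where "trG = (\<Sum>i\<in>Sl. (1 / (\<mu>l - lam i))\<^sup>2)"

definition ext :: "(nat => real) => nat => real" where
  "ext v i = (if i \<in> Sl then mv Sl (TX \<mu>l) v i else 0)"

lemma ext_dot: "dot S (ext v) w = dot Sl (mv Sl (TX \<mu>l) v) w"
proof -
  have "dot S (ext v) w = dot Sl (ext v) w" using dotS[of "ext v" w] S_eq(2) by (simp add: ext_def)
  also have "... = dot Sl (mv Sl (TX \<mu>l) v) w" by (rule dot_cong) (auto simp: ext_def)
  finally show ?thesis .
qed

lemma TX_sym: "dot Sl v (mv Sl (TX y) w) = dot Sl (mv Sl (TX y) v) w"
  by (rule mv_sym[OF fSl eigsys_sym[OF fSl TX_eig]])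

lemma V_orth: "i \<in> S ==> k \<in> S ==> dot S (V i) (V k) = (if i = k then 1 else 0)"
  using eigsysD(1)[OF eig] by (simp add: orthon_def)

text \<open>The resolvent without coordinate \<open>l\<close>, extended by 0, acts on the eigenvectors of the full matrix orthogonal to \<open>u\<close> like the reduced resolvent, up to a multiple of \<open>u\<close>.\<close>

lemma reduced_resolvent:
  assumes i: "i \<in> Sl" and k: "k \<in> Sl"
  shows "dot S (ext (V k)) (V i) = (if i = k then 1 / (\<mu>l - lam i) else 0)"
proof -
  let ?w = "ext (V k)"
  have iS: "i \<in> S" "k \<in> S" "i \<noteq> l" "k \<noteq> l" "l \<in> S" using i k ln by (auto simp: off_def)
  have hw: "dot Sl h ?w = - V k l"
  proof -
    have "\<alpha> * dot Sl h ?w = \<alpha> * dot Sl h (mv Sl (TX \<mu>l) (V k))"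
      using dot_cong[of Sl h h ?w "mv Sl (TX \<mu>l) (V k)"] by (simp add: ext_def)
    also have "... = dot Sl (\<lambda>p. \<alpha> * mv Sl (TX \<mu>l) h p) (V k)" unfolding TX_sym by (simp add: dot_scale_left)
    also have "... = dot Sl u (V k)" by (rule dot_cong) (use u_loo in auto)
    also have "... = - (\<alpha> * V k l)" using dotS[of u "V k"] V_orth[OF iS(5,2)] iS(4) by simp
    also have "... = \<alpha> * (- V k l)" by simp
    finally have "\<alpha> * dot Sl h ?w = \<alpha> * (- V k l)" .
    from mult_left_cancel[OF \<alpha>0, THEN iffD1, OF this] show ?thesis .
  qed
  have Mw: "\<mu>l * ?w p - mv S M ?w p = V k p" if p: "p \<in> Sl" for p
  proof -
    have "mv S M ?w p = mv Sl M ?w p" using mvS[of M ?w p] S_eq(2) by (simp add: ext_def)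
    also have "... = mv Sl M (mv Sl (TX \<mu>l) (V k)) p" by (rule mv_cong) (auto simp: ext_def)
    finally have "\<mu>l * ?w p - mv S M ?w p = mv Sl (shiftm \<mu>l M) (mv Sl (TX \<mu>l) (V k)) p"
      using p by (simp add: mv_shiftm[OF fSl p] ext_def)
    also have "... = V k p" unfolding Tx_def by (rule pinv_solve[OF fSl shift_eig nz(1) p])
    finally show ?thesis .
  qed
  have Ml: "\<mu>l * ?w l - mv S M ?w l = V k l"
  proof -
    have "mv S M ?w l = mv Sl M ?w l" using mvS[of M ?w l] S_eq(2) by (simp add: ext_def)
    also have "... = dot Sl h ?w" unfolding mv_def dot_def
      by (rule sum.cong) (use H_symD ln in \<open>auto simp: spk_def off_def\<close>)
    finally show ?thesis using hw S_eq(2) by (simp add: ext_def)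
  qed
  have "(\<mu>l - lam i) * dot S ?w (V i) = \<mu>l * dot S ?w (V i) - dot S (mv S M ?w) (V i)"
    using eig_dot_mv[OF _ eig iS(1), of ?w] by (simp add: left_diff_distrib)
  also have "... = dot S (\<lambda>p. \<mu>l * ?w p - mv S M ?w p) (V i)" by (simp add: dot_diff_left dot_scale_left)
  also have "... = dot S (V k) (V i)" by (rule dot_cong) (use Mw Ml S_eq(1) in auto)
  also have "... = (if i = k then 1 else 0)" using V_orth[OF iS(2,1)] by auto
  finally have e: "(\<mu>l - lam i) * dot S ?w (V i) = (if i = k then 1 else 0)" .
  moreover have "\<mu>l - lam i \<noteq> 0" using lam_simple[of i] iS by auto
  ultimately show ?thesis by (auto simp: field_simps)
qed

lemma TXu_bound: "dot Sl (mv Sl (TX \<mu>l) u) (mv Sl (TX \<mu>l) u) \<le> PP + QQ"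
proof -
  have "dot Sl (mv Sl (TX \<mu>l) u) (mv Sl (TX \<mu>l) u) = (\<Sum>j\<in>Sl. (inverse (\<mu>l - \<nu> j))\<^sup>2 * (dot Sl u (W j))\<^sup>2)"
    by (rule eig_norm[OF fSl TX_eig])
  also have "... \<le> (\<Sum>j\<in>Sl. (PP + QQ) * (dot Sl u (W j))\<^sup>2)"
  proof (intro sum_mono mult_right_mono)
    fix j assume j: "j \<in> Sl"
    have "\<bar>inverse (\<mu>l - \<nu> j)\<bar>\<^sup>2 \<le> (1 / mj j)\<^sup>2" by (intro power_mono inv_le(1)[OF j]) simp
    also have "... \<le> PP + QQ" using one_mj[of j 2] unfolding PQ_pow by (simp add: power_divide)
    finally show "(inverse (\<mu>l - \<nu> j))\<^sup>2 \<le> PP + QQ" by (simp only: power2_abs)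
  qed simp
  also have "... = (PP + QQ) * dot Sl u u" unfolding eig_norm1[OF fSl Neig, of u] by (simp add: sum_distrib_left)
  also have "... \<le> (PP + QQ) * 1"
  proof (rule mult_left_mono)
    have "0 \<le> \<alpha> * \<alpha>" by simp
    then show "dot Sl u u \<le> 1" using u1 dotS[of u u] by linarith
  qed (use PQ0 in auto)
  finally show ?thesis by simp
qed

text \<open>Compute the squared Frobenius norm of the extended resolvent in the eigenbasis of \<open>M\<close>: by \<open>reduced_resolvent\<close> it is \<open>trG\<close> plus the contribution of row and column \<open>u\<close>, at most \<open>2 \<parallel>T u\<parallel>\<^sup>2\<close>.\<close>

lemma trace_vs_gaps: "\<bar>\<sigma>\<^sup>2 * trl - \<sigma>\<^sup>2 * trG\<bar> \<le> 4 * t1 + t3"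
proof -
  define K where "K = dot Sl (mv Sl (TX \<mu>l) u) (mv Sl (TX \<mu>l) u)"
  define Th where "Th i j = (if i \<in> Sl \<and> j \<in> Sl then TX \<mu>l i j else 0)" for i j
  have mvTh: "mv S Th v i = ext v i" for v i
    using mvS[of Th v i] S_eq(2) by (auto simp: Th_def ext_def mv_def)
  have "trl = (\<Sum>i\<in>Sl. \<Sum>j\<in>Sl. (TX \<mu>l i j)\<^sup>2)" unfolding trl_def eig_frob[OF fSl TX_eig] ..
  also have "... = (\<Sum>i\<in>S. \<Sum>j\<in>S. (Th i j)\<^sup>2)"
    unfolding S_eq(1) using fSl S_eq(2) by (simp add: Th_def)
  also have "... = (\<Sum>k\<in>S. dot S (mv S Th (V k)) (mv S Th (V k)))" by (rule frob_basis[OF _ eigsysD(1)[OF eig]]) simp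
  also have "... = (\<Sum>k\<in>S. dot S (ext (V k)) (ext (V k)))" by (simp add: mvTh[abs_def])
  also have "... = dot S (ext u) (ext u) + (\<Sum>k\<in>Sl. dot S (ext (V k)) (ext (V k)))"
    unfolding S_eq(1) using fSl S_eq(2) by simp
  also have "dot S (ext u) (ext u) = K"
    unfolding ext_dot K_def by (rule dot_cong) (auto simp: ext_def)
  also have "(\<Sum>k\<in>Sl. dot S (ext (V k)) (ext (V k))) = (\<Sum>k\<in>Sl. (dot S (ext (V k)) u)\<^sup>2 + (1 / (\<mu>l - lam k))\<^sup>2)"
  proof (rule sum.cong)
    fix k assume k: "k \<in> Sl"
    have "dot S (ext (V k)) (ext (V k)) = (\<Sum>i\<in>S. (dot S (ext (V k)) (V i))\<^sup>2)" by (rule eig_norm1[OF _ eig]) simp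
    also have "... = (dot S (ext (V k)) u)\<^sup>2 + (\<Sum>i\<in>Sl. (dot S (ext (V k)) (V i))\<^sup>2)"
      unfolding S_eq(1) using fSl S_eq(2) by simp
    also have "(\<Sum>i\<in>Sl. (dot S (ext (V k)) (V i))\<^sup>2) = (\<Sum>i\<in>Sl. if i = k then (1 / (\<mu>l - lam k))\<^sup>2 else 0)"
      by (rule sum.cong) (use reduced_resolvent k in auto)
    also have "... = (1 / (\<mu>l - lam k))\<^sup>2" using k fSl by simp
    finally show "dot S (ext (V k)) (ext (V k)) = (dot S (ext (V k)) u)\<^sup>2 + (1 / (\<mu>l - lam k))\<^sup>2" .
  qed simp
  also have "... = (\<Sum>k\<in>Sl. (dot S (ext (V k)) u)\<^sup>2) + trG" by (simp add: sum.distrib trG_def)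
  finally have e: "trl - trG = K + (\<Sum>k\<in>Sl. (dot S (ext (V k)) u)\<^sup>2)" by simp
  have "(\<Sum>k\<in>Sl. (dot S (ext (V k)) u)\<^sup>2) = (\<Sum>k\<in>Sl. (dot S (ext u) (V k))\<^sup>2)"
  proof -
    have "dot S (ext (V k)) u = dot S (ext u) (V k)" for k
      unfolding ext_dot using TX_sym[of "V k" \<mu>l u] by (simp add: dot_commute)
    then show ?thesis by simp
  qed
  also have "... \<le> (\<Sum>k\<in>S. (dot S (ext u) (V k))\<^sup>2)" by (rule sum_mono2) (auto simp: off_def)
  also have "... = dot S (ext u) (ext u)" by (rule eig_norm1[OF _ eig, symmetric]) simp
  also have "... = K" unfolding ext_dot K_def by (rule dot_cong) (auto simp: ext_def)
  finally have le: "(\<Sum>k\<in>Sl. (dot S (ext (V k)) u)\<^sup>2) \<le> K" .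
  have K: "0 \<le> K" "K \<le> PP + QQ" using TXu_bound by (simp_all add: K_def dot_self_nonneg)
  have "0 \<le> (\<Sum>k\<in>Sl. (dot S (ext (V k)) u)\<^sup>2)" by (rule sum_nonneg) simp
  then have d1: "0 \<le> trl - trG" using e K(1) by linarith
  have "trl - trG \<le> K + K" using e le by linarith
  also have "... \<le> (PP + QQ) + (PP + QQ)" by (rule add_mono[OF K(2) K(2)])
  finally have d2: "trl - trG \<le> 2 * (PP + QQ)" by simp
  have "\<bar>trl - trG\<bar> \<le> 2 * (PP + QQ)" unfolding abs_of_nonneg[OF d1] by (rule d2)
  then have "\<sigma>\<^sup>2 * \<bar>trl - trG\<bar> \<le> \<sigma>\<^sup>2 * (2 * (PP + QQ))" by (intro mult_left_mono) auto
  also have "... = 2 * (\<sigma>\<^sup>2 * PP) + 2 * (\<sigma>\<^sup>2 * QQ)" by (simp add: algebra_simps)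
  also have "... \<le> 4 * t1 + t3" using \<sigma>P \<sigma>Q t0 by linarith
  finally show ?thesis by (simp add: abs_mult flip: right_diff_distrib)
qed

definition bl where "bl = (\<Sum>i\<in>B. \<sigma>\<^sup>2 / (\<mu>l - lam i)\<^sup>2)"

lemma bl_vs_gaps: "\<bar>bl - \<sigma>\<^sup>2 * trG\<bar> \<le> 2 * t1"
proof -
  have "trG = (\<Sum>i\<in>T'. (1 / (\<mu>l - lam i))\<^sup>2) + (\<Sum>i\<in>B. (1 / (\<mu>l - lam i))\<^sup>2)"
    unfolding trG_def Sl_eq by (rule sum.union_disjoint) auto
  moreover have "bl = \<sigma>\<^sup>2 * (\<Sum>i\<in>B. (1 / (\<mu>l - lam i))\<^sup>2)"
    by (simp add: bl_def sum_distrib_left power_divide)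
  ultimately have e: "bl - \<sigma>\<^sup>2 * trG = - (\<sigma>\<^sup>2 * (\<Sum>i\<in>T'. (1 / (\<mu>l - lam i))\<^sup>2))" by (simp add: distrib_left)
  have "(\<Sum>i\<in>T'. (1 / (\<mu>l - lam i))\<^sup>2) \<le> (\<Sum>i\<in>T'. 2 / \<Delta>\<^sup>2)"
  proof (rule sum_mono)
    fix i assume i: "i \<in> T'"
    have d: "9/10 * \<Delta> \<le> \<bar>\<mu>l - lam i\<bar>" using lam_sep[of i] i by auto
    have "(9/10 * \<Delta>)\<^sup>2 \<le> \<bar>\<mu>l - lam i\<bar>\<^sup>2" using \<Delta>0 by (intro power_mono d) auto
    then have "1 / (\<mu>l - lam i)\<^sup>2 \<le> 1 / (9/10 * \<Delta>)\<^sup>2" using \<Delta>0 by (intro frac_le) auto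
    also have "... \<le> 2 / \<Delta>\<^sup>2" using \<Delta>0 by (simp add: power_mult_distrib power_divide divide_simps)
    finally show "(1 / (\<mu>l - lam i))\<^sup>2 \<le> 2 / \<Delta>\<^sup>2" by (simp add: power_divide)
  qed
  also have "... = real (card T') * (2 / \<Delta>\<^sup>2)" by simp
  also have "... \<le> real r * (2 / \<Delta>\<^sup>2)" using l by (intro mult_right_mono) auto
  finally have "\<sigma>\<^sup>2 * (\<Sum>i\<in>T'. (1 / (\<mu>l - lam i))\<^sup>2) \<le> \<sigma>\<^sup>2 * (real r * (2 / \<Delta>\<^sup>2))" by (intro mult_left_mono) auto
  also have "... = 2 * (\<sigma>\<^sup>2 * real r / \<Delta>\<^sup>2)" by simp
  also have "... \<le> 2 * t1" using t1_r by simp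
  finally have "\<sigma>\<^sup>2 * (\<Sum>i\<in>T'. (1 / (\<mu>l - lam i))\<^sup>2) \<le> 2 * t1" .
  moreover have "0 \<le> \<sigma>\<^sup>2 * (\<Sum>i\<in>T'. (1 / (\<mu>l - lam i))\<^sup>2)" by (intro mult_nonneg_nonneg sum_nonneg) auto
  ultimately show ?thesis unfolding e by simp
qed

text \<open>Passage from \<open>\<tau>\<close> to the observable \<open>bl\<close>: move to \<open>x\<close>, replace the form by its conditional mean, move back to \<open>lam l\<close>, express the trace by eigengaps of \<open>M\<close>, and drop the other \<open>r - 1\<close> large eigenvalues.\<close>

lemma bias_close: "\<bar>bl - \<tau>\<bar> \<le> 300 * t1 + 100 * t3"
proof -
  have "\<bar>bl - \<tau>\<bar> \<le> \<bar>bl - \<sigma>\<^sup>2 * trG\<bar> + \<bar>\<sigma>\<^sup>2 * trl - \<sigma>\<^sup>2 * trG\<bar> + \<bar>\<sigma>\<^sup>2 * trl - \<sigma>\<^sup>2 * trx\<bar>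
      + \<bar>\<tau>x - \<sigma>\<^sup>2 * trx\<bar> + \<bar>\<tau> - \<tau>x\<bar>" by argo
  also have "... \<le> 2 * t1 + (4 * t1 + t3) + 2 * (t1 / 50 + t3 / 80) + (125 * t1 + 20 * t3) + 5202 * (t1 / 50 + t3 / 80)"
    by (intro add_mono \<tau>_at_x trace_at_x \<tau>x_concentrates trace_vs_gaps bl_vs_gaps)
  also have "... \<le> 300 * t1 + 100 * t3" using t0 by simp
  finally show ?thesis .
qed

lemma bl0: "0 \<le> bl" by (simp add: bl_def sum_nonneg)

lemma bl1: "bl \<le> 1"
proof -
  have "bl \<le> (\<Sum>i\<in>B. \<sigma>\<^sup>2 / (\<Lambda> / 2)\<^sup>2)" unfolding bl_def
  proof (rule sum_mono)
    fix i assume "i \<in> B"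
    then have "4/5 * \<Lambda> \<le> \<bar>\<mu>l - lam i\<bar>" using lam_bot[of i] by auto
    then have "\<Lambda> / 2 \<le> \<bar>\<mu>l - lam i\<bar>" using \<Lambda>(2) by linarith
    then have "(\<Lambda> / 2)\<^sup>2 \<le> \<bar>\<mu>l - lam i\<bar>\<^sup>2" by (intro power_mono) auto
    then show "\<sigma>\<^sup>2 / (\<mu>l - lam i)\<^sup>2 \<le> \<sigma>\<^sup>2 / (\<Lambda> / 2)\<^sup>2" using \<Lambda>(2) by (intro frac_le) auto
  qed
  also have "... = real (n - r) * (\<sigma>\<^sup>2 / (\<Lambda> / 2)\<^sup>2)" by simp
  also have "... \<le> real n * (\<sigma>\<^sup>2 / (\<Lambda> / 2)\<^sup>2)" by (intro mult_right_mono) auto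
  also have "... = (\<sigma>\<^sup>2 * real n) / (\<Lambda> / 2)\<^sup>2" by simp
  also have "... \<le> \<rho>\<^sup>2 / (\<Lambda> / 2)\<^sup>2" by (intro divide_right_mono \<sigma>2n) simp
  also have "... \<le> (\<Lambda> / 2)\<^sup>2 / (\<Lambda> / 2)\<^sup>2"
    using \<rho>lm \<Lambda>(1) \<rho>0 by (intro divide_right_mono power_mono) auto
  also have "... \<le> 1" by simp
  finally show ?thesis .
qed

lemma abs_\<alpha>: "\<bar>\<alpha>\<bar> = 1 / sqrt (1 + \<tau>)"
proof -
  have "\<alpha>\<^sup>2 = 1 / (1 + \<tau>)" using \<alpha>\<tau> \<tau>0 by (simp add: field_simps)
  then have "sqrt (\<alpha>\<^sup>2) = sqrt (1 / (1 + \<tau>))" by simp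
  then show ?thesis by (simp add: real_sqrt_divide)
qed

theorem debias_l: "\<bar>sqrt (1 + bl) * \<bar>\<alpha>\<bar> - 1\<bar> \<le> 300 * t1 + 100 * t3"
proof -
  define y where "y = (1 + bl) / (1 + \<tau>)"
  have y0: "0 \<le> y" using bl0 \<tau>0 by (simp add: y_def)
  have "sqrt (1 + bl) * \<bar>\<alpha>\<bar> = sqrt y" unfolding abs_\<alpha> y_def by (simp add: real_sqrt_divide)
  moreover have "\<bar>sqrt y - 1\<bar> \<le> \<bar>y - 1\<bar>"
  proof -
    have "y - 1 = (sqrt y - 1) * (sqrt y + 1)" using y0 by (simp add: algebra_simps)
    then have "\<bar>y - 1\<bar> = \<bar>sqrt y - 1\<bar> * (sqrt y + 1)" using y0 by (simp add: abs_mult)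
    moreover have "\<bar>sqrt y - 1\<bar> * 1 \<le> \<bar>sqrt y - 1\<bar> * (sqrt y + 1)" using y0 by (intro mult_left_mono) auto
    ultimately show ?thesis by simp
  qed
  moreover have "\<bar>y - 1\<bar> \<le> \<bar>bl - \<tau>\<bar>"
  proof -
    have "y - 1 = (bl - \<tau>) / (1 + \<tau>)" using \<tau>0 by (simp add: y_def field_simps)
    then have "\<bar>y - 1\<bar> = \<bar>bl - \<tau>\<bar> / (1 + \<tau>)" using \<tau>0 by (simp add: abs_divide)
    also have "... \<le> \<bar>bl - \<tau>\<bar> / 1" using \<tau>0 by (intro divide_left_mono) auto
    finally show ?thesis by simp
  qed
  ultimately show ?thesis using bias_close by linarith
qed

section \<open>Coordinates of the eigenvector\<close>

lemma ux: "dot T u u \<le> 1" "dot B u u \<le> 1" "dot T u u + dot B u u = 1"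
proof -
  have "dot S u u = dot T u u + dot B u u" unfolding STB(1) by (rule dot_un) auto
  then show 1: "dot T u u + dot B u u = 1" using u1 by simp
  show "dot T u u \<le> 1" "dot B u u \<le> 1" using 1 dot_self_nonneg[of T u] dot_self_nonneg[of B u] by linarith+
qed

lemma LTu: "L2_set u T \<le> 1" using ux(1) by (simp add: L2_set_dot)

lemma u_top: assumes k: "k < r" shows "(g \<mu>l - ls k) * u k = mv T (E \<mu>l) u k"
proof -
  have "k \<in> T" using k by simp
  moreover have "mv (T \<union> B) M u i = \<mu>l * u i" if "i \<in> T \<union> B" for i using Mu[of i] that STB(1) by simp
  ultimately show ?thesis using eig_coord(2)[OF order_refl top_big[OF l]] unfolding g_def by blast
qed

lemma u_bot: assumes i: "i \<in> B" shows "u i = mv B (R \<mu>l) (mv T H u) i"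
proof -
  have "mv (T \<union> B) M u i = \<mu>l * u i" if "i \<in> T \<union> B" for i using Mu[of i] that STB(1) by simp
  then show ?thesis using eig_coord(1)[OF order_refl top_big[OF l] _ i] by blast
qed

lemma Eu: "L2_set (mv T (E \<mu>l) u) T \<le> \<epsilon>"
proof -
  have "L2_set (mv T (E \<mu>l) u) T \<le> \<epsilon> * L2_set u T" by (rule opbD[OF E_op[OF top_big[OF l]]])
  also have "... \<le> \<epsilon> * 1" by (intro mult_left_mono LTu \<epsilon>0)
  finally show ?thesis by simp
qed

lemma g_ls: assumes k: "k < r" "k \<noteq> l" shows "9/10 * \<bar>ls l - ls k\<bar> \<le> \<bar>g \<mu>l - ls k\<bar>"
proof -
  have "\<bar>ls l - ls k\<bar> - \<epsilon> \<le> \<bar>g \<mu>l - ls k\<bar>" using loc_l by linarith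
  moreover have "100 * \<epsilon> \<le> \<bar>ls l - ls k\<bar>" using gap[OF k] \<epsilon>\<Delta> by linarith
  ultimately show ?thesis by argo
qed

text \<open>The reduced equation divided by \<open>lam l - \<gamma> (lam l) - ls k\<close>, whose size is that of the gap by \<open>loc_l\<close>.\<close>

theorem u_coord: assumes k: "k < r" "k \<noteq> l" shows "\<bar>u k\<bar> \<le> 2 * \<epsilon> / \<bar>ls l - ls k\<bar>"
proof -
  define d where "d = \<bar>ls l - ls k\<bar>"
  have d0: "0 < d" using gap[OF k] \<Delta>0 by (simp add: d_def)
  have "(9/10 * d) * \<bar>u k\<bar> \<le> \<bar>g \<mu>l - ls k\<bar> * \<bar>u k\<bar>" unfolding d_def by (intro mult_right_mono g_ls k) simp
  also have "... = \<bar>mv T (E \<mu>l) u k\<bar>" using u_top[OF k(1)] by (simp flip: abs_mult)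
  also have "... \<le> L2_set (mv T (E \<mu>l) u) T" by (rule abs_le_L2) (use k in auto)
  also have "... \<le> \<epsilon>" by (rule Eu)
  finally have "d * \<bar>u k\<bar> \<le> 2 * \<epsilon>" using d0 \<epsilon>0 by (simp add: field_simps)
  then have "\<bar>u k\<bar> \<le> 2 * \<epsilon> / d" using d0 by (simp add: field_simps)
  then show ?thesis by (simp add: d_def)
qed

lemma u_top_rest: "dot T' u u \<le> 2 * \<epsilon>\<^sup>2 / \<Delta>\<^sup>2"
proof -
  have "(\<Sum>k\<in>T'. (9/10 * \<Delta>)\<^sup>2 * (u k)\<^sup>2) \<le> (\<Sum>k\<in>T'. (mv T (E \<mu>l) u k)\<^sup>2)"
  proof (rule sum_mono)
    fix k assume "k \<in> T'"
    then have k: "k < r" "k \<noteq> l" by auto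
    have "9/10 * \<Delta> \<le> \<bar>g \<mu>l - ls k\<bar>" using g_ls[OF k] gap[OF k] by argo
    then have "(9/10 * \<Delta>)\<^sup>2 \<le> \<bar>g \<mu>l - ls k\<bar>\<^sup>2" using \<Delta>0 by (intro power_mono) auto
    then have "(9/10 * \<Delta>)\<^sup>2 * (u k)\<^sup>2 \<le> (g \<mu>l - ls k)\<^sup>2 * (u k)\<^sup>2" by (intro mult_right_mono) auto
    also have "... = (mv T (E \<mu>l) u k)\<^sup>2" using u_top[OF k(1)] by (simp flip: power_mult_distrib)
    finally show "(9/10 * \<Delta>)\<^sup>2 * (u k)\<^sup>2 \<le> (mv T (E \<mu>l) u k)\<^sup>2" .
  qed
  also have "... \<le> (\<Sum>k\<in>T. (mv T (E \<mu>l) u k)\<^sup>2)" by (rule sum_mono2) auto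
  also have "... = (L2_set (mv T (E \<mu>l) u) T)\<^sup>2" by (simp add: L2_set_def sum_nonneg)
  also have "... \<le> \<epsilon>\<^sup>2" by (intro power_mono Eu) simp
  finally have "(9/10 * \<Delta>)\<^sup>2 * dot T' u u \<le> \<epsilon>\<^sup>2" by (simp add: dot_def sum_distrib_left power2_eq_square)
  then have "81 * (\<Delta>\<^sup>2 * dot T' u u) \<le> 100 * \<epsilon>\<^sup>2" by (simp add: power_mult_distrib power_divide)
  moreover have "0 \<le> \<Delta>\<^sup>2 * dot T' u u" by (simp add: dot_self_nonneg)
  ultimately have "\<Delta>\<^sup>2 * dot T' u u \<le> 2 * \<epsilon>\<^sup>2" by linarith
  then show ?thesis using \<Delta>0 by (simp add: field_simps)
qed

lemma u_bot_norm: "dot B u u \<le> 9 * \<rho>\<^sup>2 / \<Lambda>\<^sup>2"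
proof -
  have mul: "0 < \<bar>\<mu>l\<bar>" "2 / \<bar>\<mu>l\<bar> \<le> 3 / \<Lambda>" using lam_l(1) \<Lambda>(2) by (auto simp: field_simps)
  have "L2_set u B = L2_set (mv B (R \<mu>l) (mv T H u)) B" by (rule L2_set_cong[OF refl u_bot])
  also have "... \<le> 2 / \<bar>\<mu>l\<bar> * L2_set (mv T H u) B" by (rule opbD[OF res_op[OF top_big[OF l]]])
  also have "... \<le> 3 / \<Lambda> * (\<rho> * 1)"
  proof (rule mult_mono[OF mul(2)])
    have "L2_set (mv T H u) B \<le> \<rho> * L2_set u T" by (rule H_block) (use rn in auto)
    also have "... \<le> \<rho> * 1" using \<rho>0 by (intro mult_left_mono LTu) auto
    finally show "L2_set (mv T H u) B \<le> \<rho> * 1" .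
  qed auto
  finally have "(L2_set u B)\<^sup>2 \<le> (3 / \<Lambda> * (\<rho> * 1))\<^sup>2" by (intro power_mono) auto
  then show ?thesis by (simp add: L2_set_sq power_mult_distrib power_divide)
qed

text \<open>\<open>1 - \<bar>\<alpha>\<bar> \<le> 1 - \<alpha>\<^sup>2\<close>, the mass of \<open>u\<close> outside coordinate \<open>l\<close>: the coordinates in \<open>T\<close> by \<open>u_coord\<close>, those in \<open>B\<close> by the noise norm.\<close>

theorem plugin_l: "1 - \<bar>\<alpha>\<bar> \<le> 12800 * t1 + 23409 * (\<sigma>\<^sup>2 * real n / \<Lambda>\<^sup>2)"
proof -
  have "dot T u u = \<alpha>\<^sup>2 + dot T' u u" unfolding dot_def
    by (subst sum.remove[of T l]) (use l in \<open>auto simp: power2_eq_square\<close>)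
  then have e: "1 - \<alpha>\<^sup>2 = dot T' u u + dot B u u" using ux(3) by simp
  have "\<alpha>\<^sup>2 \<le> \<bar>\<alpha>\<bar>" using mult_left_mono[OF \<alpha>1, of "\<bar>\<alpha>\<bar>"] by (simp add: power2_eq_square flip: abs_mult)
  moreover have "2 * \<epsilon>\<^sup>2 / \<Delta>\<^sup>2 \<le> 12800 * t1"
  proof -
    have "\<epsilon>\<^sup>2 \<le> (80 * (\<sigma> * sqrt (real r * lg)))\<^sup>2" by (intro power_mono \<epsilon>up \<epsilon>0)
    also have "... = 6400 * (\<sigma>\<^sup>2 * real r * lg)" using lg1 by (simp add: power_mult_distrib)
    finally have ee: "\<epsilon>\<^sup>2 \<le> 6400 * (\<sigma>\<^sup>2 * real r * lg)" .
    have "2 * \<epsilon>\<^sup>2 / \<Delta>\<^sup>2 \<le> 2 * (6400 * (\<sigma>\<^sup>2 * real r * lg)) / \<Delta>\<^sup>2"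
      by (intro divide_right_mono mult_left_mono ee) auto
    then show ?thesis by (simp add: t1_def)
  qed
  moreover have "9 * \<rho>\<^sup>2 / \<Lambda>\<^sup>2 \<le> 23409 * (\<sigma>\<^sup>2 * real n / \<Lambda>\<^sup>2)"
  proof -
    have "\<rho>\<^sup>2 \<le> (51 * (\<sigma> * sqrt (real n)))\<^sup>2" using \<rho>0 by (intro power_mono \<rho>up) auto
    also have "... = 2601 * (\<sigma>\<^sup>2 * real n)" by (simp add: power_mult_distrib)
    finally have rr: "\<rho>\<^sup>2 \<le> 2601 * (\<sigma>\<^sup>2 * real n)" .
    have "9 * \<rho>\<^sup>2 / \<Lambda>\<^sup>2 \<le> 9 * (2601 * (\<sigma>\<^sup>2 * real n)) / \<Lambda>\<^sup>2"
      by (intro divide_right_mono mult_left_mono rr) auto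
    then show ?thesis by simp
  qed
  ultimately show ?thesis using e u_top_rest u_bot_norm by linarith
qed

lemma x_facts: "lm / 2 \<le> \<bar>x\<bar>" "4/5 * \<Lambda> \<le> \<bar>x\<bar>"
proof -
  show 1: "4/5 * \<Lambda> \<le> \<bar>x\<bar>" using lam_l(1) xl \<sigma>small \<Lambda>(2) by linarith
  then show "lm / 2 \<le> \<bar>x\<bar>" using \<Lambda> lm0 by linarith
qed

text \<open>\<open>\<parallel>T x\<parallel>\<close> alone is only \<open>1 / \<Delta>\<close>. A vector on \<open>B\<close> reaches the badly conditioned directions in \<open>T\<close> only through \<open>H_TB\<close>, and \<open>rows_ok\<close> bounds what arrives there by \<open>\<Delta> / \<bar>x\<bar>\<close>, so dividing by the gap leaves \<open>1 / \<bar>x\<bar>\<close>.\<close>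

lemma TXa: "L2_set (mv Sl (TX x) aB) Sl \<le> 30 / \<Lambda>"
proof -
  define z where "z = mv Sl (TX x) aB"
  define X where "X = \<bar>x\<bar>"
  have X0: "0 < X" using x_facts \<Lambda>(2) by (simp add: X_def)
  have zeq: "x * z i - mv (T' \<union> B) M z i = aB i" if i: "i \<in> T' \<union> B" for i
  proof -
    have iS: "i \<in> Sl" using i Sl_eq by simp
    have "mv Sl (shiftm x M) z i = aB i" unfolding z_def Tx_def by (rule pinv_solve[OF fSl shift_eig nz(2) iS])
    then show ?thesis using mv_shiftm[OF fSl iS, of x M z] Sl_eq by simp
  qed
  define ra where "ra = mv B (R x) a"
  have raB: "mv B (R x) aB = ra" unfolding ra_def by (rule ext) (rule mv_cong, auto simp: botp_def)
  have raL: "L2_set ra B \<le> 2 / X"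
  proof -
    have "L2_set ra B \<le> 2 / X * L2_set a B" unfolding ra_def X_def by (rule opbD[OF res_op[OF x_facts(1)]])
    also have "... \<le> 2 / X * 1"
    proof (rule mult_left_mono)
      have "L2_set a B \<le> L2_set a S" by (rule L2_set_subset) auto
      then show "L2_set a B \<le> 1" by (simp add: L2_set_dot a1)
    qed (use X0 in auto)
    finally show ?thesis by simp
  qed
  define y where "y k = mv B H ra k" for k
  have yk: "\<bar>y k\<bar> \<le> 6 * \<sigma> * sqrt lg * (2 / X)" if k: "k < r" for k
  proof -
    have "y k = (\<Sum>i\<in>B. ra i * H i k)" unfolding y_def mv_def
      by (rule sum.cong) (use H_symD[of k] k rn in auto)
    then have "\<bar>y k\<bar> \<le> 6 * \<sigma> * sqrt lg * L2_set ra B" using e4 k unfolding rows_ok_def ra_def by auto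
    also have "... \<le> 6 * \<sigma> * sqrt lg * (2 / X)" using \<sigma>0 lg1 by (intro mult_left_mono raL) auto
    finally show ?thesis .
  qed
  have ytop: "(x - \<gamma> x - ls k) * z k - mv T' (E x) z k = y k" if k: "k \<in> T'" for k
    using schur(2)[OF T'T x_facts(1) zeq k] k unfolding raB y_def by (simp add: botp_def)
  have zbot: "z i = mv B (R x) (\<lambda>j. aB j + mv T' H z j) i" if "i \<in> B" for i
    by (rule schur(1)[OF T'T x_facts(1) zeq that])
  have gx: "9/10 * \<Delta> \<le> \<bar>x - \<gamma> x - ls k\<bar>" if k: "k \<in> T'" for k
  proof -
    have "\<bar>g x - g \<mu>l\<bar> \<le> 101/100 * \<bar>x - \<mu>l\<bar>" by (rule g_lip[OF x_facts(1) top_big[OF l]])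
    moreover have "\<bar>x - \<mu>l\<bar> \<le> \<Delta> / 100" using xl \<sigma>small by linarith
    ultimately have 1: "\<bar>g x - g \<mu>l\<bar> \<le> \<Delta> / 50" using \<Delta>0 by simp
    have 2: "\<Delta> \<le> \<bar>ls l - ls k\<bar>" using gap[of k] k by auto
    have 3: "\<epsilon> \<le> \<Delta> / 100" using \<epsilon>\<Delta> by simp
    have "\<bar>ls l - ls k\<bar> \<le> \<bar>g \<mu>l - ls l\<bar> + \<bar>g x - g \<mu>l\<bar> + \<bar>g x - ls k\<bar>" by linarith
    then have "9/10 * \<Delta> \<le> \<bar>g x - ls k\<bar>" using 1 2 3 loc_l \<Delta>0 by simp
    then show ?thesis by (simp add: g_def)
  qed
  define \<xi> where "\<xi> = L2_set z T'"
  have \<xi>0: "0 \<le> \<xi>" by (simp add: \<xi>_def)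
  have yL: "L2_set y T' \<le> 12 * (\<Delta> / X)"
  proof -
    define c where "c = 6 * \<sigma> * sqrt lg * (2 / X)"
    have c0: "0 \<le> c" using \<sigma>0 lg1 X0 by (simp add: c_def)
    have "(\<Sum>k\<in>T'. (y k)\<^sup>2) \<le> (\<Sum>k\<in>T'. c\<^sup>2)"
    proof (rule sum_mono)
      fix k assume "k \<in> T'"
      then have "\<bar>y k\<bar> \<le> c" using yk unfolding c_def by auto
      then have "\<bar>y k\<bar>\<^sup>2 \<le> c\<^sup>2" by (intro power_mono) auto
      then show "(y k)\<^sup>2 \<le> c\<^sup>2" by simp
    qed
    also have "... \<le> real r * c\<^sup>2" using l by (simp add: mult_right_mono)
    finally have "L2_set y T' \<le> sqrt (real r * c\<^sup>2)" unfolding L2_set_def by simp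
    also have "... = 12 * (\<sigma> * sqrt (real r * lg) / X)" using c0 by (simp add: real_sqrt_mult) (simp add: c_def)
    also have "... \<le> 12 * (\<Delta> / X)" using X0 \<Delta>low by (intro mult_left_mono divide_right_mono) auto
    finally show ?thesis .
  qed
  have "9/10 * \<Delta> * \<xi> \<le> L2_set (\<lambda>k. (x - \<gamma> x - ls k) * z k) T'"
  proof -
    have "9/10 * \<Delta> * \<xi> = L2_set (\<lambda>k. 9/10 * \<Delta> * z k) T'" using L2_set_scale[of "9/10 * \<Delta>" z T'] \<Delta>0 by (simp add: \<xi>_def)
    also have "... \<le> L2_set (\<lambda>k. (x - \<gamma> x - ls k) * z k) T'" unfolding L2_set_def
    proof (rule real_sqrt_le_mono, rule sum_mono)
      fix k assume k: "k \<in> T'"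
      have "(9/10 * \<Delta>)\<^sup>2 \<le> \<bar>x - \<gamma> x - ls k\<bar>\<^sup>2" using \<Delta>0 by (intro power_mono gx k) auto
      then show "(9/10 * \<Delta> * z k)\<^sup>2 \<le> ((x - \<gamma> x - ls k) * z k)\<^sup>2"
        unfolding power_mult_distrib[of _ "z k"] by (intro mult_right_mono) auto
    qed
    finally show ?thesis .
  qed
  also have "L2_set (\<lambda>k. (x - \<gamma> x - ls k) * z k) T' = L2_set (\<lambda>k. mv T' (E x) z k + y k) T'"
  proof (rule L2_set_cong[OF refl])
    fix k assume "k \<in> T'"
    then show "(x - \<gamma> x - ls k) * z k = mv T' (E x) z k + y k" using ytop[of k] by linarith
  qed
  also have "... \<le> L2_set (mv T' (E x) z) T' + L2_set y T'" by (rule L2_set_triangle_ineq)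
  also have "L2_set (mv T' (E x) z) T' \<le> \<epsilon> * \<xi>" unfolding \<xi>_def by (rule opbD[OF E_op'[OF T'T x_facts(1)]])
  also have "\<epsilon> * \<xi> \<le> \<Delta> / 100 * \<xi>" using \<epsilon>\<Delta> \<xi>0 by (intro mult_right_mono) auto
  finally have "9/10 * \<Delta> * \<xi> \<le> \<Delta> / 100 * \<xi> + 12 * (\<Delta> / X)" using yL by linarith
  moreover have "\<Delta> * (89/100 * \<xi>) = 9/10 * \<Delta> * \<xi> - \<Delta> / 100 * \<xi>" by (simp add: field_simps)
  moreover have "\<Delta> * (12 / X) = 12 * (\<Delta> / X)" by simp
  ultimately have "\<Delta> * (89/100 * \<xi>) \<le> \<Delta> * (12 / X)" by linarith
  then have "89/100 * \<xi> \<le> 12 / X" using \<Delta>0 by (simp only: mult_le_cancel_left_pos)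
  then have \<xi>: "\<xi> \<le> 14 / X" using X0 by (simp add: field_simps)
  have "L2_set z B = L2_set (mv B (R x) (\<lambda>j. aB j + mv T' H z j)) B" by (rule L2_set_cong[OF refl zbot])
  also have "... \<le> 2 / X * L2_set (\<lambda>j. aB j + mv T' H z j) B" unfolding X_def by (rule opbD[OF res_op[OF x_facts(1)]])
  also have "... \<le> 2 / X * (1 + \<rho> * \<xi>)"
  proof (rule mult_left_mono)
    have "L2_set (\<lambda>j. aB j + mv T' H z j) B \<le> L2_set aB B + L2_set (mv T' H z) B" by (rule L2_set_triangle_ineq)
    moreover have "L2_set aB B = L2_set a B" by (rule L2_set_cong) (auto simp: botp_def)
    moreover have "L2_set a B \<le> L2_set a S" by (rule L2_set_subset) auto
    moreover have "L2_set a S = 1" by (simp add: L2_set_dot a1)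
    moreover have "L2_set (mv T' H z) B \<le> \<rho> * \<xi>" unfolding \<xi>_def by (rule H_block) (use rn in auto)
    ultimately show "L2_set (\<lambda>j. aB j + mv T' H z j) B \<le> 1 + \<rho> * \<xi>" by linarith
  qed (use X0 in auto)
  also have "... \<le> 2 / X * 2"
  proof (rule mult_left_mono)
    have "\<rho> * \<xi> \<le> \<rho> * (14 / X)" using \<rho>0 by (intro mult_left_mono \<xi>) auto
    also have "... \<le> 1" using x_facts(1) \<rho>lm X0 by (simp add: X_def divide_le_eq)
    finally show "1 + \<rho> * \<xi> \<le> 2" by simp
  qed (use X0 in auto)
  finally have zB: "L2_set z B \<le> 4 / X" by simp
  have "(L2_set z Sl)\<^sup>2 = (L2_set z T')\<^sup>2 + (L2_set z B)\<^sup>2" unfolding L2_set_sq Sl_eq by (rule dot_un) auto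
  also have "... \<le> (14 / X)\<^sup>2 + (4 / X)\<^sup>2" using \<xi> zB \<xi>0 unfolding \<xi>_def by (intro add_mono power_mono) auto
  also have "... \<le> (18 / X)\<^sup>2" by (simp add: power_divide flip: add_divide_distrib) (intro divide_right_mono, auto)
  finally have "L2_set z Sl \<le> 18 / X" using X0 by (intro power2_le_imp_le[of "L2_set z Sl"]) auto
  also have "... \<le> 18 / (4/5 * \<Lambda>)" using x_facts(2) \<Lambda>(2) unfolding X_def by (intro divide_left_mono) auto
  also have "... \<le> 30 / \<Lambda>" using \<Lambda>(2) by (simp add: field_simps)
  finally show ?thesis unfolding z_def .
qed

text \<open>By \<open>u_loo_x\<close> the pairing of \<open>a\<close> with \<open>u\<close> on \<open>B\<close> is \<open>\<alpha>\<close> times a linear form in \<open>h\<close> with independent coefficients \<open>T x aB\<close>, plus a term of size \<open>\<bar>x - lam l\<bar>\<close>.\<close>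

theorem bot_part: "\<bar>dot B a u\<bar> \<le> 210 * t3"
proof -
  define w where "w = mv Sl (TX x) aB"
  have "dot B a u = dot Sl aB u"
  proof -
    have "dot Sl aB u = dot T' aB u + dot B aB u" unfolding Sl_eq by (rule dot_un) auto
    also have "dot T' aB u = 0" by (auto simp: dot_def botp_def)
    also have "dot B aB u = dot B a u" by (rule dot_cong) (auto simp: botp_def)
    finally show ?thesis by simp
  qed
  also have "... = dot Sl aB (\<lambda>i. \<alpha> * mv Sl (TX x) h i + (x - \<mu>l) * mv Sl (TX x) u i)"
    by (rule dot_cong) (use u_loo_x in auto)
  also have "... = \<alpha> * dot Sl w h + (x - \<mu>l) * dot Sl w u"
    by (simp add: dot_add_right dot_scale_right TX_sym w_def)
  finally have "\<bar>dot B a u\<bar> \<le> \<bar>\<alpha>\<bar> * \<bar>dot Sl w h\<bar> + \<bar>x - \<mu>l\<bar> * \<bar>dot Sl w u\<bar>"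
    by (simp only:) (rule order_trans[OF abs_triangle_ineq], simp add: abs_mult)
  also have "... \<le> 1 * (6 * \<sigma> * sqrt lg * L2_set w Sl) + \<sigma> * (L2_set w Sl * 1)"
  proof (intro add_mono mult_mono \<alpha>1)
    show "\<bar>dot Sl w h\<bar> \<le> 6 * \<sigma> * sqrt lg * L2_set w Sl" using e6 unfolding lin_ok_def Let_def w_def .
    show "\<bar>x - \<mu>l\<bar> \<le> \<sigma>" using xl \<sigma>small by linarith
    have "L2_set u Sl \<le> L2_set u S" by (rule L2_set_subset) (auto simp: off_def)
    also have "L2_set u S = 1" by (simp add: L2_set_dot u1)
    finally have "L2_set w Sl * L2_set u Sl \<le> L2_set w Sl * 1" by (intro mult_left_mono) auto
    then show "\<bar>dot Sl w u\<bar> \<le> L2_set w Sl * 1" using dot_CS[of Sl w u] by linarith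
  qed (use \<sigma>0 in auto)
  also have "... \<le> 7 * (\<sigma> * sqrt lg) * L2_set w Sl"
  proof -
    have "\<sigma> * 1 \<le> \<sigma> * sqrt lg" using \<sigma>0 lg1 by (intro mult_left_mono) auto
    then have "\<sigma> * L2_set w Sl \<le> (\<sigma> * sqrt lg) * L2_set w Sl" by (intro mult_right_mono) auto
    then show ?thesis by (simp add: algebra_simps)
  qed
  also have "... \<le> 7 * (\<sigma> * sqrt lg) * (30 / \<Lambda>)" unfolding w_def using \<sigma>0 lg1 by (intro mult_left_mono TXa) auto
  also have "... = 210 * t3" by (simp add: t3_def)
  finally show ?thesis .
qed

end

lemma sign_dist_le: "s = 1 \<or> s = -1 ==> sign_dist z t \<le> \<bar>z - s * t\<bar>"
  by (auto simp: sign_dist_def)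

lemma sign_dist_flip: "s = 1 \<or> s = -1 ==> sign_dist (s * z) t = sign_dist z t"
  by (auto simp: sign_dist_def min_def)

context loo
begin

definition t2 where "t2 = \<sigma> * sqrt (real r * lg) * (\<Sum>k\<in>T'. \<bar>a k\<bar> / \<bar>ls l - ls k\<bar>)"

lemma t20: "0 \<le> t2" using \<sigma>0 lg1 by (auto simp: t2_def intro!: mult_nonneg_nonneg sum_nonneg)

lemma a_l1: "\<bar>a l\<bar> \<le> 1"
proof -
  have "\<bar>a l\<bar> \<le> L2_set a S" by (rule abs_le_L2) (use ln in auto)
  then show ?thesis by (simp add: L2_set_dot a1)
qed

lemma au_rest: "\<bar>dot S a u - a l * \<alpha>\<bar> \<le> 160 * t2 + 210 * t3"
proof -
  have "dot S a u = a l * \<alpha> + dot Sl a u" by (rule dotS)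
  also have "dot Sl a u = dot T' a u + dot B a u" unfolding Sl_eq by (rule dot_un) auto
  finally have e: "dot S a u - a l * \<alpha> = dot T' a u + dot B a u" by simp
  have "\<bar>dot T' a u\<bar> \<le> (\<Sum>k\<in>T'. \<bar>a k\<bar> * \<bar>u k\<bar>)"
    unfolding dot_def by (rule order_trans[OF sum_abs]) (simp add: abs_mult)
  also have "... \<le> (\<Sum>k\<in>T'. (2 * \<epsilon>) * (\<bar>a k\<bar> / \<bar>ls l - ls k\<bar>))"
  proof (rule sum_mono)
    fix k assume "k \<in> T'"
    then have "\<bar>a k\<bar> * \<bar>u k\<bar> \<le> \<bar>a k\<bar> * (2 * \<epsilon> / \<bar>ls l - ls k\<bar>)" by (intro mult_left_mono u_coord) auto
    then show "\<bar>a k\<bar> * \<bar>u k\<bar> \<le> (2 * \<epsilon>) * (\<bar>a k\<bar> / \<bar>ls l - ls k\<bar>)" by (simp add: mult_ac)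
  qed
  also have "... = (2 * \<epsilon>) * (\<Sum>k\<in>T'. \<bar>a k\<bar> / \<bar>ls l - ls k\<bar>)" by (simp add: sum_distrib_left)
  also have "... \<le> (2 * (80 * (\<sigma> * sqrt (real r * lg)))) * (\<Sum>k\<in>T'. \<bar>a k\<bar> / \<bar>ls l - ls k\<bar>)"
    by (intro mult_right_mono mult_left_mono \<epsilon>up sum_nonneg) auto
  also have "... = 160 * t2" by (simp add: t2_def)
  finally show ?thesis unfolding e using bot_part abs_triangle_ineq[of "dot T' a u" "dot B a u"] by linarith
qed

lemma plugin_u: "sign_dist (dot S a u) (a l) \<le> 23409 * (t1 * \<bar>a l\<bar> + t2 + t3 + \<sigma>\<^sup>2 * real n / \<Lambda>\<^sup>2 * \<bar>a l\<bar>)"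
proof -
  define s where "s = sgn \<alpha>"
  have s: "s = 1 \<or> s = -1" "\<alpha> = s * \<bar>\<alpha>\<bar>" using \<alpha>0 by (auto simp: s_def sgn_if)
  have "a l * \<alpha> - s * a l = s * a l * (\<bar>\<alpha>\<bar> - 1)" by (subst s(2)) (simp add: algebra_simps)
  then have "\<bar>a l * \<alpha> - s * a l\<bar> = \<bar>a l\<bar> * \<bar>\<bar>\<alpha>\<bar> - 1\<bar>" using s(1) by (auto simp: abs_mult)
  also have "\<bar>\<bar>\<alpha>\<bar> - 1\<bar> = 1 - \<bar>\<alpha>\<bar>" using \<alpha>1 by simp
  also have "\<bar>a l\<bar> * (1 - \<bar>\<alpha>\<bar>) \<le> \<bar>a l\<bar> * (12800 * t1 + 23409 * (\<sigma>\<^sup>2 * real n / \<Lambda>\<^sup>2))" by (intro mult_left_mono plugin_l) simp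
  finally have m: "\<bar>a l * \<alpha> - s * a l\<bar> \<le> \<bar>a l\<bar> * (12800 * t1 + 23409 * (\<sigma>\<^sup>2 * real n / \<Lambda>\<^sup>2))" .
  have "sign_dist (dot S a u) (a l) \<le> \<bar>dot S a u - s * a l\<bar>" by (rule sign_dist_le[OF s(1)])
  also have "... \<le> \<bar>dot S a u - a l * \<alpha>\<bar> + \<bar>a l * \<alpha> - s * a l\<bar>" by linarith
  also have "... \<le> (160 * t2 + 210 * t3) + \<bar>a l\<bar> * (12800 * t1 + 23409 * (\<sigma>\<^sup>2 * real n / \<Lambda>\<^sup>2))"
    by (rule add_mono[OF au_rest m])
  also have "... = 160 * t2 + 210 * t3 + 12800 * (t1 * \<bar>a l\<bar>) + 23409 * (\<sigma>\<^sup>2 * real n / \<Lambda>\<^sup>2 * \<bar>a l\<bar>)"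
    by (simp add: algebra_simps)
  also have "... \<le> 23409 * (t1 * \<bar>a l\<bar> + t2 + t3 + \<sigma>\<^sup>2 * real n / \<Lambda>\<^sup>2 * \<bar>a l\<bar>)"
  proof -
    have "0 \<le> t1 * \<bar>a l\<bar>" using t0 by simp
    then have "160 * t2 + 210 * t3 + 12800 * (t1 * \<bar>a l\<bar>) \<le> 23409 * t2 + 23409 * t3 + 23409 * (t1 * \<bar>a l\<bar>)" using t20 t0 by linarith
    then show ?thesis by (simp add: algebra_simps)
  qed
  finally show ?thesis .
qed

text \<open>Combines \<open>au_rest\<close> and \<open>debias_l\<close>; the factor \<open>sqrt (1 + bl)\<close> is bounded and so only rescales the remainder.\<close>

lemma debiased_u: "sign_dist (sqrt (1 + bl) * dot S a u) (a l) \<le> 23409 * (t1 * \<bar>a l\<bar> + t2 + t3)"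
proof -
  define s where "s = sgn \<alpha>"
  have s: "s = 1 \<or> s = -1" "\<alpha> = s * \<bar>\<alpha>\<bar>" using \<alpha>0 by (auto simp: s_def sgn_if)
  define q where "q = sqrt (1 + bl)"
  have q: "0 \<le> q" "q \<le> 2" using bl0 bl1 by (auto simp: q_def intro!: real_le_lsqrt)
  have "q * (a l * \<alpha>) - s * a l = s * a l * (q * \<bar>\<alpha>\<bar> - 1)" by (subst s(2)) (simp add: algebra_simps)
  then have "\<bar>q * (a l * \<alpha>) - s * a l\<bar> = \<bar>a l\<bar> * \<bar>q * \<bar>\<alpha>\<bar> - 1\<bar>" using s(1) by (auto simp: abs_mult)
  also have "... \<le> \<bar>a l\<bar> * (300 * t1 + 100 * t3)" unfolding q_def by (intro mult_left_mono debias_l) simp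
  also have "... = 300 * (t1 * \<bar>a l\<bar>) + 100 * (\<bar>a l\<bar> * t3)" by (simp add: algebra_simps)
  also have "... \<le> 300 * (t1 * \<bar>a l\<bar>) + 100 * (1 * t3)" using a_l1 t0 by (intro add_left_mono mult_left_mono mult_right_mono) auto
  finally have m: "\<bar>q * (a l * \<alpha>) - s * a l\<bar> \<le> 300 * (t1 * \<bar>a l\<bar>) + 100 * (1 * t3)" .
  have "\<bar>q * dot S a u - q * (a l * \<alpha>)\<bar> = q * \<bar>dot S a u - a l * \<alpha>\<bar>"
    using q by (simp add: abs_mult flip: right_diff_distrib)
  also have "... \<le> 2 * (160 * t2 + 210 * t3)" by (intro mult_mono au_rest q) auto
  finally have m2: "\<bar>q * dot S a u - q * (a l * \<alpha>)\<bar> \<le> 2 * (160 * t2 + 210 * t3)" .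
  have "sign_dist (q * dot S a u) (a l) \<le> \<bar>q * dot S a u - s * a l\<bar>" by (rule sign_dist_le[OF s(1)])
  also have "... \<le> \<bar>q * dot S a u - q * (a l * \<alpha>)\<bar> + \<bar>q * (a l * \<alpha>) - s * a l\<bar>" by linarith
  also have "... \<le> 2 * (160 * t2 + 210 * t3) + (300 * (t1 * \<bar>a l\<bar>) + 100 * (1 * t3))" by (rule add_mono[OF m2 m])
  also have "... \<le> 23409 * (t1 * \<bar>a l\<bar> + t2 + t3)"
  proof -
    have "0 \<le> t1 * \<bar>a l\<bar>" using t0 by simp
    then show ?thesis using t20 t0 by simp
  qed
  finally show ?thesis by (simp add: q_def)
qed

end

context debias
begin

theorem estimates:
  assumes w1: "dot S w w = 1" and w: "\<And>i. i \<in> S ==> mv S M w i = lam l * w i"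
  defines "Ea \<equiv> \<sigma>\<^sup>2 * real r * lg / \<Delta>\<^sup>2 * \<bar>a l\<bar> + \<sigma> * sqrt (real r * lg) * (\<Sum>k\<in>{..<r} - {l}. \<bar>a k\<bar> / \<bar>ls l - ls k\<bar>)
     + \<sigma> * sqrt lg / \<bar>ls l\<bar>"
  shows "sign_dist (dot S a w) (a l) \<le> 23409 * (Ea + \<sigma>\<^sup>2 * real n / \<bar>ls l\<bar>\<^sup>2 * \<bar>a l\<bar>)"
    and "sign_dist (sqrt (1 + (\<Sum>i\<in>B. \<sigma>\<^sup>2 / (lam l - lam i)\<^sup>2)) * dot S a w) (a l) \<le> 23409 * Ea"
proof -
  have "sym_on (off n l) M" by (rule sym_on_subset[OF M_sym]) (auto simp: off_def)
  then obtain W \<nu> where "eigsys (off n l) M W \<nu>" using spectral_theorem[of "off n l" M] by (auto simp: off_def)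
  then interpret loo n r ls H \<sigma> \<rho> \<epsilon> lm l \<Delta> V lam lg x a W \<nu> by unfold_locales
  define s where "s = dot S w (V l)"
  have ws: "w i = s * V l i" if "i \<in> S" for i unfolding s_def by (rule eigvec_unique[OF w that])
  have dw: "dot S a w = s * dot S a (V l)"
  proof -
    have "dot S a w = dot S a (\<lambda>i. s * V l i)" by (rule dot_cong) (use ws in auto)
    then show ?thesis by (simp add: dot_scale_right)
  qed
  have "dot S w w = dot S (\<lambda>i. s * V l i) (\<lambda>i. s * V l i)" by (rule dot_cong) (use ws in auto)
  also have "... = s * s * dot S (V l) (V l)" unfolding dot_scale_left dot_scale_right by simp
  finally have "s * s = 1" using w1 u1 by simp
  then have s: "s = 1 \<or> s = -1" by (simp add: square_eq_1_iff)
  have Ea: "Ea = t1 * \<bar>a l\<bar> + t2 + t3" by (simp add: Ea_def t1_def t2_def t3_def)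
  show "sign_dist (dot S a w) (a l) \<le> 23409 * (Ea + \<sigma>\<^sup>2 * real n / \<bar>ls l\<bar>\<^sup>2 * \<bar>a l\<bar>)"
    unfolding dw sign_dist_flip[OF s] Ea by (rule plugin_u)
  have sq: "sqrt (1 + bl) * (s * dot S a (V l)) = s * (sqrt (1 + bl) * dot S a (V l))" by simp
  show "sign_dist (sqrt (1 + (\<Sum>i\<in>B. \<sigma>\<^sup>2 / (lam l - lam i)\<^sup>2)) * dot S a w) (a l) \<le> 23409 * Ea"
    unfolding dw bl_def[symmetric] Ea sq sign_dist_flip[OF s] by (rule debiased_u)
qed

end

section \<open>From a net to all spectral parameters\<close>

text \<open>A grid in \<open>1/x\<close> of spacing \<open>\<sigma> / \<rho>\<^sup>2\<close>, so that finitely many points serve all \<open>x\<close> up to infinity.\<close>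

definition netX :: "nat => real => real => real set" where
  "netX n \<sigma> \<rho> = (\<lambda>j. \<rho>\<^sup>2 / (\<sigma> * of_int j)) ` ({- int n..int n} - {0})"

lemma card_netX: "card (netX n \<sigma> \<rho>) \<le> 2 * n"
proof -
  have "card (netX n \<sigma> \<rho>) \<le> card ({- int n..int n} - {0})" unfolding netX_def by (rule card_image_le) simp
  also have "... = 2 * n" by (subst card_Diff_singleton) auto
  finally show ?thesis .
qed

lemma finite_netX: "finite (netX n \<sigma> \<rho>)" by (simp add: netX_def)

lemma netX_close:
  assumes \<sigma>: "0 < \<sigma>" and \<rho>: "\<rho> = 51 * (\<sigma> * sqrt (real n))" and n: "16 \<le> n" and x: "50 * \<rho> \<le> \<bar>x\<bar>"
  shows "\<exists>x'\<in>netX n \<sigma> \<rho>. 25 * \<rho> \<le> \<bar>x'\<bar> \<and> \<bar>1 / x - 1 / x'\<bar> \<le> \<sigma> / \<rho>\<^sup>2"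
proof -
  have sn: "4 \<le> sqrt (real n)" using n by (intro real_le_rsqrt) auto
  have \<rho>0: "0 < \<rho>" using \<sigma> n by (simp add: \<rho>)
  define \<eta> where "\<eta> = \<sigma> / \<rho>\<^sup>2"
  have \<eta>0: "0 < \<eta>" using \<sigma> \<rho>0 by (simp add: \<eta>_def)
  have \<eta>\<rho>: "\<eta> * \<rho> = 1 / (51 * sqrt (real n))"
  proof -
    have "\<eta> * \<rho> = \<sigma> / \<rho>" using \<rho>0 by (simp add: \<eta>_def power2_eq_square)
    also have "... = 1 / (51 * sqrt (real n))" using \<sigma> n by (simp add: \<rho>)
    finally show ?thesis .
  qed
  have x0: "0 < \<bar>x\<bar>" using x \<rho>0 by linarith
  define y where "y = 1 / \<bar>x\<bar>"
  have y0: "0 < y" using x0 by (simp add: y_def)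
  have y1: "y \<le> 1 / (50 * \<rho>)" unfolding y_def using x \<rho>0 by (intro frac_le) auto
  \<comment> \<open>rounding \<open>1 / \<bar>x\<bar>\<close> up at most halves \<open>\<bar>x\<bar>\<close>, which explains the factors 50 and 25\<close>
  define m where "m = \<lceil>y / \<eta>\<rceil>"
  have m1: "y / \<eta> \<le> of_int m" "of_int m < y / \<eta> + 1" unfolding m_def by linarith+
  have m0: "0 < m" using m1(1) y0 \<eta>0 by (smt (verit) divide_pos_pos of_int_0_less_iff)
  have b: "y \<le> \<eta> * of_int m" "\<eta> * of_int m \<le> y + \<eta>" using m1 \<eta>0 by (auto simp: field_simps)
  have ye: "y / \<eta> \<le> 51/50 * sqrt (real n)"
  proof -
    have "y / \<eta> \<le> 1 / (50 * \<rho>) / \<eta>" using y1 \<eta>0 by (intro divide_right_mono) auto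
    also have "... = 1 / (50 * (\<eta> * \<rho>))" by (simp add: field_simps)
    also have "... = 51/50 * sqrt (real n)" unfolding \<eta>\<rho> by simp
    finally show ?thesis .
  qed
  have mn: "m \<le> int n"
  proof -
    have "of_int m \<le> 51/50 * sqrt (real n) + 1" using m1 ye by linarith
    also have "... \<le> 4 * sqrt (real n)" using sn by linarith
    also have "... \<le> sqrt (real n) * sqrt (real n)" using sn by (intro mult_right_mono) auto
    also have "... = real n" by simp
    finally have "real_of_int m \<le> real_of_int (int n)" by simp
    then show ?thesis by (simp only: of_int_le_iff)
  qed
  define j where "j = (if 0 < x then m else - m)"
  define x' where "x' = \<rho>\<^sup>2 / (\<sigma> * of_int j)"
  have jn: "j \<in> {- int n..int n} - {0}" using mn m0 by (auto simp: j_def)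
  have inv: "1 / x' = \<eta> * of_int j" using \<sigma> \<rho>0 by (simp add: x'_def \<eta>_def)
  have xs: "1 / x = (if 0 < x then y else - y)" using x0 by (auto simp: y_def)
  have "\<bar>1 / x - 1 / x'\<bar> = \<bar>y - \<eta> * of_int m\<bar>" unfolding inv xs j_def by (auto simp: abs_if)
  then have c: "\<bar>1 / x - 1 / x'\<bar> \<le> \<eta>" using b by linarith
  have "25 * \<rho> \<le> \<bar>x'\<bar>"
  proof -
    have "\<bar>1 / x'\<bar> = \<eta> * of_int m" unfolding inv j_def using \<eta>0 m0 by (auto simp: abs_mult)
    also have "... \<le> 1 / (50 * \<rho>) + \<eta>" using b y1 by linarith
    also have "\<eta> \<le> 1 / (50 * \<rho>)"
    proof -
      have "\<eta> * \<rho> \<le> 1 / 50" unfolding \<eta>\<rho> using sn by (simp add: divide_le_eq)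
      then show ?thesis using \<rho>0 by (simp add: field_simps)
    qed
    finally have "\<bar>1 / x'\<bar> \<le> 1 / (25 * \<rho>)" by simp
    moreover have "x' \<noteq> 0" using \<rho>0 \<sigma> jn by (auto simp: x'_def)
    ultimately show ?thesis using \<rho>0 by (simp add: field_simps)
  qed
  moreover have "x' \<in> netX n \<sigma> \<rho>" unfolding netX_def x'_def using jn by blast
  ultimately show ?thesis using c \<eta>_def by blast
qed

lemma Gmat_form:
  assumes H: "sym_on {..<n} H" and rn: "r \<le> n"
  shows "dot {..<r} v (mv {..<r} (Gmat n r H x) v) =
    dot {r..<n} (mv {..<r} H v) (mv {r..<n} (res n r H x) (mv {..<r} H v))"
proof -
  let ?T = "{..<r}" and ?B = "{r..<n}" and ?R = "res n r H x"
  have "dot ?T v (mv ?T (Gmat n r H x) v) = (\<Sum>k\<in>?T. \<Sum>k'\<in>?T. \<Sum>i\<in>?B. \<Sum>j\<in>?B. (v k * H k i) * (?R i j * (H j k' * v k')))"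
    by (simp add: dot_def mv_def Gmat_def sum_distrib_left sum_distrib_right mult_ac)
  also have "... = (\<Sum>k\<in>?T. \<Sum>i\<in>?B. \<Sum>k'\<in>?T. \<Sum>j\<in>?B. (v k * H k i) * (?R i j * (H j k' * v k')))"
    by (rule sum.cong[OF refl]) (rule sum.swap)
  also have "... = (\<Sum>i\<in>?B. \<Sum>k\<in>?T. \<Sum>k'\<in>?T. \<Sum>j\<in>?B. (v k * H k i) * (?R i j * (H j k' * v k')))" by (rule sum.swap)
  also have "... = (\<Sum>i\<in>?B. \<Sum>k\<in>?T. (H i k * v k) * (\<Sum>j\<in>?B. ?R i j * mv ?T H v j))"
  proof (intro sum.cong refl)
    fix i k assume i: "i \<in> ?B" and k: "k \<in> ?T"
    have Hs: "H k i = H i k" using H i k rn by (auto simp: sym_on_def)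
    have "(\<Sum>k'\<in>?T. \<Sum>j\<in>?B. (v k * H k i) * (?R i j * (H j k' * v k'))) = (\<Sum>j\<in>?B. \<Sum>k'\<in>?T. (v k * H k i) * (?R i j * (H j k' * v k')))"
      by (rule sum.swap)
    also have "... = (H i k * v k) * (\<Sum>j\<in>?B. ?R i j * mv ?T H v j)" unfolding Hs
      by (simp add: mv_def sum_distrib_left mult_ac)
    finally show "(\<Sum>k'\<in>?T. \<Sum>j\<in>?B. (v k * H k i) * (?R i j * (H j k' * v k'))) = (H i k * v k) * (\<Sum>j\<in>?B. ?R i j * mv ?T H v j)" .
  qed
  also have "... = dot ?B (mv ?T H v) (mv ?B ?R (mv ?T H v))"
    by (simp add: dot_def mv_def[of ?T] mv_def[of ?B] sum_distrib_right)
  finally show ?thesis .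
qed

lemma res_eig':
  assumes V: "eigsys {r..<n} H V \<mu>"
  shows "eigsys {r..<n} (res n r H x) V (\<lambda>k. inverse (x - \<mu> k))"
  unfolding res_def by (rule eigsys_pinv) (simp, unfold shiftm_def[abs_def], rule eigsys_shift[OF _ V], simp)

lemma Gmat_sym:
  assumes H: "sym_on {..<n} H" and rn: "r \<le> n"
  shows "sym_on {..<r} (Gmat n r H x)"
  unfolding sym_on_def
proof (intro ballI)
  fix k k' assume k: "k \<in> {..<r}" "k' \<in> {..<r}"
  have HB: "sym_on {r..<n} H" by (rule sym_on_subset[OF H]) auto
  obtain V \<mu> where "eigsys {r..<n} H V \<mu>" using spectral_theorem[OF _ HB] by auto
  from eigsys_sym[OF _ res_eig'[OF this]] have R: "sym_on {r..<n} (res n r H x)" by simp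
  have "Gmat n r H x k k' = (\<Sum>j\<in>{r..<n}. \<Sum>i\<in>{r..<n}. H k i * res n r H x i j * H j k')"
    unfolding Gmat_def by (rule sum.swap)
  also have "... = Gmat n r H x k' k" unfolding Gmat_def
  proof (intro sum.cong refl)
    fix i j assume "i \<in> {r..<n}" "j \<in> {r..<n}"
    then have "H k j = H j k" "H i k' = H k' i" "res n r H x j i = res n r H x i j"
      using k rn H R by (auto simp: sym_on_def)
    then show "H k j * res n r H x j i * H i k' = H k' i * res n r H x i j * H j k" by simp
  qed
  finally show "Gmat n r H x k k' = Gmat n r H x k' k" .
qed

lemma inv_diff_le:
  fixes x x' \<mu> :: real
  assumes "0 < \<rho>" "\<bar>\<mu>\<bar> \<le> \<rho>" "2 * \<rho> \<le> \<bar>x\<bar>" "2 * \<rho> \<le> \<bar>x'\<bar>" "\<bar>1 / x - 1 / x'\<bar> \<le> \<eta>"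
  shows "\<bar>inverse (x - \<mu>) - inverse (x' - \<mu>)\<bar> \<le> 4 * \<eta>"
proof -
  have h: "\<bar>x\<bar> / 2 \<le> \<bar>x - \<mu>\<bar>" "\<bar>x'\<bar> / 2 \<le> \<bar>x' - \<mu>\<bar>" using assms(2-4) by linarith+
  have p: "0 < \<bar>x\<bar>" "0 < \<bar>x'\<bar>" using assms(1,3,4) by linarith+
  have nz: "x - \<mu> \<noteq> 0" "x' - \<mu> \<noteq> 0" using h p by auto
  have i: "\<bar>inverse (x - \<mu>)\<bar> \<le> 2 / \<bar>x\<bar>" "\<bar>inverse (x' - \<mu>)\<bar> \<le> 2 / \<bar>x'\<bar>"
    by (rule inverse_le[OF p(1) h(1)], rule inverse_le[OF p(2) h(2)])
  have "inverse (x - \<mu>) - inverse (x' - \<mu>) = (x' - x) * (inverse (x - \<mu>) * inverse (x' - \<mu>))"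
    using nz by (simp add: field_simps)
  moreover have "x' - x = (1 / x - 1 / x') * (x * x')" using p by (auto simp: field_simps)
  ultimately have "inverse (x - \<mu>) - inverse (x' - \<mu>) = (1 / x - 1 / x') * (x * x') * (inverse (x - \<mu>) * inverse (x' - \<mu>))" by simp
  then have "\<bar>inverse (x - \<mu>) - inverse (x' - \<mu>)\<bar> = \<bar>1 / x - 1 / x'\<bar> * (\<bar>x\<bar> * \<bar>x'\<bar>) * (\<bar>inverse (x - \<mu>)\<bar> * \<bar>inverse (x' - \<mu>)\<bar>)"
    by (simp only: abs_mult)
  also have "... \<le> \<eta> * (\<bar>x\<bar> * \<bar>x'\<bar>) * (2 / \<bar>x\<bar> * (2 / \<bar>x'\<bar>))"
    by (intro mult_mono i assms(5) order_refl) (use p assms(5) in \<open>auto intro!: mult_nonneg_nonneg\<close>)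
  also have "... = 4 * \<eta>" using p by simp
  finally show ?thesis .
qed

text \<open>The resolvent is Lipschitz in \<open>1/x\<close>, so \<open>Gmat - gam\<close> at \<open>x\<close> and at the nearest grid point differ by at most \<open>5 \<sigma>\<close>.\<close>

lemma E_net:
  assumes H: "sym_on {..<n} H" and rn: "r \<le> n" and \<sigma>: "0 < \<sigma>" and \<rho>: "\<rho> = 51 * (\<sigma> * sqrt (real n))" and n: "16 \<le> n"
    and Hop: "opb {..<n} H \<rho>" and HT: "opb {..<r} H \<epsilon>1" and \<epsilon>0: "0 \<le> \<epsilon>1" "0 \<le> \<epsilon>3"
    and net: "\<And>x'. x' \<in> netX n \<sigma> \<rho> ==> 25 * \<rho> \<le> \<bar>x'\<bar> ==>
      opb {..<r} (\<lambda>k k'. Gmat n r H x' k k' - (if k = k' then gam n r H \<sigma> x' else 0)) \<epsilon>3"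
    and x: "50 * \<rho> \<le> \<bar>x\<bar>"
  shows "opb {..<r} (Emat n r H \<sigma> x) (\<epsilon>1 + \<epsilon>3 + 5 * \<sigma>)"
proof -
  let ?T = "{..<r}" and ?B = "{r..<n}"
  have \<rho>0: "0 < \<rho>" using \<sigma> n by (simp add: \<rho>)
  obtain x' where x': "x' \<in> netX n \<sigma> \<rho>" "25 * \<rho> \<le> \<bar>x'\<bar>" "\<bar>1 / x - 1 / x'\<bar> \<le> \<sigma> / \<rho>\<^sup>2"
    using netX_close[OF \<sigma> \<rho> n x] by blast
  have HB: "sym_on ?B H" by (rule sym_on_subset[OF H]) auto
  then obtain V \<mu> where V: "eigsys ?B H V \<mu>" using spectral_theorem[of ?B H] by auto
  have BS: "?B \<subseteq> {..<n}" by auto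
  have "opb ?B H \<rho>" by (rule opb_subset[OF _ BS Hop]) (use \<rho>0 in auto)
  then have \<mu>: "\<bar>\<mu> k\<bar> \<le> \<rho>" if "k \<in> ?B" for k using eig_le_opb[OF _ V _ that] by simp
  have d: "\<bar>inverse (x - \<mu> k) - inverse (x' - \<mu> k)\<bar> \<le> 4 * (\<sigma> / \<rho>\<^sup>2)" if "k \<in> ?B" for k
    by (rule inv_diff_le[OF \<rho>0 \<mu>[OF that] _ _ x'(3)]) (use x x'(2) \<rho>0 in auto)
  have gd: "\<bar>gam n r H \<sigma> x - gam n r H \<sigma> x'\<bar> \<le> \<sigma>"
  proof -
    have "(\<Sum>i\<in>?B. res n r H x i i) - (\<Sum>i\<in>?B. res n r H x' i i) = (\<Sum>k\<in>?B. inverse (x - \<mu> k) - inverse (x' - \<mu> k))"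
      unfolding eig_trace[OF finite_atLeastLessThan res_eig'[OF V]] by (simp add: sum_subtractf)
    then have "\<bar>(\<Sum>i\<in>?B. res n r H x i i) - (\<Sum>i\<in>?B. res n r H x' i i)\<bar> \<le> (\<Sum>k\<in>?B. 4 * (\<sigma> / \<rho>\<^sup>2))"
      by (simp only:) (rule order_trans[OF sum_abs], rule sum_mono, rule d)
    also have "... = real (n - r) * (4 * (\<sigma> / \<rho>\<^sup>2))" by simp
    also have "... \<le> real n * (4 * (\<sigma> / \<rho>\<^sup>2))" using \<sigma> by (intro mult_right_mono) auto
    finally have 1: "\<bar>(\<Sum>i\<in>?B. res n r H x i i) - (\<Sum>i\<in>?B. res n r H x' i i)\<bar> \<le> real n * (4 * (\<sigma> / \<rho>\<^sup>2))" .
    have "\<bar>gam n r H \<sigma> x - gam n r H \<sigma> x'\<bar> = \<sigma>\<^sup>2 * \<bar>(\<Sum>i\<in>?B. res n r H x i i) - (\<Sum>i\<in>?B. res n r H x' i i)\<bar>"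
      unfolding gam_def by (simp add: abs_mult flip: right_diff_distrib)
    also have "... \<le> \<sigma>\<^sup>2 * (real n * (4 * (\<sigma> / \<rho>\<^sup>2)))" by (rule mult_left_mono[OF 1]) simp
    also have "... = \<sigma> * (4 / 2601)" using \<sigma> n by (simp add: \<rho> power_mult_distrib field_simps power2_eq_square)
    also have "... \<le> \<sigma>" using \<sigma> by simp
    finally show ?thesis .
  qed
  show ?thesis
  proof (rule opb_of_form)
    show "finite ?T" by simp
    show "sym_on ?T (Emat n r H \<sigma> x)"
      using Gmat_sym[OF H rn, of x] H rn by (auto simp: sym_on_def Emat_def)
    show "0 \<le> \<epsilon>1 + \<epsilon>3 + 5 * \<sigma>" using \<epsilon>0 \<sigma> by simp
    fix v assume v1: "dot ?T v v = 1"
    define y where "y = mv ?T H v"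
    let ?Q = "\<lambda>k k'. Gmat n r H x' k k' - (if k = k' then gam n r H \<sigma> x' else 0)"
    have diag: "dot ?T v (mv ?T (\<lambda>k k'. A k k' - (if k = k' then c else 0)) v) = dot ?T v (mv ?T A v) - c" for A c
    proof -
      have "mv ?T (\<lambda>k k'. A k k' - (if k = k' then c else 0)) v k = mv ?T A v k - c * v k" if "k \<in> ?T" for k
        using that by (simp add: mv_def left_diff_distrib sum_subtractf if_distrib[of "\<lambda>y. y * _"] cong: if_cong)
      then have "dot ?T v (mv ?T (\<lambda>k k'. A k k' - (if k = k' then c else 0)) v) = dot ?T v (\<lambda>k. mv ?T A v k - c * v k)"
        by (intro dot_cong) auto
      then show ?thesis by (simp add: dot_diff_right dot_scale_right v1)
    qed
    have addm: "dot ?T v (mv ?T (\<lambda>k k'. A k k' + C k k') v) = dot ?T v (mv ?T A v) + dot ?T v (mv ?T C v)" for A C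
      by (simp add: dot_def mv_def distrib_right distrib_left sum.distrib)
    have e: "dot ?T v (mv ?T (Emat n r H \<sigma> x) v) = dot ?T v (mv ?T H v) + (dot ?T v (mv ?T (Gmat n r H x) v) - gam n r H \<sigma> x)"
      unfolding Emat_def[abs_def] addm diag ..
    have q: "dot ?T v (mv ?T ?Q v) = dot ?T v (mv ?T (Gmat n r H x') v) - gam n r H \<sigma> x'" by (rule diag)
    have G: "\<bar>dot ?T v (mv ?T (Gmat n r H x) v) - dot ?T v (mv ?T (Gmat n r H x') v)\<bar> \<le> 4 * \<sigma>"
    proof -
      have "dot ?T v (mv ?T (Gmat n r H x) v) - dot ?T v (mv ?T (Gmat n r H x') v)
         = (\<Sum>k\<in>?B. (inverse (x - \<mu> k) - inverse (x' - \<mu> k)) * (dot ?B y (V k))\<^sup>2)"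
        unfolding Gmat_form[OF H rn] y_def[symmetric] eig_form[OF finite_atLeastLessThan res_eig'[OF V]]
        by (simp add: left_diff_distrib sum_subtractf)
      also have "\<bar>...\<bar> \<le> (\<Sum>k\<in>?B. 4 * (\<sigma> / \<rho>\<^sup>2) * (dot ?B y (V k))\<^sup>2)"
      proof (rule order_trans[OF sum_abs], rule sum_mono)
        fix k assume k: "k \<in> ?B"
        show "\<bar>(inverse (x - \<mu> k) - inverse (x' - \<mu> k)) * (dot ?B y (V k))\<^sup>2\<bar> \<le> 4 * (\<sigma> / \<rho>\<^sup>2) * (dot ?B y (V k))\<^sup>2"
          unfolding abs_mult abs_power2 by (rule mult_right_mono[OF d[OF k]]) simp
      qed
      also have "... = 4 * (\<sigma> / \<rho>\<^sup>2) * dot ?B y y" unfolding eig_norm1[OF finite_atLeastLessThan V, of y] by (simp add: sum_distrib_left)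
      also have "... \<le> 4 * (\<sigma> / \<rho>\<^sup>2) * \<rho>\<^sup>2"
      proof (rule mult_left_mono)
        have "L2_set y ?B \<le> \<rho> * L2_set v ?T" unfolding y_def by (rule opb_block[OF _ _ _ Hop]) (use rn in auto)
        then have "L2_set y ?B \<le> \<rho>" using v1 by (simp add: L2_set_dot)
        then have "(L2_set y ?B)\<^sup>2 \<le> \<rho>\<^sup>2" by (intro power_mono) auto
        then show "dot ?B y y \<le> \<rho>\<^sup>2" by (simp add: L2_set_sq)
      qed (use \<sigma> in simp)
      also have "... = 4 * \<sigma>" using \<rho>0 by simp
      finally show ?thesis .
    qed
    have "\<bar>dot ?T v (mv ?T H v)\<bar> \<le> \<epsilon>1" using form_le_opb[OF HT, of v] v1 by simp
    moreover have "\<bar>dot ?T v (mv ?T ?Q v)\<bar> \<le> \<epsilon>3" using form_le_opb[OF net[OF x'(1,2)], of v] v1 by simp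
    ultimately show "\<bar>dot ?T v (mv ?T (Emat n r H \<sigma> x) v)\<bar> \<le> \<epsilon>1 + \<epsilon>3 + 5 * \<sigma>"
      using G gd unfolding e q by linarith
  qed
qed

section \<open>Tail bounds along an injective indexing\<close>

lemma frob2_eig: "finite S ==> eigsys S A V \<nu> ==> frob2 S A = (\<Sum>k\<in>S. (\<nu> k)\<^sup>2)"
  unfolding frob2_def by (rule eig_frob)

lemma quad_tail_opb:
  assumes fin: "finite I" and A: "sym_on I A" and D: "opb I A D" "0 \<le> D" and F: "frob2 I A \<le> F\<^sup>2" "0 \<le> F"
    and L: "0 < L" and \<sigma>: "0 < \<sigma>"
  shows "emeasure (iid I \<sigma>) {\<omega>\<in>space (iid I \<sigma>).
     \<sigma>\<^sup>2 * (4 * (F * sqrt L + D * L)) < \<bar>dot I \<omega> (mv I A \<omega>) - \<sigma>\<^sup>2 * tr I A\<bar>} \<le> ennreal (2 * exp (- L))"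
proof -
  obtain V \<nu> where V: "eigsys I A V \<nu>" using spectral_theorem[OF fin A] by blast
  have "(\<Sum>k\<in>I. (\<nu> k)\<^sup>2) \<le> F\<^sup>2" using F(1) frob2_eig[OF fin V] by simp
  from quad_tail[OF fin V eig_le_opb[OF fin V D(1)] D(2) this F(2) L \<sigma>] show ?thesis by (simp add: tr_def)
qed

text \<open>\<open>frob2 (A\<^sup>2) = tr A\<^sup>4\<close> dominates the fourth power of every eigenvalue.\<close>

lemma opb_fourth:
  assumes fin: "finite S" and A: "sym_on S A"
  shows "opb S A (sqrt (sqrt (frob2 S (mprod S A A))))"
proof -
  obtain V \<nu> where V: "eigsys S A V \<nu>" using spectral_theorem[OF fin A] by blast
  have f: "frob2 S (mprod S A A) = (\<Sum>k\<in>S. (\<nu> k * \<nu> k)\<^sup>2)" by (rule frob2_eig[OF fin eigsys_mprod[OF fin V V]])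
  show ?thesis
  proof (rule opb_eig[OF fin V])
    fix k assume k: "k \<in> S"
    have "(\<nu> k * \<nu> k)\<^sup>2 \<le> frob2 S (mprod S A A)" unfolding f by (rule member_le_sum[OF k]) (auto simp: fin)
    then have "sqrt ((\<nu> k * \<nu> k)\<^sup>2) \<le> sqrt (frob2 S (mprod S A A))" by (rule real_sqrt_le_mono)
    moreover have "sqrt ((\<nu> k * \<nu> k)\<^sup>2) = (\<nu> k)\<^sup>2" by (simp only: real_sqrt_abs) (simp add: power2_eq_square)
    ultimately have "(\<nu> k)\<^sup>2 \<le> sqrt (frob2 S (mprod S A A))" by (simp only:)
    then show "\<bar>\<nu> k\<bar> \<le> sqrt (sqrt (frob2 S (mprod S A A)))" by (rule real_le_rsqrt[of "\<bar>\<nu> k\<bar>", unfolded power2_abs])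
  qed (simp add: frob2_def sum_nonneg)
qed

lemma quad_tail_reindex:
  fixes A :: "'k => 'k => real"
  assumes fin: "finite K" and inj: "inj_on \<phi> K" and A: "sym_on K A" and D: "opb K A D" "0 \<le> D"
    and F: "frob2 K A \<le> F\<^sup>2" "0 \<le> F" and L: "0 < L" and \<sigma>: "0 < \<sigma>"
  shows "emeasure (iid (\<phi> ` K) \<sigma>) {\<omega>\<in>space (iid (\<phi> ` K) \<sigma>).
     \<sigma>\<^sup>2 * (4 * (F * sqrt L + D * L)) < \<bar>dot K (\<lambda>i. \<omega> (\<phi> i)) (mv K A (\<lambda>i. \<omega> (\<phi> i))) - \<sigma>\<^sup>2 * tr K A\<bar>} \<le> ennreal (2 * exp (- L))"
proof -
  define \<pi> where "\<pi> = the_inv_into K \<phi>"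
  have \<pi>: "\<pi> (\<phi> i) = i" if "i \<in> K" for i unfolding \<pi>_def by (rule the_inv_into_f_f[OF inj that])
  define A' where "A' p q = A (\<pi> p) (\<pi> q)" for p q
  have re: "(\<Sum>p\<in>\<phi> ` K. f p) = (\<Sum>i\<in>K. f (\<phi> i))" for f :: "'a => real" by (simp add: sum.reindex[OF inj])
  have mvA: "mv (\<phi> ` K) A' v (\<phi> i) = mv K A (\<lambda>i. v (\<phi> i)) i" if "i \<in> K" for v i
    unfolding mv_def re by (rule sum.cong) (use \<pi> that in \<open>auto simp: A'_def\<close>)
  have dt: "dot (\<phi> ` K) u v = dot K (\<lambda>i. u (\<phi> i)) (\<lambda>i. v (\<phi> i))" for u v by (simp add: dot_def re)
  have "sym_on (\<phi> ` K) A'" using A by (auto simp: sym_on_def A'_def \<pi>)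
  moreover have "opb (\<phi> ` K) A' D" unfolding opb_def
  proof
    fix v
    have "dot (\<phi> ` K) (mv (\<phi> ` K) A' v) (mv (\<phi> ` K) A' v) = dot K (mv K A (\<lambda>i. v (\<phi> i))) (mv K A (\<lambda>i. v (\<phi> i)))"
      unfolding dt by (rule dot_cong) (use mvA in auto)
    then show "L2_set (mv (\<phi> ` K) A' v) (\<phi> ` K) \<le> D * L2_set v (\<phi> ` K)"
      using opbD[OF D(1), of "\<lambda>i. v (\<phi> i)"] by (simp add: L2_set_dot dt)
  qed
  moreover have "frob2 (\<phi> ` K) A' \<le> F\<^sup>2" using F(1) unfolding frob2_def re by (simp add: A'_def \<pi>)
  ultimately have "emeasure (iid (\<phi> ` K) \<sigma>) {\<omega>\<in>space (iid (\<phi> ` K) \<sigma>).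
     \<sigma>\<^sup>2 * (4 * (F * sqrt L + D * L)) < \<bar>dot (\<phi> ` K) \<omega> (mv (\<phi> ` K) A' \<omega>) - \<sigma>\<^sup>2 * tr (\<phi> ` K) A'\<bar>} \<le> ennreal (2 * exp (- L))"
    using fin D(2) F(2) L \<sigma> by (intro quad_tail_opb) auto
  moreover have "dot (\<phi> ` K) \<omega> (mv (\<phi> ` K) A' \<omega>) = dot K (\<lambda>i. \<omega> (\<phi> i)) (mv K A (\<lambda>i. \<omega> (\<phi> i)))" for \<omega>
    unfolding dt by (rule dot_cong) (use mvA in auto)
  moreover have "tr (\<phi> ` K) A' = tr K A" unfolding tr_def re by (simp add: A'_def \<pi>)
  ultimately show ?thesis by simp
qed

lemma lin_tail_reindex:
  fixes w :: "'k => real"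
  assumes fin: "finite K" and inj: "inj_on \<phi> K" and L: "0 \<le> L" and \<sigma>: "0 < \<sigma>"
  shows "emeasure (iid (\<phi> ` K) \<sigma>) {\<omega>\<in>space (iid (\<phi> ` K) \<sigma>).
     sqrt (2 * L) * (\<sigma> * L2_set w K) < \<bar>\<Sum>i\<in>K. w i * \<omega> (\<phi> i)\<bar>} \<le> ennreal (2 * exp (- L))"
proof -
  define \<pi> where "\<pi> = the_inv_into K \<phi>"
  have \<pi>: "\<pi> (\<phi> i) = i" if "i \<in> K" for i unfolding \<pi>_def by (rule the_inv_into_f_f[OF inj that])
  have re: "(\<Sum>p\<in>\<phi> ` K. f p) = (\<Sum>i\<in>K. f (\<phi> i))" for f :: "'a => real" by (simp add: sum.reindex[OF inj])
  have "(\<Sum>p\<in>\<phi> ` K. \<sigma>\<^sup>2 * (w (\<pi> p))\<^sup>2) = \<sigma>\<^sup>2 * (\<Sum>i\<in>K. (w i)\<^sup>2)"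
    unfolding re by (simp add: \<pi> sum_distrib_left)
  also have "... = (\<sigma> * L2_set w K)\<^sup>2" by (simp add: power_mult_distrib L2_set_def sum_nonneg)
  finally have "(\<Sum>p\<in>\<phi> ` K. \<sigma>\<^sup>2 * (w (\<pi> p))\<^sup>2) \<le> (\<sigma> * L2_set w K)\<^sup>2" by simp
  from lin_tail[OF _ _ this _ L] have "emeasure (iid (\<phi> ` K) \<sigma>) {\<omega>\<in>space (iid (\<phi> ` K) \<sigma>).
     sqrt (2 * L) * (\<sigma> * L2_set w K) < \<bar>\<Sum>p\<in>\<phi> ` K. w (\<pi> p) * \<omega> p\<bar>} \<le> ennreal (2 * exp (- L))"
    using fin \<sigma> by simp
  moreover have "(\<Sum>p\<in>\<phi> ` K. w (\<pi> p) * \<omega> p) = (\<Sum>i\<in>K. w i * \<omega> (\<phi> i))" for \<omega>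
    unfolding re by (simp add: \<pi>)
  ultimately show ?thesis by simp
qed

section \<open>The noise\<close>

definition Idx :: "nat => (nat \<times> nat) set" where "Idx n = {(i, j). j \<le> i \<and> i < n}"
definition sd :: "real => nat \<times> nat => real" where "sd \<sigma> p = (if fst p = snd p then sqrt 2 * \<sigma> else \<sigma>)"
definition noi :: "nat => real => (nat \<times> nat => real) measure" where "noi n \<sigma> = PiM (Idx n) (\<lambda>p. nd (sd \<sigma> p))"
text \<open>Symmetric matrix entries read from the lower triangle.\<close>

definition ent :: "(nat \<times> nat => real) => nat => nat => real" where "ent w i j = w (max i j, min i j)"

lemma noise_law_noi: "noise_law n \<sigma> = noi n \<sigma>"
proof -
  have "(\<lambda>(i, j). density lborel (normal_density 0 (if i = j then sqrt 2 * \<sigma> else \<sigma>))) = (\<lambda>p. nd (sd \<sigma> p))"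
    by (auto simp: nd_def sd_def fun_eq_iff)
  then show ?thesis by (simp add: noise_law_def noi_def Idx_def)
qed

lemma finite_Idx: "finite (Idx n)"
  by (rule finite_subset[of _ "{..<n} \<times> {..<n}"]) (auto simp: Idx_def)

lemma sd_pos: "0 < \<sigma> ==> 0 < sd \<sigma> p" by (simp add: sd_def)

lemma ent_sym: "ent w i j = ent w j i" by (simp add: ent_def max.commute min.commute)

lemma ent_sym_on: "sym_on S (ent w)" by (simp add: sym_on_def ent_sym)

lemma Idx_mem: "i < n ==> j < n ==> (max i j, min i j) \<in> Idx n" by (auto simp: Idx_def)

lemma ent_meas: "i < n ==> j < n ==> (\<lambda>w. ent w i j) \<in> borel_measurable (noi n \<sigma>)"
  unfolding ent_def noi_def by (rule component_measurable[OF Idx_mem])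

lemma prob_noi: "0 < \<sigma> ==> prob_space (noi n \<sigma>)"
  unfolding noi_def by (rule prob_PiM_nd) (rule sd_pos)

text \<open>Folding a symmetric double sum onto the lower triangle counts off-diagonal entries twice, which is exactly the ratio of the variances on and off the diagonal.\<close>

lemma sym_sum:
  fixes F :: "nat => nat => real"
  assumes fin: "finite T" and F: "\<And>i j. i \<in> T ==> j \<in> T ==> F i j = F j i"
  shows "(\<Sum>i\<in>T. \<Sum>j\<in>T. F i j) = (\<Sum>p\<in>{(i, j). i \<in> T \<and> j \<in> T \<and> j \<le> i}. (if fst p = snd p then 1 else 2) * F (fst p) (snd p))"
proof -
  have "(\<Sum>i\<in>T. \<Sum>j\<in>T. F i j) = (\<Sum>i\<in>T. \<Sum>j\<in>T. (if j \<le> i then F i j else 0)) + (\<Sum>i\<in>T. \<Sum>j\<in>T. (if i < j then F i j else 0))"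
    unfolding sum.distrib[symmetric] by (intro sum.cong refl) auto
  also have "(\<Sum>i\<in>T. \<Sum>j\<in>T. (if i < j then F i j else 0)) = (\<Sum>j\<in>T. \<Sum>i\<in>T. (if i < j then F i j else 0))" by (rule sum.swap)
  also have "... = (\<Sum>i\<in>T. \<Sum>j\<in>T. (if j < i then F i j else 0))"
    by (intro sum.cong refl) (use F in auto)
  also have "(\<Sum>i\<in>T. \<Sum>j\<in>T. (if j \<le> i then F i j else 0)) + (\<Sum>i\<in>T. \<Sum>j\<in>T. (if j < i then F i j else 0)) =
     (\<Sum>i\<in>T. \<Sum>j\<in>T. (if j \<le> i then (if i = j then 1 else 2) * F i j else 0))"
    unfolding sum.distrib[symmetric] by (intro sum.cong refl) auto
  also have "... = (\<Sum>p\<in>T \<times> T. (if snd p \<le> fst p then (if fst p = snd p then 1 else 2) * F (fst p) (snd p) else 0))"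
    by (simp add: sum.cartesian_product split_def)
  also have "... = (\<Sum>p\<in>{(i, j). i \<in> T \<and> j \<in> T \<and> j \<le> i}. (if fst p = snd p then 1 else 2) * F (fst p) (snd p))"
    by (rule sum.mono_neutral_cong_right) (use fin in auto)
  finally show ?thesis .
qed

text \<open>The doubled variance on the diagonal makes the variance of the form the constant \<open>2 \<sigma>\<^sup>2 \<bar>\<zeta>\<bar>\<^sup>4\<close> on spheres, at most \<open>5 \<sigma>\<^sup>2\<close> on the net.\<close>

lemma net_form_prob:
  assumes T: "T \<subseteq> {..<n}" and z: "z \<in> netZ T" and L: "0 \<le> L" and \<sigma>: "0 < \<sigma>"
  shows "emeasure (noi n \<sigma>) {w \<in> space (noi n \<sigma>). sqrt (2 * L) * (sqrt 5 * \<sigma>) < \<bar>dot T (netp T z) (mv T (ent w) (netp T z))\<bar>}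
    \<le> ennreal (2 * exp (- L))"
proof -
  have fT: "finite T" using T finite_subset by auto
  define \<zeta> where "\<zeta> = netp T z"
  define Tr where "Tr = {(i, j). i \<in> T \<and> j \<in> T \<and> j \<le> i}"
  have TrI: "Tr \<subseteq> Idx n" using T by (auto simp: Tr_def Idx_def)
  define wt :: "nat \<times> nat => real" where "wt p = (if fst p = snd p then 1 else 2)" for p
  define c where "c p = (if p \<in> Tr then wt p * (\<zeta> (fst p) * \<zeta> (snd p)) else 0)" for p
  have form: "dot T \<zeta> (mv T (ent w) \<zeta>) = (\<Sum>p\<in>Idx n. c p * w p)" for w
  proof -
    have "dot T \<zeta> (mv T (ent w) \<zeta>) = (\<Sum>i\<in>T. \<Sum>j\<in>T. \<zeta> i * \<zeta> j * ent w i j)"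
      by (simp add: dot_def mv_def sum_distrib_left mult_ac)
    also have "... = (\<Sum>p\<in>Tr. wt p * (\<zeta> (fst p) * \<zeta> (snd p) * ent w (fst p) (snd p)))"
      unfolding Tr_def wt_def by (rule sym_sum[OF fT]) (simp add: ent_sym mult_ac)
    also have "... = (\<Sum>p\<in>Tr. c p * w p)"
      by (rule sum.cong) (auto simp: c_def Tr_def ent_def max_def min_def)
    also have "... = (\<Sum>p\<in>Idx n. c p * w p)"
      by (rule sum.mono_neutral_left) (use TrI finite_Idx in \<open>auto simp: c_def\<close>)
    finally show ?thesis .
  qed
  have "(\<Sum>p\<in>Idx n. (sd \<sigma> p)\<^sup>2 * (c p)\<^sup>2) = (\<Sum>p\<in>Tr. (sd \<sigma> p)\<^sup>2 * (c p)\<^sup>2)"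
    by (rule sum.mono_neutral_right) (use TrI finite_Idx in \<open>auto simp: c_def\<close>)
  also have "... = (\<Sum>p\<in>Tr. wt p * (2 * \<sigma>\<^sup>2 * ((\<zeta> (fst p))\<^sup>2 * (\<zeta> (snd p))\<^sup>2)))"
    by (rule sum.cong) (auto simp: c_def sd_def wt_def power_mult_distrib)
  also have "... = (\<Sum>i\<in>T. \<Sum>j\<in>T. 2 * \<sigma>\<^sup>2 * ((\<zeta> i)\<^sup>2 * (\<zeta> j)\<^sup>2))"
    unfolding Tr_def wt_def by (rule sym_sum[OF fT, symmetric]) simp
  also have "... = 2 * \<sigma>\<^sup>2 * (dot T \<zeta> \<zeta>)\<^sup>2"
    by (simp add: dot_def power2_eq_square sum_product sum_distrib_left sum_distrib_right mult_ac)
  also have "... \<le> 2 * \<sigma>\<^sup>2 * (25/16)\<^sup>2"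
    by (intro mult_left_mono power_mono) (use netp_norm[OF fT z] in \<open>auto simp: \<zeta>_def dot_self_nonneg\<close>)
  also have "... \<le> (sqrt 5 * \<sigma>)\<^sup>2" by (simp add: power_mult_distrib power2_eq_square[of "25/16"])
  finally have v: "(\<Sum>p\<in>Idx n. (sd \<sigma> p)\<^sup>2 * (c p)\<^sup>2) \<le> (sqrt 5 * \<sigma>)\<^sup>2" .
  show ?thesis using lin_tail[OF finite_Idx sd_pos[OF \<sigma>] v _ L] \<sigma>
    unfolding form[unfolded \<zeta>_def] noi_def by simp
qed

definition netbad :: "nat => real => nat set => real => (nat \<times> nat => real) => bool" where
  "netbad n \<sigma> T L w \<longleftrightarrow> (\<exists>z\<in>netZ T. sqrt (2 * L) * (sqrt 5 * \<sigma>) < \<bar>dot T (netp T z) (mv T (ent w) (netp T z))\<bar>)"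

lemma netbad_meas:
  assumes T: "T \<subseteq> {..<n}"
  shows "{w \<in> space (noi n \<sigma>). netbad n \<sigma> T L w} \<in> sets (noi n \<sigma>)"
proof -
  have fT: "finite T" using T finite_subset by auto
  have m: "(\<lambda>w. dot T \<zeta> (mv T (ent w) \<zeta>)) \<in> borel_measurable (noi n \<sigma>)" for \<zeta>
    unfolding dot_def mv_def
    by (intro poly_measurable ent_meas) (use T in auto)
  have "{w \<in> space (noi n \<sigma>). netbad n \<sigma> T L w} =
     (\<Union>z\<in>netZ T. {w \<in> space (noi n \<sigma>). sqrt (2 * L) * (sqrt 5 * \<sigma>) < \<bar>dot T (netp T z) (mv T (ent w) (netp T z))\<bar>})"
    by (auto simp: netbad_def)
  also have "... \<in> sets (noi n \<sigma>)"
    by (rule sets.finite_UN[OF finite_netZ[OF fT]]) (intro borel_measurable_less borel_measurable_abs borel_measurable_const m)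
  finally show ?thesis .
qed

lemma union_bound:
  assumes fin: "finite Z" and m: "\<And>z. z \<in> Z ==> A z \<in> sets M" and b: "\<And>z. z \<in> Z ==> emeasure M (A z) \<le> ennreal p" and p: "0 \<le> p"
  shows "emeasure M (\<Union>z\<in>Z. A z) \<le> ennreal (real (card Z) * p)"
proof -
  have "emeasure M (\<Union>z\<in>Z. A z) \<le> (\<Sum>z\<in>Z. emeasure M (A z))"
    by (rule emeasure_subadditive_finite[OF fin]) (use m in auto)
  also have "... \<le> (\<Sum>z\<in>Z. ennreal p)" by (rule sum_mono) (rule b)
  also have "... = ennreal (real (card Z) * p)" using p by (simp add: ennreal_mult ennreal_of_nat_eq_real_of_nat)
  finally show ?thesis .
qed

lemma netbad_prob:
  assumes T: "T \<subseteq> {..<n}" and L: "0 \<le> L" and \<sigma>: "0 < \<sigma>"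
  shows "emeasure (noi n \<sigma>) {w \<in> space (noi n \<sigma>). netbad n \<sigma> T L w} \<le> ennreal (exp (27 * real (card T)) * (2 * exp (- L)))"
proof -
  have fT: "finite T" using T finite_subset by auto
  have m: "(\<lambda>w. dot T \<zeta> (mv T (ent w) \<zeta>)) \<in> borel_measurable (noi n \<sigma>)" for \<zeta>
    unfolding dot_def mv_def
    by (intro poly_measurable ent_meas) (use T in auto)
  have "{w \<in> space (noi n \<sigma>). netbad n \<sigma> T L w} =
     (\<Union>z\<in>netZ T. {w \<in> space (noi n \<sigma>). sqrt (2 * L) * (sqrt 5 * \<sigma>) < \<bar>dot T (netp T z) (mv T (ent w) (netp T z))\<bar>})"
    by (auto simp: netbad_def)
  also have "emeasure (noi n \<sigma>) ... \<le> ennreal (real (card (netZ T)) * (2 * exp (- L)))"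
    by (rule union_bound[OF finite_netZ[OF fT]])
       (auto intro!: net_form_prob T L \<sigma> borel_measurable_less borel_measurable_abs m)
  also have "... \<le> ennreal (exp (27 * real (card T)) * (2 * exp (- L)))"
    by (intro ennreal_leI mult_right_mono card_netZ[OF fT]) auto
  finally show ?thesis .
qed

lemma not_netbad_opb:
  assumes T: "finite T" and nb: "\<not> netbad n \<sigma> T L w" and \<sigma>: "0 < \<sigma>" and L: "0 \<le> L"
  shows "opb T (ent w) (16/7 * (sqrt (2 * L) * (sqrt 5 * \<sigma>)))"
  by (rule net_opnorm[OF T ent_sym_on]) (use nb \<sigma> L in \<open>auto simp: netbad_def not_less\<close>)

section \<open>Tail bounds with coefficients that depend on the other entries\<close>

text \<open>\<open>J\<close> avoids the diagonal, so its entries all have standard deviation \<open>\<sigma>\<close>.\<close>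

lemma cond_bound:
  assumes J: "J \<subseteq> Idx n" and \<sigma>: "0 < \<sigma>" and off: "\<And>p. p \<in> J ==> fst p \<noteq> snd p"
    and P: "P \<in> sets (noi n \<sigma>)"
    and bd: "\<And>y. emeasure (iid J \<sigma>) {z \<in> space (iid J \<sigma>). merge (Idx n - J) J (y, z) \<in> P} \<le> \<delta>"
  shows "emeasure (noi n \<sigma>) P \<le> \<delta>"
proof -
  have I: "(Idx n - J) \<union> J = Idx n" using J by auto
  have e: "PiM J (\<lambda>p. nd (sd \<sigma> p)) = PiM J (\<lambda>_. nd \<sigma>)"
    by (rule PiM_cong) (use off in \<open>auto simp: sd_def\<close>)
  have "emeasure (PiM ((Idx n - J) \<union> J) (\<lambda>p. nd (sd \<sigma> p))) P \<le> \<delta>"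
    by (rule section_bound) (use finite_Idx finite_subset[OF J finite_Idx] sd_pos[OF \<sigma>] P bd in \<open>auto simp: I e noi_def simp del: Un_Diff_cancel2\<close>)
  then show ?thesis by (simp only: I noi_def)
qed

lemma merge_in: "p \<in> J ==> I \<inter> J = {} ==> merge I J (y, z) p = z p"
  by (auto simp: merge_def)

lemma merge_out: "p \<in> I ==> merge I J (y, z) p = y p"
  by (auto simp: merge_def)

lemma res_meas:
  assumes "r \<le> n" "i \<in> {r..<n}" "j \<in> {r..<n}"
  shows "(\<lambda>w. res n r (ent w) x i j) \<in> borel_measurable (noi n \<sigma>)"
  unfolding res_def
proof (rule pinv_measurable[OF _ assms(2,3)])
  fix i j assume "i \<in> {r..<n}" "j \<in> {r..<n}"
  then show "(\<lambda>w. shiftm x (ent w) i j) \<in> borel_measurable (noi n \<sigma>)" unfolding shiftm_def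
    by (intro borel_measurable_diff borel_measurable_const ent_meas) auto
qed

lemma res_cong:
  assumes "\<And>i j. i \<in> {r..<n} ==> j \<in> {r..<n} ==> H i j = H' i j" "i \<in> {r..<n}" "j \<in> {r..<n}"
  shows "res n r H x i j = res n r H' x i j"
  unfolding res_def by (rule pinv_cong[OF _ assms(2,3)]) (simp add: shiftm_def assms(1))

lemma res_sym: "sym_on {r..<n} H ==> sym_on {r..<n} (res n r H x)"
  unfolding res_def by (rule pinv_sym) (auto simp: sym_on_def shiftm_def)


lemma sqrt_measurable: "f \<in> borel_measurable M ==> (\<lambda>x. sqrt (f x)) \<in> borel_measurable M"
  by measurable

lemma cond_lin_prob:
  fixes \<phi> :: "nat => nat \<times> nat" and W :: "(nat \<times> nat => real) => nat => real"
  assumes fin: "finite K" and inj: "inj_on \<phi> K" and J: "\<phi> ` K \<subseteq> Idx n" and off: "\<forall>i\<in>K. fst (\<phi> i) \<noteq> snd (\<phi> i)"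
    and ind: "\<forall>w w'. (\<forall>p\<in>Idx n - \<phi> ` K. w p = w' p) --> (\<forall>i\<in>K. W w i = W w' i)"
    and meas: "\<forall>i\<in>K. (\<lambda>w. W w i) \<in> borel_measurable (noi n \<sigma>)"
    and L: "0 \<le> L" and \<sigma>: "0 < \<sigma>"
  defines "P \<equiv> {w \<in> space (noi n \<sigma>). sqrt (2 * L) * (\<sigma> * L2_set (W w) K) < \<bar>\<Sum>i\<in>K. W w i * w (\<phi> i)\<bar>}"
  shows "P \<in> sets (noi n \<sigma>)" "emeasure (noi n \<sigma>) P \<le> ennreal (2 * exp (- L))"
proof -
  have comp: "(\<lambda>w. w (\<phi> i)) \<in> borel_measurable (noi n \<sigma>)" if "i \<in> K" for i
    unfolding noi_def by (rule component_measurable) (use J that in auto)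
  show P: "P \<in> sets (noi n \<sigma>)" unfolding P_def L2_set_def
    by (intro borel_measurable_less borel_measurable_abs borel_measurable_times borel_measurable_sum borel_measurable_const
        sqrt_measurable borel_measurable_power meas[rule_format] comp) auto
  let ?J = "\<phi> ` K"
  show "emeasure (noi n \<sigma>) P \<le> ennreal (2 * exp (- L))"
  proof (rule cond_bound[OF J \<sigma> _ P])
    show "fst p \<noteq> snd p" if "p \<in> ?J" for p using that off by auto
    fix y
    have same: "W (merge (Idx n - ?J) ?J (y, z)) i = W y i" if i: "i \<in> K" for z i
      using ind[rule_format, of "merge (Idx n - ?J) ?J (y, z)" y i] i by (simp add: merge_out)
    have "{z \<in> space (iid ?J \<sigma>). merge (Idx n - ?J) ?J (y, z) \<in> P} \<subseteq>
       {z \<in> space (iid ?J \<sigma>). sqrt (2 * L) * (\<sigma> * L2_set (W y) K) < \<bar>\<Sum>i\<in>K. W y i * z (\<phi> i)\<bar>}"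
    proof safe
      fix z assume z: "merge (Idx n - ?J) ?J (y, z) \<in> P"
      have "L2_set (W (merge (Idx n - ?J) ?J (y, z))) K = L2_set (W y) K"
        by (rule L2_set_cong[OF refl same])
      moreover have "(\<Sum>i\<in>K. W (merge (Idx n - ?J) ?J (y, z)) i * merge (Idx n - ?J) ?J (y, z) (\<phi> i)) = (\<Sum>i\<in>K. W y i * z (\<phi> i))"
        by (rule sum.cong) (auto simp: same merge_in)
      ultimately show "sqrt (2 * L) * (\<sigma> * L2_set (W y) K) < \<bar>\<Sum>i\<in>K. W y i * z (\<phi> i)\<bar>"
        using z by (simp add: P_def)
    qed
    then have "emeasure (iid ?J \<sigma>) {z \<in> space (iid ?J \<sigma>). merge (Idx n - ?J) ?J (y, z) \<in> P} \<le>
       emeasure (iid ?J \<sigma>) {z \<in> space (iid ?J \<sigma>). sqrt (2 * L) * (\<sigma> * L2_set (W y) K) < \<bar>\<Sum>i\<in>K. W y i * z (\<phi> i)\<bar>}"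
    proof (rule emeasure_mono)
      have "(\<lambda>z. \<Sum>i\<in>K. W y i * z (\<phi> i)) \<in> borel_measurable (iid ?J \<sigma>)"
        by (intro poly_measurable component_measurable) auto
      then show "{z \<in> space (iid ?J \<sigma>). sqrt (2 * L) * (\<sigma> * L2_set (W y) K) < \<bar>\<Sum>i\<in>K. W y i * z (\<phi> i)\<bar>} \<in> sets (iid ?J \<sigma>)"
        by measurable
    qed
    also have "... \<le> ennreal (2 * exp (- L))" by (rule lin_tail_reindex[OF fin inj L \<sigma>])
    finally show "emeasure (iid ?J \<sigma>) {z \<in> space (iid ?J \<sigma>). merge (Idx n - ?J) ?J (y, z) \<in> P} \<le> ennreal (2 * exp (- L))" .
  qed
qed

text \<open>\<open>G\<close> restricts to the outcomes on which the matrix has the norm bounds; like the matrix, it does not depend on the entries in the form.\<close>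

lemma cond_quad_prob:
  fixes \<phi> :: "'k => nat \<times> nat" and A :: "(nat \<times> nat => real) => 'k => 'k => real"
  assumes fin: "finite K" and inj: "inj_on \<phi> K" and J: "\<phi> ` K \<subseteq> Idx n" and off: "\<forall>i\<in>K. fst (\<phi> i) \<noteq> snd (\<phi> i)"
    and ind: "\<forall>w w'. (\<forall>p\<in>Idx n - \<phi> ` K. w p = w' p) -->
      (\<forall>i\<in>K. \<forall>j\<in>K. A w i j = A w' i j) \<and> F w = F w' \<and> D w = D w' \<and> (G w --> G w')"
    and meas: "\<forall>i\<in>K. \<forall>j\<in>K. (\<lambda>w. A w i j) \<in> borel_measurable (noi n \<sigma>)"
      "F \<in> borel_measurable (noi n \<sigma>)" "D \<in> borel_measurable (noi n \<sigma>)" "{w \<in> space (noi n \<sigma>). G w} \<in> sets (noi n \<sigma>)"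
    and A: "\<forall>w. G w --> sym_on K (A w) \<and> opb K (A w) (D w) \<and> 0 \<le> D w \<and> frob2 K (A w) \<le> (F w)\<^sup>2 \<and> 0 \<le> F w"
    and L: "0 < L" and \<sigma>: "0 < \<sigma>"
  defines "P \<equiv> {w \<in> space (noi n \<sigma>). G w \<and> \<sigma>\<^sup>2 * (4 * (F w * sqrt L + D w * L)) <
      \<bar>dot K (\<lambda>i. w (\<phi> i)) (mv K (A w) (\<lambda>i. w (\<phi> i))) - \<sigma>\<^sup>2 * tr K (A w)\<bar>}"
  shows "P \<in> sets (noi n \<sigma>)" "emeasure (noi n \<sigma>) P \<le> ennreal (2 * exp (- L))"
proof -
  have comp: "(\<lambda>w. w (\<phi> i)) \<in> borel_measurable (noi n \<sigma>)" if "i \<in> K" for i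
    unfolding noi_def by (rule component_measurable) (use J that in auto)
  have P': "P = {w \<in> space (noi n \<sigma>). G w} \<inter> {w \<in> space (noi n \<sigma>). \<sigma>\<^sup>2 * (4 * (F w * sqrt L + D w * L)) <
      \<bar>dot K (\<lambda>i. w (\<phi> i)) (mv K (A w) (\<lambda>i. w (\<phi> i))) - \<sigma>\<^sup>2 * tr K (A w)\<bar>}" by (auto simp: P_def)
  show P: "P \<in> sets (noi n \<sigma>)" unfolding P' dot_def mv_def tr_def
    by (intro sets.Int meas(2-4) meas(1)[rule_format] borel_measurable_less borel_measurable_abs borel_measurable_times borel_measurable_sum borel_measurable_const
        borel_measurable_diff borel_measurable_add comp)
  let ?J = "\<phi> ` K"
  show "emeasure (noi n \<sigma>) P \<le> ennreal (2 * exp (- L))"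
  proof (rule cond_bound[OF J \<sigma> _ P])
    show "fst p \<noteq> snd p" if "p \<in> ?J" for p using that off by auto
    fix y :: "nat \<times> nat => real"
    let ?m = "\<lambda>z. merge (Idx n - ?J) ?J (y, z)"
    have mo: "?m z p = y p" if "p \<in> Idx n - ?J" for z p by (rule merge_out[OF that])
    have same: "(\<forall>i\<in>K. \<forall>j\<in>K. A (?m z) i j = A y i j) \<and> F (?m z) = F y \<and> D (?m z) = D y \<and> (G (?m z) --> G y)" for z
      using ind[rule_format, of "?m z" y] mo by blast
    show "emeasure (iid ?J \<sigma>) {z \<in> space (iid ?J \<sigma>). ?m z \<in> P} \<le> ennreal (2 * exp (- L))"
    proof (cases "G y")
      case False
      then have "{z \<in> space (iid ?J \<sigma>). ?m z \<in> P} = {}" using same by (auto simp: P_def)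
      then show ?thesis by (simp only: emeasure_empty) simp
    next
      case Gy: True
      have "{z \<in> space (iid ?J \<sigma>). ?m z \<in> P} \<subseteq>
         {z \<in> space (iid ?J \<sigma>). \<sigma>\<^sup>2 * (4 * (F y * sqrt L + D y * L)) <
          \<bar>dot K (\<lambda>i. z (\<phi> i)) (mv K (A y) (\<lambda>i. z (\<phi> i))) - \<sigma>\<^sup>2 * tr K (A y)\<bar>}"
      proof safe
        fix z assume z: "?m z \<in> P"
        have "dot K (\<lambda>i. ?m z (\<phi> i)) (mv K (A (?m z)) (\<lambda>i. ?m z (\<phi> i))) = dot K (\<lambda>i. z (\<phi> i)) (mv K (A y) (\<lambda>i. z (\<phi> i)))"
          unfolding dot_def mv_def by (intro sum.cong refl) (simp add: same merge_in)
        moreover have "tr K (A (?m z)) = tr K (A y)" unfolding tr_def by (intro sum.cong refl) (simp add: same)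
        ultimately show "\<sigma>\<^sup>2 * (4 * (F y * sqrt L + D y * L)) <
          \<bar>dot K (\<lambda>i. z (\<phi> i)) (mv K (A y) (\<lambda>i. z (\<phi> i))) - \<sigma>\<^sup>2 * tr K (A y)\<bar>"
          using z same[of z] by (simp add: P_def)
      qed
      then have "emeasure (iid ?J \<sigma>) {z \<in> space (iid ?J \<sigma>). ?m z \<in> P} \<le>
         emeasure (iid ?J \<sigma>) {z \<in> space (iid ?J \<sigma>). \<sigma>\<^sup>2 * (4 * (F y * sqrt L + D y * L)) <
          \<bar>dot K (\<lambda>i. z (\<phi> i)) (mv K (A y) (\<lambda>i. z (\<phi> i))) - \<sigma>\<^sup>2 * tr K (A y)\<bar>}"
      proof (rule emeasure_mono)
        have "(\<lambda>z. dot K (\<lambda>i. z (\<phi> i)) (mv K (A y) (\<lambda>i. z (\<phi> i)))) \<in> borel_measurable (iid ?J \<sigma>)"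
          unfolding dot_def mv_def
          by (intro poly_measurable component_measurable) auto
        then show "{z \<in> space (iid ?J \<sigma>). \<sigma>\<^sup>2 * (4 * (F y * sqrt L + D y * L)) <
          \<bar>dot K (\<lambda>i. z (\<phi> i)) (mv K (A y) (\<lambda>i. z (\<phi> i))) - \<sigma>\<^sup>2 * tr K (A y)\<bar>} \<in> sets (iid ?J \<sigma>)"
          by measurable
      qed
      also have "... \<le> ennreal (2 * exp (- L))"
        by (rule quad_tail_reindex[OF fin inj]) (use A Gy L \<sigma> in auto)
      finally show ?thesis .
    qed
  qed
qed

section \<open>The concentration events\<close>

lemma sqrt32: "0 \<le> lg ==> 0 \<le> c ==> sqrt (2 * (16 * lg)) * c \<le> 6 * sqrt lg * c"
proof -
  assume a: "0 \<le> lg" "0 \<le> c"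
  have "sqrt (2 * (16 * lg)) = sqrt 32 * sqrt lg" by (simp flip: real_sqrt_mult)
  moreover have "sqrt 32 \<le> 6" by (rule real_le_lsqrt) auto
  ultimately have "sqrt (2 * (16 * lg)) \<le> 6 * sqrt lg" using a by (simp add: mult_right_mono)
  then show ?thesis by (rule mult_right_mono) (rule a)
qed

text \<open>The resolvent of \<open>H_BB\<close> is independent of the entries \<open>H i k\<close> with \<open>i \<in> B\<close>, \<open>k \<in> T\<close>.\<close>

lemma rows_prob:
  assumes rn: "r \<le> n" and \<sigma>: "0 < \<sigma>" and lg: "0 \<le> lg" and k: "k < r"
  shows "\<exists>P\<in>sets (noi n \<sigma>). emeasure (noi n \<sigma>) P \<le> ennreal (2 * exp (- (16 * lg))) \<and>
    (\<forall>w\<in>space (noi n \<sigma>) - P. \<bar>\<Sum>i\<in>{r..<n}. mv {r..<n} (res n r (ent w) x) a i * ent w i k\<bar>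
     \<le> 6 * \<sigma> * sqrt lg * L2_set (mv {r..<n} (res n r (ent w) x) a) {r..<n})"
proof -
  let ?B = "{r..<n}"
  define W where "W w = mv ?B (res n r (ent w) x) a" for w
  define \<phi> where "\<phi> i = (i, k)" for i :: nat
  define P where "P = {w \<in> space (noi n \<sigma>). sqrt (2 * (16 * lg)) * (\<sigma> * L2_set (W w) ?B) < \<bar>\<Sum>i\<in>?B. W w i * w (\<phi> i)\<bar>}"
  have inj: "inj_on \<phi> ?B" by (auto simp: inj_on_def \<phi>_def)
  have J: "\<phi> ` ?B \<subseteq> Idx n" using k by (auto simp: \<phi>_def Idx_def)
  have off: "\<forall>i\<in>?B. fst (\<phi> i) \<noteq> snd (\<phi> i)" using k by (auto simp: \<phi>_def)
  have ind: "\<forall>w w'. (\<forall>p\<in>Idx n - \<phi> ` ?B. w p = w' p) --> (\<forall>i\<in>?B. W w i = W w' i)"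
  proof (intro allI impI ballI)
    fix w w' :: "nat \<times> nat => real" and i assume w: "\<forall>p\<in>Idx n - \<phi> ` ?B. w p = w' p" and i: "i \<in> ?B"
    have "ent w i j = ent w' i j" if "i \<in> ?B" "j \<in> ?B" for i j
      unfolding ent_def by (rule w[rule_format]) (use that k in \<open>auto simp: Idx_def \<phi>_def\<close>)
    then show "W w i = W w' i" unfolding W_def by (intro mv_cong res_cong i) auto
  qed
  have meas: "\<forall>i\<in>?B. (\<lambda>w. W w i) \<in> borel_measurable (noi n \<sigma>)"
    unfolding W_def mv_def by (intro ballI poly_measurable res_meas rn)
  have "0 \<le> 16 * lg" using lg by simp
  note c = cond_lin_prob[OF finite_atLeastLessThan inj J off ind meas this \<sigma>, folded P_def]
  show ?thesis
  proof (intro bexI[of _ P] conjI ballI)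
    show "P \<in> sets (noi n \<sigma>)" "emeasure (noi n \<sigma>) P \<le> ennreal (2 * exp (- (16 * lg)))" by (rule c)+
    fix w assume w: "w \<in> space (noi n \<sigma>) - P"
    have "(\<Sum>i\<in>?B. W w i * w (\<phi> i)) = (\<Sum>i\<in>?B. W w i * ent w i k)"
      by (rule sum.cong) (use k in \<open>auto simp: ent_def \<phi>_def max_def min_def\<close>)
    then have "\<bar>\<Sum>i\<in>?B. W w i * ent w i k\<bar> \<le> sqrt (2 * (16 * lg)) * (\<sigma> * L2_set (W w) ?B)"
      using w by (simp add: P_def not_less)
    also have "... \<le> 6 * sqrt lg * (\<sigma> * L2_set (W w) ?B)" by (rule sqrt32[OF lg]) (use \<sigma> in simp)
    finally show "\<bar>\<Sum>i\<in>?B. mv ?B (res n r (ent w) x) a i * ent w i k\<bar> \<le> 6 * \<sigma> * sqrt lg * L2_set (mv ?B (res n r (ent w) x) a) ?B"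
      by (simp add: W_def mult_ac)
  qed
qed

text \<open>Where column \<open>l\<close> sits in the lower triangle.\<close>

definition pos :: "nat => nat => nat \<times> nat" where "pos l i = (max i l, min i l)"

lemma pos_facts:
  assumes l: "l < n"
  shows "inj_on (pos l) (off n l)" "pos l ` off n l \<subseteq> Idx n" "\<forall>i\<in>off n l. fst (pos l i) \<noteq> snd (pos l i)"
proof -
  show "inj_on (pos l) (off n l)" by (auto simp: inj_on_def pos_def off_def max_def min_def split: if_splits)
  show "pos l ` off n l \<subseteq> Idx n" using l by (auto simp: Idx_def pos_def off_def)
  show "\<forall>i\<in>off n l. fst (pos l i) \<noteq> snd (pos l i)" by (auto simp: pos_def off_def max_def min_def)
qed

lemma Tx_ind:
  assumes l: "l < n" and w: "\<forall>p\<in>Idx n - pos l ` off n l. w p = w' p" and ij: "i \<in> off n l" "j \<in> off n l"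
  shows "Tx n r ls (ent w) l x i j = Tx n r ls (ent w') l x i j"
proof -
  have e: "ent w i j = ent w' i j" if "i \<in> off n l" "j \<in> off n l" for i j
    unfolding ent_def by (rule w[rule_format]) (use that l in \<open>auto simp: Idx_def pos_def off_def max_def min_def split: if_splits\<close>)
  show ?thesis unfolding Tx_def by (rule pinv_cong[OF _ ij]) (simp add: shiftm_def spk_def e)
qed

lemma Tx_meas:
  assumes "l < n" and ij: "i \<in> off n l" "j \<in> off n l"
  shows "(\<lambda>w. Tx n r ls (ent w) l x i j) \<in> borel_measurable (noi n \<sigma>)"
  unfolding Tx_def
proof (rule pinv_measurable[OF _ ij])
  fix i j assume "i \<in> off n l" "j \<in> off n l"
  then show "(\<lambda>w. shiftm x (spk r ls (ent w)) i j) \<in> borel_measurable (noi n \<sigma>)" unfolding shiftm_def spk_def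
    by (intro borel_measurable_diff borel_measurable_add borel_measurable_const ent_meas) (auto simp: off_def)
qed

lemma finite_off: "finite (off n l)" by (simp add: off_def)

lemma Tx_sym: "sym_on (off n l) (Tx n r ls (ent w) l x)"
  unfolding Tx_def by (rule pinv_sym[OF finite_off]) (simp add: sym_on_def shiftm_def spk_def ent_sym)

lemma lin_prob:
  assumes l: "l < n" and \<sigma>: "0 < \<sigma>" and lg: "0 \<le> lg"
  shows "\<exists>P\<in>sets (noi n \<sigma>). emeasure (noi n \<sigma>) P \<le> ennreal (2 * exp (- (16 * lg))) \<and>
    (\<forall>w\<in>space (noi n \<sigma>) - P. lin_ok n r ls (ent w) \<sigma> lg l a x)"
proof -
  let ?B = "off n l"
  define W where "W w = mv ?B (Tx n r ls (ent w) l x) (botp r a)" for w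
  define P where "P = {w \<in> space (noi n \<sigma>). sqrt (2 * (16 * lg)) * (\<sigma> * L2_set (W w) ?B) < \<bar>\<Sum>i\<in>?B. W w i * w (pos l i)\<bar>}"
  have ind: "\<forall>w w'. (\<forall>p\<in>Idx n - pos l ` ?B. w p = w' p) --> (\<forall>i\<in>?B. W w i = W w' i)"
    unfolding W_def by (intro allI impI ballI mv_cong Tx_ind[OF l]) auto
  have meas: "\<forall>i\<in>?B. (\<lambda>w. W w i) \<in> borel_measurable (noi n \<sigma>)"
    unfolding W_def mv_def by (intro ballI poly_measurable Tx_meas l)
  have "0 \<le> 16 * lg" using lg by simp
  note c = cond_lin_prob[OF finite_off pos_facts[OF l] ind meas this \<sigma>, folded P_def]
  show ?thesis
  proof (intro bexI[of _ P] conjI ballI)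
    show "P \<in> sets (noi n \<sigma>)" "emeasure (noi n \<sigma>) P \<le> ennreal (2 * exp (- (16 * lg)))" by (rule c)+
    fix w assume w: "w \<in> space (noi n \<sigma>) - P"
    have "(\<Sum>i\<in>?B. W w i * w (pos l i)) = dot ?B (W w) (\<lambda>i. ent w i l)"
      by (simp add: dot_def ent_def pos_def)
    then have "\<bar>dot ?B (W w) (\<lambda>i. ent w i l)\<bar> \<le> sqrt (2 * (16 * lg)) * (\<sigma> * L2_set (W w) ?B)"
      using w by (simp add: P_def not_less)
    also have "... \<le> 6 * sqrt lg * (\<sigma> * L2_set (W w) ?B)" by (rule sqrt32[OF lg]) (use \<sigma> in simp)
    finally show "lin_ok n r ls (ent w) \<sigma> lg l a x"
      by (simp add: lin_ok_def Let_def W_def mult_ac)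
  qed
qed

lemma mprod_cong: "(\<And>i j. i \<in> S ==> j \<in> S ==> A i j = A' i j) ==> (\<And>i j. i \<in> S ==> j \<in> S ==> B i j = B' i j) ==>
   i \<in> S ==> j \<in> S ==> mprod S A B i j = mprod S A' B' i j"
  unfolding mprod_def by (rule sum.cong) auto

lemma frob2_cong: "(\<And>i j. i \<in> S ==> j \<in> S ==> A i j = A' i j) ==> frob2 S A = frob2 S A'"
  unfolding frob2_def by (intro sum.cong refl) auto

lemma mprod_self_sym: "sym_on S A ==> sym_on S (mprod S A A)"
  unfolding sym_on_def mprod_def
proof (intro ballI sum.cong refl)
  fix i j k assume A: "\<forall>i\<in>S. \<forall>j\<in>S. A i j = A j i" and k: "i \<in> S" "j \<in> S" "k \<in> S"
  have "A i k = A k i" "A k j = A j k" using A k by blast+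
  then show "A i k * A k j = A j k * A k i" by (simp only: mult.commute)
qed

lemma quad_prob:
  assumes l: "l < n" and \<sigma>: "0 < \<sigma>" and lg: "0 < lg"
  shows "\<exists>P\<in>sets (noi n \<sigma>). emeasure (noi n \<sigma>) P \<le> ennreal (2 * exp (- (16 * lg))) \<and>
    (\<forall>w\<in>space (noi n \<sigma>) - P. quad_ok n r ls (ent w) \<sigma> lg l x)"
proof -
  let ?B = "off n l"
  define A where "A w = mprod ?B (Tx n r ls (ent w) l x) (Tx n r ls (ent w) l x)" for w
  define F where "F w = sqrt (frob2 ?B (A w))" for w
  define D where "D w = sqrt (sqrt (frob2 ?B (mprod ?B (A w) (A w))))" for w
  define P where "P = {w \<in> space (noi n \<sigma>). True \<and> \<sigma>\<^sup>2 * (4 * (F w * sqrt (16 * lg) + D w * (16 * lg))) <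
      \<bar>dot ?B (\<lambda>i. w (pos l i)) (mv ?B (A w) (\<lambda>i. w (pos l i))) - \<sigma>\<^sup>2 * tr ?B (A w)\<bar>}"
  have Aind: "A w i j = A w' i j" if w: "\<forall>p\<in>Idx n - pos l ` ?B. w p = w' p" and "i \<in> ?B" "j \<in> ?B" for w w' i j
    unfolding A_def by (rule mprod_cong) (auto intro!: Tx_ind[OF l w] that(2,3))
  have ind: "\<forall>w w'. (\<forall>p\<in>Idx n - pos l ` ?B. w p = w' p) -->
      (\<forall>i\<in>?B. \<forall>j\<in>?B. A w i j = A w' i j) \<and> F w = F w' \<and> D w = D w' \<and> (True --> True)"
  proof (intro allI impI)
    fix w w' :: "nat \<times> nat => real" assume w: "\<forall>p\<in>Idx n - pos l ` ?B. w p = w' p"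
    have e: "A w i j = A w' i j" if "i \<in> ?B" "j \<in> ?B" for i j by (rule Aind[OF w that])
    have "F w = F w'" unfolding F_def using frob2_cong[of ?B "A w" "A w'"] e by simp
    moreover have "D w = D w'" unfolding D_def
      using frob2_cong[OF mprod_cong[of ?B "A w" "A w'" "A w" "A w'"], of ?B] e by simp
    ultimately show "(\<forall>i\<in>?B. \<forall>j\<in>?B. A w i j = A w' i j) \<and> F w = F w' \<and> D w = D w' \<and> (True --> True)" using e by simp
  qed
  have meas: "\<forall>i\<in>?B. \<forall>j\<in>?B. (\<lambda>w. A w i j) \<in> borel_measurable (noi n \<sigma>)"
    unfolding A_def mprod_def by (intro ballI borel_measurable_sum borel_measurable_times Tx_meas l)
  have Fm: "F \<in> borel_measurable (noi n \<sigma>)" unfolding F_def frob2_def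
    by (intro sqrt_measurable borel_measurable_sum borel_measurable_power meas[rule_format])
  have Dm: "D \<in> borel_measurable (noi n \<sigma>)" unfolding D_def frob2_def mprod_def
    by (intro sqrt_measurable borel_measurable_sum borel_measurable_power borel_measurable_times meas[rule_format])
  have s: "sym_on ?B (A w)" for w unfolding A_def by (rule mprod_self_sym[OF Tx_sym])
  have D: "opb ?B (A w) (D w)" "0 \<le> D w" for w unfolding D_def
    by (rule opb_fourth[OF finite_off s]) (simp add: frob2_def sum_nonneg)
  have F: "frob2 ?B (A w) \<le> (F w)\<^sup>2" "0 \<le> F w" for w unfolding F_def by (simp_all add: frob2_def sum_nonneg)
  have lg': "0 < 16 * lg" using lg by simp
  have tru: "{w \<in> space (noi n \<sigma>). True} \<in> sets (noi n \<sigma>)" by simp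
  note c = cond_quad_prob[where G = "\<lambda>_. True", OF finite_off pos_facts[OF l] ind meas Fm Dm tru _ lg' \<sigma>, folded P_def]
  show ?thesis
  proof (intro bexI[of _ P] conjI ballI)
    show "P \<in> sets (noi n \<sigma>)" "emeasure (noi n \<sigma>) P \<le> ennreal (2 * exp (- (16 * lg)))" by (rule c, use s D F in auto)+
    fix w assume w: "w \<in> space (noi n \<sigma>) - P"
    then show "quad_ok n r ls (ent w) \<sigma> lg l x"
      by (simp add: P_def not_less quad_ok_def Let_def F_def D_def A_def ent_def[of w _ l] pos_def)
  qed
qed

section \<open>The block coupling the spike to the bulk\<close>

lemma frob2_opb:
  assumes fin: "finite S" and A: "sym_on S A" and D: "opb S A D" "0 \<le> D"
  shows "frob2 S A \<le> real (card S) * D\<^sup>2"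
proof -
  obtain V \<nu> where V: "eigsys S A V \<nu>" using spectral_theorem[OF fin A] by blast
  have "frob2 S A = (\<Sum>k\<in>S. (\<nu> k)\<^sup>2)" by (rule frob2_eig[OF fin V])
  also have "... \<le> (\<Sum>k\<in>S. D\<^sup>2)"
  proof (rule sum_mono)
    fix k assume "k \<in> S"
    from eig_le_opb[OF fin V D(1) this] show "(\<nu> k)\<^sup>2 \<le> D\<^sup>2" using abs_le_square_iff[of "\<nu> k" D] D(2) by simp
  qed
  finally show ?thesis by simp
qed

text \<open>The form \<open>g R g\<close> with \<open>g = H_BT \<zeta>\<close> is a form in the entries of \<open>H_BT\<close>, with matrix the Kronecker product of \<open>R\<close> and \<open>\<zeta> \<zeta>\<^sup>T\<close>.\<close>

lemma kron_facts:
  fixes R :: "'b => 'b => real" and \<zeta> :: "'t => real"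
  assumes B: "finite B" and T: "finite T"
  defines "K \<equiv> B \<times> T" and "A \<equiv> (\<lambda>p q. \<zeta> (snd p) * \<zeta> (snd q) * R (fst p) (fst q))"
  shows "\<And>v. dot K v (mv K A v) = dot B (\<lambda>i. \<Sum>k\<in>T. \<zeta> k * v (i, k)) (mv B R (\<lambda>i. \<Sum>k\<in>T. \<zeta> k * v (i, k)))"
    and "frob2 K A = (dot T \<zeta> \<zeta>)\<^sup>2 * frob2 B R"
    and "tr K A = dot T \<zeta> \<zeta> * tr B R"
    and "sym_on B R ==> opb B R D ==> 0 \<le> D ==> dot T \<zeta> \<zeta> \<le> c ==> sym_on K A \<and> opb K A (c * D)"
proof -
  have sK: "(\<Sum>p\<in>K. f p) = (\<Sum>i\<in>B. \<Sum>k\<in>T. f (i, k))" for f :: "'b \<times> 't => real"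
    unfolding K_def by (simp add: sum.cartesian_product)
  show form: "dot K v (mv K A v) = dot B (\<lambda>i. \<Sum>k\<in>T. \<zeta> k * v (i, k)) (mv B R (\<lambda>i. \<Sum>k\<in>T. \<zeta> k * v (i, k)))" for v
  proof -
    have "mv K A v (i, k) = \<zeta> k * mv B R (\<lambda>i. \<Sum>k\<in>T. \<zeta> k * v (i, k)) i" for i k
      unfolding mv_def sK by (simp add: A_def sum_distrib_left mult_ac)
    then show ?thesis unfolding dot_def sK by (simp add: sum_distrib_right sum_distrib_left mult_ac)
  qed
  have "frob2 K A = (\<Sum>i\<in>B. \<Sum>k\<in>T. \<Sum>j\<in>B. \<Sum>k'\<in>T. ((\<zeta> k)\<^sup>2 * (\<zeta> k')\<^sup>2) * (R i j)\<^sup>2)"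
    unfolding frob2_def sK by (simp add: A_def power_mult_distrib)
  also have "... = (\<Sum>i\<in>B. \<Sum>j\<in>B. \<Sum>k\<in>T. \<Sum>k'\<in>T. ((\<zeta> k)\<^sup>2 * (\<zeta> k')\<^sup>2) * (R i j)\<^sup>2)"
    by (intro sum.cong refl sum.swap)
  also have "... = (\<Sum>i\<in>B. \<Sum>j\<in>B. (dot T \<zeta> \<zeta>)\<^sup>2 * (R i j)\<^sup>2)"
    unfolding dot_def power2_eq_square sum_product by (simp add: sum_distrib_right)
  finally show "frob2 K A = (dot T \<zeta> \<zeta>)\<^sup>2 * frob2 B R" by (simp add: frob2_def sum_distrib_left)
  show "tr K A = dot T \<zeta> \<zeta> * tr B R"
    unfolding tr_def sK dot_def by (simp add: A_def sum_distrib_left sum_distrib_right)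
  assume R: "sym_on B R" "opb B R D" "0 \<le> D" and c: "dot T \<zeta> \<zeta> \<le> c"
  have c0: "0 \<le> c" using c dot_self_nonneg[of T \<zeta>] by linarith
  have s: "sym_on K A" using R(1) by (auto simp: sym_on_def K_def A_def mult_ac)
  moreover have "opb K A (c * D)"
  proof (rule opb_of_form[OF _ s])
    show "finite K" using B T by (simp add: K_def)
    show "0 \<le> c * D" using c0 R by simp
    fix v assume v: "dot K v v = 1"
    define u where "u i = (\<Sum>k\<in>T. \<zeta> k * v (i, k))" for i
    have "dot B u u \<le> (\<Sum>i\<in>B. dot T \<zeta> \<zeta> * dot T (\<lambda>k. v (i, k)) (\<lambda>k. v (i, k)))"
      unfolding dot_def[of B]
    proof (rule sum_mono)
      fix i
      have "u i * u i = (dot T \<zeta> (\<lambda>k. v (i, k)))\<^sup>2" by (simp add: u_def dot_def power2_eq_square)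
      also have "... \<le> (L2_set \<zeta> T * L2_set (\<lambda>k. v (i, k)) T)\<^sup>2"
        using power_mono[OF dot_CS[of T \<zeta> "\<lambda>k. v (i, k)"], of 2] by simp
      also have "... = dot T \<zeta> \<zeta> * dot T (\<lambda>k. v (i, k)) (\<lambda>k. v (i, k))"
        by (simp add: power_mult_distrib L2_set_dot dot_self_nonneg)
      finally show "u i * u i \<le> dot T \<zeta> \<zeta> * dot T (\<lambda>k. v (i, k)) (\<lambda>k. v (i, k))" .
    qed
    also have "... = dot T \<zeta> \<zeta> * dot K v v" unfolding dot_def[of K] sK by (simp add: dot_def[of T "\<lambda>k. v (_, k)"] sum_distrib_left)
    finally have "dot B u u \<le> c" using c v by simp
    have "\<bar>dot K v (mv K A v)\<bar> = \<bar>dot B u (mv B R u)\<bar>" by (simp add: form u_def[abs_def])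
    also have "... \<le> D * dot B u u" by (rule form_le_opb[OF R(2)])
    also have "... \<le> D * c" by (rule mult_left_mono) fact+
    finally show "\<bar>dot K v (mv K A v)\<bar> \<le> c * D" by (simp add: mult.commute)
  qed
  ultimately show "sym_on K A \<and> opb K A (c * D)" ..
qed

lemma res_opb:
  assumes H: "sym_on {r..<n} H" and op: "opb {r..<n} H \<rho>" and x: "2 * \<rho> \<le> \<bar>x\<bar>" "0 < \<rho>"
  shows "opb {r..<n} (res n r H x) (2 / \<bar>x\<bar>)"
proof -
  have f: "finite {r..<n}" by simp
  obtain V \<mu> where V: "eigsys {r..<n} H V \<mu>" using spectral_theorem[OF f H] by blast
  show ?thesis
  proof (rule opb_eig[OF f res_eig'[OF V]])
    fix k assume "k \<in> {r..<n}"
    from eig_le_opb[OF f V op this] x have "0 < \<bar>x\<bar>" "\<bar>x\<bar> / 2 \<le> \<bar>x - \<mu> k\<bar>" by (auto simp: abs_if split: if_splits)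
    then show "\<bar>inverse (x - \<mu> k)\<bar> \<le> 2 / \<bar>x\<bar>" by (rule inverse_le)
  qed simp
qed

text \<open>Via an exceptional measurable set, so that the property itself need not be measurable.\<close>

definition mostly :: "'a measure => real => ('a => bool) => bool" where
  "mostly M p Q \<longleftrightarrow> (\<exists>P\<in>sets M. emeasure M P \<le> ennreal p \<and> (\<forall>w\<in>space M - P. Q w))"

lemma mostly_mono: "mostly M p Q ==> p \<le> p' ==> (\<And>w. Q w ==> Q' w) ==> mostly M p' Q'"
  unfolding mostly_def by (meson ennreal_leI order_trans)

lemma mostly_all:
  assumes I: "finite I" "real (card I) \<le> N" and p: "0 \<le> p" and Q: "\<And>i. i \<in> I ==> mostly M p (Q i)"
  shows "mostly M (N * p) (\<lambda>w. \<forall>i\<in>I. Q i w)"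
proof -
  have "\<forall>i\<in>I. \<exists>P. P \<in> sets M \<and> emeasure M P \<le> ennreal p \<and> (\<forall>w\<in>space M - P. Q i w)"
    using Q unfolding mostly_def by blast
  then obtain P where P: "\<And>i. i \<in> I ==> P i \<in> sets M \<and> emeasure M (P i) \<le> ennreal p \<and> (\<forall>w\<in>space M - P i. Q i w)"
    by (auto dest!: bchoice)
  have "emeasure M (\<Union>i\<in>I. P i) \<le> ennreal (real (card I) * p)"
    by (rule union_bound[OF I(1) _ _ p]) (use P in auto)
  also have "... \<le> ennreal (N * p)" by (intro ennreal_leI mult_right_mono I p)
  finally show ?thesis unfolding mostly_def
    by (intro bexI[of _ "\<Union>i\<in>I. P i"] conjI) (use I P in \<open>auto intro: sets.finite_UN\<close>)
qed

lemma mostly_conj: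
  assumes "mostly M p Q" "mostly M q R" "0 \<le> p" "0 \<le> q"
  shows "mostly M (p + q) (\<lambda>w. Q w \<and> R w)"
proof -
  obtain P1 P2 where P: "P1 \<in> sets M" "emeasure M P1 \<le> ennreal p" "\<forall>w\<in>space M - P1. Q w"
     "P2 \<in> sets M" "emeasure M P2 \<le> ennreal q" "\<forall>w\<in>space M - P2. R w"
    using assms(1,2) unfolding mostly_def by blast
  have "emeasure M (P1 \<union> P2) \<le> emeasure M P1 + emeasure M P2" by (rule emeasure_subadditive) fact+
  also have "... \<le> ennreal p + ennreal q" by (rule add_mono) fact+
  also have "... = ennreal (p + q)" using assms(3,4) by simp
  finally show ?thesis unfolding mostly_def by (intro bexI[of _ "P1 \<union> P2"] conjI) (use P in auto)
qed

text \<open>One net direction and one grid point for the coupling block. The bound on \<open>H_BB\<close>, needed for the resolvent, is the event \<open>netbad\<close>, which involves only entries in \<open>B\<close>.\<close>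

lemma block_prob:
  assumes rn: "r \<le> n" and \<sigma>: "0 < \<sigma>" and L: "0 < L" and LB: "0 \<le> LB" and z: "z \<in> netZ {..<r}"
    and \<rho>: "16/7 * (sqrt (2 * LB) * (sqrt 5 * \<sigma>)) \<le> \<rho>" "0 < \<rho>" "2 * \<rho> \<le> \<bar>x\<bar>"
  defines "\<zeta> \<equiv> netp {..<r} z" and "D \<equiv> 25/16 * (2 / \<bar>x\<bar>)"
  shows "mostly (noi n \<sigma>) (2 * exp (- L)) (\<lambda>w. netbad n \<sigma> {r..<n} LB w \<or>
    \<bar>dot {r..<n} (mv {..<r} (ent w) \<zeta>) (mv {r..<n} (res n r (ent w) x) (mv {..<r} (ent w) \<zeta>))
      - dot {..<r} \<zeta> \<zeta> * gam n r (ent w) \<sigma> x\<bar> \<le> \<sigma>\<^sup>2 * (4 * ((sqrt (real n) * D) * sqrt L + D * L)))"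
proof -
  let ?B = "{r..<n}" and ?T = "{..<r}"
  let ?K = "?B \<times> ?T"
  let ?R = "\<lambda>w. res n r (ent w) x"
  let ?G = "\<lambda>w. \<not> netbad n \<sigma> ?B LB w"
  let ?F = "\<lambda>w::nat \<times> nat => real. sqrt (real n) * D" and ?D = "\<lambda>w::nat \<times> nat => real. D"
  define A where "A w = (\<lambda>p q. \<zeta> (snd p) * \<zeta> (snd q) * ?R w (fst p) (fst q))" for w
  define \<phi> :: "nat \<times> nat => nat \<times> nat" where "\<phi> p = p" for p
  define P where "P = {w \<in> space (noi n \<sigma>). ?G w \<and> \<sigma>\<^sup>2 * (4 * (?F w * sqrt L + ?D w * L)) <
      \<bar>dot ?K (\<lambda>i. w (\<phi> i)) (mv ?K (A w) (\<lambda>i. w (\<phi> i))) - \<sigma>\<^sup>2 * tr ?K (A w)\<bar>}"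
  have fB: "finite ?B" and fT: "finite ?T" and fK: "finite ?K" by auto
  note kron = kron_facts[OF fB fT]
  have D0: "0 \<le> D" by (simp add: D_def)
  have c: "dot ?T \<zeta> \<zeta> \<le> 25/16" unfolding \<zeta>_def by (rule netp_norm[OF fT z])
  have inj: "inj_on \<phi> ?K" by (simp add: inj_on_def \<phi>_def)
  have J: "\<phi> ` ?K \<subseteq> Idx n" by (auto simp: \<phi>_def Idx_def)
  have off: "\<forall>p\<in>?K. fst (\<phi> p) \<noteq> snd (\<phi> p)" by (auto simp: \<phi>_def)
  have ind: "\<forall>w w'. (\<forall>p\<in>Idx n - \<phi> ` ?K. w p = w' p) -->
      (\<forall>i\<in>?K. \<forall>j\<in>?K. A w i j = A w' i j) \<and> ?F w = ?F w' \<and> ?D w = ?D w' \<and> (?G w --> ?G w')"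
  proof (intro allI impI)
    fix w w' :: "nat \<times> nat => real" assume w: "\<forall>p\<in>Idx n - \<phi> ` ?K. w p = w' p"
    have e: "ent w i j = ent w' i j" if "i \<in> ?B" "j \<in> ?B" for i j
      unfolding ent_def by (rule w[rule_format]) (use that in \<open>auto simp: Idx_def \<phi>_def\<close>)
    have "A w i j = A w' i j" if "i \<in> ?K" "j \<in> ?K" for i j
    proof -
      have "?R w (fst i) (fst j) = ?R w' (fst i) (fst j)" by (rule res_cong[OF e]) (use that in auto)
      then show ?thesis by (simp only: A_def)
    qed
    moreover have "dot ?B v (mv ?B (ent w) v) = dot ?B v (mv ?B (ent w') v)" for v
      unfolding dot_def mv_def by (intro sum.cong refl) (simp add: e)
    ultimately show "(\<forall>i\<in>?K. \<forall>j\<in>?K. A w i j = A w' i j) \<and> ?F w = ?F w' \<and> ?D w = ?D w' \<and> (?G w --> ?G w')"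
      by (simp add: netbad_def)
  qed
  have meas: "\<forall>i\<in>?K. \<forall>j\<in>?K. (\<lambda>w. A w i j) \<in> borel_measurable (noi n \<sigma>)"
    unfolding A_def by (intro ballI borel_measurable_times borel_measurable_const res_meas rn) auto
  have nb: "{w \<in> space (noi n \<sigma>). netbad n \<sigma> ?B LB w} \<in> sets (noi n \<sigma>)" by (rule netbad_meas) auto
  have "{w \<in> space (noi n \<sigma>). ?G w} = space (noi n \<sigma>) - {w \<in> space (noi n \<sigma>). netbad n \<sigma> ?B LB w}" by auto
  then have Gm: "{w \<in> space (noi n \<sigma>). ?G w} \<in> sets (noi n \<sigma>)" using nb by (simp only: sets.compl_sets)
  have F0: "0 \<le> ?F w" for w using D0 by simp
  have AG: "\<forall>w. ?G w --> sym_on ?K (A w) \<and> opb ?K (A w) (?D w) \<and> 0 \<le> ?D w \<and> frob2 ?K (A w) \<le> (?F w)\<^sup>2 \<and> 0 \<le> ?F w"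
  proof (intro allI impI)
    fix w assume g: "?G w"
    have o: "opb ?B (ent w) \<rho>"
      using not_netbad_opb[OF fB g \<sigma> LB] \<rho>(1) unfolding opb_def by (meson L2_set_nonneg mult_right_mono order_trans)
    have R: "sym_on ?B (?R w)" "opb ?B (?R w) (2 / \<bar>x\<bar>)"
      by (rule res_sym[OF ent_sym_on], rule res_opb[OF ent_sym_on o \<rho>(3,2)])
    have 1: "sym_on ?K (A w) \<and> opb ?K (A w) D" unfolding A_def D_def by (rule kron(4)[OF R _ c]) simp
    have "frob2 ?B (?R w) \<le> real (card ?B) * (2 / \<bar>x\<bar>)\<^sup>2" by (rule frob2_opb[OF fB R]) simp
    also have "... \<le> real n * (2 / \<bar>x\<bar>)\<^sup>2" by (intro mult_right_mono) auto
    finally have "frob2 ?K (A w) \<le> (25/16)\<^sup>2 * (real n * (2 / \<bar>x\<bar>)\<^sup>2)" unfolding A_def kron(2)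
      by (intro mult_mono power_mono c) (auto simp: dot_self_nonneg frob2_def intro!: sum_nonneg)
    also have "... = (?F w)\<^sup>2" by (simp only: D_def power_mult_distrib real_sqrt_pow2[OF of_nat_0_le_iff] mult_ac)
    finally show "sym_on ?K (A w) \<and> opb ?K (A w) (?D w) \<and> 0 \<le> ?D w \<and> frob2 ?K (A w) \<le> (?F w)\<^sup>2 \<and> 0 \<le> ?F w"
      using 1 D0 F0 by simp
  qed
  note c' = cond_quad_prob[where G = ?G, OF fK inj J off ind meas borel_measurable_const borel_measurable_const Gm AG L \<sigma>, folded P_def]
  show ?thesis unfolding mostly_def
  proof (intro bexI[of _ P] conjI ballI c')
    fix w assume w: "w \<in> space (noi n \<sigma>) - P"
    define g where "g = mv ?T (ent w) \<zeta>"
    have gi: "(\<Sum>k\<in>?T. \<zeta> k * w (i, k)) = g i" if "i \<in> ?B" for i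
      unfolding g_def mv_def by (rule sum.cong) (use that in \<open>auto simp: ent_def max_def min_def\<close>)
    have "dot ?K (\<lambda>i. w (\<phi> i)) (mv ?K (A w) (\<lambda>i. w (\<phi> i))) =
       dot ?B (\<lambda>i. \<Sum>k\<in>?T. \<zeta> k * w (i, k)) (mv ?B (?R w) (\<lambda>i. \<Sum>k\<in>?T. \<zeta> k * w (i, k)))"
      unfolding A_def \<phi>_def by (rule kron(1))
    also have "... = dot ?B g (mv ?B (?R w) g)" by (intro dot_cong mv_cong gi) auto
    finally have 1: "dot ?K (\<lambda>i. w (\<phi> i)) (mv ?K (A w) (\<lambda>i. w (\<phi> i))) = dot ?B g (mv ?B (?R w) g)" .
    have 2: "\<sigma>\<^sup>2 * tr ?K (A w) = dot ?T \<zeta> \<zeta> * gam n r (ent w) \<sigma> x"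
      unfolding A_def kron(3) by (simp add: gam_def tr_def mult_ac)
    show "netbad n \<sigma> ?B LB w \<or> \<bar>dot ?B (mv ?T (ent w) \<zeta>) (mv ?B (?R w) (mv ?T (ent w) \<zeta>))
      - dot ?T \<zeta> \<zeta> * gam n r (ent w) \<sigma> x\<bar> \<le> \<sigma>\<^sup>2 * (4 * ((sqrt (real n) * D) * sqrt L + D * L))"
      using w unfolding P_def mem_Collect_eq Diff_iff 1 2 g_def[symmetric] not_less by (auto simp only: not_less)
  qed
qed

section \<open>The good event\<close>

lemma opb_mono: "opb S A c ==> c \<le> c' ==> opb S A c'"
  unfolding opb_def by (meson L2_set_nonneg mult_right_mono order_trans)

lemma net_level:
  assumes L: "0 \<le> L" "L \<le> 43 * m" and \<sigma>: "0 < \<sigma>"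
  shows "16/7 * (sqrt (2 * L) * (sqrt 5 * \<sigma>)) \<le> 48 * (\<sigma> * sqrt m)"
proof -
  have "sqrt (2 * L) * sqrt 5 = sqrt (10 * L)" by (simp flip: real_sqrt_mult)
  also have "... \<le> sqrt (21\<^sup>2 * m)" using L by (intro real_sqrt_le_mono) simp
  also have "... = 21 * sqrt m" by (simp only: real_sqrt_mult real_sqrt_abs)
  finally have "(sqrt (2 * L) * sqrt 5) * \<sigma> \<le> (21 * sqrt m) * \<sigma>" using \<sigma> by (intro mult_right_mono) auto
  then show ?thesis by (simp add: mult_ac)
qed

text \<open>The \<open>27 d\<close> pays for the size of the net, \<open>16 lg\<close> is the remaining exponent.\<close>

lemma netbad_mostly:
  assumes T: "T \<subseteq> {..<n}" and c: "real (card T) \<le> d" and \<sigma>: "0 < \<sigma>" and lg: "0 \<le> lg" and d: "0 \<le> d"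
  shows "mostly (noi n \<sigma>) (2 * exp (- (16 * lg))) (\<lambda>w. \<not> netbad n \<sigma> T (27 * d + 16 * lg) w)"
proof -
  let ?L = "27 * d + 16 * lg"
  have L0: "0 \<le> ?L" using d lg by simp
  have "emeasure (noi n \<sigma>) {w \<in> space (noi n \<sigma>). netbad n \<sigma> T ?L w} \<le> ennreal (exp (27 * real (card T)) * (2 * exp (- ?L)))"
    by (rule netbad_prob[OF T]) (use \<sigma> L0 in auto)
  also have "... \<le> ennreal (2 * exp (- (16 * lg)))"
  proof (rule ennreal_leI)
    have "exp (27 * real (card T)) * (2 * exp (- ?L)) = 2 * exp (27 * real (card T) - ?L)"
      by (simp only: exp_diff exp_minus) (simp add: divide_inverse mult_ac)
    also have "... \<le> 2 * exp (- (16 * lg))" using c by simp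
    finally show "exp (27 * real (card T)) * (2 * exp (- ?L)) \<le> 2 * exp (- (16 * lg))" .
  qed
  finally show ?thesis unfolding mostly_def
    by (intro bexI[of _ "{w \<in> space (noi n \<sigma>). netbad n \<sigma> T ?L w}"] conjI netbad_meas[OF T]) auto
qed

lemma block_level:
  assumes n: "16 \<le> n" and \<sigma>: "0 < \<sigma>" and r: "1 \<le> r" "r \<le> n" and lg: "1 \<le> lg" "lg \<le> real n"
    and x: "25 * (51 * (\<sigma> * sqrt (real n))) \<le> \<bar>x\<bar>"
  defines "L \<equiv> 27 * real r + 20 * lg" and "D \<equiv> 25/16 * (2 / \<bar>x\<bar>)"
  shows "16/7 * (\<sigma>\<^sup>2 * (4 * ((sqrt (real n) * D) * sqrt L + D * L))) \<le> 2 * (\<sigma> * sqrt (real r * lg))"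
proof -
  define s where "s = sqrt (real n)"
  have s: "0 < s" "s * s = real n" using n by (auto simp: s_def)
  have x0: "0 < \<bar>x\<bar>" using x \<sigma> s unfolding s_def by (smt (verit) mult_pos_pos)
  have D0: "0 \<le> D" by (simp add: D_def)
  have D: "D * (408 * (\<sigma> * s)) \<le> 1"
  proof -
    have "D * (408 * (\<sigma> * s)) = (25/8 * (408 * (\<sigma> * s))) / \<bar>x\<bar>" by (simp add: D_def)
    also have "... \<le> 1" using x x0 unfolding s_def[symmetric] by (simp add: divide_le_eq)
    finally show ?thesis .
  qed
  have L0: "0 < L" using r lg by (simp add: L_def)
  define q where "q = sqrt L"
  have q: "0 < q" "q * q = L" using L0 by (auto simp: q_def)
  have "L \<le> 7\<^sup>2 * real n" using r lg by (simp add: L_def)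
  then have "q \<le> sqrt (7\<^sup>2 * real n)" unfolding q_def by (rule real_sqrt_le_mono)
  also have "... = 7 * s" by (simp only: real_sqrt_mult real_sqrt_abs s_def)
  finally have qs: "q \<le> 7 * s" .
  have "real r \<le> real r * lg" "lg \<le> real r * lg" using r lg mult_left_mono[of 1 lg "real r"] mult_right_mono[of 1 "real r" lg] by auto
  then have "L \<le> 7\<^sup>2 * (real r * lg)" by (simp add: L_def)
  then have "q \<le> sqrt (7\<^sup>2 * (real r * lg))" unfolding q_def by (rule real_sqrt_le_mono)
  also have "... = 7 * sqrt (real r * lg)" by (simp only: real_sqrt_mult[of "7\<^sup>2"] real_sqrt_abs)
  finally have qr: "q \<le> 7 * sqrt (real r * lg)" .
  have "(s * D) * q + D * L = D * (s * q + q * q)" using q(2) by (simp add: algebra_simps)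
  also have "... \<le> D * (s * q + (7 * s) * q)" using qs q s D0 by (intro mult_left_mono add_left_mono mult_right_mono) auto
  also have "... = 8 * (D * s) * q" by (simp add: algebra_simps)
  finally have "16/7 * (\<sigma>\<^sup>2 * (4 * ((s * D) * q + D * L))) \<le> 16/7 * (\<sigma>\<^sup>2 * (4 * (8 * (D * s) * q)))"
    by (intro mult_left_mono) auto
  also have "... = (16/7 * 32 / 408) * (D * (408 * (\<sigma> * s))) * (\<sigma> * q)" by (simp add: power2_eq_square)
  also have "... \<le> (16/7 * 32 / 408) * 1 * (\<sigma> * (7 * sqrt (real r * lg)))"
    using D q \<sigma> qr D0 s by (intro mult_mono) auto
  also have "... \<le> 2 * (\<sigma> * sqrt (real r * lg))"
  proof -
    have "0 \<le> \<sigma> * sqrt (real r * lg)" using \<sigma> r lg by simp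
    then show ?thesis by simp
  qed
  finally show ?thesis by (simp add: s_def q_def)
qed

text \<open>The union over directions and grid points, and the passage from forms on the net to operator norms.\<close>

lemma block_mostly:
  assumes n: "16 \<le> n" and \<sigma>: "0 < \<sigma>" and r: "1 \<le> r" "r \<le> n" and lg: "1 \<le> lg" "lg \<le> real n"
  shows "mostly (noi n \<sigma>) (real (2 * n) * (2 * exp (- (20 * lg)))) (\<lambda>w. netbad n \<sigma> {r..<n} (27 * real n + 16 * lg) w \<or>
    (\<forall>x\<in>netX n \<sigma> (51 * (\<sigma> * sqrt (real n))). 25 * (51 * (\<sigma> * sqrt (real n))) \<le> \<bar>x\<bar> -->
      opb {..<r} (\<lambda>k k'. Gmat n r (ent w) x k k' - (if k = k' then gam n r (ent w) \<sigma> x else 0)) (2 * (\<sigma> * sqrt (real r * lg)))))"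
proof -
  define \<rho> where "\<rho> = 51 * (\<sigma> * sqrt (real n))"
  let ?B = "{r..<n}" and ?T = "{..<r}"
  let ?LB = "27 * real n + 16 * lg" and ?L = "27 * real r + 20 * lg"
  let ?X = "{x \<in> netX n \<sigma> \<rho>. 25 * \<rho> \<le> \<bar>x\<bar>}"
  let ?\<tau> = "\<lambda>x. \<sigma>\<^sup>2 * (4 * ((sqrt (real n) * (25/16 * (2 / \<bar>x\<bar>))) * sqrt ?L + (25/16 * (2 / \<bar>x\<bar>)) * ?L))"
  let ?Q = "\<lambda>x z w. netbad n \<sigma> ?B ?LB w \<or>
    \<bar>dot ?B (mv ?T (ent w) (netp ?T z)) (mv ?B (res n r (ent w) x) (mv ?T (ent w) (netp ?T z)))
      - dot ?T (netp ?T z) (netp ?T z) * gam n r (ent w) \<sigma> x\<bar> \<le> ?\<tau> x"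
  have \<rho>0: "0 < \<rho>" using \<sigma> n by (simp add: \<rho>_def)
  have \<rho>: "16/7 * (sqrt (2 * ?LB) * (sqrt 5 * \<sigma>)) \<le> \<rho>"

  proof -
    have "16/7 * (sqrt (2 * ?LB) * (sqrt 5 * \<sigma>)) \<le> 48 * (\<sigma> * sqrt (real n))" by (rule net_level) (use \<sigma> lg n in auto)
    also have "... \<le> \<rho>" unfolding \<rho>_def using \<sigma> by (intro mult_right_mono) auto
    finally show ?thesis .
  qed
  have fX: "finite ?X" using finite_netX by simp
  have cX: "real (card ?X) \<le> real (2 * n)"
    using card_mono[OF finite_netX, of ?X n \<sigma> \<rho>] card_netX[of n \<sigma> \<rho>] by (simp del: of_nat_mult)
  have one: "mostly (noi n \<sigma>) (exp (27 * real (card ?T)) * (2 * exp (- ?L))) (\<lambda>w. \<forall>z\<in>netZ ?T. ?Q x z w)" if x: "x \<in> ?X" for x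
  proof (rule mostly_all)
    show "finite (netZ ?T)" "real (card (netZ ?T)) \<le> exp (27 * real (card ?T))" by (simp_all only: finite_netZ card_netZ finite_lessThan)
    fix z assume z: "z \<in> netZ ?T"
    have "0 < ?L" "0 \<le> ?LB" using lg by auto
    then show "mostly (noi n \<sigma>) (2 * exp (- ?L)) (?Q x z)"
      using x \<rho>0 by (intro block_prob[OF r(2) \<sigma> _ _ z \<rho> \<rho>0]) auto
  qed simp
  have all: "mostly (noi n \<sigma>) (real (2 * n) * (exp (27 * real (card ?T)) * (2 * exp (- ?L)))) (\<lambda>w. \<forall>x\<in>?X. \<forall>z\<in>netZ ?T. ?Q x z w)"
    by (rule mostly_all[OF fX cX _ one]) auto
  have e: "exp (27 * real (card ?T)) * (2 * exp (- ?L)) = 2 * exp (- (20 * lg))"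
    by (simp add: exp_diff exp_minus exp_add field_simps)
  show ?thesis unfolding \<rho>_def[symmetric]
  proof (rule mostly_mono[OF all[unfolded e] order_refl])
    fix w assume w: "\<forall>x\<in>?X. \<forall>z\<in>netZ ?T. ?Q x z w"
    show "netbad n \<sigma> ?B ?LB w \<or> (\<forall>x\<in>netX n \<sigma> \<rho>. 25 * \<rho> \<le> \<bar>x\<bar> -->
      opb ?T (\<lambda>k k'. Gmat n r (ent w) x k k' - (if k = k' then gam n r (ent w) \<sigma> x else 0)) (2 * (\<sigma> * sqrt (real r * lg))))"
    proof (cases "netbad n \<sigma> ?B ?LB w")
      case False
      show ?thesis
      proof (intro disjI2 ballI impI)
        fix x assume x: "x \<in> netX n \<sigma> \<rho>" "25 * \<rho> \<le> \<bar>x\<bar>"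
        let ?Y = "\<lambda>k k'. Gmat n r (ent w) x k k' - (if k = k' then gam n r (ent w) \<sigma> x else 0)"
        have Y: "dot ?T v (mv ?T ?Y v) = dot ?B (mv ?T (ent w) v) (mv ?B (res n r (ent w) x) (mv ?T (ent w) v)) - dot ?T v v * gam n r (ent w) \<sigma> x" for v
        proof -
          have "mv ?T ?Y v k = mv ?T (Gmat n r (ent w) x) v k - gam n r (ent w) \<sigma> x * v k" if "k \<in> ?T" for k
            using that unfolding mv_def by (simp add: left_diff_distrib sum_subtractf if_distrib[of "\<lambda>c. c * _"] cong: if_cong)
          then have "dot ?T v (mv ?T ?Y v) = (\<Sum>k\<in>?T. v k * mv ?T (Gmat n r (ent w) x) v k - v k * v k * gam n r (ent w) \<sigma> x)"
            unfolding dot_def by (intro sum.cong refl) (simp add: right_diff_distrib mult_ac)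
          then have "dot ?T v (mv ?T ?Y v) = dot ?T v (mv ?T (Gmat n r (ent w) x) v) - dot ?T v v * gam n r (ent w) \<sigma> x"
            by (simp only: dot_def sum_subtractf sum_distrib_right)
          then show ?thesis by (simp add: Gmat_form[OF ent_sym_on r(2)])
        qed
        have sy: "sym_on ?T ?Y" using Gmat_sym[OF ent_sym_on r(2), of w x] by (auto simp: sym_on_def)
        have "opb ?T ?Y (16/7 * ?\<tau> x)"
        proof (rule net_opnorm[OF finite_lessThan sy])
          show "0 \<le> ?\<tau> x" using lg by (intro mult_nonneg_nonneg add_nonneg_nonneg) auto
          fix z assume z: "z \<in> netZ ?T"
          show "\<bar>dot ?T (netp ?T z) (mv ?T ?Y (netp ?T z))\<bar> \<le> ?\<tau> x" unfolding Y using w x z False by blast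
        qed
        moreover have "16/7 * ?\<tau> x \<le> 2 * (\<sigma> * sqrt (real r * lg))"
          by (rule block_level[OF n \<sigma> r lg]) (use x in \<open>simp add: \<rho>_def\<close>)
        ultimately show "opb ?T ?Y (2 * (\<sigma> * sqrt (real r * lg)))" by (rule opb_mono)
      qed
    qed simp
  qed
qed


lemma failure_total:
  assumes n: "1 \<le> n" and lg: "lg = ln (real n)"
  defines "E \<equiv> 2 * exp (- (16 * lg))"
  shows "E + (E + (E + (real (2 * n) * (2 * exp (- (20 * lg))) + 3 * real n ^ 3 * (real n * E + (E + E))))) \<le> 30 / real n ^ 10"
proof -
  define e where "e = 1 / real n"
  have n0: "0 < real n" using n by simp
  have e: "0 < e" "e \<le> 1" "real n * e = 1" using n by (auto simp: e_def)
  have "exp (- lg) = e" using n0 by (simp add: lg e_def exp_minus divide_inverse)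
  then have ek: "exp (- (real k * lg)) = e ^ k" for k using exp_of_nat_mult[of k "- lg"] by simp
  have E: "E = 2 * e ^ 16" "exp (- (20 * lg)) = e ^ 20" using ek[of 16] ek[of 20] by (simp_all add: E_def)
  have ne: "real n * e ^ Suc k = e ^ k" for k using e(3) by (simp add: mult.assoc[symmetric])
  have ne1: "real n * e ^ 20 = e ^ 19" using ne[of 19] by simp
  have ne2: "real n ^ 4 * e ^ 16 = e ^ 12"
    using ne[of 15] ne[of 14] ne[of 13] ne[of 12] by (simp add: power4_eq_xxxx mult.assoc)
  have ne3: "real n ^ 3 * e ^ 16 = e ^ 13"
    using ne[of 15] ne[of 14] ne[of 13] by (simp add: power3_eq_cube mult.assoc)
  have dec: "e ^ k \<le> e ^ 10" if "10 \<le> k" for k using e that by (intro power_decreasing) auto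
  have "E + (E + (E + (real (2 * n) * (2 * exp (- (20 * lg))) + 3 * real n ^ 3 * (real n * E + (E + E))))) =
     6 * e ^ 16 + (4 * (real n * e ^ 20) + (6 * (real n ^ 4 * e ^ 16) + 12 * (real n ^ 3 * e ^ 16)))"
    unfolding E by (simp add: algebra_simps power4_eq_xxxx power3_eq_cube)
  also have "... \<le> 28 * e ^ 10" unfolding ne1 ne2 ne3
    using dec[of 16] dec[of 19] dec[of 12] dec[of 13] by simp
  also have "... \<le> 30 / real n ^ 10" using n0 by (simp add: e_def power_one_over divide_right_mono)
  finally show ?thesis .
qed

text \<open>The grid \<open>c + \<sigma> / n * j\<close> has about \<open>2 n\<^sup>3\<close> points, each costing about \<open>n\<close> events of probability at most \<open>2\<close> times \<open>n\<^sup>-\<^sup>1\<^sup>6\<close>. The constants are \<open>80 \<ge> 48 + 2 + 5\<close> from the block on \<open>T\<close>, the coupling and the discretisation.\<close>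

theorem good_event:
  assumes n: "16 \<le> n" and \<sigma>: "0 < \<sigma>" and r: "1 \<le> r" "r \<le> n" and l: "l < n" and lg: "lg = ln (real n)" "1 \<le> lg"
  shows "mostly (noi n \<sigma>) (30 / real n ^ 10) (\<lambda>w.
    opb {..<n} (ent w) (51 * (\<sigma> * sqrt (real n))) \<and>
    (\<forall>x. 50 * (51 * (\<sigma> * sqrt (real n))) \<le> \<bar>x\<bar> --> opb {..<r} (Emat n r (ent w) \<sigma> x) (80 * (\<sigma> * sqrt (real r * lg)))) \<and>
    (\<forall>j\<in>{- int (n ^ 3)..int (n ^ 3)}. rows_ok n r (ent w) \<sigma> lg a (c + \<sigma> / real n * of_int j) \<and>
       quad_ok n r ls (ent w) \<sigma> lg l (c + \<sigma> / real n * of_int j) \<and> lin_ok n r ls (ent w) \<sigma> lg l a (c + \<sigma> / real n * of_int j)))"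
proof -
  define \<rho> where "\<rho> = 51 * (\<sigma> * sqrt (real n))"
  let ?E = "2 * exp (- (16 * lg))"
  let ?B = "{r..<n}" and ?T = "{..<r}" and ?S = "{..<n}"
  let ?L = "27 * real n + 16 * lg" and ?LT = "27 * real r + 16 * lg"
  have E0: "0 \<le> ?E" by simp
  have lgn: "lg \<le> real n" using ln_le_minus_one[of "real n"] n lg by simp
  have lg0: "0 \<le> lg" "0 < lg" using lg by auto
  have 1: "mostly (noi n \<sigma>) ?E (\<lambda>w. \<not> netbad n \<sigma> ?S ?L w)" by (rule netbad_mostly) (use \<sigma> lg0 in auto)
  have 2: "mostly (noi n \<sigma>) ?E (\<lambda>w. \<not> netbad n \<sigma> ?T ?LT w)" by (rule netbad_mostly) (use \<sigma> lg0 r in auto)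
  have 3: "mostly (noi n \<sigma>) ?E (\<lambda>w. \<not> netbad n \<sigma> ?B ?L w)" by (rule netbad_mostly) (use \<sigma> lg0 in auto)
  note 4 = block_mostly[OF n \<sigma> r lg(2) lgn, folded \<rho>_def]
  have 5: "mostly (noi n \<sigma>) (real n * ?E) (\<lambda>w. \<forall>k\<in>?T. \<bar>\<Sum>i\<in>?B. mv ?B (res n r (ent w) x) a i * ent w i k\<bar>
     \<le> 6 * \<sigma> * sqrt lg * L2_set (mv ?B (res n r (ent w) x) a) ?B)" for x
    by (rule mostly_all) (use r rows_prob[OF r(2) \<sigma> lg0(1)] in \<open>auto simp: mostly_def\<close>)
  have 6: "mostly (noi n \<sigma>) ?E (\<lambda>w. quad_ok n r ls (ent w) \<sigma> lg l x)" for x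
    unfolding mostly_def by (rule quad_prob[OF l \<sigma> lg0(2)])
  have 7: "mostly (noi n \<sigma>) ?E (\<lambda>w. lin_ok n r ls (ent w) \<sigma> lg l a x)" for x
    unfolding mostly_def by (rule lin_prob[OF l \<sigma> lg0(1)])
  let ?J = "{- int (n ^ 3)..int (n ^ 3)}"
  let ?x = "\<lambda>j::int. c + \<sigma> / real n * of_int j"
  let ?Q = "\<lambda>j w. (\<forall>k\<in>?T. \<bar>\<Sum>i\<in>?B. mv ?B (res n r (ent w) (?x j)) a i * ent w i k\<bar>
     \<le> 6 * \<sigma> * sqrt lg * L2_set (mv ?B (res n r (ent w) (?x j)) a) ?B) \<and> quad_ok n r ls (ent w) \<sigma> lg l (?x j) \<and> lin_ok n r ls (ent w) \<sigma> lg l a (?x j)"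
  have 8: "mostly (noi n \<sigma>) (3 * real n ^ 3 * (real n * ?E + (?E + ?E))) (\<lambda>w. \<forall>j\<in>?J. ?Q j w)"
  proof (rule mostly_all)
    show "real (card ?J) \<le> 3 * real n ^ 3"
    proof -
      have "1 \<le> real n ^ 3" using n by simp
      moreover have "real (card ?J) = 2 * real n ^ 3 + 1"
        by (simp only: card_atLeastAtMost_int) (simp add: nat_add_distrib nat_mult_distrib)
      ultimately show ?thesis by simp
    qed
    show "mostly (noi n \<sigma>) (real n * ?E + (?E + ?E)) (?Q j)" for j
      by (intro mostly_conj 5 6 7) auto
  qed auto
  have all: "mostly (noi n \<sigma>) (?E + (?E + (?E + (real (2 * n) * (2 * exp (- (20 * lg))) + 3 * real n ^ 3 * (real n * ?E + (?E + ?E))))))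
    (\<lambda>w. \<not> netbad n \<sigma> ?S ?L w \<and> \<not> netbad n \<sigma> ?T ?LT w \<and> \<not> netbad n \<sigma> ?B ?L w \<and>
     (netbad n \<sigma> ?B ?L w \<or> (\<forall>x\<in>netX n \<sigma> \<rho>. 25 * \<rho> \<le> \<bar>x\<bar> -->
      opb ?T (\<lambda>k k'. Gmat n r (ent w) x k k' - (if k = k' then gam n r (ent w) \<sigma> x else 0)) (2 * (\<sigma> * sqrt (real r * lg))))) \<and>
     (\<forall>j\<in>?J. ?Q j w))"
    by (intro mostly_conj 1 2 3 4 8) auto
  show ?thesis
  proof (rule mostly_mono[OF all failure_total[OF _ lg(1)]])
    show "1 \<le> n" using n by simp
    fix w
    assume w: "\<not> netbad n \<sigma> ?S ?L w \<and> \<not> netbad n \<sigma> ?T ?LT w \<and> \<not> netbad n \<sigma> ?B ?L w \<and>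
     (netbad n \<sigma> ?B ?L w \<or> (\<forall>x\<in>netX n \<sigma> \<rho>. 25 * \<rho> \<le> \<bar>x\<bar> -->
      opb ?T (\<lambda>k k'. Gmat n r (ent w) x k k' - (if k = k' then gam n r (ent w) \<sigma> x else 0)) (2 * (\<sigma> * sqrt (real r * lg))))) \<and>
     (\<forall>j\<in>?J. ?Q j w)"
    from w have nbS: "\<not> netbad n \<sigma> ?S ?L w" and nbT: "\<not> netbad n \<sigma> ?T ?LT w" and Qj: "\<forall>j\<in>?J. ?Q j w"
      and net: "\<forall>x\<in>netX n \<sigma> \<rho>. 25 * \<rho> \<le> \<bar>x\<bar> -->
      opb ?T (\<lambda>k k'. Gmat n r (ent w) x k k' - (if k = k' then gam n r (ent w) \<sigma> x else 0)) (2 * (\<sigma> * sqrt (real r * lg)))"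
      by blast+
    have S0: "0 \<le> \<sigma> * sqrt (real n)" using \<sigma> by simp
    have "?L \<le> 43 * real n" "0 \<le> ?L" using lgn lg0 by auto
    then have "16/7 * (sqrt (2 * ?L) * (sqrt 5 * \<sigma>)) \<le> 48 * (\<sigma> * sqrt (real n))" by (intro net_level \<sigma>)
    then have "16/7 * (sqrt (2 * ?L) * (sqrt 5 * \<sigma>)) \<le> \<rho>" using S0 unfolding \<rho>_def by linarith
    then have op: "opb ?S (ent w) \<rho>" by (rule opb_mono[OF not_netbad_opb[OF finite_lessThan nbS \<sigma> \<open>0 \<le> ?L\<close>]])
    have rl: "1 \<le> real r * lg" using r lg mult_mono[of 1 "real r" 1 lg] by simp
    have LT0: "0 \<le> ?LT" using lg0 by simp
    have "?LT \<le> 43 * (real r * lg)"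
    proof -
      have "real r \<le> real r * lg" "lg \<le> real r * lg" using r lg mult_left_mono[of 1 lg "real r"] mult_right_mono[of 1 "real r" lg] by auto
      then show ?thesis by simp
    qed
    then have "16/7 * (sqrt (2 * ?LT) * (sqrt 5 * \<sigma>)) \<le> 48 * (\<sigma> * sqrt (real r * lg))" using lg0 by (intro net_level \<sigma>) auto
    then have opT: "opb ?T (ent w) (48 * (\<sigma> * sqrt (real r * lg)))"
      by (rule opb_mono[OF not_netbad_opb[OF finite_lessThan nbT \<sigma> LT0]])
    have s1: "\<sigma> \<le> \<sigma> * sqrt (real r * lg)" using rl \<sigma> mult_left_mono[of 1 "sqrt (real r * lg)" \<sigma>] by simp
    have E: "opb ?T (Emat n r (ent w) \<sigma> x) (80 * (\<sigma> * sqrt (real r * lg)))" if x: "50 * \<rho> \<le> \<bar>x\<bar>" for x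
    proof (rule opb_mono)
      show "opb ?T (Emat n r (ent w) \<sigma> x) (48 * (\<sigma> * sqrt (real r * lg)) + 2 * (\<sigma> * sqrt (real r * lg)) + 5 * \<sigma>)"
        by (rule E_net[OF ent_sym_on r(2) \<sigma> \<rho>_def n op opT _ _ net[rule_format] x]) (use s1 \<sigma> in auto)
      show "48 * (\<sigma> * sqrt (real r * lg)) + 2 * (\<sigma> * sqrt (real r * lg)) + 5 * \<sigma> \<le> 80 * (\<sigma> * sqrt (real r * lg))" using s1 \<sigma> by linarith
    qed
    show "opb ?S (ent w) (51 * (\<sigma> * sqrt (real n))) \<and>
    (\<forall>x. 50 * (51 * (\<sigma> * sqrt (real n))) \<le> \<bar>x\<bar> --> opb {..<r} (Emat n r (ent w) \<sigma> x) (80 * (\<sigma> * sqrt (real r * lg)))) \<and>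
    (\<forall>j\<in>?J. rows_ok n r (ent w) \<sigma> lg a (?x j) \<and> quad_ok n r ls (ent w) \<sigma> lg l (?x j) \<and> lin_ok n r ls (ent w) \<sigma> lg l a (?x j))"
      unfolding \<rho>_def[symmetric] rows_ok_def
    proof (intro conjI allI impI ballI)
      show "opb ?S (ent w) \<rho>" by (rule op)
      show "opb ?T (Emat n r (ent w) \<sigma> x) (80 * (\<sigma> * sqrt (real r * lg)))" if "50 * \<rho> \<le> \<bar>x\<bar>" for x by (rule E[OF that])
      fix j assume j: "j \<in> ?J"
      have q: "?Q j w" using Qj j by blast
      then show "quad_ok n r ls (ent w) \<sigma> lg l (?x j)" "lin_ok n r ls (ent w) \<sigma> lg l a (?x j)" by blast+
      fix k assume "k < r"
      then show "\<bar>\<Sum>i\<in>?B. mv ?B (res n r (ent w) (?x j)) a i * ent w i k\<bar>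
     \<le> 6 * \<sigma> * sqrt lg * L2_set (mv ?B (res n r (ent w) (?x j)) a) ?B" using q by blast
    qed
  qed
qed

section \<open>Rotation invariance of the noise\<close>

definition hq :: "nat \<times> nat => real" where "hq q = (if fst q = snd q then 1 / 2 else 1)"

definition Gq :: "(nat => nat => real) => nat \<times> nat => nat => nat => real" where
  "Gq Q q x y = Q x (fst q) * Q y (snd q) + Q x (snd q) * Q y (fst q)"

text \<open>The lower triangle of \<open>Q H Q\<^sup>T\<close>, written as a linear map of the lower triangle of \<open>H\<close>; \<open>hq\<close> compensates that \<open>Gq\<close> counts a diagonal entry twice.\<close>

definition rotw :: "nat => (nat => nat => real) => (nat \<times> nat => real) => nat \<times> nat => real" where
  "rotw n Q w = (\<lambda>p\<in>Idx n. \<Sum>q\<in>Idx n. hq q * Gq Q q (fst p) (snd p) * w q)"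

lemma Gq_swap: "Gq Q q y x = Gq Q q x y" by (simp add: Gq_def mult.commute add.commute)

lemma Idx_alt: "Idx n = {(i, j). i \<in> {..<n} \<and> j \<in> {..<n} \<and> j \<le> i}" by (auto simp: Idx_def)

lemma ent_rotw:
  assumes x: "x < n" and y: "y < n"
  shows "ent (rotw n Q w) x y = (\<Sum>i<n. \<Sum>j<n. Q x i * ent w i j * Q y j)"
proof -
  have "ent (rotw n Q w) x y = (\<Sum>q\<in>Idx n. hq q * Gq Q q x y * w q)"
    unfolding ent_def rotw_def using Idx_mem[OF x y] by (auto simp: max_def min_def Gq_swap)
  also have "... = (\<Sum>p\<in>Idx n. (if fst p = snd p then 1 else 2) * (1 / 2 * Gq Q (fst p, snd p) x y * ent w (fst p) (snd p)))"
    by (rule sum.cong) (auto simp: hq_def Idx_def ent_def max_def min_def)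
  also have "... = (\<Sum>i<n. \<Sum>j<n. 1 / 2 * Gq Q (i, j) x y * ent w i j)"
    unfolding Idx_alt by (rule sym_sum[symmetric]) (auto simp: Gq_def ent_sym)
  also have "... = 1 / 2 * (\<Sum>i<n. \<Sum>j<n. Q x i * ent w i j * Q y j) + 1 / 2 * (\<Sum>i<n. \<Sum>j<n. Q x j * ent w i j * Q y i)"
    by (simp add: Gq_def sum_distrib_left sum.distrib[symmetric] algebra_simps)
  also have "(\<Sum>i<n. \<Sum>j<n. Q x j * ent w i j * Q y i) = (\<Sum>j<n. \<Sum>i<n. Q x j * ent w i j * Q y i)" by (rule sum.swap)
  also have "... = (\<Sum>i<n. \<Sum>j<n. Q x i * ent w i j * Q y j)" by (intro sum.cong refl) (simp add: ent_sym)
  finally show ?thesis by simp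
qed

text \<open>The same map in standardised entries.\<close>

definition rotV :: "(nat => nat => real) => nat \<times> nat => nat \<times> nat => real" where
  "rotV Q p q = hq q * Gq Q q (fst p) (snd p) * sd 1 q / sd 1 p"

text \<open>The weights \<open>1 / sd\<^sup>2\<close> turn the sum over the triangle into half the full double sum (\<open>sym_sum\<close>), which factorises into inner products of columns of \<open>Q\<close>.\<close>

lemma rotV_colorth:
  assumes Q: "orthon {..<n} {..<n} Q"
  shows "colorth (Idx n) (rotV Q)"
  unfolding colorth_def
proof (intro ballI)
  fix q q' assume q: "q \<in> Idx n" "q' \<in> Idx n"
  define C where "C a b = (\<Sum>x<n. Q x a * Q x b)" for a b
  have C: "C a b = (if a = b then 1 else 0)" if "a < n" "b < n" for a b
    unfolding C_def by (rule orthon_rows[OF _ _ Q]) (use that in auto)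
  obtain i j k m where ij: "q = (i, j)" "q' = (k, m)" by (cases q, cases q')
  have b: "j \<le> i" "i < n" "m \<le> k" "k < n" "j < n" "m < n" using q unfolding ij by (auto simp: Idx_def)
  have "(\<Sum>p\<in>Idx n. rotV Q p q * rotV Q p q') =
    (\<Sum>p\<in>Idx n. (if fst p = snd p then 1 else 2) * (hq q * hq q' * sd 1 q * sd 1 q' / 2 * (Gq Q q (fst p) (snd p) * Gq Q q' (fst p) (snd p))))"
    by (rule sum.cong) (auto simp: rotV_def sd_def field_simps)
  also have "... = (\<Sum>x<n. \<Sum>y<n. hq q * hq q' * sd 1 q * sd 1 q' / 2 * (Gq Q q x y * Gq Q q' x y))"
    unfolding Idx_alt by (rule sym_sum[symmetric]) (auto simp: Gq_swap)
  also have "... = hq q * hq q' * sd 1 q * sd 1 q' / 2 * (\<Sum>x<n. \<Sum>y<n. Gq Q q x y * Gq Q q' x y)"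
    by (simp add: sum_distrib_left)
  also have "(\<Sum>x<n. \<Sum>y<n. Gq Q q x y * Gq Q q' x y) = (\<Sum>x<n. \<Sum>y<n. (Q x i * Q x k) * (Q y j * Q y m)
     + (Q x i * Q x m) * (Q y j * Q y k) + (Q x j * Q x k) * (Q y i * Q y m) + (Q x j * Q x m) * (Q y i * Q y k))"
    by (intro sum.cong refl) (simp add: Gq_def ij algebra_simps)
  also have "... = C i k * C j m + C i m * C j k + C j k * C i m + C j m * C i k"
    unfolding C_def sum_product by (simp only: sum.distrib)
  also have "hq q * hq q' * sd 1 q * sd 1 q' / 2 * ... = (if q = q' then 1 else 0)"
    using b by (auto simp: C ij hq_def sd_def)
  finally show "(\<Sum>p\<in>Idx n. rotV Q p q * rotV Q p q') = (if q = q' then 1 else 0)" .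
qed

lemma rotw_measurable: "rotw n Q \<in> measurable (noi n \<sigma>) (noi n \<sigma>)"
  unfolding rotw_def noi_def
  by (rule measurable_restrict)
     (auto simp: measurable_cong_sets[OF refl sets_nd] intro!: borel_measurable_sum borel_measurable_times component_measurable)

theorem rotw_preserves:
  assumes Q: "orthon {..<n} {..<n} Q" and \<sigma>: "0 < \<sigma>" and P: "P \<in> sets (noi n \<sigma>)"
  shows "emeasure (noi n \<sigma>) (rotw n Q -` P \<inter> space (noi n \<sigma>)) = emeasure (noi n \<sigma>) P"
proof -
  let ?I = "Idx n" and ?s = "sd \<sigma>"
  have noi: "noi n \<sigma> = PiM ?I (\<lambda>p. nd (?s p))" by (simp add: noi_def)
  have d: "distr (gau ?I) (noi n \<sigma>) (scl ?I ?s) = noi n \<sigma>" unfolding noi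
    by (rule PiM_scale[OF finite_Idx sd_pos[OF \<sigma>]])
  have sm: "scl ?I ?s \<in> measurable (gau ?I) (noi n \<sigma>)" unfolding noi by (rule scl_measurable)
  have P': "rotw n Q -` P \<inter> space (noi n \<sigma>) \<in> sets (noi n \<sigma>)" by (rule measurable_sets[OF rotw_measurable P])
  have com: "rotw n Q (scl ?I ?s \<omega>) = scl ?I ?s (lin ?I (rotV Q) \<omega>)" for \<omega>
  proof -
    have "sd \<sigma> p = \<sigma> * sd 1 p" for p by (simp add: sd_def)
    moreover have "sd 1 p \<noteq> 0" for p using sd_pos[of 1 p] by simp
    ultimately show ?thesis
      by (auto simp: rotw_def scl_def lin_def rotV_def fun_eq_iff restrict_def sum_distrib_left intro!: sum.cong)
  qed
  have ssp: "scl ?I ?s \<omega> \<in> space (noi n \<sigma>)" for \<omega> unfolding noi space_PiM_nd by (simp add: scl_def)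
  have Pm: "indicator P \<in> borel_measurable (noi n \<sigma>)" using P by simp
  have f: "(\<lambda>\<omega>. indicator P (scl ?I ?s \<omega>) :: ennreal) \<in> borel_measurable (gau ?I)"
    by (rule measurable_compose[OF sm Pm])
  have "emeasure (noi n \<sigma>) (rotw n Q -` P \<inter> space (noi n \<sigma>)) =
     (\<integral>\<^sup>+w. indicator (rotw n Q -` P \<inter> space (noi n \<sigma>)) w \<partial>distr (gau ?I) (noi n \<sigma>) (scl ?I ?s))"
    unfolding d using P' by simp
  also have "... = (\<integral>\<^sup>+\<omega>. indicator (rotw n Q -` P \<inter> space (noi n \<sigma>)) (scl ?I ?s \<omega>) \<partial>gau ?I)"
    by (rule nn_integral_distr[OF sm]) (use P' in simp)
  also have "... = (\<integral>\<^sup>+\<omega>. indicator P (scl ?I ?s (lin ?I (rotV Q) \<omega>)) \<partial>gau ?I)"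
    by (rule nn_integral_cong) (simp add: indicator_def ssp com)
  also have "... = (\<integral>\<^sup>+\<omega>. indicator P (scl ?I ?s \<omega>) \<partial>gau ?I)"
    by (rule bspec[OF gauss_orthogonal_invariant[OF finite_Idx rotV_colorth[OF Q], unfolded pres_def] f])
  also have "... = (\<integral>\<^sup>+w. indicator P w \<partial>distr (gau ?I) (noi n \<sigma>) (scl ?I ?s))"
    by (rule nn_integral_distr[OF sm, symmetric]) (use P in simp)
  also have "... = emeasure (noi n \<sigma>) P" unfolding d using P by simp
  finally show ?thesis .
qed

lemma mostly_rotate:
  assumes Q: "orthon {..<n} {..<n} Q" and \<sigma>: "0 < \<sigma>" and m: "mostly (noi n \<sigma>) p R"
  shows "mostly (noi n \<sigma>) p (\<lambda>w. R (rotw n Q w))"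
proof -
  obtain P where P: "P \<in> sets (noi n \<sigma>)" "emeasure (noi n \<sigma>) P \<le> ennreal p" "\<forall>w\<in>space (noi n \<sigma>) - P. R w"
    using m unfolding mostly_def by blast
  show ?thesis unfolding mostly_def
  proof (intro bexI[of _ "rotw n Q -` P \<inter> space (noi n \<sigma>)"] conjI ballI)
    show "emeasure (noi n \<sigma>) (rotw n Q -` P \<inter> space (noi n \<sigma>)) \<le> ennreal p"
      using rotw_preserves[OF Q \<sigma> P(1)] P(2) by simp
    show "rotw n Q -` P \<inter> space (noi n \<sigma>) \<in> sets (noi n \<sigma>)" by (rule measurable_sets[OF rotw_measurable P(1)])
    fix w assume "w \<in> space (noi n \<sigma>) - (rotw n Q -` P \<inter> space (noi n \<sigma>))"
    then show "R (rotw n Q w)" using P(3) measurable_space[OF rotw_measurable] by auto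
  qed
qed

section \<open>The estimates on the good event\<close>

text \<open>\<open>\<bar>lam l - ls l\<bar> \<le> 102 \<sigma> \<surd>n\<close>, so the grid with \<open>n\<^sup>3\<close> steps of length \<open>\<sigma> / n\<close> contains a point \<open>x\<close> within \<open>\<sigma> / n\<close> of \<open>lam l\<close>; the previous estimates apply with it.\<close>

theorem det_estimates:
  fixes H :: "nat => nat => real" and ls lam a w :: "nat => real"
  assumes n: "104 \<le> n" and \<sigma>: "0 < \<sigma>" and l: "l < r" and rn: "r \<le> n" and lg: "1 \<le> lg" "lg\<^sup>2 \<le> real n"
    and H: "sym_on {..<n} H" and lsdec: "\<And>j k. j \<le> k ==> k < r ==> \<bar>ls k\<bar> \<le> \<bar>ls j\<bar>"
    and snr: "5100 * (\<sigma> * sqrt (real n)) \<le> \<bar>ls (r - 1)\<bar>" and rlg: "4 * (real r * lg) \<le> real n"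
    and \<Delta>: "8000 * (\<sigma> * sqrt (real r * lg)) \<le> \<Delta>" and gap: "\<And>k. k < r ==> k \<noteq> l ==> \<Delta> \<le> \<bar>ls l - ls k\<bar>"
    and eig: "eigsys {..<n} (spk r ls H) V lam" and lab: "labelling n r ls lam"
    and a1: "dot {..<n} a a = 1"
    and good: "opb {..<n} H (51 * (\<sigma> * sqrt (real n)))"
      "\<And>x. 50 * (51 * (\<sigma> * sqrt (real n))) \<le> \<bar>x\<bar> ==> opb {..<r} (Emat n r H \<sigma> x) (80 * (\<sigma> * sqrt (real r * lg)))"
      "\<And>j. j \<in> {- int (n ^ 3)..int (n ^ 3)} ==> rows_ok n r H \<sigma> lg a (ls l + \<sigma> / real n * of_int j) \<and>
       quad_ok n r ls H \<sigma> lg l (ls l + \<sigma> / real n * of_int j) \<and> lin_ok n r ls H \<sigma> lg l a (ls l + \<sigma> / real n * of_int j)"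
    and w1: "dot {..<n} w w = 1" and w: "\<And>i. i \<in> {..<n} ==> mv {..<n} (spk r ls H) w i = lam l * w i"
  defines "Ea \<equiv> \<sigma>\<^sup>2 * real r * lg / \<Delta>\<^sup>2 * \<bar>a l\<bar> + \<sigma> * sqrt (real r * lg) * (\<Sum>k\<in>{..<r} - {l}. \<bar>a k\<bar> / \<bar>ls l - ls k\<bar>)
     + \<sigma> * sqrt lg / \<bar>ls l\<bar>"
  shows "sign_dist (dot {..<n} a w) (a l) \<le> 23409 * (Ea + \<sigma>\<^sup>2 * real n / \<bar>ls l\<bar>\<^sup>2 * \<bar>a l\<bar>)"
    and "sign_dist (sqrt (1 + (\<Sum>i\<in>{r..<n}. \<sigma>\<^sup>2 / (lam l - lam i)\<^sup>2)) * dot {..<n} a w) (a l) \<le> 23409 * Ea"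
proof -
  define s where "s = sqrt (real n)"
  have s: "1 \<le> s" "s * s = real n" using n by (auto simp: s_def)
  define \<rho> where "\<rho> = 51 * (\<sigma> * sqrt (real n))"
  define \<epsilon> where "\<epsilon> = 80 * (\<sigma> * sqrt (real r * lg))"
  have r1: "1 \<le> real r" using l by simp
  have rl: "1 \<le> real r * lg" using r1 lg mult_mono[of 1 "real r" 1 lg] by simp
  have sr: "1 \<le> sqrt (real r * lg)" using rl by simp
  have s1: "\<sigma> \<le> \<sigma> * sqrt (real r * lg)" using sr \<sigma> mult_left_mono[of 1 "sqrt (real r * lg)" \<sigma>] by simp
  have \<epsilon>\<rho>: "\<epsilon> \<le> \<rho>"
  proof -
    have "sqrt (real r * lg) \<le> sqrt (real n / 2\<^sup>2)" using rlg by (intro real_sqrt_le_mono) simp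
    also have "... = s / 2" by (simp add: s_def real_sqrt_divide)
    finally have "\<sigma> * sqrt (real r * lg) \<le> \<sigma> * (s / 2)" using \<sigma> by (intro mult_left_mono) auto
    then have "\<epsilon> \<le> 40 * (\<sigma> * s)" by (simp add: \<epsilon>_def)
    also have "... \<le> \<rho>" unfolding \<rho>_def s_def using \<sigma> by (intro mult_right_mono) auto
    finally show ?thesis .
  qed
  have lm: "\<bar>ls (r - 1)\<bar> \<le> \<bar>ls k\<bar>" if "k < r" for k using lsdec[of k "r - 1"] that l by simp
  have \<rho>lm: "100 * \<rho> \<le> \<bar>ls (r - 1)\<bar>" using snr by (simp add: \<rho>_def)
  interpret labelled n r ls H \<sigma> \<rho> \<epsilon> "\<bar>ls (r - 1)\<bar>" l \<Delta> V lam
  proof unfold_locales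
    show "opb {..<r} (Emat n r H \<sigma> x) \<epsilon>" if "\<bar>ls (r - 1)\<bar> / 2 \<le> \<bar>x\<bar>" for x
      unfolding \<epsilon>_def by (rule good(2)) (use that \<rho>lm in \<open>simp add: \<rho>_def\<close>)
    show "\<sigma> * sqrt (real n) \<le> \<rho>" using \<sigma> by (simp add: \<rho>_def)
    show "0 < \<Delta>" using \<Delta> s1 \<sigma> by linarith
    show "100 * \<epsilon> \<le> \<Delta>" using \<Delta> by (simp add: \<epsilon>_def)
    show "0 \<le> \<epsilon>" using s1 \<sigma> by (simp add: \<epsilon>_def)
    show "opb {..<n} H \<rho>" using good(1) by (simp add: \<rho>_def)
  qed (use rn n H \<sigma> \<rho>lm lm \<epsilon>\<rho> l lsdec gap eig lab in auto)
  define j where "j = \<lfloor>(lam l - ls l) / (\<sigma> / real n)\<rfloor>"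
  define x where "x = ls l + \<sigma> / real n * of_int j"
  have dl: "0 < \<sigma> / real n" using \<sigma> n by simp
  have f: "of_int j \<le> (lam l - ls l) / (\<sigma> / real n)" "(lam l - ls l) / (\<sigma> / real n) < of_int j + 1"
    unfolding j_def by linarith+
  have f1: "\<sigma> / real n * of_int j \<le> lam l - ls l" using f(1) unfolding pos_le_divide_eq[OF dl] by (simp only: mult.commute)
  have f2: "lam l - ls l < \<sigma> / real n * of_int j + \<sigma> / real n" using f(2) unfolding pos_divide_less_eq[OF dl]
    by (simp only: distrib_right mult_1 mult.commute)
  have xl: "\<bar>x - lam l\<bar> \<le> \<sigma> / real n" unfolding x_def using f1 f2 by linarith
  have jb: "\<bar>real_of_int j\<bar> \<le> 103 * real n * real n"
  proof -
    have q: "\<bar>(lam l - ls l) / (\<sigma> / real n)\<bar> \<le> 102 * real n * s"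
    proof -
      have "\<bar>(lam l - ls l) / (\<sigma> / real n)\<bar> = \<bar>lam l - ls l\<bar> * (real n / \<sigma>)" using \<sigma> by (simp add: abs_mult)
      also have "... \<le> (2 * \<rho>) * (real n / \<sigma>)" by (intro mult_right_mono lam_l(3)) (use \<sigma> in simp)
      also have "... = 102 * real n * s" using \<sigma> by (simp add: \<rho>_def s_def)
      finally show ?thesis .
    qed
    have "s \<le> real n" using s mult_left_mono[of 1 s s] by simp
    then have "102 * real n * s \<le> 102 * real n * real n" by (intro mult_left_mono) auto
    moreover have "1 \<le> real n * real n" using n mult_mono[of 1 "real n" 1 "real n"] by simp
    ultimately show ?thesis using q f by linarith
  qed
  also have "... \<le> real n * real n * real n" using n by (intro mult_right_mono) auto
  also have "... = real_of_int (int (n ^ 3))" by (simp add: power3_eq_cube)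
  finally have "\<bar>j\<bar> \<le> int (n ^ 3)" by linarith
  then have jJ: "j \<in> {- int (n ^ 3)..int (n ^ 3)}" by auto
  interpret debias n r ls H \<sigma> \<rho> \<epsilon> "\<bar>ls (r - 1)\<bar>" l \<Delta> V lam lg x a
  proof unfold_locales
    show "\<sigma> \<le> \<epsilon>" unfolding \<epsilon>_def using s1 \<sigma> by linarith
    show "\<sigma> * sqrt (real r * lg) \<le> \<Delta>" using \<Delta> s1 \<sigma> by linarith
  qed (use lg xl a1 good(3)[OF jJ] in \<open>auto simp: \<epsilon>_def \<rho>_def x_def\<close>)
  show "sign_dist (dot {..<n} a w) (a l) \<le> 23409 * (Ea + \<sigma>\<^sup>2 * real n / \<bar>ls l\<bar>\<^sup>2 * \<bar>a l\<bar>)"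
    unfolding Ea_def by (rule estimates(1)[OF w1 w])
  show "sign_dist (sqrt (1 + (\<Sum>i\<in>{r..<n}. \<sigma>\<^sup>2 / (lam l - lam i)\<^sup>2)) * dot {..<n} a w) (a l) \<le> 23409 * Ea"
    unfolding Ea_def by (rule estimates(2)[OF w1 w])
qed

section \<open>Matrices with a given characteristic polynomial\<close>

lemma linear_factors_permute:
  fixes f g :: "'a => real"
  assumes fin: "finite S" and e: "(\<Prod>i\<in>S. [:- f i, 1:]) = (\<Prod>i\<in>S. [:- g i, 1:])"
  obtains p where "p permutes S" "\<forall>i\<in>S. g i = f (p i)"
proof -
  have pr: "proots (\<Prod>i\<in>S. [:- h i, 1:]) = image_mset h (mset_set S)" for h :: "'a => real"
  proof -
    have "proots (\<Prod>i\<in>S. [:- h i, 1:]) = (\<Sum>i\<in>S. {#h i#})" by (subst proots_prod) auto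
    also have "... = image_mset h (mset_set S)" using fin by (induction S rule: finite_induct) auto
    finally show ?thesis .
  qed
  have "image_mset g (mset_set S) = image_mset f (mset_set S)" using pr[of f] pr[of g] e by simp
  then show ?thesis by (rule image_mset_eq_implies_permutes[OF fin]) (use that in blast)
qed

text \<open>The orthonormal eigenbasis gives a similarity with a diagonal matrix.\<close>

lemma char_poly_eigsys:
  assumes M: "M \<in> carrier_mat n n" and V: "eigsys {..<n} (\<lambda>i j. M $$ (i, j)) V \<nu>"
  shows "char_poly M = (\<Prod>i<n. [:- \<nu> i, 1:])"
proof -
  let ?S = "{..<n}"
  define P where "P = mat n n (\<lambda>(i, k). V k i)"
  define R where "R = mat n n (\<lambda>(k, i). V k i)"
  define D where "D = mat n n (\<lambda>(i, j). if i = j then \<nu> i else 0)"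
  have c: "P \<in> carrier_mat n n" "R \<in> carrier_mat n n" "D \<in> carrier_mat n n" by (simp_all add: P_def R_def D_def)
  have PR: "P * R = 1\<^sub>m n"
  proof (rule eq_matI)
    fix i j assume ij: "i < dim_row (1\<^sub>m n :: real mat)" "j < dim_col (1\<^sub>m n :: real mat)"
    then have "(P * R) $$ (i, j) = (\<Sum>k<n. V k i * V k j)"
      by (auto simp: P_def R_def scalar_prod_def lessThan_atLeast0 intro!: sum.cong)
    then show "(P * R) $$ (i, j) = 1\<^sub>m n $$ (i, j)" using eig_rows[OF _ V, of i j] ij by simp
  qed (simp_all add: P_def R_def)
  have RP: "R * P = 1\<^sub>m n"
  proof (rule eq_matI)
    fix i j assume ij: "i < dim_row (1\<^sub>m n :: real mat)" "j < dim_col (1\<^sub>m n :: real mat)"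
    then have "(R * P) $$ (i, j) = dot ?S (V i) (V j)"
      by (auto simp: P_def R_def scalar_prod_def dot_def lessThan_atLeast0 intro!: sum.cong)
    then show "(R * P) $$ (i, j) = 1\<^sub>m n $$ (i, j)" using eigsysD(1)[OF V] ij by (simp add: orthon_def)
  qed (simp_all add: P_def R_def)
  have PDR: "M = P * D * R"
  proof (rule eq_matI)
    fix i j assume "i < dim_row (P * D * R)" "j < dim_col (P * D * R)"
    then have ij: "i < n" "j < n" by (simp_all add: P_def R_def)
    have PD: "(P * D) $$ (i, k) = V k i * \<nu> k" if "k < n" for k
    proof -
      have "(P * D) $$ (i, k) = (\<Sum>m = 0..<n. V m i * (if m = k then \<nu> m else 0))"
        using ij that by (simp add: P_def D_def scalar_prod_def)
      also have "... = (\<Sum>m = 0..<n. if m = k then V m i * \<nu> m else 0)" by (intro sum.cong) auto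
      finally show ?thesis using that by simp
    qed
    have "(P * D * R) $$ (i, j) = (\<Sum>k = 0..<n. (P * D) $$ (i, k) * V k j)"
      using ij c by (simp add: scalar_prod_def R_def)
    also have "... = (\<Sum>k<n. \<nu> k * V k i * V k j)"
      by (auto simp: PD lessThan_atLeast0 intro!: sum.cong)
    finally show "M $$ (i, j) = (P * D * R) $$ (i, j)" using eig_entry[OF _ V, of i j] ij by simp
  qed (use M in \<open>simp_all add: P_def R_def\<close>)
  have "similar_mat_wit M D P R" unfolding similar_mat_wit_def Let_def using M c PR RP PDR by auto
  then have "char_poly M = char_poly D" by (intro char_poly_similar) (auto simp: similar_mat_def)
  also have "... = (\<Prod>a\<leftarrow>diag_mat D. [:- a, 1:])"
    by (rule char_poly_upper_triangular[OF c(3)]) (auto simp: upper_triangular_def D_def)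
  also have "diag_mat D = map \<nu> [0..<n]" by (auto simp: diag_mat_def D_def)
  also have "(\<Prod>a\<leftarrow>map \<nu> [0..<n]. [:- a, 1:]) = (\<Prod>i<n. [:- \<nu> i, 1:])"
    by (simp add: prod.distinct_set_conv_list[symmetric] lessThan_atLeast0 comp_def)
  finally show ?thesis .
qed

lemma eigsys_of_char_poly:
  assumes M: "M \<in> carrier_mat n n" and s: "sym_on {..<n} (\<lambda>i j. M $$ (i, j))" and c: "char_poly M = (\<Prod>i<n. [:- \<mu> i, 1:])"
  shows "\<exists>V. eigsys {..<n} (\<lambda>i j. M $$ (i, j)) V \<mu>"
proof -
  obtain V \<nu> where V: "eigsys {..<n} (\<lambda>i j. M $$ (i, j)) V \<nu>" using spectral_theorem[OF finite_lessThan s] by blast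
  have "(\<Prod>i<n. [:- \<nu> i, 1:]) = (\<Prod>i<n. [:- \<mu> i, 1:])" using char_poly_eigsys[OF M V] c by simp
  then obtain p where p: "p permutes {..<n}" "\<forall>i\<in>{..<n}. \<mu> i = \<nu> (p i)"
    by (rule linear_factors_permute[OF finite_lessThan])
  have pin: "p i \<in> {..<n} \<longleftrightarrow> i \<in> {..<n}" for i by (rule permutes_in_image[OF p(1)])
  have inj: "p i = p j \<longleftrightarrow> i = j" for i j using permutes_inj[OF p(1)] by (auto simp: inj_def)
  have "eigsys {..<n} (\<lambda>i j. M $$ (i, j)) (\<lambda>i. V (p i)) \<mu>"
    unfolding eigsys_def orthon_def
  proof (intro conjI ballI)
    fix i j assume "i \<in> {..<n}" "j \<in> {..<n}"
    then show "dot {..<n} (V (p i)) (V (p j)) = (if i = j then 1 else 0)"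
      using eigsysD(1)[OF V] pin inj unfolding orthon_def by simp
  next
    fix k i assume "k \<in> {..<n}" "i \<in> {..<n}"
    then show "mv {..<n} (\<lambda>i j. M $$ (i, j)) (V (p k)) i = \<mu> k * V (p k) i"
      using eigsysD(2)[OF V, of "p k" i] pin p(2) by simp
  qed
  then show ?thesis by blast
qed

section \<open>Changing to the coordinates of the signal\<close>

text \<open>Coordinates with respect to the orthonormal basis \<open>Q\<close>.\<close>

definition cob :: "nat => (nat => nat => real) => (nat => real) => nat => real" where
  "cob n Q v x = dot {..<n} v (Q x)"

lemma cob_dot:
  assumes Q: "orthon {..<n} {..<n} Q"
  shows "dot {..<n} (cob n Q u) (cob n Q v) = dot {..<n} u v"
proof -
  have "dot {..<n} u v = (\<Sum>i<n. u i * (\<Sum>x<n. cob n Q v x * Q x i))"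
    unfolding dot_def[of _ u v]
  proof (rule sum.cong[OF refl])
    fix i assume "i \<in> {..<n}"
    from orthon_expand[OF _ _ Q refl this, of v] show "u i * v i = u i * (\<Sum>x<n. cob n Q v x * Q x i)"
      by (simp add: cob_def)
  qed
  also have "... = (\<Sum>x<n. \<Sum>i<n. u i * (cob n Q v x * Q x i))" unfolding sum_distrib_left by (rule sum.swap)
  also have "... = dot {..<n} (cob n Q u) (cob n Q v)"
    by (simp add: dot_def cob_def[of n Q u] sum_distrib_left sum_distrib_right mult_ac)
  finally show ?thesis by simp
qed

lemma cob_mv:
  assumes Q: "orthon {..<n} {..<n} Q" and x: "x < n"
    and W: "\<And>x y. x < n ==> y < n ==> W x y = (\<Sum>i<n. \<Sum>j<n. Q x i * m i j * Q y j)"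
  shows "mv {..<n} W (cob n Q v) x = cob n Q (mv {..<n} m v) x"
proof -
  have "mv {..<n} W (cob n Q v) x = (\<Sum>y<n. \<Sum>i<n. \<Sum>j<n. Q x i * m i j * (cob n Q v y * Q y j))"
    unfolding mv_def by (rule sum.cong) (simp_all add: W[OF x] sum_distrib_left sum_distrib_right mult_ac)
  also have "... = (\<Sum>i<n. \<Sum>y<n. \<Sum>j<n. Q x i * m i j * (cob n Q v y * Q y j))" by (rule sum.swap)
  also have "... = (\<Sum>i<n. \<Sum>j<n. \<Sum>y<n. Q x i * m i j * (cob n Q v y * Q y j))" by (intro sum.cong refl sum.swap)
  also have "... = (\<Sum>i<n. \<Sum>j<n. Q x i * m i j * v j)"
  proof (intro sum.cong refl)
    fix i j assume "j \<in> {..<n}"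
    from orthon_expand[OF _ _ Q refl this, of v] show "(\<Sum>y<n. Q x i * m i j * (cob n Q v y * Q y j)) = Q x i * m i j * v j"
      by (simp add: cob_def sum_distrib_left)
  qed
  also have "... = cob n Q (mv {..<n} m v) x" by (simp add: cob_def dot_def mv_def sum_distrib_left sum_distrib_right mult_ac)
  finally show ?thesis .
qed

lemma cob_eigsys:
  assumes Q: "orthon {..<n} {..<n} Q" and V: "eigsys {..<n} m V \<nu>"
    and W: "\<And>x y. x < n ==> y < n ==> W x y = (\<Sum>i<n. \<Sum>j<n. Q x i * m i j * Q y j)"
  shows "eigsys {..<n} W (\<lambda>k. cob n Q (V k)) \<nu>"
  unfolding eigsys_def orthon_def cob_dot[OF Q]
proof (intro conjI ballI)
  show "dot {..<n} (V j) (V k) = (if j = k then 1 else 0)" if "j \<in> {..<n}" "k \<in> {..<n}" for j k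
    using eigsysD(1)[OF V] that by (simp add: orthon_def)
  fix k x assume k: "k \<in> {..<n}" and x: "x \<in> {..<n}"
  have "mv {..<n} W (cob n Q (V k)) x = cob n Q (mv {..<n} m (V k)) x" by (rule cob_mv[OF Q _ W]) (use x in auto)
  also have "... = cob n Q (\<lambda>i. \<nu> k * V k i) x"
    unfolding cob_def by (rule dot_cong) (use eigsysD(2)[OF V k] in auto)
  finally show "mv {..<n} W (cob n Q (V k)) x = \<nu> k * cob n Q (V k) x"
    by (simp add: cob_def dot_def sum_distrib_left mult_ac)
qed

text \<open>If the first \<open>r\<close> basis vectors are the eigenvectors of the signal, the observed matrix becomes a spiked matrix with rotated noise.\<close>

lemma spk_rotw:
  assumes Q: "orthon {..<n} {..<n} Q" and rn: "r \<le> n" and U: "\<And>k i. k < r ==> i < n ==> Q k i = U k i"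
    and x: "x < n" and y: "y < n"
  shows "spk r ls (ent (rotw n Q \<omega>)) x y =
    (\<Sum>i<n. \<Sum>j<n. Q x i * ((\<Sum>k<r. ls k * U k i * U k j) + ent \<omega> i j) * Q y j)"
proof -
  have c: "(\<Sum>i<n. Q x i * U k i) = (if x = k then 1 else 0)" if "k < r" "x < n" for k x
  proof -
    have "(\<Sum>i<n. Q x i * U k i) = dot {..<n} (Q x) (Q k)" unfolding dot_def by (rule sum.cong) (use U that in auto)
    then show ?thesis using Q that rn by (simp add: orthon_def)
  qed
  have "(\<Sum>i<n. \<Sum>j<n. Q x i * (\<Sum>k<r. ls k * U k i * U k j) * Q y j) =
    (\<Sum>i<n. \<Sum>j<n. \<Sum>k<r. ls k * ((Q x i * U k i) * (Q y j * U k j)))"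
    by (intro sum.cong refl) (simp add: sum_distrib_left sum_distrib_right mult_ac)
  also have "... = (\<Sum>i<n. \<Sum>k<r. \<Sum>j<n. ls k * ((Q x i * U k i) * (Q y j * U k j)))"
    by (intro sum.cong refl sum.swap)
  also have "... = (\<Sum>k<r. \<Sum>i<n. \<Sum>j<n. ls k * ((Q x i * U k i) * (Q y j * U k j)))" by (rule sum.swap)
  also have "... = (\<Sum>k<r. ls k * ((\<Sum>i<n. Q x i * U k i) * (\<Sum>j<n. Q y j * U k j)))"
    unfolding sum_product by (simp add: sum_distrib_left)
  also have "... = (\<Sum>k<r. if k = x then (if x = y then ls k else 0) else 0)"
    by (rule sum.cong) (use x y in \<open>auto simp: c\<close>)
  also have "... = (if x = y \<and> x < r then ls x else 0)" by (auto simp: sum.delta)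
  finally have 1: "(\<Sum>i<n. \<Sum>j<n. Q x i * (\<Sum>k<r. ls k * U k i * U k j) * Q y j) = (if x = y \<and> x < r then ls x else 0)" .
  show ?thesis
    unfolding spk_def ent_rotw[OF x y] 1[symmetric] by (simp add: distrib_left distrib_right sum.distrib)
qed

section \<open>Sizes of the parameters\<close>

lemma ln_facts:
  fixes n :: nat
  assumes "256 \<le> n" shows "1 \<le> ln (real n)" "(ln (real n))\<^sup>2 \<le> real n"
proof -
  have "exp 1 \<le> real n" using exp_le assms by linarith
  then show "1 \<le> ln (real n)" using assms by (subst ln_ge_iff) auto
  \<comment> \<open>\<open>ln n = 4 ln t \<le> 4 t\<close> and \<open>t \<ge> 4\<close>; this is where \<open>n \<ge> 256\<close> comes from\<close>
  define t where "t = sqrt (sqrt (real n))"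
  have "sqrt (sqrt (4 ^ 4)) \<le> t" unfolding t_def using assms by (intro real_sqrt_le_mono) simp
  moreover have "sqrt (sqrt (4 ^ 4)) = (4::real)" by (simp add: real_sqrt_unique)
  ultimately have t: "4 \<le> t" by simp
  have t4: "real n = t\<^sup>2 * t\<^sup>2" by (simp add: t_def flip: power2_eq_square)
  have "ln (real n) = 4 * ln t" using t unfolding t4 by (simp add: ln_mult power2_eq_square)
  also have "... \<le> 4 * t" using ln_le_minus_one[of t] t by simp
  finally have "(ln (real n))\<^sup>2 \<le> (4 * t)\<^sup>2" using \<open>1 \<le> ln (real n)\<close> by (intro power_mono) auto
  also have "... = 4\<^sup>2 * t\<^sup>2" by (rule power_mult_distrib)
  also have "... \<le> t\<^sup>2 * t\<^sup>2" using t by (intro mult_right_mono power_mono) auto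
  finally show "(ln (real n))\<^sup>2 \<le> real n" unfolding t4 .
qed

lemma gap_facts:
  assumes l: "1 \<le> l" "l \<le> r" and dec: "\<And>j k. 1 \<le> j ==> j \<le> k ==> k \<le> r ==> \<bar>ls k\<bar> \<le> \<bar>ls j\<bar>"
  shows "eigen_gap r ls l \<le> 2 * lam_max ls" "\<And>k. 1 \<le> k ==> k \<le> r ==> k \<noteq> l ==> eigen_gap r ls l \<le> \<bar>ls l - ls k\<bar>"
proof -
  have g: "eigen_gap r ls l \<le> \<bar>ls l - ls k\<bar>" if "1 \<le> k" "k \<le> r" "k \<noteq> l" for k
  proof -
    have "r > 1" using that l by linarith
    then show ?thesis unfolding eigen_gap_def using that by (auto intro!: Min_le)
  qed
  then show "\<And>k. 1 \<le> k ==> k \<le> r ==> k \<noteq> l ==> eigen_gap r ls l \<le> \<bar>ls l - ls k\<bar>" .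
  show "eigen_gap r ls l \<le> 2 * lam_max ls"
  proof (cases "r > 1")
    case True
    define k where "k = (if l = 1 then 2 else (1::nat))"
    have k: "1 \<le> k" "k \<le> r" "k \<noteq> l" using True by (auto simp: k_def)
    have "\<bar>ls k\<bar> \<le> lam_max ls" "\<bar>ls l\<bar> \<le> lam_max ls" unfolding lam_max_def using dec[of 1 k] dec[of 1 l] k l by auto
    then show ?thesis using g[OF k] by linarith
  qed (simp add: eigen_gap_def lam_max_def)
qed

text \<open>As \<open>\<kappa> \<ge> 1\<close> and \<open>\<Delta> \<le> 2 lam_max\<close>, the argument of the logarithm is at least \<open>n / 2 \<ge> \<surd>n\<close>; hence \<open>log n\<close> may replace it in all estimates.\<close>

lemma log_factor:
  assumes n: "4 \<le> n" and d: "0 < \<Delta>" "\<Delta> \<le> 2 * lam_max ls" and m: "0 < lam_min r ls" "lam_min r ls \<le> lam_max ls"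
  shows "ln (real n) \<le> 2 * ln (real n * cond_num r ls * lam_max ls / \<Delta>)"
proof -
  have lm: "0 < lam_max ls" using m by linarith
  have c: "1 \<le> cond_num r ls" using m by (simp add: cond_num_def)
  have h: "1 / 2 \<le> lam_max ls / \<Delta>" using d by (simp add: field_simps)
  have "real n * 1 * (1 / 2) \<le> real n * cond_num r ls * (lam_max ls / \<Delta>)"
    by (intro mult_mono h c) (use c in auto)
  then have b: "real n / 2 \<le> real n * cond_num r ls * lam_max ls / \<Delta>" by simp
  have "real n \<le> (real n / 2)\<^sup>2" using n mult_right_mono[of 4 "real n" "real n"] by (simp add: power2_eq_square)
  then have "ln (real n) \<le> ln ((real n / 2)\<^sup>2)" using n by (intro ln_mono) auto
  also have "... = 2 * ln (real n / 2)" using n by (simp add: ln_realpow)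
  also have "... \<le> 2 * ln (real n * cond_num r ls * lam_max ls / \<Delta>)" using b n by (intro mult_left_mono ln_mono) auto
  finally show ?thesis .
qed

lemma scalar_prod_dot: "u \<in> carrier_vec n ==> v \<in> carrier_vec n ==> u \<bullet> v = dot {..<n} (\<lambda>i. u $ i) (\<lambda>i. v $ i)"
  by (auto simp: scalar_prod_def dot_def lessThan_atLeast0)

lemma Suc_sum: "(\<Sum>k=1..r. f k) = (\<Sum>k<r. f (Suc k))"
  using sum.shift_bounds_Suc_ivl[of f 0 r] by (simp add: lessThan_atLeast0 atLeastLessThanSuc_atLeastAtMost)

lemma double_const:
  fixes s e m t :: real
  shows "s \<le> 23409 * e ==> e \<le> 2 * m ==> s \<le> 46818 * m"
    and "s \<le> 23409 * (e + t) ==> e \<le> 2 * m ==> 0 \<le> t ==> s \<le> 46818 * (m + t)"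
  by (simp_all add: algebra_simps)

text \<open>Translation to 0-based coordinates in an orthonormal basis \<open>Q\<close> extending the signal eigenvectors, applied to \<open>good_event\<close> pulled back along the rotation of the noise.\<close>

lemma theorem_instance:
  assumes n: "256 \<le> n" and dec: "eigen_decomposition n r Mstar ls us" and l: "1 \<le> l" "l \<le> r" and \<sigma>: "0 < \<sigma>"
    and snr: "\<sigma> * sqrt (real n) \<le> 1 / 5100 * lam_min r ls" and rk: "real r \<le> 1 / 4 * real n / (ln (real n))\<^sup>2"
    and gap: "8000 * \<sigma> * sqrt (real r) * ln (real n) < eigen_gap r ls l"
    and a: "a \<in> carrier_vec n" "norm2 a = 1"
  shows "\<exists>E \<in> sets (noise_law n \<sigma>).
         measure (noise_law n \<sigma>) E \<ge> 1 - 46818 / real n ^ 10 \<and>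
         (\<forall>\<omega> \<in> E. \<forall>lam u.
            eigenvalue_labelling n r ls (Mstar + noise_mat n \<omega>) lam \<and>
            eigenvector (Mstar + noise_mat n \<omega>) u (lam l) \<and> norm2 u = 1
            -->
            sign_dist (plugin_est a u) (a \<bullet> us l)
              \<le> 46818 * (E_md n r \<sigma> ls us a l + \<sigma>\<^sup>2 * real n / (ls l)\<^sup>2 * \<bar>a \<bullet> us l\<bar>) \<and>
            sign_dist (debiased_est n r \<sigma> lam l a u) (a \<bullet> us l)
              \<le> 46818 * E_md n r \<sigma> ls us a l)"
proof -
  let ?S = "{..<n}"
  define lg where "lg = ln (real n)"
  have lg: "1 \<le> lg" "lg\<^sup>2 \<le> real n" using ln_facts[OF n] by (simp_all add: lg_def)
  define ls' where "ls' k = ls (Suc k)" for k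
  define l' where "l' = l - 1"
  have l': "l' < r" "Suc l' = l" using l by (auto simp: l'_def)
  define U where "U k i = us (Suc k) $ i" for k i
  have us: "us k \<in> carrier_vec n" if "1 \<le> k" "k \<le> r" for k using dec that by (simp add: eigen_decomposition_def)
  have uso: "us j \<bullet> us k = (if j = k then 1 else 0)" if "1 \<le> j" "j \<le> r" "1 \<le> k" "k \<le> r" for j k
    using dec that by (simp add: eigen_decomposition_def)
  have lsn: "ls k \<noteq> 0" if "1 \<le> k" "k \<le> r" for k using dec that by (simp add: eigen_decomposition_def)
  have lsd: "\<bar>ls k\<bar> \<le> \<bar>ls j\<bar>" if "1 \<le> j" "j \<le> k" "k \<le> r" for j k
    using dec that unfolding eigen_decomposition_def by (meson atLeastAtMost_iff le_trans)
  have Ms: "Mstar = mat n n (\<lambda>(i, j). \<Sum>k=1..r. ls k * us k $ i * us k $ j)" using dec by (simp add: eigen_decomposition_def)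
  define \<Delta> where "\<Delta> = eigen_gap r ls l"
  have rn: "r \<le> n" and rlg: "4 * (real r * lg) \<le> real n"
  proof -
    have "lg * 1 \<le> lg * lg" using lg by (intro mult_left_mono) auto
    then have "real r * lg \<le> real r * lg\<^sup>2" by (intro mult_left_mono) (auto simp: power2_eq_square)
    moreover have "4 * (real r * lg\<^sup>2) \<le> real n"
      using rk lg unfolding lg_def[symmetric] by (simp add: field_simps)
    ultimately show 1: "4 * (real r * lg) \<le> real n" by linarith
    have "real r * 1 \<le> real r * lg" using lg by (intro mult_left_mono) auto
    then have "real r \<le> real n" using 1 by linarith
    then show "r \<le> n" by simp
  qed
  have U: "orthon ?S {..<r} U"
    unfolding orthon_def
  proof (intro ballI)
    fix j k assume jk: "j \<in> {..<r}" "k \<in> {..<r}"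
    have "dot ?S (U j) (U k) = us (Suc j) \<bullet> us (Suc k)"
      unfolding U_def by (rule scalar_prod_dot[symmetric]) (use us jk in auto)
    then show "dot ?S (U j) (U k) = (if j = k then 1 else 0)" using uso[of "Suc j" "Suc k"] jk by simp
  qed
  obtain Q where Q: "orthon ?S ?S Q" "\<forall>k\<in>{..<r}. Q k = U k"
    using orthon_extend[OF finite_lessThan finite_lessThan _ U, of n] rn by auto
  define a' where "a' = cob n Q (\<lambda>i. a $ i)"
  have a'k: "a' k = a \<bullet> us (Suc k)" if "k < r" for k
    unfolding a'_def cob_def using Q(2) that us[of "Suc k"] a(1) by (simp add: scalar_prod_dot[of a n] U_def[abs_def])
  have a1: "dot ?S a' a' = 1"
  proof -
    have "dot ?S a' a' = a \<bullet> a" unfolding a'_def cob_dot[OF Q(1)] by (rule scalar_prod_dot[OF a(1) a(1), symmetric])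
    then show ?thesis using a(2) by (simp add: norm2_def)
  qed
  have sl: "8000 * (\<sigma> * sqrt (real r * lg)) \<le> \<Delta>"
  proof -
    have "lg \<le> lg\<^sup>2" using lg mult_right_mono[of 1 lg lg] by (simp add: power2_eq_square)
    then have "sqrt lg \<le> sqrt (lg\<^sup>2)" by (rule real_sqrt_le_mono)
    then have "sqrt lg \<le> lg" using lg by simp
    then have "\<sigma> * (sqrt (real r) * sqrt lg) \<le> \<sigma> * (sqrt (real r) * lg)" using \<sigma> by (intro mult_left_mono) auto
    then show ?thesis using gap by (simp add: \<Delta>_def lg_def real_sqrt_mult mult_ac)
  qed
  have gf1: "\<Delta> \<le> 2 * lam_max ls" unfolding \<Delta>_def by (rule gap_facts(1)[OF l]) (rule lsd)
  have gf2: "\<Delta> \<le> \<bar>ls l - ls k\<bar>" if "1 \<le> k" "k \<le> r" "k \<noteq> l" for k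
    unfolding \<Delta>_def by (rule gap_facts(2)[OF l _ that]) (rule lsd)
  have r1: "1 \<le> r" using l by simp
  have m: "0 < lam_min r ls" "lam_min r ls \<le> lam_max ls"
    using lsn[of r] lsd[of 1 r] r1 by (auto simp: lam_min_def lam_max_def)
  have \<Delta>0: "0 < \<Delta>"
  proof -
    have "0 \<le> 8000 * \<sigma> * sqrt (real r) * ln (real n)" using \<sigma> lg by (simp add: lg_def)
    then show ?thesis using gap unfolding \<Delta>_def by linarith
  qed
  define L where "L = ln (real n * cond_num r ls * lam_max ls / \<Delta>)"
  have lgL: "lg \<le> 2 * L" unfolding lg_def L_def by (rule log_factor[OF _ \<Delta>0 gf1 m]) (use n in simp)
  define Ea where "Ea = \<sigma>\<^sup>2 * real r * lg / \<Delta>\<^sup>2 * \<bar>a' l'\<bar> + \<sigma> * sqrt (real r * lg) * (\<Sum>k\<in>{..<r} - {l'}. \<bar>a' k\<bar> / \<bar>ls' l' - ls' k\<bar>)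
     + \<sigma> * sqrt lg / \<bar>ls' l'\<bar>"
  have Emd: "Ea \<le> 2 * E_md n r \<sigma> ls us a l" and Emd0: "0 \<le> E_md n r \<sigma> ls us a l"
  proof -
    define Z where "Z = (\<Sum>k\<in>{1..r} - {l}. \<bar>a \<bullet> us k\<bar> / \<bar>ls l - ls k\<bar>)"
    have Z0: "0 \<le> Z" unfolding Z_def by (intro sum_nonneg) auto
    have bij: "bij_betw Suc ({..<r} - {l'}) ({1..r} - {l})"
      by (simp add: bij_betw_def image_set_diff l'(2) lessThan_atLeast0 atLeastLessThanSuc_atLeastAtMost)
    have Z: "(\<Sum>k\<in>{..<r} - {l'}. \<bar>a' k\<bar> / \<bar>ls' l' - ls' k\<bar>) = Z"
      unfolding Z_def sum.reindex_bij_betw[OF bij, symmetric] by (rule sum.cong) (use l' in \<open>auto simp: a'k ls'_def\<close>)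
    have E: "E_md n r \<sigma> ls us a l = \<sigma>\<^sup>2 * real r * lg / \<Delta>\<^sup>2 * \<bar>a \<bullet> us l\<bar> + \<sigma> * sqrt (real r * L) * Z + \<sigma> * sqrt L / \<bar>ls l\<bar>"
      by (simp add: E_md_def Let_def \<Delta>_def L_def lg_def Z_def)
    have sq: "sqrt lg \<le> 2 * sqrt L"
    proof -
      have "sqrt lg \<le> sqrt (2\<^sup>2 * L)" using lgL lg by (intro real_sqrt_le_mono) simp
      then show ?thesis by (simp only: real_sqrt_mult real_sqrt_abs)
    qed
    have L0: "0 \<le> L" using lgL lg by simp
    have t1: "0 \<le> \<sigma>\<^sup>2 * real r * lg / \<Delta>\<^sup>2 * \<bar>a \<bullet> us l\<bar>" using lg by simp
    have t2: "\<sigma> * sqrt (real r * lg) * Z \<le> 2 * (\<sigma> * sqrt (real r * L) * Z)"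
    proof -
      have "(\<sigma> * sqrt (real r) * Z) * sqrt lg \<le> (\<sigma> * sqrt (real r) * Z) * (2 * sqrt L)"
        using \<sigma> Z0 by (intro mult_left_mono sq) auto
      then show ?thesis by (simp add: real_sqrt_mult mult_ac)
    qed
    have t3: "\<sigma> * sqrt lg / \<bar>ls l\<bar> \<le> 2 * (\<sigma> * sqrt L / \<bar>ls l\<bar>)"
    proof -
      have "(\<sigma> / \<bar>ls l\<bar>) * sqrt lg \<le> (\<sigma> / \<bar>ls l\<bar>) * (2 * sqrt L)" using \<sigma> by (intro mult_left_mono sq) auto
      then show ?thesis by (simp add: mult_ac)
    qed
    have gen: "p + q + s \<le> 2 * (p + q' + s')" if "0 \<le> p" "q \<le> 2 * q'" "s \<le> 2 * s'" for p q q' s s' :: real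
      using that unfolding distrib_left by linarith
    have Ea': "Ea = \<sigma>\<^sup>2 * real r * lg / \<Delta>\<^sup>2 * \<bar>a \<bullet> us l\<bar> + \<sigma> * sqrt (real r * lg) * Z + \<sigma> * sqrt lg / \<bar>ls l\<bar>"
      unfolding Ea_def Z using l' by (simp add: a'k ls'_def)
    show "Ea \<le> 2 * E_md n r \<sigma> ls us a l" unfolding E Ea' by (rule gen[OF t1 t2 t3])
    show "0 \<le> E_md n r \<sigma> ls us a l" unfolding E using t1 \<sigma> L0 Z0 by (intro add_nonneg_nonneg) auto
  qed
  have n16: "16 \<le> n" "104 \<le> n" using n by auto
  have l'n: "l' < n" using l' rn by simp
  define good where "good w \<longleftrightarrow> opb ?S (ent w) (51 * (\<sigma> * sqrt (real n))) \<and>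
    (\<forall>x. 50 * (51 * (\<sigma> * sqrt (real n))) \<le> \<bar>x\<bar> --> opb {..<r} (Emat n r (ent w) \<sigma> x) (80 * (\<sigma> * sqrt (real r * lg)))) \<and>
    (\<forall>j\<in>{- int (n ^ 3)..int (n ^ 3)}. rows_ok n r (ent w) \<sigma> lg a' (ls' l' + \<sigma> / real n * of_int j) \<and>
       quad_ok n r ls' (ent w) \<sigma> lg l' (ls' l' + \<sigma> / real n * of_int j) \<and> lin_ok n r ls' (ent w) \<sigma> lg l' a' (ls' l' + \<sigma> / real n * of_int j))" for w
  have "mostly (noi n \<sigma>) (30 / real n ^ 10) good" unfolding good_def
    by (rule good_event[OF n16(1) \<sigma> r1 rn l'n lg_def lg(1)])
  then have "mostly (noi n \<sigma>) (30 / real n ^ 10) (\<lambda>w. good (rotw n Q w))" by (rule mostly_rotate[OF Q(1) \<sigma>])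
  then obtain P where P: "P \<in> sets (noi n \<sigma>)" "emeasure (noi n \<sigma>) P \<le> ennreal (30 / real n ^ 10)"
      "\<forall>w\<in>space (noi n \<sigma>) - P. good (rotw n Q w)"
    unfolding mostly_def by blast
  interpret prob_space "noi n \<sigma>" by (rule prob_noi[OF \<sigma>])
  have concl: "sign_dist (plugin_est a u) (a \<bullet> us l)
              \<le> 46818 * (E_md n r \<sigma> ls us a l + \<sigma>\<^sup>2 * real n / (ls l)\<^sup>2 * \<bar>a \<bullet> us l\<bar>) \<and>
            sign_dist (debiased_est n r \<sigma> lam l a u) (a \<bullet> us l)
              \<le> 46818 * E_md n r \<sigma> ls us a l"
    if g: "good (rotw n Q \<omega>)" and lab: "eigenvalue_labelling n r ls (Mstar + noise_mat n \<omega>) lam"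
      and ev: "eigenvector (Mstar + noise_mat n \<omega>) u (lam l)" and u1: "norm2 u = 1" for \<omega> lam u
  proof -
    define M where "M = Mstar + noise_mat n \<omega>"
    define H where "H = ent (rotw n Q \<omega>)"
    define lam' where "lam' i = lam (Suc i)" for i
    have Mc: "M \<in> carrier_mat n n" by (simp add: M_def Ms noise_mat_def)
    have Me: "M $$ (i, j) = (\<Sum>k<r. ls' k * U k i * U k j) + ent \<omega> i j" if "i < n" "j < n" for i j
      using that by (simp add: M_def Ms noise_mat_def Suc_sum[unfolded One_nat_def] ls'_def U_def ent_def)
    have Msym: "sym_on ?S (\<lambda>i j. M $$ (i, j))" unfolding sym_on_def by (auto simp: Me ent_sym mult_ac)
    have "char_poly M = (\<Prod>i=1..n. [:- lam i, 1:])" using lab by (simp add: eigenvalue_labelling_def M_def)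
    also have "... = (\<Prod>i<n. [:- lam' i, 1:])"
      using prod.shift_bounds_Suc_ivl[of "\<lambda>i. [:- lam i, 1:]" 0 n] by (simp add: lam'_def lessThan_atLeast0 atLeastLessThanSuc_atLeastAtMost)
    finally obtain V where V: "eigsys ?S (\<lambda>i j. M $$ (i, j)) V lam'" using eigsys_of_char_poly[OF Mc Msym] by blast
    have W: "spk r ls' H x y = (\<Sum>i<n. \<Sum>j<n. Q x i * M $$ (i, j) * Q y j)" if "x < n" "y < n" for x y
      unfolding H_def spk_rotw[OF Q(1) rn _ that, of U, OF fun_cong[OF Q(2)[rule_format]], simplified] by (intro sum.cong refl) (simp add: Me)
    have eig: "eigsys ?S (spk r ls' H) (\<lambda>k. cob n Q (V k)) lam'" by (rule cob_eigsys[OF Q(1) V]) (rule W)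
    have mag: "\<forall>i\<in>{1..n}. \<forall>j\<in>{1..n}. i \<le> j \<and> \<not> (j \<le> r \<and> ls i * ls j < 0) --> \<bar>lam j\<bar> \<le> \<bar>lam i\<bar>"
      and ord: "\<forall>i\<in>{1..r}. \<forall>j\<in>{1..r}. ls i < 0 \<and> 0 < ls j --> lam i \<le> lam j"
      by (rule lab[unfolded eigenvalue_labelling_def, THEN conjunct2, THEN conjunct1],
          rule lab[unfolded eigenvalue_labelling_def, THEN conjunct2, THEN conjunct2])
    have labelling: "labelling n r ls' lam'"
      unfolding labelling_def
    proof (intro conjI allI impI)
      fix i j assume "i < n" "j < n" "i \<le> j \<and> \<not> (j < r \<and> ls' i * ls' j < 0)"
      then show "\<bar>lam' j\<bar> \<le> \<bar>lam' i\<bar>" unfolding lam'_def ls'_def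
        by (intro mag[rule_format]) auto
    next
      fix i j assume "i < r" "j < r" "ls' i < 0 \<and> 0 < ls' j"
      then show "lam' i \<le> lam' j" unfolding lam'_def ls'_def by (intro ord[rule_format]) auto
    qed
    have uc: "u \<in> carrier_vec n" and Mu: "M *\<^sub>v u = lam l \<cdot>\<^sub>v u" using ev Mc by (auto simp: eigenvector_def M_def[symmetric])
    define u' where "u' = cob n Q (\<lambda>i. u $ i)"
    have u'1: "dot ?S u' u' = 1"
    proof -
      have "dot ?S u' u' = u \<bullet> u" unfolding u'_def cob_dot[OF Q(1)] by (rule scalar_prod_dot[OF uc uc, symmetric])
      then show ?thesis using u1 by (simp add: norm2_def)
    qed
    have u'e: "mv ?S (spk r ls' H) u' x = lam' l' * u' x" if x: "x \<in> ?S" for x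
    proof -
      have "mv ?S (spk r ls' H) u' x = cob n Q (mv ?S (\<lambda>i j. M $$ (i, j)) (\<lambda>i. u $ i)) x"
        unfolding u'_def by (rule cob_mv[OF Q(1) _ W]) (use x in auto)
      also have "... = cob n Q (\<lambda>i. lam l * u $ i) x" unfolding cob_def
      proof (rule dot_cong)
        fix i assume i: "i \<in> ?S"
        have "mv ?S (\<lambda>i j. M $$ (i, j)) (\<lambda>i. u $ i) i = (M *\<^sub>v u) $ i"
          using i Mc uc by (auto simp: mv_def scalar_prod_def lessThan_atLeast0 intro!: sum.cong)
        then show "mv ?S (\<lambda>i j. M $$ (i, j)) (\<lambda>i. u $ i) i = lam l * u $ i" using Mu i uc by simp
      qed simp
      finally show ?thesis using l' by (simp add: u'_def lam'_def cob_def dot_def sum_distrib_left mult_ac)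
    qed
    have dau: "dot ?S a' u' = a \<bullet> u" unfolding a'_def u'_def cob_dot[OF Q(1)] by (rule scalar_prod_dot[OF a(1) uc, symmetric])
    have al: "a' l' = a \<bullet> us l" using a'k[OF l'(1)] l' by simp
    have lsl: "ls' l' = ls l" using l' by (simp add: ls'_def)
    have g3: "\<And>j. j \<in> {- int (n ^ 3)..int (n ^ 3)} ==> rows_ok n r H \<sigma> lg a' (ls' l' + \<sigma> / real n * of_int j) \<and>
       quad_ok n r ls' H \<sigma> lg l' (ls' l' + \<sigma> / real n * of_int j) \<and> lin_ok n r ls' H \<sigma> lg l' a' (ls' l' + \<sigma> / real n * of_int j)"
      using g unfolding good_def H_def by blast
    have g1: "opb ?S H (51 * (\<sigma> * sqrt (real n)))"
      and g2: "\<And>x. 50 * (51 * (\<sigma> * sqrt (real n))) \<le> \<bar>x\<bar> ==> opb {..<r} (Emat n r H \<sigma> x) (80 * (\<sigma> * sqrt (real r * lg)))"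
      using g unfolding good_def H_def by blast+
    have dec': "\<bar>ls' k\<bar> \<le> \<bar>ls' j\<bar>" if "j \<le> k" "k < r" for j k unfolding ls'_def by (rule lsd) (use that in auto)
    have snr': "5100 * (\<sigma> * sqrt (real n)) \<le> \<bar>ls' (r - 1)\<bar>" using snr r1 by (simp add: ls'_def lam_min_def)
    have gap': "\<Delta> \<le> \<bar>ls' l' - ls' k\<bar>" if "k < r" "k \<noteq> l'" for k
      unfolding ls'_def l'(2) by (rule gf2) (use that l' in auto)
    have Hs: "sym_on ?S H" unfolding H_def by (rule ent_sym_on)
    note est = det_estimates[OF n16(2) \<sigma> l'(1) rn lg Hs _ snr' rlg sl _ eig labelling a1 g1 _ _ u'1, folded Ea_def]
    have est1: "sign_dist (dot ?S a' u') (a' l') \<le> 23409 * (Ea + \<sigma>\<^sup>2 * real n / \<bar>ls' l'\<bar>\<^sup>2 * \<bar>a' l'\<bar>)"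
      by (rule est(1)) (erule (1) dec' | erule (1) gap' | erule g2 | erule g3 | erule u'e)+
    have est2: "sign_dist (sqrt (1 + (\<Sum>i\<in>{r..<n}. \<sigma>\<^sup>2 / (lam' l' - lam' i)\<^sup>2)) * dot ?S a' u') (a' l') \<le> 23409 * Ea"
      by (rule est(2)) (erule (1) dec' | erule (1) gap' | erule g2 | erule g3 | erule u'e)+
    have e1: "sign_dist (a \<bullet> u) (a \<bullet> us l) \<le> 23409 * (Ea + \<sigma>\<^sup>2 * real n / \<bar>ls l\<bar>\<^sup>2 * \<bar>a \<bullet> us l\<bar>)"
      using est1 by (simp only: dau al lsl)
    have bc: "(\<Sum>i\<in>{r..<n}. \<sigma>\<^sup>2 / (lam' l' - lam' i)\<^sup>2) = bias_corr n r \<sigma> lam l"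
    proof -
      have e: "{r<..n} = Suc ` {r..<n}" by (simp add: atLeastLessThanSuc_atLeastAtMost atLeastSucAtMost_greaterThanAtMost)
      show ?thesis unfolding bias_corr_def e by (subst sum.reindex) (simp_all add: lam'_def l'(2))
    qed
    have e2: "sign_dist (debiased_est n r \<sigma> lam l a u) (a \<bullet> us l) \<le> 23409 * Ea"
      using est2 by (simp only: dau al bc debiased_est_def)
    have "0 \<le> \<sigma>\<^sup>2 * real n / (ls l)\<^sup>2 * \<bar>a \<bullet> us l\<bar>" by simp
    then show ?thesis using double_const(2)[OF e1 Emd] double_const(1)[OF e2 Emd] by (simp only: plugin_est_def power2_abs)
  qed
  show ?thesis unfolding noise_law_noi
  proof (intro bexI[of _ "space (noi n \<sigma>) - P"] conjI ballI allI impI)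
    show "space (noi n \<sigma>) - P \<in> sets (noi n \<sigma>)" using P(1) by (rule sets.compl_sets)
    have "measure (noi n \<sigma>) P \<le> 30 / real n ^ 10" using P(2) by (simp add: emeasure_eq_measure)
    also have "... \<le> 46818 / real n ^ 10" by (intro divide_right_mono) auto
    finally show "1 - 46818 / real n ^ 10 \<le> measure (noi n \<sigma>) (space (noi n \<sigma>) - P)" using prob_compl[OF P(1)] by simp
  qed (use concl P(3) in blast)+
qed

theorem theorem1:
  shows "\<exists>c0 > 0. \<exists>c1 > 0. \<exists>C0 > 0. \<exists>C > 0. \<exists>N :: nat. \<forall>n \<ge> N.
    \<forall>(r :: nat) (l :: nat) (\<sigma> :: real) (Mstar :: real mat) ls us a.
      eigen_decomposition n r Mstar ls us \<and> 1 \<le> l \<and> l \<le> r \<and> \<sigma> > 0 \<and>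
      \<sigma> * sqrt (real n) \<le> c0 * lam_min r ls \<and>
      real r \<le> c1 * real n / (ln (real n))\<^sup>2 \<and>
      eigen_gap r ls l > C0 * \<sigma> * sqrt (real r) * ln (real n) \<and>
      a \<in> carrier_vec n \<and> norm2 a = 1
      -->
      (\<exists>E \<in> sets (noise_law n \<sigma>).
         measure (noise_law n \<sigma>) E \<ge> 1 - C / real n ^ 10 \<and>
         (\<forall>\<omega> \<in> E. \<forall>lam u.
            eigenvalue_labelling n r ls (Mstar + noise_mat n \<omega>) lam \<and>
            eigenvector (Mstar + noise_mat n \<omega>) u (lam l) \<and> norm2 u = 1
            -->
            sign_dist (plugin_est a u) (a \<bullet> us l)
              \<le> C * (E_md n r \<sigma> ls us a l + \<sigma>\<^sup>2 * real n / (ls l)\<^sup>2 * \<bar>a \<bullet> us l\<bar>) \<and>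
            sign_dist (debiased_est n r \<sigma> lam l a u) (a \<bullet> us l)
              \<le> C * E_md n r \<sigma> ls us a l))"
proof -
  \<comment> \<open>\<open>5100 = 100 * 51\<close> and \<open>8000 = 100 * 80\<close> are 100 times the constants in the bounds for \<open>H\<close> and \<open>E\<close>; \<open>46818 = 2 * 23409\<close>\<close>
  have pos: "0 < (1 / 5100 :: real)" "0 < (1 / 4 :: real)" "0 < (8000 :: real)" "0 < (46818 :: real)" by auto
  show ?thesis
    by (rule exI[of _ "1 / 5100"], rule conjI[OF pos(1)], rule exI[of _ "1 / 4"], rule conjI[OF pos(2)],
        rule exI[of _ 8000], rule conjI[OF pos(3)], rule exI[of _ 46818], rule conjI[OF pos(4)], rule exI[of _ 256],
        intro allI impI, elim conjE, rule theorem_instance)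
qed

end
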